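(* Let $G$ be a connected, locally finite graph and suppose that $\Gamma\subseteq\mathrm{Aut}(G)$ is transitive and nonunimodular. Then $p_c(G)<p_c(G,\Gamma,\lambda)\leq p_t(G,\Gamma)$ for every $\lambda\in(0,1)$.
   Context: For $p\in[0,1]$, $G[p]$ denotes the random subgraph of $G=(V,E)$ obtained by Bernoulli bond percolation: each edge is independently retained with probability $p$ and deleted otherwise. Clusters are connected components of $G[p]$. $p_c(G)=\inf\{p: G[p]$ contains an infinite cluster almost surely$\}$. $\tau_p(u,v)$ is the probability that $u$ and $v$ are connected in $G[p]$. A subgroup $\Gamma\subseteq\mathrm{Aut}(G)$ is transitive if it acts transitively on $V$. For transitive $\Gamma$ the modular function is $\Delta(x,y)=|\mathrm{Stab}_y x|/|\mathrm{Stab}_x y|$ for $x,y\in V$, where $\mathrm{Stab}_x$ is the stabilizer of $x$ in $\Gamma$ and $\mathrm{Stab}_x y$ is the orbit of $y$ under $\mathrm{Stab}_x$. $\Gamma$ is nonunimodular if $\Delta\not\equiv 1$. For $\lambda\in\mathbb{R}$ the tilted susceptibility is $\chi_{p,\lambda}(v)=\sum_{u\in V}\tau_p(v,u)\Delta(v,u)^\lambda$. Define $p_c(G,\Gamma,\lambda)=\sup\{p\in[0,1]:\chi_{p,\lambda}(v)<\infty\}$ and $p_t(G,\Gamma)=\sup\{p\in[0,1]:\chi_{p,\lambda}(v)<\infty$ for some $\lambda\in\mathbb{R}\}$; these do not depend on the choice of $v\in V$. *)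

theory Defs
  imports "HOL-Probability.Probability" "HOL-Algebra.Group_Action"
begin

section \<open>Graphs and their automorphisms\<close>

definition simple_graph :: "'a set \<Rightarrow> 'a set set \<Rightarrow> bool" where
  "simple_graph V E \<longleftrightarrow> (\<forall>e\<in>E. e \<subseteq> V \<and> card e = 2)"

definition adj :: "'a set set \<Rightarrow> ('a \<times> 'a) set" where
  "adj E = {(x, y). {x, y} \<in> E}"

definition connected_graph :: "'a set \<Rightarrow> 'a set set \<Rightarrow> bool" where
  "connected_graph V E \<longleftrightarrow> (\<forall>x\<in>V. \<forall>y\<in>V. (x, y) \<in> (adj E)\<^sup>*)"

definition locally_finite_graph :: "'a set \<Rightarrow> 'a set set \<Rightarrow> bool" where
  "locally_finite_graph V E \<longleftrightarrow> (\<forall>v\<in>V. finite {e \<in> E. v \<in> e})"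

definition graph_Aut :: "'a set \<Rightarrow> 'a set set \<Rightarrow> ('a \<Rightarrow> 'a) monoid" where
  "graph_Aut V E = (BijGroup V)\<lparr>carrier :=
     {f \<in> Bij V. \<forall>x\<in>V. \<forall>y\<in>V. {f x, f y} \<in> E \<longleftrightarrow> {x, y} \<in> E}\<rparr>"

lemma subgroup_graph_Aut: "subgroup (carrier (graph_Aut V E)) (BijGroup V)"
proof (rule group.subgroupI[OF group_BijGroup])
  let ?A = "{f \<in> Bij V. \<forall>x\<in>V. \<forall>y\<in>V. {f x, f y} \<in> E \<longleftrightarrow> {x, y} \<in> E}"
  have A: "carrier (graph_Aut V E) = ?A"
    by (simp add: graph_Aut_def)
  show "carrier (graph_Aut V E) \<subseteq> carrier (BijGroup V)"
    by (auto simp: A BijGroup_def)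
  have "(\<lambda>x\<in>V. x) \<in> ?A"
    by (auto simp: id_Bij)
  then show "carrier (graph_Aut V E) \<noteq> {}"
    unfolding A by blast
next
  fix f assume f: "f \<in> carrier (graph_Aut V E)"
  then have fB: "f \<in> Bij V"
    and fE: "\<And>x y. x \<in> V \<Longrightarrow> y \<in> V \<Longrightarrow> {f x, f y} \<in> E \<longleftrightarrow> {x, y} \<in> E"
    by (auto simp: graph_Aut_def)
  have f_inv: "f (inv_into V f x) = x" "inv_into V f x \<in> V" if "x \<in> V" for x
    using fB that by (auto simp: Bij_def bij_betw_def f_inv_into_f inv_into_into)
  have "{inv_into V f x, inv_into V f y} \<in> E \<longleftrightarrow> {x, y} \<in> E" if "x \<in> V" "y \<in> V" for x y
    using fE[of "inv_into V f x" "inv_into V f y"] f_inv that by simp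
  then show "inv\<^bsub>BijGroup V\<^esub> f \<in> carrier (graph_Aut V E)"
    using fB by (simp add: inv_BijGroup graph_Aut_def restrict_inv_into_Bij)
next
  fix f g assume fg: "f \<in> carrier (graph_Aut V E)" "g \<in> carrier (graph_Aut V E)"
  then have B: "f \<in> Bij V" "g \<in> Bij V"
    by (auto simp: graph_Aut_def)
  have "g x \<in> V" if "x \<in> V" for x
    using B(2) that Bij_imp_funcset by blast
  then show "f \<otimes>\<^bsub>BijGroup V\<^esub> g \<in> carrier (graph_Aut V E)"
    using fg B by (auto simp: graph_Aut_def BijGroup_def compose_Bij compose_eq)
qed

section \<open>The modular function\<close>

text \<open>A group \<open>\<Gamma>\<close> of permutations of \<open>V\<close>, seen as a group acting on \<open>V\<close> via the identity map.\<close>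

abbreviation perm_group :: "'a set \<Rightarrow> ('a \<Rightarrow> 'a) set \<Rightarrow> ('a \<Rightarrow> 'a) monoid" where
  "perm_group V \<Gamma> \<equiv> (BijGroup V)\<lparr>carrier := \<Gamma>\<rparr>"

definition vertex_transitive :: "'a set \<Rightarrow> ('a \<Rightarrow> 'a) set \<Rightarrow> bool" where
  "vertex_transitive V \<Gamma> \<longleftrightarrow> transitive_action (perm_group V \<Gamma>) V (\<lambda>\<gamma>. \<gamma>)"

definition Stab :: "'a set \<Rightarrow> ('a \<Rightarrow> 'a) set \<Rightarrow> 'a \<Rightarrow> ('a \<Rightarrow> 'a) set" where
  "Stab V \<Gamma> x = stabilizer (perm_group V \<Gamma>) (\<lambda>\<gamma>. \<gamma>) x"

definition Stab_orbit :: "'a set \<Rightarrow> ('a \<Rightarrow> 'a) set \<Rightarrow> 'a \<Rightarrow> 'a \<Rightarrow> 'a set" where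
  "Stab_orbit V \<Gamma> x y = orbit (perm_group V (Stab V \<Gamma> x)) (\<lambda>\<gamma>. \<gamma>) y"

text \<open>On a connected, locally finite graph the orbits below are finite, so \<^const>\<open>card\<close> is
  their true cardinality.\<close>

definition modular_fun :: "'a set \<Rightarrow> ('a \<Rightarrow> 'a) set \<Rightarrow> 'a \<Rightarrow> 'a \<Rightarrow> real" where
  "modular_fun V \<Gamma> x y = real (card (Stab_orbit V \<Gamma> y x)) / real (card (Stab_orbit V \<Gamma> x y))"

definition nonunimodular :: "'a set \<Rightarrow> ('a \<Rightarrow> 'a) set \<Rightarrow> bool" where
  "nonunimodular V \<Gamma> \<longleftrightarrow> \<not> (\<forall>x\<in>V. \<forall>y\<in>V. modular_fun V \<Gamma> x y = 1)"

section \<open>Bernoulli bond percolation\<close>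

definition percolation :: "'a set set \<Rightarrow> real \<Rightarrow> ('a set \<Rightarrow> bool) measure" where
  "percolation E p = (\<Pi>\<^sub>M e\<in>E. measure_pmf (bernoulli_pmf p))"

definition open_edges :: "'a set set \<Rightarrow> ('a set \<Rightarrow> bool) \<Rightarrow> 'a set set" where
  "open_edges E \<omega> = {e \<in> E. \<omega> e}"

definition cluster :: "'a set set \<Rightarrow> ('a set \<Rightarrow> bool) \<Rightarrow> 'a \<Rightarrow> 'a set" where
  "cluster E \<omega> v = {u. (v, u) \<in> (adj (open_edges E \<omega>))\<^sup>*}"

text \<open>For an infinite connected graph the set below contains 1, so the infimum in \<open>\<real>\<close> is
  genuine.\<close>

definition p_c :: "'a set \<Rightarrow> 'a set set \<Rightarrow> real" where
  "p_c V E = Inf {p \<in> {0..1}. AE \<omega> in percolation E p. \<exists>v\<in>V. infinite (cluster E \<omega> v)}"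

definition tau :: "'a set set \<Rightarrow> real \<Rightarrow> 'a \<Rightarrow> 'a \<Rightarrow> real" where
  "tau E p u v = measure (percolation E p) {\<omega> \<in> space (percolation E p). v \<in> cluster E \<omega> u}"

definition tilted_susceptibility ::
    "'a set \<Rightarrow> 'a set set \<Rightarrow> ('a \<Rightarrow> 'a) set \<Rightarrow> real \<Rightarrow> real \<Rightarrow> 'a \<Rightarrow> ennreal" where
  "tilted_susceptibility V E \<Gamma> p l v =
     (\<Sum>\<^sub>\<infinity>u\<in>V. ennreal (tau E p v u * modular_fun V \<Gamma> v u powr l))"

text \<open>The base vertex \<open>v\<close> is kept as a parameter. At \<open>p = 0\<close> the tilted susceptibility is finite,
  so the suprema in \<open>\<real>\<close> are over nonempty bounded sets.\<close>

definition p_c_tilted ::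
    "'a set \<Rightarrow> 'a set set \<Rightarrow> ('a \<Rightarrow> 'a) set \<Rightarrow> real \<Rightarrow> 'a \<Rightarrow> real" where
  "p_c_tilted V E \<Gamma> l v = Sup {p \<in> {0..1}. tilted_susceptibility V E \<Gamma> p l v < \<infinity>}"

definition p_t :: "'a set \<Rightarrow> 'a set set \<Rightarrow> ('a \<Rightarrow> 'a) set \<Rightarrow> 'a \<Rightarrow> real" where
  "p_t V E \<Gamma> v = Sup {p \<in> {0..1}. \<exists>l::real. tilted_susceptibility V E \<Gamma> p l v < \<infinity>}"

end

(* Write heights as logarithms of the modular function and suppose, for lambda in [1/2, 1), that the tilted
   threshold p is at most p_c (lambda < 1/2 reduces to 1 - lambda by mass transport). Since the tilted sum is
   finite on a relatively open set of parameters below 1, it is infinite at p. We show that it is bounded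
   uniformly below p, hence finite at p.

   Below p_c, upward connections inside the half-space above the origin decay at least like q^(-x): otherwise
   mass transport makes the mean offspring of downward bridges exceed a constant, and large sets of vertices
   would survive downwards forever. At p let alpha >= 1 and beta be the exponents of upward and downward half-
   space connections. By mass transport, E |points reached at depth x| is at least q^x times the upward
   connection probability, while large sets descend easily; comparing the two gives beta <= alpha - 1. Growing
   many points at height t upwards along bridges then shows that finding n of them has probability at most C
   q^(-alpha t) n^(-theta), with theta as close to 1 as desired. Combined with the tree-graph and BK
   inequalities, this bounds the tilted sum G over ladder points (points that are highest on a path from the
   origin) by C G^(1 - gamma/2) with constants independent of the parameter below p, whence G is bounded. *)
theory Submission
  imports Defs
begin

section \<open>Bernoulli percolation on finitely many edges\<close>

text \<open>Why beta <= alpha - 1 matters: an upward bridge of height s has mean offspring about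
  q^(-s) times the probability of a downward connection, that is q^(-(1 + beta) s), which is then at
  least q^(-alpha s). So n points at height t keep descendants until about log_q(n) / alpha higher
  up. Reaching that height has probability about q^(-alpha t) / n, which therefore bounds the chance
  of finding n points.

  Since the tail n^(-theta) with theta < 1 is not summable, counts are truncated at G^7 q^(kappa t).
  A path cut at its highest point gives two ladder sums, each at most G because lambda >= 1/2, so
  the three factors of the tree-graph inequality give (G^2)^3 = G^6 and the truncated part is
  harmless. The price G^(7 (1 - theta)) is a small power of G when theta is near 1.

  Paths that leave the half-space are cut at their lowest point: depth up to 2k costs p^(-k),
  greater depth gains q^(-2 lambda k). Balancing with k of order log G gives gamma = lambda / (1 +
  a), where q^a is at least 2/p.\<close>

definition weight :: "real \<Rightarrow> 'b set \<Rightarrow> 'b set \<Rightarrow> real" where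
  "weight p F S = (\<Prod>e\<in>F. if e \<in> S then p else 1 - p)"

text \<open>A configuration is the set of open edges of a finite \<open>F\<close>, so expectations
  are finite sums and polynomials in \<open>p\<close>. The product measure is brought in only at the
  end.\<close>

definition Eb :: "real \<Rightarrow> 'b set \<Rightarrow> ('b set \<Rightarrow> real) \<Rightarrow> real" where
  "Eb p F f = (\<Sum>S\<in>Pow F. weight p F S * f S)"

definition Pr :: "real \<Rightarrow> 'b set \<Rightarrow> ('b set \<Rightarrow> bool) \<Rightarrow> real" where
  "Pr p F A = Eb p F (\<lambda>S. of_bool (A S))"

lemma Eb_empty [simp]: "Eb p {} f = f {}"
  by (simp add: Eb_def weight_def)

text \<open>Conditioning on the state of one edge; this recursion drives the inductions on
  \<open>F\<close> below.\<close>

lemma Eb_insert: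
  assumes "finite F" "e \<notin> F"
  shows "Eb p (insert e F) f = (1 - p) * Eb p F f + p * Eb p F (\<lambda>S. f (insert e S))"
proof -
  have inj: "inj_on (insert e) (Pow F)"
    using assms by (auto simp: inj_on_def)
  have 1: "weight p (insert e F) S = (1 - p) * weight p F S" if "S \<subseteq> F" for S
    using assms that by (auto simp: weight_def)
  have 2: "weight p (insert e F) (insert e S) = p * weight p F S" if "S \<subseteq> F" for S
  proof -
    have "(\<Prod>x\<in>F. if x \<in> insert e S then p else 1 - p) = (\<Prod>x\<in>F. if x \<in> S then p else 1 - p)"
      using assms by (intro prod.cong) auto
    then show ?thesis using assms by (simp add: weight_def)
  qed
  have "Eb p (insert e F) f = (\<Sum>S\<in>Pow F. weight p (insert e F) S * f S)
      + (\<Sum>S\<in>insert e ` Pow F. weight p (insert e F) S * f S)"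
    unfolding Eb_def Pow_insert using assms by (intro sum.union_disjoint) auto
  also have "(\<Sum>S\<in>insert e ` Pow F. weight p (insert e F) S * f S)
      = (\<Sum>S\<in>Pow F. weight p (insert e F) (insert e S) * f (insert e S))"
    by (simp add: sum.reindex[OF inj])
  finally show ?thesis
    using 1 2 by (simp add: Eb_def sum_distrib_left mult.assoc)
qed

lemma weight_nonneg: "0 \<le> p \<Longrightarrow> p \<le> 1 \<Longrightarrow> 0 \<le> weight p F S"
  unfolding weight_def by (intro prod_nonneg) auto

lemma Eb_cong: "(\<And>S. S \<subseteq> F \<Longrightarrow> f S = g S) \<Longrightarrow> Eb p F f = Eb p F g"
  unfolding Eb_def by (intro sum.cong) auto

lemma Eb_mono: "0 \<le> p \<Longrightarrow> p \<le> 1 \<Longrightarrow> (\<And>S. S \<subseteq> F \<Longrightarrow> f S \<le> g S) \<Longrightarrow> Eb p F f \<le> Eb p F g"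
  unfolding Eb_def by (intro sum_mono mult_left_mono weight_nonneg) auto

lemma Eb_add: "Eb p F (\<lambda>S. f S + g S) = Eb p F f + Eb p F g"
  by (simp add: Eb_def sum.distrib algebra_simps)

lemma Eb_diff: "Eb p F (\<lambda>S. f S - g S) = Eb p F f - Eb p F g"
  by (simp add: Eb_def sum_subtractf algebra_simps)

lemma Eb_cmult: "Eb p F (\<lambda>S. c * f S) = c * Eb p F f"
  by (simp add: Eb_def sum_distrib_left mult.left_commute)

lemma Eb_cmult_right: "Eb p F (\<lambda>S. f S * c) = Eb p F f * c"
  using Eb_cmult[of p F c f] by (simp add: mult.commute)

lemma Eb_sum: "Eb p F (\<lambda>S. \<Sum>i\<in>I. f i S) = (\<Sum>i\<in>I. Eb p F (f i))"
  unfolding Eb_def sum_distrib_left by (rule sum.swap)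

lemma Eb_const: "finite F \<Longrightarrow> Eb p F (\<lambda>S. c) = c"
  by (induction F rule: finite_induct) (auto simp: Eb_insert algebra_simps)

lemma Eb_nonneg: "0 \<le> p \<Longrightarrow> p \<le> 1 \<Longrightarrow> (\<And>S. S \<subseteq> F \<Longrightarrow> 0 \<le> f S) \<Longrightarrow> 0 \<le> Eb p F f"
  unfolding Eb_def by (intro sum_nonneg mult_nonneg_nonneg weight_nonneg) auto

text \<open>Fubini for independent edge sets. Exploration arguments use it in this form: reveal
  \<open>F\<close>, then average over the still unseen \<open>G\<close>.\<close>

lemma Eb_Un:
  assumes "finite F" "finite G" "F \<inter> G = {}"
  shows "Eb p (F \<union> G) f = Eb p F (\<lambda>S. Eb p G (\<lambda>T. f (S \<union> T)))"
  using assms(2,3)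
proof (induction G arbitrary: f rule: finite_induct)
  case empty
  then show ?case by simp
next
  case (insert e G)
  have "Eb p (F \<union> insert e G) f = Eb p (insert e (F \<union> G)) f"
    by simp
  also have "\<dots> = (1 - p) * Eb p (F \<union> G) f + p * Eb p (F \<union> G) (\<lambda>S. f (insert e S))"
    using insert assms by (intro Eb_insert) auto
  also have "\<dots> = Eb p F (\<lambda>S. (1 - p) * Eb p G (\<lambda>T. f (S \<union> T)) + p * Eb p G (\<lambda>T. f (S \<union> insert e T)))"
    using insert by (simp add: Eb_add Eb_cmult)
  also have "\<dots> = Eb p F (\<lambda>S. Eb p (insert e G) (\<lambda>T. f (S \<union> T)))"
    using insert by (simp add: Eb_insert)
  finally show ?case .
qed

lemma Eb_local:
  assumes "finite F" "G \<subseteq> F" "\<And>S. S \<subseteq> F \<Longrightarrow> f S = f (S \<inter> G)"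
  shows "Eb p F f = Eb p G f"
proof -
  have fin: "finite G" "finite (F - G)" using assms finite_subset by auto
  have "Eb p F f = Eb p (G \<union> (F - G)) f"
    using assms by (simp add: Un_absorb1)
  also have "\<dots> = Eb p G (\<lambda>S. Eb p (F - G) (\<lambda>T. f (S \<union> T)))"
    using fin by (intro Eb_Un) auto
  also have "\<dots> = Eb p G (\<lambda>S. Eb p (F - G) (\<lambda>T. f S))"
  proof (intro Eb_cong)
    fix S T assume "S \<subseteq> G" "T \<subseteq> F - G"
    then have "(S \<union> T) \<inter> G = S" "S \<union> T \<subseteq> F" using assms by auto
    then show "f (S \<union> T) = f S" using assms(3)[of "S \<union> T"] by simp
  qed
  finally show ?thesis using fin by (simp add: Eb_const)
qed

lemma Eb_indep:
  assumes "finite F" "A \<inter> B = {}" "\<And>S. S \<subseteq> F \<Longrightarrow> f S = f (S \<inter> A)" "\<And>S. S \<subseteq> F \<Longrightarrow> g S = g (S \<inter> B)"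
  shows "Eb p F (\<lambda>S. f S * g S) = Eb p F f * Eb p F g"
proof -
  have F: "F = (F \<inter> A) \<union> (F - A)" by auto
  have fin: "finite (F \<inter> A)" "finite (F - A)" using assms by auto
  have "Eb p F (\<lambda>S. f S * g S) = Eb p (F \<inter> A) (\<lambda>S. Eb p (F - A) (\<lambda>T. f (S \<union> T) * g (S \<union> T)))"
    by (subst F, intro Eb_Un fin) auto
  also have "\<dots> = Eb p (F \<inter> A) (\<lambda>S. Eb p (F - A) (\<lambda>T. f S * g T))"
  proof (intro Eb_cong)
    fix S T assume ST: "S \<subseteq> F \<inter> A" "T \<subseteq> F - A"
    then have "S \<union> T \<subseteq> F" "S \<subseteq> F" "T \<subseteq> F" by auto
    note sub = this
    have "f (S \<union> T) = f ((S \<union> T) \<inter> A)" "f S = f (S \<inter> A)"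
      by (rule assms(3), rule sub)+
    moreover have "(S \<union> T) \<inter> A = S \<inter> A" using ST by auto
    ultimately have f: "f (S \<union> T) = f S" by simp
    have "g (S \<union> T) = g ((S \<union> T) \<inter> B)" "g T = g (T \<inter> B)"
      by (rule assms(4), rule sub)+
    moreover have "(S \<union> T) \<inter> B = T \<inter> B" using ST assms(2) by auto
    ultimately have "g (S \<union> T) = g T" by simp
    then show "f (S \<union> T) * g (S \<union> T) = f S * g T" using f by simp
  qed
  also have "\<dots> = Eb p (F \<inter> A) f * Eb p (F - A) g"
    by (simp add: Eb_cmult Eb_cmult_right)
  also have "Eb p (F \<inter> A) f = Eb p F f"
  proof (rule Eb_local[symmetric])
    fix S assume "S \<subseteq> F"
    moreover have "S \<inter> (F \<inter> A) = S \<inter> A" using \<open>S \<subseteq> F\<close> by auto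
    ultimately show "f S = f (S \<inter> (F \<inter> A))" using assms(3) by simp
  qed (use assms in auto)
  also have "Eb p (F - A) g = Eb p F g"
  proof (rule Eb_local[symmetric])
    fix S assume "S \<subseteq> F"
    then have "g (S \<inter> (F - A)) = g (S \<inter> (F - A) \<inter> B)" using assms(4) by (meson Diff_subset inf.coboundedI2)
    moreover have "S \<inter> (F - A) \<inter> B = S \<inter> B" using \<open>S \<subseteq> F\<close> assms(2) by auto
    ultimately show "g S = g (S \<inter> (F - A))" using assms(4)[OF \<open>S \<subseteq> F\<close>] by simp
  qed (use assms in auto)
  finally show ?thesis .
qed

text \<open>Raising the parameter of one edge moves weight from the section with \<open>e\<close>
  closed to the section with \<open>e\<close> open, which is the larger one for monotone
  \<open>f\<close>.\<close>

lemma Eb_mono_p: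
  assumes "finite F" "0 \<le> p" "p \<le> p'" "p' \<le> 1" "mono f"
  shows "Eb p F f \<le> Eb p' F f"
  using assms(1,5)
proof (induction F arbitrary: f rule: finite_induct)
  case empty
  then show ?case by simp
next
  case (insert e F)
  let ?g = "\<lambda>S. f (insert e S)"
  have m: "mono ?g" using insert.prems by (auto simp: mono_def intro!: monoD[OF insert.prems])
  have le: "Eb p F f \<le> Eb p F ?g"
    using assms by (intro Eb_mono) (auto intro!: monoD[OF insert.prems])
  have "(1 - p) * Eb p F f + p * Eb p F ?g \<le> (1 - p') * Eb p F f + p' * Eb p F ?g"
    using mult_right_mono[of p p' "Eb p F ?g - Eb p F f"] le assms by (simp add: algebra_simps)
  also have "\<dots> \<le> (1 - p') * Eb p' F f + p' * Eb p' F ?g"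
    using assms insert.IH[OF insert.prems] insert.IH[OF m] by (intro add_mono mult_left_mono) auto
  finally show ?case using insert by (simp add: Eb_insert)
qed

lemma Eb_mono_F:
  assumes "finite F'" "F \<subseteq> F'" "0 \<le> p" "p \<le> 1" "mono f"
  shows "Eb p F f \<le> Eb p F' f"
proof -
  have fin: "finite F" "finite (F' - F)" using assms finite_subset by auto
  have "Eb p F f = Eb p F (\<lambda>S. Eb p (F' - F) (\<lambda>T. f S))"
    using fin by (simp add: Eb_const)
  also have "\<dots> \<le> Eb p F (\<lambda>S. Eb p (F' - F) (\<lambda>T. f (S \<union> T)))"
    using assms by (intro Eb_mono) (auto intro!: monoD[OF assms(5)])
  also have "\<dots> = Eb p (F \<union> (F' - F)) f"
    using fin by (intro Eb_Un[symmetric]) auto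
  also have "F \<union> (F' - F) = F'" using assms by auto
  finally show ?thesis .
qed

lemma Eb_continuous: "continuous_on UNIV (\<lambda>p. Eb p F f)"
proof -
  have "continuous_on UNIV (\<lambda>p::real. if e \<in> S then p else 1 - p)" for e and S :: "'a set"
    by (cases "e \<in> S") (simp_all add: continuous_on_diff)
  then show ?thesis
    unfolding Eb_def weight_def by (intro continuous_on_sum continuous_on_mult continuous_on_prod continuous_on_const)
qed

lemma Eb_image:
  assumes "finite F" "inj_on g F"
  shows "Eb p (g ` F) f = Eb p F (\<lambda>S. f (g ` S))"
  using assms
proof (induction F arbitrary: f rule: finite_induct)
  case empty
  then show ?case by simp
next
  case (insert e F)
  then have "g e \<notin> g ` F" by auto
  with insert show ?case by (simp add: Eb_insert)
qed

lemma Pr_cong: "(\<And>S. S \<subseteq> F \<Longrightarrow> A S = B S) \<Longrightarrow> Pr p F A = Pr p F B"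
  unfolding Pr_def by (intro Eb_cong) auto

lemma Pr_mono:
  assumes "0 \<le> p" "p \<le> 1" "\<And>S. S \<subseteq> F \<Longrightarrow> A S \<Longrightarrow> B S"
  shows "Pr p F A \<le> Pr p F B"
  unfolding Pr_def using assms by (intro Eb_mono) auto

lemma Pr_nonneg: "0 \<le> p \<Longrightarrow> p \<le> 1 \<Longrightarrow> 0 \<le> Pr p F A"
  unfolding Pr_def by (intro Eb_nonneg) auto

lemma Pr_le_1: "finite F \<Longrightarrow> 0 \<le> p \<Longrightarrow> p \<le> 1 \<Longrightarrow> Pr p F A \<le> 1"
  using Eb_mono[of p F "\<lambda>S. of_bool (A S)" "\<lambda>S. 1"] by (simp add: Pr_def Eb_const)

lemma Pr_not: "finite F \<Longrightarrow> Pr p F (\<lambda>S. \<not> A S) = 1 - Pr p F A"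
  using Eb_diff[of p F "\<lambda>S. 1" "\<lambda>S. of_bool (A S)"]
  by (simp add: Pr_def Eb_const of_bool_not_iff)

definition incr :: "('b set \<Rightarrow> bool) \<Rightarrow> bool" where
  "incr A \<longleftrightarrow> (\<forall>S T. S \<subseteq> T \<longrightarrow> A S \<longrightarrow> A T)"

lemma incr_of_bool: "incr A \<Longrightarrow> mono (\<lambda>S. of_bool (A S) :: real)"
  by (auto simp: mono_def incr_def)

lemma incrD: "incr A \<Longrightarrow> A S \<Longrightarrow> S \<subseteq> T \<Longrightarrow> A T"
  by (auto simp: incr_def)

lemma incrI: "(\<And>S T. S \<subseteq> T \<Longrightarrow> A S \<Longrightarrow> A T) \<Longrightarrow> incr A"
  by (auto simp: incr_def)

lemma incr_section: "incr A \<Longrightarrow> incr (\<lambda>S. A (insert e S))"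
  by (rule incrI) (erule incrD, auto)

lemma Pr_mono_p:
  "finite F \<Longrightarrow> 0 \<le> p \<Longrightarrow> p \<le> p' \<Longrightarrow> p' \<le> 1 \<Longrightarrow> incr A \<Longrightarrow> Pr p F A \<le> Pr p' F A"
  unfolding Pr_def by (intro Eb_mono_p incr_of_bool)

lemma Pr_mono_F:
  "finite F' \<Longrightarrow> F \<subseteq> F' \<Longrightarrow> 0 \<le> p \<Longrightarrow> p \<le> 1 \<Longrightarrow> incr A \<Longrightarrow> Pr p F A \<le> Pr p F' A"
  unfolding Pr_def by (intro Eb_mono_F incr_of_bool)

lemma Pr_insert:
  "finite F \<Longrightarrow> e \<notin> F \<Longrightarrow>
    Pr p (insert e F) A = (1 - p) * Pr p F A + p * Pr p F (\<lambda>S. A (insert e S))"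
  unfolding Pr_def by (rule Eb_insert)

lemma Pr_union_le:
  assumes "0 \<le> p" "p \<le> 1" "finite I" "\<And>S. S \<subseteq> F \<Longrightarrow> A S \<Longrightarrow> \<exists>i\<in>I. B i S"
  shows "Pr p F A \<le> (\<Sum>i\<in>I. Pr p F (B i))"
proof -
  have "of_bool (A S) \<le> (\<Sum>i\<in>I. of_bool (B i S) :: real)" if "S \<subseteq> F" for S
  proof (cases "A S")
    case True
    then obtain i where i: "i \<in> I" "B i S" using assms(4)[OF \<open>S \<subseteq> F\<close> True] by auto
    have "of_bool (B i S) \<le> (\<Sum>i\<in>I. of_bool (B i S) :: real)"
      using assms(3) i(1) by (intro member_le_sum) auto
    then show ?thesis using i True by simp
  qed (auto intro!: sum_nonneg)
  then have "Pr p F A \<le> Eb p F (\<lambda>S. \<Sum>i\<in>I. of_bool (B i S))"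
    unfolding Pr_def using assms by (intro Eb_mono) auto
  then show ?thesis by (simp add: Eb_sum Pr_def)
qed

lemma Pr_or_le: "0 \<le> p \<Longrightarrow> p \<le> 1 \<Longrightarrow> Pr p F (\<lambda>S. A S \<or> B S) \<le> Pr p F A + Pr p F B"
  unfolding Pr_def Eb_add[symmetric] by (intro Eb_mono) auto

text \<open>A one-edge case of the Harris inequality: opening \<open>e\<close> can only help
  \<open>A\<close>, so prescribing one open edge costs at most a factor \<open>p\<close>.\<close>

lemma Pr_edge_open:
  assumes "finite F" "e \<in> F" "0 \<le> p" "p \<le> 1" "incr A"
  shows "p * Pr p F A \<le> Pr p F (\<lambda>S. e \<in> S \<and> A S)"
proof -
  define G where "G = F - {e}"
  have G: "F = insert e G" "finite G" "e \<notin> G" using assms by (auto simp: G_def)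
  have a: "Pr p G (\<lambda>S. e \<in> S \<and> A S) = 0"
    using G(3) by (auto simp: Pr_def Eb_def intro!: sum.neutral)
  have b: "Pr p G A \<le> Pr p G (\<lambda>S. A (insert e S))"
    using assms by (intro Pr_mono) (auto intro: incrD[OF assms(5)])
  have "Pr p F A \<le> Pr p G (\<lambda>S. A (insert e S))"
  proof -
    have "(1 - p) * Pr p G A \<le> (1 - p) * Pr p G (\<lambda>S. A (insert e S))"
      using b assms by (intro mult_left_mono) auto
    then show ?thesis unfolding G(1) using G by (simp add: Pr_insert algebra_simps)
  qed
  then have "p * Pr p F A \<le> p * Pr p G (\<lambda>S. A (insert e S))"
    using assms by (intro mult_left_mono) auto
  moreover have "Pr p F (\<lambda>S. e \<in> S \<and> A S) = p * Pr p G (\<lambda>S. A (insert e S))"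
    unfolding G(1) using G a by (simp add: Pr_insert)
  ultimately show ?thesis by simp
qed

subsection \<open>The van den Berg--Kesten inequality\<close>

text \<open>Disjoint occurrence. The second witness is all of \<open>S - I\<close>, which is no
  restriction when \<open>B\<close> is increasing.\<close>

definition disjointly :: "('b set \<Rightarrow> bool) \<Rightarrow> ('b set \<Rightarrow> bool) \<Rightarrow> 'b set \<Rightarrow> bool" where
  "disjointly A B S \<longleftrightarrow> (\<exists>I\<subseteq>S. A I \<and> B (S - I))"

lemma disI:
  assumes "incr B" "A I" "B J" "I \<union> J \<subseteq> S" "I \<inter> J = {}"
  shows "disjointly A B S"
  unfolding disjointly_def using assms by (auto intro!: exI[of _ I] intro: incrD[OF assms(1,3)])

lemma incr_disjointly: "incr B \<Longrightarrow> incr (disjointly A B)"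
proof (rule incrI)
  fix S T assume B: "incr B" and ST: "S \<subseteq> T" and "disjointly A B S"
  then obtain I where I: "I \<subseteq> S" "A I" "B (S - I)" by (auto simp: disjointly_def)
  have "B (T - I)" by (rule incrD[OF B I(3)]) (use ST in auto)
  then show "disjointly A B T" unfolding disjointly_def using I ST by (intro exI[of _ I]) auto
qed

text \<open>Induction on the edges: when \<open>e\<close> is open, at most one of the two witnesses
  uses it. Two upper bounds for the open case are kept, because the way to combine them depends on
  the size of \<open>p\<close>.\<close>

theorem BK:
  assumes "finite F" "0 \<le> p" "p \<le> 1" "incr A" "incr B"
  shows "Pr p F (disjointly A B) \<le> Pr p F A * Pr p F B"
  using assms(1,4,5)
proof (induction F arbitrary: A B rule: finite_induct)
  case empty
  then show ?case by (auto simp: Pr_def disjointly_def)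
next
  case (insert e F)
  define A1 where "A1 = (\<lambda>S. A (insert e S))"
  define B1 where "B1 = (\<lambda>S. B (insert e S))"
  have mA1: "incr A1" and mB1: "incr B1"
    unfolding A1_def B1_def by (intro incr_section insert.prems)+
  have AA1: "A S \<Longrightarrow> A1 S" and BB1: "B S \<Longrightarrow> B1 S" for S
    unfolding A1_def B1_def
    by (erule incrD[OF insert.prems(1)], blast) (erule incrD[OF insert.prems(2)], blast)
  define x where "x = Pr p F (disjointly A B)"
  define y where "y = Pr p F (\<lambda>S. disjointly A B (insert e S))"
  let ?a0 = "Pr p F A" and ?a1 = "Pr p F A1" and ?b0 = "Pr p F B" and ?b1 = "Pr p F B1"
  have a: "?a0 \<le> ?a1" "0 \<le> ?a0" and b: "?b0 \<le> ?b1" "0 \<le> ?b0"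
    using assms AA1 BB1 by (auto intro!: Pr_mono Pr_nonneg)
  have split: "disjointly A B (insert e S) \<longleftrightarrow> disjointly A1 B S \<or> disjointly A B1 S" if "S \<subseteq> F" for S
  proof
    assume "disjointly A B (insert e S)"
    then obtain I where I: "I \<subseteq> insert e S" "A I" "B (insert e S - I)" by (auto simp: disjointly_def)
    have eS: "e \<notin> S" using that insert by auto
    show "disjointly A1 B S \<or> disjointly A B1 S"
    proof (cases "e \<in> I")
      case True
      then have "insert e (I - {e}) = I" "insert e S - I = S - (I - {e})" using eS by auto
      then have "A1 (I - {e})" "B (S - (I - {e}))" using I by (simp_all add: A1_def)
      then have "disjointly A1 B S" unfolding disjointly_def using I by (intro exI[of _ "I - {e}"]) auto
      then show ?thesis ..
    next
      case False
      then have "insert e S - I = insert e (S - I)" by auto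
      then have "B1 (S - I)" using I by (simp add: B1_def)
      then have "disjointly A B1 S" unfolding disjointly_def using I False by (intro exI[of _ I]) auto
      then show ?thesis ..
    qed
  next
    have eS: "e \<notin> S" using that insert by auto
    assume "disjointly A1 B S \<or> disjointly A B1 S"
    then show "disjointly A B (insert e S)"
    proof
      assume "disjointly A1 B S"
      then obtain I where I: "I \<subseteq> S" "A (insert e I)" "B (S - I)" by (auto simp: disjointly_def A1_def)
      moreover have "insert e S - insert e I = S - I" using eS I by auto
      ultimately show ?thesis unfolding disjointly_def by (intro exI[of _ "insert e I"]) auto
    next
      assume "disjointly A B1 S"
      then obtain I where I: "I \<subseteq> S" "A I" "B (insert e (S - I))" by (auto simp: disjointly_def B1_def)
      moreover have "insert e S - I = insert e (S - I)" using eS I by auto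
      ultimately show ?thesis unfolding disjointly_def by (intro exI[of _ I]) auto
    qed
  qed
  \<comment> \<open>With \<open>e\<close> open the event is a union of two events, both of which
    contain the event with \<open>e\<close> closed; the probability \<open>x\<close> of the latter
    can therefore be subtracted once.\<close>
  have y1: "y \<le> Pr p F (disjointly A1 B) + Pr p F (disjointly A B1) - x"
  proof -
    have "y + x = Eb p F (\<lambda>S. of_bool (disjointly A B (insert e S)) + of_bool (disjointly A B S))"
      by (simp add: y_def x_def Pr_def Eb_add)
    also have "\<dots> \<le> Eb p F (\<lambda>S. of_bool (disjointly A1 B S) + of_bool (disjointly A B1 S))"
    proof (intro Eb_mono assms(2,3))
      fix S assume "S \<subseteq> F"
      moreover have "disjointly A B S \<Longrightarrow> disjointly A1 B S \<and> disjointly A B1 S"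
        unfolding disjointly_def using AA1 BB1 by blast
      ultimately show "of_bool (disjointly A B (insert e S)) + of_bool (disjointly A B S)
          \<le> (of_bool (disjointly A1 B S) + of_bool (disjointly A B1 S) :: real)"
        using split[of S] by auto
    qed
    finally show ?thesis by (simp add: Pr_def Eb_add)
  qed
  have y2: "y \<le> Pr p F (disjointly A1 B1)"
    unfolding y_def
  proof (intro Pr_mono assms(2,3))
    fix S assume "S \<subseteq> F" "disjointly A B (insert e S)"
    then show "disjointly A1 B1 S" using split[of S] AA1 BB1 unfolding disjointly_def by blast
  qed
  have x: "x \<le> ?a0 * ?b0" unfolding x_def by (intro insert.IH insert.prems)
  have "Pr p F (disjointly A1 B) \<le> ?a1 * ?b0" "Pr p F (disjointly A B1) \<le> ?a0 * ?b1" "Pr p F (disjointly A1 B1) \<le> ?a1 * ?b1"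
    using insert.IH mA1 mB1 insert.prems by auto
  then have y1': "y \<le> ?a1 * ?b0 + ?a0 * ?b1 - x" and y2': "y \<le> ?a1 * ?b1"
    using y1 y2 by linarith+
  have sq: "0 \<le> (?a1 - ?a0) * (?b1 - ?b0)" using a b by simp
  \<comment> \<open>The bound containing \<open>- x\<close> gets the smaller of the weights
    \<open>p\<close> and \<open>1 - p\<close>, so that the remaining coefficient of \<open>x\<close>
    or \<open>y\<close> stays nonnegative. The right side then exceeds the estimate by the square of
    that weight times \<open>(?a1 - ?a0) * (?b1 - ?b0)\<close>.\<close>
  have "(1 - p) * x + p * y \<le> ((1 - p) * ?a0 + p * ?a1) * ((1 - p) * ?b0 + p * ?b1)"
  proof (cases "p \<le> 1/2")
    case True
    have "p * y \<le> p * (?a1 * ?b0 + ?a0 * ?b1 - x)" using y1' assms by (intro mult_left_mono)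
    moreover have "(1 - 2 * p) * x \<le> (1 - 2 * p) * (?a0 * ?b0)"
      using x True by (intro mult_left_mono) auto
    moreover have "0 \<le> p\<^sup>2 * ((?a1 - ?a0) * (?b1 - ?b0))" using sq by simp
    ultimately show ?thesis by (simp add: algebra_simps power2_eq_square)
  next
    case False
    have "(1 - p) * y \<le> (1 - p) * (?a1 * ?b0 + ?a0 * ?b1 - x)" using y1' assms by (intro mult_left_mono) auto
    moreover have "(2 * p - 1) * y \<le> (2 * p - 1) * (?a1 * ?b1)"
      using y2' False by (intro mult_left_mono) auto
    moreover have "0 \<le> (1 - p)\<^sup>2 * ((?a1 - ?a0) * (?b1 - ?b0))" using sq by simp
    ultimately show ?thesis by (simp add: algebra_simps power2_eq_square)
  qed
  then show ?case using insert by (simp add: Pr_insert x_def y_def A1_def B1_def)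
qed

subsection \<open>Moments\<close>

lemma chebyshev_half:
  assumes "finite F" "0 \<le> p" "p \<le> 1" "0 < m" "m \<le> Eb p F Z"
    "Eb p F (\<lambda>S. (Z S)\<^sup>2) \<le> (Eb p F Z)\<^sup>2 + v"
  shows "Pr p F (\<lambda>S. Z S < m / 2) \<le> 4 * v / m\<^sup>2"
proof -
  define \<mu> where "\<mu> = Eb p F Z"
  have "(m / 2)\<^sup>2 * of_bool (Z S < m / 2) \<le> (Z S - \<mu>)\<^sup>2" for S
  proof (cases "Z S < m / 2")
    case True
    then have "m / 2 \<le> \<mu> - Z S" using assms by (simp add: \<mu>_def)
    then have "(m / 2)\<^sup>2 \<le> (\<mu> - Z S)\<^sup>2" using assms by (intro power_mono) auto
    then show ?thesis using True by (simp add: power2_commute)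
  qed simp
  then have "Eb p F (\<lambda>S. (m / 2)\<^sup>2 * of_bool (Z S < m / 2)) \<le> Eb p F (\<lambda>S. (Z S - \<mu>)\<^sup>2)"
    using assms by (intro Eb_mono)
  also have "\<dots> = Eb p F (\<lambda>S. (Z S)\<^sup>2 - 2 * \<mu> * Z S + \<mu>\<^sup>2)"
    by (simp add: power2_diff algebra_simps)
  also have "\<dots> = Eb p F (\<lambda>S. (Z S)\<^sup>2) - \<mu>\<^sup>2"
    using assms by (simp add: Eb_add Eb_diff Eb_cmult Eb_const \<mu>_def power2_eq_square)
  also have "\<dots> \<le> v" using assms by (simp add: \<mu>_def)
  finally have "(m / 2)\<^sup>2 * Pr p F (\<lambda>S. Z S < m / 2) \<le> v"
    by (simp add: Pr_def Eb_cmult)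
  then show ?thesis using assms by (simp add: field_simps)
qed

text \<open>Layer-cake formula up to level \<open>m\<close>; above it, \<open>X\<close> is at most
  \<open>X^2 / m\<close>.\<close>

lemma Eb_le_truncated:
  fixes X :: "'b set \<Rightarrow> nat"
  assumes "finite F" "0 \<le> p" "p \<le> 1" "0 < m"
  shows "Eb p F (\<lambda>S. real (X S)) \<le> (\<Sum>n=1..m. Pr p F (\<lambda>S. n \<le> X S)) + Eb p F (\<lambda>S. (real (X S))\<^sup>2) / m"
proof -
  have "real (X S) \<le> (\<Sum>n=1..m. of_bool (n \<le> X S)) + (real (X S))\<^sup>2 * (1 / m)" for S
  proof (cases "X S \<le> m")
    case True
    have "(\<Sum>n=1..m. of_bool (n \<le> X S)) = (\<Sum>n\<in>{1..X S}. 1 :: real)"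
      using True by (intro sum.mono_neutral_cong_right) auto
    then show ?thesis by simp
  next
    case False
    then have "real (X S) * real m \<le> real (X S) * real (X S)" by (intro mult_left_mono) auto
    then have "real (X S) \<le> (real (X S))\<^sup>2 * (1 / m)"
      using assms by (simp add: power2_eq_square field_simps)
    moreover have "0 \<le> (\<Sum>n=1..m. of_bool (n \<le> X S) :: real)" by (intro sum_nonneg) auto
    ultimately show ?thesis by linarith
  qed
  then have "Eb p F (\<lambda>S. real (X S)) \<le> Eb p F (\<lambda>S. (\<Sum>n=1..m. of_bool (n \<le> X S)) + (real (X S))\<^sup>2 * (1 / m))"
    using assms by (intro Eb_mono)
  then show ?thesis unfolding Pr_def by (simp only: Eb_add Eb_sum Eb_cmult_right) simp
qed

section \<open>Restricted connections and disjoint paths\<close>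

text \<open>Only edges with both ends in \<open>R\<close> may be used; a point outside \<open>R\<close> is linked to itself only.\<close>

definition linked :: "'a set set \<Rightarrow> 'a set \<Rightarrow> 'a \<Rightarrow> 'a \<Rightarrow> bool" where
  "linked S R x y \<longleftrightarrow> (x, y) \<in> (adj {e \<in> S. e \<subseteq> R})\<^sup>*"

lemma linked_refl [simp]: "linked S R x x"
  by (simp add: linked_def)

lemma linked_trans: "linked S R x y \<Longrightarrow> linked S R y z \<Longrightarrow> linked S R x z"
  unfolding linked_def by (rule rtrancl_trans)

lemma linked_sym: "linked S R x y \<Longrightarrow> linked S R y x"
proof -
  have "sym (adj {e \<in> S. e \<subseteq> R})"
    by (auto simp: sym_def adj_def insert_commute)
  then show "linked S R x y \<Longrightarrow> linked S R y x"
    unfolding linked_def by (meson sym_rtrancl symD)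
qed

lemma linked_mono:
  assumes "linked S R x y" "S \<subseteq> S'" "R \<subseteq> R'"
  shows "linked S' R' x y"
proof -
  have "adj {e \<in> S. e \<subseteq> R} \<subseteq> adj {e \<in> S'. e \<subseteq> R'}"
    using assms by (auto simp: adj_def)
  then show ?thesis using assms(1) rtrancl_mono unfolding linked_def by blast
qed

lemma incr_linked [intro]: "incr (\<lambda>S. linked S R x y)"
  by (rule incrI) (erule linked_mono, auto)

lemma incr_bex: "(\<And>i. i \<in> I \<Longrightarrow> incr (A i)) \<Longrightarrow> incr (\<lambda>S. \<exists>i\<in>I. A i S)"
  unfolding incr_def by blast

lemma incr_conj: "incr A \<Longrightarrow> incr B \<Longrightarrow> incr (\<lambda>S. A S \<and> B S)"
  unfolding incr_def by blast

lemma linked_cong: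
  assumes "\<And>e. e \<subseteq> R \<Longrightarrow> e \<in> S \<longleftrightarrow> e \<in> S'"
  shows "linked S R x y \<longleftrightarrow> linked S' R x y"
proof -
  have "{e \<in> S. e \<subseteq> R} = {e \<in> S'. e \<subseteq> R}" using assms by auto
  then show ?thesis by (simp add: linked_def)
qed

lemma linked_edge: "{x, y} \<in> S \<Longrightarrow> x \<in> R \<Longrightarrow> y \<in> R \<Longrightarrow> linked S R x y"
  unfolding linked_def by (intro r_into_rtrancl) (simp add: adj_def)

section \<open>Paths as vertex lists\<close>

fun path_edges :: "'a list \<Rightarrow> 'a set set" where
  "path_edges (x # y # xs) = insert {x, y} (path_edges (y # xs))"
| "path_edges _ = {}"

lemma path_edges_append: "path_edges (as @ w # bs) = path_edges (as @ [w]) \<union> path_edges (w # bs)"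
proof (induction as)
  case (Cons a as)
  then show ?case by (cases as) auto
qed simp

lemma path_edges_subset: "e \<in> path_edges xs \<Longrightarrow> e \<subseteq> set xs"
  by (induction xs rule: path_edges.induct) auto

lemma path_edges_snoc_meets: "e \<in> path_edges (as @ [w]) \<Longrightarrow> \<exists>a\<in>set as. a \<in> e"
proof (induction as)
  case (Cons a as)
  then show ?case by (cases as) auto
qed simp

lemma Union_pe: "2 \<le> length xs \<Longrightarrow> \<Union>(path_edges xs) = set xs"
proof (induction xs rule: path_edges.induct)
  case (1 x y xs)
  then show ?case by (cases xs) auto
qed auto

lemma path_edges_linked: "xs \<noteq> [] \<Longrightarrow> path_edges xs \<subseteq> S \<Longrightarrow> set xs \<subseteq> R \<Longrightarrow> linked S R (hd xs) (last xs)"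
proof (induction xs rule: path_edges.induct)
  case (1 x y xs)
  then have "linked S R y (last (y # xs))" by simp
  moreover have "linked S R x y" using 1 by (intro linked_edge) auto
  ultimately show ?case using linked_trans[of S R x y "last (y # xs)"] by simp
qed auto

text \<open>Loops are erased along the induction, because distinct vertices are what makes the two
  pieces of a cut path edge-disjoint. The alternative \<open>xs = [x]\<close> covers a start outside
  \<open>R\<close>, which is linked only to itself.\<close>

lemma linked_path:
  assumes "linked S R x y"
  obtains xs where "distinct xs" "xs \<noteq> []" "hd xs = x" "last xs = y" "path_edges xs \<subseteq> S"
    "set xs \<subseteq> R \<or> xs = [x]" "set xs \<subseteq> insert x (\<Union>S)"
proof -
  have "\<exists>xs. distinct xs \<and> xs \<noteq> [] \<and> hd xs = x \<and> last xs = y \<and> path_edges xs \<subseteq> {e \<in> S. e \<subseteq> R}"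
    using assms unfolding linked_def
  proof (induction rule: converse_rtrancl_induct)
    case base
    show ?case by (intro exI[of _ "[y]"]) auto
  next
    case (step x z)
    then obtain zs where zs: "distinct zs" "zs \<noteq> []" "hd zs = z" "last zs = y" "path_edges zs \<subseteq> {e \<in> S. e \<subseteq> R}"
      by blast
    show ?case
    proof (cases "x \<in> set zs")
      case True
      then obtain as bs where ab: "zs = as @ x # bs" by (meson split_list)
      have "path_edges zs = path_edges (as @ [x]) \<union> path_edges (x # bs)" unfolding ab by (rule path_edges_append)
      then have "path_edges (x # bs) \<subseteq> {e \<in> S. e \<subseteq> R}" using zs(5) by blast
      then show ?thesis using zs ab by (intro exI[of _ "x # bs"]) auto
    next
      case False
      obtain zs' where zs': "zs = z # zs'" using zs by (cases zs) auto
      have "{x, z} \<in> {e \<in> S. e \<subseteq> R}" using step(1) by (simp add: adj_def)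
      then show ?thesis using zs False zs' by (intro exI[of _ "x # zs"]) auto
    qed
  qed
  then obtain xs where xs: "distinct xs" "xs \<noteq> []" "hd xs = x" "last xs = y" "path_edges xs \<subseteq> {e \<in> S. e \<subseteq> R}"
    by blast
  show ?thesis
  proof (cases "length xs \<ge> 2")
    case True
    then have "\<Union>(path_edges xs) = set xs" by (rule Union_pe)
    then have "set xs \<subseteq> R" "set xs \<subseteq> \<Union>S" using xs(5) by blast+
    then show ?thesis using that[of xs] xs by blast
  next
    case False
    then have "xs = [x]" using xs(2,3) by (cases xs; cases "tl xs") auto
    then show ?thesis using that[of xs] xs by auto
  qed
qed

section \<open>Edge-disjoint decompositions of connections\<close>

lemma disjoint_pe_split:
  assumes "distinct (as @ w # bs)"
  shows "path_edges (as @ [w]) \<inter> path_edges (w # bs) = {}"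
proof (rule equals0I)
  fix e assume "e \<in> path_edges (as @ [w]) \<inter> path_edges (w # bs)"
  then obtain a where "a \<in> set as" "a \<in> e" "e \<subseteq> set (w # bs)"
    using path_edges_snoc_meets[of e as w] path_edges_subset[of e "w # bs"] by blast
  then show False using assms by auto
qed

lemma disjointly_path_split:
  assumes "distinct (as @ w # bs)" "path_edges (as @ w # bs) \<subseteq> S" "set (as @ [w]) \<subseteq> R1" "set (w # bs) \<subseteq> R2"
  shows "disjointly (\<lambda>S. linked S R1 (hd (as @ [w])) w) (\<lambda>S. linked S R2 w (last (w # bs))) S"
proof (rule disI[where I = "path_edges (as @ [w])" and J = "path_edges (w # bs)"])
  show "incr (\<lambda>S. linked S R2 w (last (w # bs)))" by (rule incr_linked)
  show "linked (path_edges (as @ [w])) R1 (hd (as @ [w])) w"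
    using path_edges_linked[of "as @ [w]" "path_edges (as @ [w])" R1] assms by simp
  show "linked (path_edges (w # bs)) R2 w (last (w # bs))"
    using path_edges_linked[of "w # bs" "path_edges (w # bs)" R2] assms by simp
  show "path_edges (as @ [w]) \<union> path_edges (w # bs) \<subseteq> S" using assms(2) path_edges_append[of as w bs] by blast
  show "path_edges (as @ [w]) \<inter> path_edges (w # bs) = {}" by (rule disjoint_pe_split[OF assms(1)])
qed

text \<open>A self-avoiding path is cut at a vertex that maximizes \<open>\<phi>\<close>. With the
  height as \<open>\<phi>\<close> this yields ladder points, with the negated height it yields
  lowest points.\<close>

lemma linked_highest:
  fixes \<phi> :: "'a \<Rightarrow> real"
  assumes "linked S R x y"
  shows "\<exists>w\<in>insert x (\<Union>S). (w \<in> R \<or> w = x) \<and> disjointly (\<lambda>S. linked S {z \<in> R. \<phi> z \<le> \<phi> w} x w)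
    (\<lambda>S. linked S {z \<in> R. \<phi> z \<le> \<phi> w} w y) S \<and> (w \<noteq> x \<longrightarrow> w \<in> R \<and> x \<in> R \<and> \<phi> x \<le> \<phi> w)"
proof -
  obtain xs where xs: "distinct xs" "xs \<noteq> []" "hd xs = x" "last xs = y" "path_edges xs \<subseteq> S"
    "set xs \<subseteq> R \<or> xs = [x]" "set xs \<subseteq> insert x (\<Union>S)"
    using linked_path[OF assms] by blast
  have "Max (\<phi> ` set xs) \<in> \<phi> ` set xs" using xs(2) by (intro Max_in) auto
  then obtain w where w1: "w \<in> set xs" "\<phi> w = Max (\<phi> ` set xs)" by auto
  have w: "w \<in> set xs" "\<And>z. z \<in> set xs \<Longrightarrow> \<phi> z \<le> \<phi> w"
    using w1 by simp_all
  obtain as bs where ab: "xs = as @ w # bs" using w(1) by (meson split_list)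
  show ?thesis
  proof (cases "set xs \<subseteq> R")
    case True
    then have "set (as @ [w]) \<subseteq> {z \<in> R. \<phi> z \<le> \<phi> w}" "set (w # bs) \<subseteq> {z \<in> R. \<phi> z \<le> \<phi> w}"
      using w ab by auto
    moreover have "hd (as @ [w]) = x" "last (w # bs) = y" using xs ab by (auto simp: hd_append)
    ultimately have "disjointly (\<lambda>S. linked S {z \<in> R. \<phi> z \<le> \<phi> w} x w) (\<lambda>S. linked S {z \<in> R. \<phi> z \<le> \<phi> w} w y) S"
      using disjointly_path_split[of as w bs S "{z \<in> R. \<phi> z \<le> \<phi> w}" "{z \<in> R. \<phi> z \<le> \<phi> w}"] xs(1,5) ab by metis
    moreover have "x \<in> set xs" using xs by (metis hd_in_set)
    ultimately show ?thesis using w True xs(7) by blast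
  next
    case False
    then have "xs = [x]" using xs by auto
    then have "y = x" "w = x" using xs w by auto
    then show ?thesis by (intro bexI[of _ x]) (auto simp: disjointly_def)
  qed
qed

text \<open>The path is cut at its first vertex outside \<open>B\<close>; only the first piece is
  confined, since the second may come back into \<open>B\<close>.\<close>

lemma linked_first_exit:
  assumes "linked S R x y" "x \<in> B" "y \<notin> B"
  shows "\<exists>w\<in>\<Union>S. w \<in> R \<and> w \<notin> B \<and> disjointly (\<lambda>S. linked S (insert w (R \<inter> B)) x w) (\<lambda>S. linked S R w y) S"
proof -
  obtain xs where xs: "distinct xs" "xs \<noteq> []" "hd xs = x" "last xs = y" "path_edges xs \<subseteq> S"
    "set xs \<subseteq> R \<or> xs = [x]" "set xs \<subseteq> insert x (\<Union>S)"
    using linked_path[OF assms(1)] by blast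
  have "xs \<noteq> [x]"
  proof
    assume "xs = [x]"
    then have "y = x" using xs(4) by simp
    then show False using assms(2,3) by simp
  qed
  then have R: "set xs \<subseteq> R" using xs(6) by simp
  have "last xs \<in> set xs" using xs(2) by simp
  then have "\<exists>z\<in>set xs. z \<notin> B" using xs(4) assms(3) by blast
  then obtain as w bs where ab: "xs = as @ w # bs" "w \<notin> B" "\<forall>z\<in>set as. z \<in> B"
    using split_list_first_prop[of xs "\<lambda>z. z \<notin> B"] by auto
  have "set (as @ [w]) \<subseteq> insert w (R \<inter> B)" "set (w # bs) \<subseteq> R" using ab R by auto
  moreover have "hd (as @ [w]) = x" "last (w # bs) = y" using xs ab by (auto simp: hd_append)
  ultimately have "disjointly (\<lambda>S. linked S (insert w (R \<inter> B)) x w) (\<lambda>S. linked S R w y) S"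
    using disjointly_path_split[of as w bs S "insert w (R \<inter> B)" R] xs(1,5) ab(1) by metis
  moreover have "w \<in> \<Union>S" "w \<in> R" using xs(7) ab R assms by auto
  ultimately show ?thesis using ab by blast
qed

lemma disD: "disjointly A B S \<Longrightarrow> incr A \<Longrightarrow> incr B \<Longrightarrow> A S \<and> B S"
  unfolding disjointly_def incr_def by (metis Diff_subset)

text \<open>The point \<open>w\<close> is where a path from \<open>u'\<close> towards
  \<open>v\<close> first meets a path from \<open>v\<close> to \<open>u\<close>. The rest of the
  former path is discarded, which leaves three edge-disjoint arms at \<open>w\<close>.\<close>

lemma linked_tree_graph:
  assumes "linked S R v u" "linked S R v u'"
  shows "\<exists>w\<in>insert v (\<Union>S). (w \<in> R \<or> w = v) \<and>
    disjointly (\<lambda>S. linked S R v w) (disjointly (\<lambda>S. linked S R w u) (\<lambda>S. linked S R w u')) S"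
proof -
  obtain xs where xs: "distinct xs" "xs \<noteq> []" "hd xs = v" "last xs = u" "path_edges xs \<subseteq> S"
    "set xs \<subseteq> R \<or> xs = [v]" "set xs \<subseteq> insert v (\<Union>S)"
    using linked_path[OF assms(1)] by blast
  obtain ys where ys: "distinct ys" "ys \<noteq> []" "hd ys = u'" "last ys = v" "path_edges ys \<subseteq> S"
    "set ys \<subseteq> R \<or> ys = [u']" "set ys \<subseteq> insert u' (\<Union>S)"
    using linked_path[OF linked_sym[OF assms(2)]] by blast
  have "last ys \<in> set ys" "hd xs \<in> set xs" using xs(2) ys(2) by simp_all
  then have "\<exists>z\<in>set ys. z \<in> set xs" using xs(3) ys(4) by metis
  then obtain as w bs where ab: "ys = as @ w # bs" "w \<in> set xs" "\<forall>z\<in>set as. z \<notin> set xs"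
    using split_list_first_prop[of ys "\<lambda>z. z \<in> set xs"] by auto
  obtain cs ds where cd: "xs = cs @ w # ds" using ab(2) by (meson split_list)
  have c1: "linked (path_edges (cs @ [w])) R v w"
  proof (cases "set xs \<subseteq> R")
    case True
    then show ?thesis using path_edges_linked[of "cs @ [w]" "path_edges (cs @ [w])" R] xs cd by (auto simp: hd_append split: if_splits)
  next
    case False
    then have "w = v" using xs ab by auto
    then show ?thesis by simp
  qed
  have c2: "linked (path_edges (w # ds)) R w u"
  proof (cases "set xs \<subseteq> R")
    case True
    then show ?thesis using path_edges_linked[of "w # ds" "path_edges (w # ds)" R] xs cd by (auto split: if_splits)
  next
    case False
    then have "w = v" "u = v" using xs ab by auto
    then show ?thesis by simp
  qed
  have c3: "linked (path_edges (as @ [w])) R w u'"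
  proof (cases "set ys \<subseteq> R")
    case True
    then have "linked (path_edges (as @ [w])) R u' w"
      using path_edges_linked[of "as @ [w]" "path_edges (as @ [w])" R] ys ab by (auto simp: hd_append split: if_splits)
    then show ?thesis by (rule linked_sym)
  next
    case False
    then have "ys = [u']" using ys by auto
    then have "w = u'" using ab by (auto simp: append_eq_Cons_conv Cons_eq_append_conv)
    then show ?thesis by simp
  qed
  have sub: "path_edges (cs @ [w]) \<subseteq> S" "path_edges (w # ds) \<subseteq> S" "path_edges (as @ [w]) \<subseteq> S"
    using xs(5) ys(5) path_edges_append[of cs w ds] path_edges_append[of as w bs] unfolding ab(1) cd by blast+
  have d12: "path_edges (cs @ [w]) \<inter> path_edges (w # ds) = {}"
    using disjoint_pe_split xs(1) cd by metis
  have d3: "e \<notin> path_edges (as @ [w])" if "e \<in> path_edges (cs @ [w]) \<union> path_edges (w # ds)" for e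
  proof
    assume "e \<in> path_edges (as @ [w])"
    then obtain a where "a \<in> set as" "a \<in> e" using path_edges_snoc_meets by metis
    moreover have "e \<subseteq> set xs" using that path_edges_subset[of e xs] path_edges_append[of cs w ds] unfolding cd by blast
    ultimately show False using ab(3) by blast
  qed
  have "disjointly (\<lambda>S. linked S R w u) (\<lambda>S. linked S R w u') (path_edges (w # ds) \<union> path_edges (as @ [w]))"
    by (rule disI[where I = "path_edges (w # ds)" and J = "path_edges (as @ [w])"]) (use c2 c3 d3 in auto)
  moreover have "incr (disjointly (\<lambda>S. linked S R w u) (\<lambda>S. linked S R w u'))"
    by (intro incr_disjointly incr_linked)
  ultimately have "disjointly (\<lambda>S. linked S R v w) (disjointly (\<lambda>S. linked S R w u) (\<lambda>S. linked S R w u')) S"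
    using c1 d12 d3 sub
    by (intro disI[where I = "path_edges (cs @ [w])" and J = "path_edges (w # ds) \<union> path_edges (as @ [w])" and A = "\<lambda>S. linked S R v w"
          and B = "disjointly (\<lambda>S. linked S R w u) (\<lambda>S. linked S R w u')"]) blast+
  moreover have "w = v" if "xs = [v]" using ab(2) that by simp
  then have "w \<in> R \<or> w = v" "w \<in> insert v (\<Union>S)" using xs(6,7) ab(2) by blast+
  ultimately show ?thesis by blast
qed

text \<open>In each of the following three bounds the paths of the decomposition are edge-disjoint, so that
  the BK inequality applies.\<close>

lemma Pr_linked_highest:
  fixes \<phi> :: "'a \<Rightarrow> real"
  assumes "finite F" "0 \<le> p" "p \<le> 1" "finite W" "insert x (\<Union>F) \<subseteq> W"
  shows "Pr p F (\<lambda>S. linked S R x y) \<le>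
    (\<Sum>w\<in>W. Pr p F (\<lambda>S. linked S {z \<in> R. \<phi> z \<le> \<phi> w} x w) * Pr p F (\<lambda>S. linked S {z \<in> R. \<phi> z \<le> \<phi> w} w y))"
proof -
  have "Pr p F (\<lambda>S. linked S R x y) \<le>
    (\<Sum>w\<in>W. Pr p F (disjointly (\<lambda>S. linked S {z \<in> R. \<phi> z \<le> \<phi> w} x w) (\<lambda>S. linked S {z \<in> R. \<phi> z \<le> \<phi> w} w y)))"
  proof (rule Pr_union_le[OF assms(2,3,4)])
    fix S assume "S \<subseteq> F" "linked S R x y"
    then show "\<exists>w\<in>W. disjointly (\<lambda>S. linked S {z \<in> R. \<phi> z \<le> \<phi> w} x w) (\<lambda>S. linked S {z \<in> R. \<phi> z \<le> \<phi> w} w y) S"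
      using linked_highest[of S R x y \<phi>] assms(5) by blast
  qed
  also have "\<dots> \<le> (\<Sum>w\<in>W. Pr p F (\<lambda>S. linked S {z \<in> R. \<phi> z \<le> \<phi> w} x w) * Pr p F (\<lambda>S. linked S {z \<in> R. \<phi> z \<le> \<phi> w} w y))"
    using assms by (intro sum_mono BK incr_linked) auto
  finally show ?thesis .
qed

lemma Pr_linked_first_exit:
  assumes "finite F" "0 \<le> p" "p \<le> 1" "finite W" "\<Union>F - B \<subseteq> W" "x \<in> B" "y \<notin> B"
  shows "Pr p F (\<lambda>S. linked S R x y) \<le>
    (\<Sum>w\<in>W. Pr p F (\<lambda>S. linked S (insert w (R \<inter> B)) x w) * Pr p F (\<lambda>S. linked S R w y))"
proof -
  have "Pr p F (\<lambda>S. linked S R x y) \<le>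
    (\<Sum>w\<in>W. Pr p F (disjointly (\<lambda>S. linked S (insert w (R \<inter> B)) x w) (\<lambda>S. linked S R w y)))"
  proof (rule Pr_union_le[OF assms(2,3,4)])
    fix S assume "S \<subseteq> F" "linked S R x y"
    then show "\<exists>w\<in>W. disjointly (\<lambda>S. linked S (insert w (R \<inter> B)) x w) (\<lambda>S. linked S R w y) S"
      using linked_first_exit[of S R x y B] assms by blast
  qed
  also have "\<dots> \<le> (\<Sum>w\<in>W. Pr p F (\<lambda>S. linked S (insert w (R \<inter> B)) x w) * Pr p F (\<lambda>S. linked S R w y))"
    using assms by (intro sum_mono BK incr_linked) auto
  finally show ?thesis .
qed

lemma Pr_tree_graph:
  assumes "finite F" "0 \<le> p" "p \<le> 1" "finite W" "insert v (\<Union>F) \<subseteq> W"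
  shows "Pr p F (\<lambda>S. linked S R v u \<and> linked S R v u') \<le>
    (\<Sum>w | w \<in> W \<and> (w \<in> R \<or> w = v).
      Pr p F (\<lambda>S. linked S R v w) * (Pr p F (\<lambda>S. linked S R w u) * Pr p F (\<lambda>S. linked S R w u')))"
proof -
  let ?W = "{w \<in> W. w \<in> R \<or> w = v}"
  have fW: "finite ?W" using assms by auto
  have "Pr p F (\<lambda>S. linked S R v u \<and> linked S R v u') \<le>
    (\<Sum>w\<in>?W. Pr p F (disjointly (\<lambda>S. linked S R v w) (disjointly (\<lambda>S. linked S R w u) (\<lambda>S. linked S R w u'))))"
  proof (rule Pr_union_le[OF assms(2,3) fW])
    fix S assume "S \<subseteq> F" "linked S R v u \<and> linked S R v u'"
    then show "\<exists>w\<in>?W. disjointly (\<lambda>S. linked S R v w) (disjointly (\<lambda>S. linked S R w u) (\<lambda>S. linked S R w u')) S"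
      using linked_tree_graph[of S R v u u'] assms(5) by blast
  qed
  also have "\<dots> \<le> (\<Sum>w\<in>?W. Pr p F (\<lambda>S. linked S R v w) * Pr p F (disjointly (\<lambda>S. linked S R w u) (\<lambda>S. linked S R w u')))"
    using assms by (intro sum_mono BK incr_linked incr_disjointly) auto
  also have "\<dots> \<le> (\<Sum>w\<in>?W. Pr p F (\<lambda>S. linked S R v w) * (Pr p F (\<lambda>S. linked S R w u) * Pr p F (\<lambda>S. linked S R w u')))"
    using assms by (intro sum_mono mult_left_mono BK incr_linked Pr_nonneg) auto
  finally show ?thesis by simp
qed

section \<open>The modular function and the mass-transport principle\<close>

locale transitive_graph =
  fixes V :: "'a set" and E :: "'a set set" and \<Gamma> :: "('a \<Rightarrow> 'a) set"
  assumes simple: "simple_graph V E" and conn: "connected_graph V E" and lf: "locally_finite_graph V E"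
    and subgr: "subgroup \<Gamma> (graph_Aut V E)" and vtrans: "vertex_transitive V \<Gamma>"
begin

lemma edge_subset: "e \<in> E \<Longrightarrow> e \<subseteq> V" and edge_card: "e \<in> E \<Longrightarrow> card e = 2"
  using simple by (auto simp: simple_graph_def)

lemma edgeD: "{x, y} \<in> E \<Longrightarrow> x \<in> V \<and> y \<in> V \<and> x \<noteq> y"
  using edge_subset[of "{x, y}"] edge_card[of "{x, y}"] by (auto simp: card_2_iff)

lemma edgeE: "e \<in> E \<Longrightarrow> \<exists>x y. e = {x, y} \<and> x \<noteq> y \<and> x \<in> V \<and> y \<in> V"
  using edge_card[of e] edge_subset[of e] by (auto simp: card_2_iff)

lemma \<Gamma>_Bij: "\<gamma> \<in> \<Gamma> \<Longrightarrow> \<gamma> \<in> Bij V"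
  using subgroup.subset[OF subgr] by (auto simp: graph_Aut_def)

lemma \<Gamma>_bij: "\<gamma> \<in> \<Gamma> \<Longrightarrow> bij_betw \<gamma> V V"
  using \<Gamma>_Bij by (auto simp: Bij_def)

lemma \<Gamma>_V: "\<gamma> \<in> \<Gamma> \<Longrightarrow> x \<in> V \<Longrightarrow> \<gamma> x \<in> V"
  using \<Gamma>_bij bij_betwE by blast

lemma \<Gamma>_inj: "\<gamma> \<in> \<Gamma> \<Longrightarrow> inj_on \<gamma> V"
  using \<Gamma>_bij bij_betw_def by blast

lemma \<Gamma>_edge: "\<gamma> \<in> \<Gamma> \<Longrightarrow> x \<in> V \<Longrightarrow> y \<in> V \<Longrightarrow> {\<gamma> x, \<gamma> y} \<in> E \<longleftrightarrow> {x, y} \<in> E"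
  using subgroup.subset[OF subgr] by (auto simp: graph_Aut_def)

lemma \<Gamma>_comp: "\<gamma> \<in> \<Gamma> \<Longrightarrow> \<gamma>' \<in> \<Gamma> \<Longrightarrow> compose V \<gamma> \<gamma>' \<in> \<Gamma>"
  using subgroup.m_closed[OF subgr, of \<gamma> \<gamma>'] \<Gamma>_Bij by (simp add: graph_Aut_def BijGroup_def)

lemma \<Gamma>_id: "(\<lambda>x\<in>V. x) \<in> \<Gamma>"
  using subgroup.one_closed[OF subgr] by (simp add: graph_Aut_def BijGroup_def)

lemma \<Gamma>_inv:
  assumes "\<gamma> \<in> \<Gamma>"
  obtains \<gamma>' where "\<gamma>' \<in> \<Gamma>" "\<And>x. x \<in> V \<Longrightarrow> \<gamma>' (\<gamma> x) = x" "\<And>x. x \<in> V \<Longrightarrow> \<gamma> (\<gamma>' x) = x"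
proof -
  let ?A = "graph_Aut V E"
  have eq: "(BijGroup V)\<lparr>carrier := carrier ?A\<rparr> = ?A" by (simp add: graph_Aut_def)
  have "group ((BijGroup V)\<lparr>carrier := carrier ?A\<rparr>)"
    by (rule subgroup.subgroup_is_group[OF subgroup_graph_Aut group_BijGroup])
  then have grp: "group ?A" unfolding eq .
  have \<gamma>A: "\<gamma> \<in> carrier ?A" using subgroup.subset[OF subgr] assms by auto
  define \<gamma>' where "\<gamma>' = inv\<^bsub>?A\<^esub> \<gamma>"
  have \<gamma>': "\<gamma>' \<in> \<Gamma>" unfolding \<gamma>'_def using subgroup.m_inv_closed[OF subgr assms] .
  have B: "\<gamma> \<in> Bij V" "\<gamma>' \<in> Bij V" using \<Gamma>_Bij assms \<gamma>' by auto
  have "\<gamma>' \<otimes>\<^bsub>?A\<^esub> \<gamma> = \<one>\<^bsub>?A\<^esub>" "\<gamma> \<otimes>\<^bsub>?A\<^esub> \<gamma>' = \<one>\<^bsub>?A\<^esub>"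
    unfolding \<gamma>'_def using group.l_inv[OF grp \<gamma>A] group.r_inv[OF grp \<gamma>A] by auto
  then have "compose V \<gamma>' \<gamma> = (\<lambda>x\<in>V. x)" "compose V \<gamma> \<gamma>' = (\<lambda>x\<in>V. x)"
    using B by (auto simp: graph_Aut_def BijGroup_def)
  then have "\<gamma>' (\<gamma> x) = x" "\<gamma> (\<gamma>' x) = x" if "x \<in> V" for x
    using that by (metis compose_eq restrict_apply')+
  then show ?thesis using that \<gamma>' by blast
qed

lemma \<Gamma>_trans: "x \<in> V \<Longrightarrow> y \<in> V \<Longrightarrow> \<exists>\<gamma>\<in>\<Gamma>. \<gamma> x = y"
  using transitive_action.unique_orbit[OF vtrans[unfolded vertex_transitive_def]] by auto

lemma adj_V: "(x, y) \<in> adj E \<Longrightarrow> x \<in> V \<and> y \<in> V"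
  using edgeD by (auto simp: adj_def)

subsection \<open>Balls\<close>

definition gball :: "'a \<Rightarrow> nat \<Rightarrow> 'a set" where
  "gball x n = {y. \<exists>k\<le>n. (x, y) \<in> adj E ^^ k}"

lemma gball_self [simp]: "x \<in> gball x n"
  by (auto simp: gball_def intro!: exI[of _ 0])

lemma gball_mono: "m \<le> n \<Longrightarrow> gball x m \<subseteq> gball x n"
  by (auto simp: gball_def intro: le_trans)

lemma gball_V: "x \<in> V \<Longrightarrow> gball x n \<subseteq> V"
proof
  fix y assume "x \<in> V" "y \<in> gball x n"
  then obtain k where "(x, y) \<in> adj E ^^ k" by (auto simp: gball_def)
  then show "y \<in> V" using \<open>x \<in> V\<close> by (cases k) (auto dest: adj_V)
qed

lemma nbr_finite: "x \<in> V \<Longrightarrow> finite {y. (x, y) \<in> adj E}"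
proof -
  assume x: "x \<in> V"
  have fin: "finite {e \<in> E. x \<in> e}" using lf x by (auto simp: locally_finite_graph_def)
  have "{y. (x, y) \<in> adj E} \<subseteq> \<Union>{e \<in> E. x \<in> e}" by (auto simp: adj_def)
  moreover have "finite (\<Union>{e \<in> E. x \<in> e})"
    using fin edge_card by (intro finite_Union) (auto intro: card_ge_0_finite)
  ultimately show ?thesis by (rule finite_subset)
qed

lemma sym_adj: "(x, y) \<in> adj E \<longleftrightarrow> (y, x) \<in> adj E"
  by (auto simp: adj_def insert_commute)

lemma relpow_sym: "(x, y) \<in> adj E ^^ k \<longleftrightarrow> (y, x) \<in> adj E ^^ k"
proof -
  have "(x, y) \<in> adj E ^^ k \<Longrightarrow> (y, x) \<in> adj E ^^ k" for x y
  proof (induction k arbitrary: x y)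
    case (Suc k)
    then obtain z where "(x, z) \<in> adj E ^^ k" "(z, y) \<in> adj E" by auto
    then have "(z, x) \<in> adj E ^^ k" "(y, z) \<in> adj E" using Suc.IH sym_adj by auto
    then show ?case by (rule relpow_Suc_I2[rotated])
  qed simp
  then show ?thesis by blast
qed

lemma gball_sym: "y \<in> gball x n \<longleftrightarrow> x \<in> gball y n"
  unfolding gball_def using relpow_sym by auto

lemma gball_trans:
  assumes "y \<in> gball x m" "z \<in> gball y n"
  shows "z \<in> gball x (m + n)"
proof -
  obtain j k where "j \<le> m" "(x, y) \<in> adj E ^^ j" "k \<le> n" "(y, z) \<in> adj E ^^ k"
    using assms by (auto simp: gball_def)
  moreover from this have "(x, z) \<in> adj E ^^ (j + k)" by (auto simp: relpow_add)
  ultimately show ?thesis unfolding gball_def by (auto intro!: exI[of _ "j + k"])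
qed

lemma gball_edge: "{x, y} \<in> E \<Longrightarrow> y \<in> gball x (Suc n)"
  unfolding gball_def by (auto intro!: exI[of _ 1] simp: adj_def)

lemma gball_Suc: "gball x (Suc n) = gball x n \<union> (\<Union>y\<in>gball x n. {z. (y, z) \<in> adj E})"
proof (rule Set.set_eqI, rule iffI)
  fix z assume "z \<in> gball x (Suc n)"
  then obtain k where k: "k \<le> Suc n" "(x, z) \<in> adj E ^^ k" by (auto simp: gball_def)
  show "z \<in> gball x n \<union> (\<Union>y\<in>gball x n. {z. (y, z) \<in> adj E})"
  proof (cases "k \<le> n")
    case True
    then show ?thesis using k by (auto simp: gball_def)
  next
    case False
    then have "k = Suc n" using k by auto
    then obtain y where "(x, y) \<in> adj E ^^ n" "(y, z) \<in> adj E" using k by auto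
    then have "y \<in> gball x n" by (auto simp: gball_def)
    then show ?thesis using \<open>(y, z) \<in> adj E\<close> by blast
  qed
next
  fix z assume "z \<in> gball x n \<union> (\<Union>y\<in>gball x n. {z. (y, z) \<in> adj E})"
  then show "z \<in> gball x (Suc n)"
  proof
    assume "z \<in> gball x n"
    then show ?thesis using gball_mono[of n "Suc n" x] by auto
  next
    assume "z \<in> (\<Union>y\<in>gball x n. {z. (y, z) \<in> adj E})"
    then obtain y where "y \<in> gball x n" "(y, z) \<in> adj E" by blast
    then show ?thesis using gball_trans[of y x n z 1] gball_edge[of y z 0] by (auto simp: adj_def)
  qed
qed

lemma gball_finite: "x \<in> V \<Longrightarrow> finite (gball x n)"
proof (induction n)
  case 0
  have "gball x 0 = {x}" by (auto simp: gball_def)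
  then show ?case by simp
next
  case (Suc n)
  then show ?case using gball_V[of x n] nbr_finite by (auto simp: gball_Suc)
qed

lemma gball_Union: "x \<in> V \<Longrightarrow> (\<Union>n. gball x n) = V"
proof (intro equalityI subsetI)
  fix y assume "x \<in> V" "y \<in> V"
  then have "(x, y) \<in> (adj E)\<^sup>*" using conn by (auto simp: connected_graph_def)
  then obtain k where "(x, y) \<in> adj E ^^ k" using rtrancl_imp_relpow by blast
  then show "y \<in> (\<Union>n. gball x n)" by (auto simp: gball_def)
qed (use gball_V in auto)

lemma \<Gamma>_gball:
  assumes "\<gamma> \<in> \<Gamma>" "x \<in> V"
  shows "\<gamma> ` gball x n = gball (\<gamma> x) n"
proof -
  have *: "\<gamma> ` gball x n \<subseteq> gball (\<gamma> x) n" if "\<gamma> \<in> \<Gamma>" "x \<in> V" for \<gamma> x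
  proof (induction n)
    case 0
    then show ?case by (auto simp: gball_def)
  next
    case (Suc n)
    show ?case
    proof
      fix w assume "w \<in> \<gamma> ` gball x (Suc n)"
      then obtain z where z: "w = \<gamma> z" "z \<in> gball x (Suc n)" by auto
      show "w \<in> gball (\<gamma> x) (Suc n)"
      proof (cases "z \<in> gball x n")
        case True
        then show ?thesis using Suc z gball_mono[of n "Suc n" "\<gamma> x"] by auto
      next
        case False
        then obtain y where y: "y \<in> gball x n" "(y, z) \<in> adj E" using z(2) unfolding gball_Suc by blast
        then have "(\<gamma> y, \<gamma> z) \<in> adj E" using \<Gamma>_edge[OF that(1)] adj_V[OF y(2)] by (auto simp: adj_def)
        moreover have "\<gamma> y \<in> gball (\<gamma> x) n" using Suc y by auto
        ultimately show ?thesis unfolding gball_Suc z(1) by blast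
      qed
    qed
  qed
  obtain \<gamma>' where \<gamma>': "\<gamma>' \<in> \<Gamma>" "\<And>x. x \<in> V \<Longrightarrow> \<gamma>' (\<gamma> x) = x" "\<And>x. x \<in> V \<Longrightarrow> \<gamma> (\<gamma>' x) = x"
    using \<Gamma>_inv[OF assms(1)] by blast
  have "gball (\<gamma> x) n \<subseteq> \<gamma> ` gball x n"
  proof
    fix w assume w: "w \<in> gball (\<gamma> x) n"
    then have "w \<in> V" using gball_V \<Gamma>_V assms by blast
    moreover have "\<gamma>' w \<in> gball x n" using *[OF \<gamma>'(1) \<Gamma>_V[OF assms]] w \<gamma>'(2)[OF assms(2)] by auto
    ultimately show "w \<in> \<gamma> ` gball x n" using \<gamma>'(3) by (metis imageI)
  qed
  then show ?thesis using *[OF assms] by blast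
qed

subsection \<open>Orbits of stabilizers\<close>

definition orb :: "'a \<Rightarrow> 'a \<Rightarrow> 'a set" where
  "orb x y = {\<gamma> y |\<gamma>. \<gamma> \<in> \<Gamma> \<and> \<gamma> x = x}"

abbreviation D :: "'a \<Rightarrow> 'a \<Rightarrow> real" where
  "D \<equiv> modular_fun V \<Gamma>"

lemma D_eq: "D x y = real (card (orb y x)) / real (card (orb x y))"
  by (simp add: modular_fun_def Stab_orbit_def Stab_def orbit_def stabilizer_def orb_def conj_commute)

lemma orb_self: "y \<in> V \<Longrightarrow> x \<in> V \<Longrightarrow> y \<in> orb x y"
  unfolding orb_def using \<Gamma>_id by (intro CollectI exI[of _ "\<lambda>x\<in>V. x"]) auto

lemma orb_finite:
  assumes "x \<in> V" "y \<in> V"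
  shows "finite (orb x y)"
proof -
  obtain n where "y \<in> gball x n" using gball_Union[OF assms(1)] assms(2) by blast
  then have "orb x y \<subseteq> gball x n"
    unfolding orb_def using \<Gamma>_gball[OF _ assms(1)] by (auto, metis image_eqI)
  then show ?thesis using gball_finite[OF assms(1)] finite_subset by blast
qed

lemma card_orb_pos: "x \<in> V \<Longrightarrow> y \<in> V \<Longrightarrow> 0 < card (orb x y)"
  using orb_finite orb_self by (metis card_gt_0_iff empty_iff)

lemma D_pos: "x \<in> V \<Longrightarrow> y \<in> V \<Longrightarrow> 0 < D x y"
  using card_orb_pos by (simp add: D_eq)

lemma D_self [simp]: "x \<in> V \<Longrightarrow> D x x = 1"
  using card_orb_pos[of x x] by (simp add: D_eq)

lemma orb_\<Gamma>:
  assumes "\<gamma> \<in> \<Gamma>" "x \<in> V" "y \<in> V"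
  shows "orb (\<gamma> x) (\<gamma> y) = \<gamma> ` orb x y"
proof -
  have *: "\<gamma> ` orb x y \<subseteq> orb (\<gamma> x) (\<gamma> y)" if g: "\<gamma> \<in> \<Gamma>" "x \<in> V" "y \<in> V" for \<gamma> x y
  proof
    fix w assume "w \<in> \<gamma> ` orb x y"
    then obtain \<beta> where \<beta>: "\<beta> \<in> \<Gamma>" "\<beta> x = x" "w = \<gamma> (\<beta> y)" by (auto simp: orb_def)
    obtain \<gamma>' where \<gamma>': "\<gamma>' \<in> \<Gamma>" "\<And>x. x \<in> V \<Longrightarrow> \<gamma>' (\<gamma> x) = x" "\<And>x. x \<in> V \<Longrightarrow> \<gamma> (\<gamma>' x) = x"
      using \<Gamma>_inv[OF g(1)] by blast
    define \<delta> where "\<delta> = compose V \<gamma> (compose V \<beta> \<gamma>')"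
    have "\<delta> \<in> \<Gamma>" unfolding \<delta>_def by (intro \<Gamma>_comp g \<beta> \<gamma>')
    moreover have "\<delta> (\<gamma> z) = \<gamma> (\<beta> z)" if "z \<in> V" for z
      using that \<gamma>'(2)[OF that] \<Gamma>_V[OF \<open>\<gamma> \<in> \<Gamma>\<close> that] by (simp add: \<delta>_def compose_eq)
    ultimately show "w \<in> orb (\<gamma> x) (\<gamma> y)" unfolding orb_def using g \<beta>
      by (intro CollectI exI[of _ \<delta>]) simp
  qed
  obtain \<gamma>' where \<gamma>': "\<gamma>' \<in> \<Gamma>" "\<And>x. x \<in> V \<Longrightarrow> \<gamma>' (\<gamma> x) = x" "\<And>x. x \<in> V \<Longrightarrow> \<gamma> (\<gamma>' x) = x"
    using \<Gamma>_inv[OF assms(1)] by blast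
  have "orb (\<gamma> x) (\<gamma> y) \<subseteq> \<gamma> ` orb x y"
  proof
    fix w assume w: "w \<in> orb (\<gamma> x) (\<gamma> y)"
    then have wV: "w \<in> V" using \<Gamma>_V assms by (auto simp: orb_def)
    have "\<gamma>' w \<in> orb x y"
      using *[OF \<gamma>'(1) \<Gamma>_V[OF assms(1,2)] \<Gamma>_V[OF assms(1,3)]] w \<gamma>'(2) assms by auto
    then show "w \<in> \<gamma> ` orb x y" using \<gamma>'(3)[OF wV] by force
  qed
  then show ?thesis using *[OF assms] by blast
qed

lemma card_orb_\<Gamma>: "\<gamma> \<in> \<Gamma> \<Longrightarrow> x \<in> V \<Longrightarrow> y \<in> V \<Longrightarrow> card (orb (\<gamma> x) (\<gamma> y)) = card (orb x y)"
proof -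
  assume a: "\<gamma> \<in> \<Gamma>" "x \<in> V" "y \<in> V"
  have "orb x y \<subseteq> V" using a \<Gamma>_V by (auto simp: orb_def)
  then show ?thesis using orb_\<Gamma>[OF a] \<Gamma>_inj[OF a(1)] by (metis card_image inj_on_subset)
qed

lemma D_\<Gamma>: "\<gamma> \<in> \<Gamma> \<Longrightarrow> x \<in> V \<Longrightarrow> y \<in> V \<Longrightarrow> D (\<gamma> x) (\<gamma> y) = D x y"
  by (simp add: D_eq card_orb_\<Gamma>)

text \<open>The orbit of the pair fibres over the orbit of \<open>y\<close>, and an element of the
  stabilizer of \<open>x\<close> that moves \<open>y\<close> to \<open>y'\<close> carries one fibre
  onto the other.\<close>

lemma card_pair_orbit:
  assumes "x \<in> V" "y \<in> V" "z \<in> V"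
  shows "card {(\<gamma> y, \<gamma> z) |\<gamma>. \<gamma> \<in> \<Gamma> \<and> \<gamma> x = x} = card (orb x y) * card {\<gamma> z |\<gamma>. \<gamma> \<in> \<Gamma> \<and> \<gamma> x = x \<and> \<gamma> y = y}"
proof -
  let ?K = "{\<gamma> z |\<gamma>. \<gamma> \<in> \<Gamma> \<and> \<gamma> x = x \<and> \<gamma> y = y}"
  define B where "B y' = {\<gamma> z |\<gamma>. \<gamma> \<in> \<Gamma> \<and> \<gamma> x = x \<and> \<gamma> y = y'}" for y'
  have eq: "{(\<gamma> y, \<gamma> z) |\<gamma>. \<gamma> \<in> \<Gamma> \<and> \<gamma> x = x} = Sigma (orb x y) B"
    by (auto simp: B_def orb_def) metis+
  have Bsub: "B y' \<subseteq> orb x z" for y' by (auto simp: B_def orb_def)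
  have "card (B y') = card ?K" if y': "y' \<in> orb x y" for y'
  proof -
    obtain \<beta> where \<beta>: "\<beta> \<in> \<Gamma>" "\<beta> x = x" "\<beta> y = y'" using y' by (auto simp: orb_def)
    obtain \<beta>' where \<beta>': "\<beta>' \<in> \<Gamma>" "\<And>x. x \<in> V \<Longrightarrow> \<beta>' (\<beta> x) = x" "\<And>x. x \<in> V \<Longrightarrow> \<beta> (\<beta>' x) = x"
      using \<Gamma>_inv[OF \<beta>(1)] by blast
    have "B y' = \<beta> ` ?K"
    proof (intro equalityI subsetI)
      fix w assume "w \<in> B y'"
      then obtain \<gamma> where \<gamma>: "\<gamma> \<in> \<Gamma>" "\<gamma> x = x" "\<gamma> y = y'" "w = \<gamma> z" by (auto simp: B_def)
      let ?d = "compose V \<beta>' \<gamma>"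
      have "?d \<in> \<Gamma>" by (intro \<Gamma>_comp \<beta>' \<gamma>)
      moreover have "?d x = x" "?d y = y" "?d z = \<beta>' w"
        using \<gamma> \<beta> \<beta>'(2)[of x] \<beta>'(2)[of y] assms by (auto simp: compose_eq)
      ultimately have "\<beta>' w \<in> ?K" by (intro CollectI exI[of _ ?d]) simp
      moreover have "w \<in> V" using \<gamma> \<Gamma>_V assms by auto
      ultimately show "w \<in> \<beta> ` ?K" using \<beta>'(3)[of w] by (intro rev_image_eqI[of "\<beta>' w"]) auto
    next
      fix w assume "w \<in> \<beta> ` ?K"
      then obtain \<gamma> where \<gamma>: "\<gamma> \<in> \<Gamma>" "\<gamma> x = x" "\<gamma> y = y" "w = \<beta> (\<gamma> z)" by auto
      let ?d = "compose V \<beta> \<gamma>"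
      have "?d \<in> \<Gamma>" by (intro \<Gamma>_comp \<beta> \<gamma>)
      moreover have "?d x = x" "?d y = y'" "?d z = w"
        using \<gamma> \<beta> assms by (auto simp: compose_eq)
      ultimately show "w \<in> B y'" unfolding B_def by (intro CollectI exI[of _ ?d]) simp
    qed
    moreover have "?K \<subseteq> V" using \<Gamma>_V assms by auto
    then have "inj_on \<beta> ?K" by (rule inj_on_subset[OF \<Gamma>_inj[OF \<beta>(1)]])
    ultimately show ?thesis by (simp only: card_image)
  qed
  moreover have "finite (B y')" for y' using Bsub orb_finite assms finite_subset by blast
  ultimately show ?thesis unfolding eq using orb_finite assms by (simp add: card_SigmaI)
qed

text \<open>Let \<open>N a b c\<close> be the size of the orbit of the pair \<open>(b, c)\<close>
  under the stabilizer of \<open>a\<close>. The two-point stabilizer contributes the same factor to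
  \<open>N a b c\<close> and \<open>N b a c\<close>, so \<open>D a b = N b a c / N a b c\<close>,
  and such quotients telescope.\<close>

lemma D_cocycle:
  assumes "x \<in> V" "y \<in> V" "z \<in> V"
  shows "D x y * D y z = D x z"
proof -
  define N where "N a b c = card {(\<gamma> b, \<gamma> c) |\<gamma>. \<gamma> \<in> \<Gamma> \<and> \<gamma> a = a}" for a b c
  define K where "K a b c = card {\<gamma> c |\<gamma>. \<gamma> \<in> \<Gamma> \<and> \<gamma> a = a \<and> \<gamma> b = b}" for a b c
  have N: "N a b c = card (orb a b) * K a b c" if "a \<in> V" "b \<in> V" "c \<in> V" for a b c
    unfolding N_def K_def using card_pair_orbit that by simp
  have Nswap: "N a b c = N a c b" for a b c
  proof -
    have "{(\<gamma> b, \<gamma> c) |\<gamma>. \<gamma> \<in> \<Gamma> \<and> \<gamma> a = a} = prod.swap ` {(\<gamma> c, \<gamma> b) |\<gamma>. \<gamma> \<in> \<Gamma> \<and> \<gamma> a = a}" by force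
    then show ?thesis unfolding N_def by (simp add: card_image)
  qed
  have Kswap: "K a b c = K b a c" for a b c unfolding K_def by (metis (no_types, lifting))
  have Kpos: "0 < K a b c" if "a \<in> V" "b \<in> V" "c \<in> V" for a b c
  proof -
    let ?K = "{\<gamma> c |\<gamma>. \<gamma> \<in> \<Gamma> \<and> \<gamma> a = a \<and> \<gamma> b = b}"
    have "?K \<subseteq> orb a c" by (auto simp: orb_def)
    then have "finite ?K" using orb_finite[OF that(1,3)] by (rule finite_subset)
    moreover have "c \<in> ?K"
      using \<Gamma>_id that by (intro CollectI exI[of _ "\<lambda>x\<in>V. x"]) auto
    then have "?K \<noteq> {}" by (rule ex_in_conv[THEN iffD1, OF exI])
    ultimately show ?thesis unfolding K_def card_gt_0_iff by simp
  qed
  have D': "D a b = real (N b a c) / real (N a b c)" if "a \<in> V" "b \<in> V" "c \<in> V" for a b c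
    using N[of b a c] N[of a b c] Kswap[of b a c] Kpos[OF that] that by (simp add: D_eq)
  have pos: "0 < N y z x" using N[of y z x] card_orb_pos[of y z] Kpos[of y z x] assms by simp
  have "D x y = N y z x / N x y z" "D y z = N z y x / N y z x" "D x z = N z x y / N x z y"
    using D'[of x y z] D'[of y z x] D'[of x z y] assms Nswap[of y x z] by simp_all
  then show ?thesis using pos Nswap[of z y x] Nswap[of x z y] by simp
qed

definition invariant :: "('a \<Rightarrow> 'a \<Rightarrow> real) \<Rightarrow> bool" where
  "invariant f \<longleftrightarrow> (\<forall>\<gamma>\<in>\<Gamma>. \<forall>x\<in>V. \<forall>y\<in>V. f (\<gamma> x) (\<gamma> y) = f x y)"

text \<open>Sums over \<open>V\<close> are handled through bounds on their finite partial sums.\<close>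

definition sum_bdd :: "('a \<Rightarrow> real) \<Rightarrow> real \<Rightarrow> bool" where
  "sum_bdd f c \<longleftrightarrow> (\<forall>U. finite U \<longrightarrow> U \<subseteq> V \<longrightarrow> sum f U \<le> c)"

text \<open>For each orbit of pairs, \<open>u\<close> and \<open>w\<close> are matched when \<open>(v, u)\<close> and \<open>(w, v)\<close> belong to it.\<close>

lemma mass_transport:
  assumes f: "invariant f" "\<And>x y. x \<in> V \<Longrightarrow> y \<in> V \<Longrightarrow> 0 \<le> f x y"
    and v: "v \<in> V" and bdd: "sum_bdd (\<lambda>u. f u v * D v u) c"
  shows "sum_bdd (\<lambda>u. f v u) c"
  unfolding sum_bdd_def
proof (intro allI impI)
  fix U assume U: "finite U" "U \<subseteq> V"
  define M where "M u = {\<gamma> v |\<gamma>. \<gamma> \<in> \<Gamma> \<and> \<gamma> u = v}" for u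
  define M' where "M' w = {u. u \<in> V \<and> w \<in> M u}" for w
  have M: "M u = \<beta> ` orb u v" if b: "u \<in> V" "\<beta> \<in> \<Gamma>" "\<beta> u = v" for u \<beta>
  proof (intro equalityI subsetI)
    fix w assume "w \<in> M u"
    then obtain \<gamma> where \<gamma>: "\<gamma> \<in> \<Gamma>" "\<gamma> u = v" "w = \<gamma> v" by (auto simp: M_def)
    obtain \<beta>' where \<beta>': "\<beta>' \<in> \<Gamma>" "\<And>x. x \<in> V \<Longrightarrow> \<beta>' (\<beta> x) = x" "\<And>x. x \<in> V \<Longrightarrow> \<beta> (\<beta>' x) = x"
      using \<Gamma>_inv[OF b(2)] by blast
    let ?d = "compose V \<beta>' \<gamma>"
    have "?d \<in> \<Gamma>" by (intro \<Gamma>_comp \<beta>' \<gamma>)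
    moreover have "?d u = u" "?d v = \<beta>' w" using \<gamma> \<beta>'(2)[of u] b v by (auto simp: compose_eq)
    ultimately have "\<beta>' w \<in> orb u v" unfolding orb_def by (intro CollectI exI[of _ ?d]) simp
    moreover have "w \<in> V" using \<gamma> \<Gamma>_V v by auto
    ultimately show "w \<in> \<beta> ` orb u v" using \<beta>'(3)[of w] by (intro rev_image_eqI[of "\<beta>' w"]) auto
  next
    fix w assume "w \<in> \<beta> ` orb u v"
    then obtain \<gamma> where \<gamma>: "\<gamma> \<in> \<Gamma>" "\<gamma> u = u" "w = \<beta> (\<gamma> v)" by (auto simp: orb_def)
    let ?d = "compose V \<beta> \<gamma>"
    have "?d \<in> \<Gamma>" by (intro \<Gamma>_comp \<gamma> b)
    moreover have "?d u = v" "?d v = w" using \<gamma> b v by (auto simp: compose_eq)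
    ultimately show "w \<in> M u" unfolding M_def by (intro CollectI exI[of _ ?d]) simp
  qed
  have cardM: "finite (M u) \<and> card (M u) = card (orb u v) \<and> M u \<subseteq> V" if u: "u \<in> V" for u
  proof -
    obtain \<beta> where \<beta>: "\<beta> \<in> \<Gamma>" "\<beta> u = v" using \<Gamma>_trans u v by blast
    have "orb u v \<subseteq> V" using \<Gamma>_V v by (auto simp: orb_def)
    then show ?thesis using M[OF u \<beta>] orb_finite[OF u v] \<Gamma>_inj[OF \<beta>(1)] \<Gamma>_V[OF \<beta>(1)]
      by (auto simp: card_image inj_on_subset)
  qed
  \<comment> \<open>Inverse automorphisms show that the matching is symmetric.\<close>
  have M'M: "M' w = M w" if w: "w \<in> V" for w
  proof (intro equalityI subsetI)
    fix u assume "u \<in> M' w"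
    then obtain \<gamma> where \<gamma>: "\<gamma> \<in> \<Gamma>" "\<gamma> u = v" "w = \<gamma> v" "u \<in> V" by (auto simp: M_def M'_def)
    obtain \<gamma>' where "\<gamma>' \<in> \<Gamma>" "\<And>x. x \<in> V \<Longrightarrow> \<gamma>' (\<gamma> x) = x" "\<And>x. x \<in> V \<Longrightarrow> \<gamma> (\<gamma>' x) = x"
      using \<Gamma>_inv[OF \<gamma>(1)] by blast
    moreover from this have "\<gamma>' v = u" "\<gamma>' w = v" using \<gamma> v by auto
    ultimately show "u \<in> M w" unfolding M_def by auto
  next
    fix u assume "u \<in> M w"
    then obtain \<gamma> where \<gamma>: "\<gamma> \<in> \<Gamma>" "\<gamma> w = v" "u = \<gamma> v" by (auto simp: M_def)
    obtain \<gamma>' where "\<gamma>' \<in> \<Gamma>" "\<And>x. x \<in> V \<Longrightarrow> \<gamma>' (\<gamma> x) = x" "\<And>x. x \<in> V \<Longrightarrow> \<gamma> (\<gamma>' x) = x"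
      using \<Gamma>_inv[OF \<gamma>(1)] by blast
    moreover from this have "\<gamma>' u = v" "\<gamma>' v = w" using \<gamma> v w by auto
    moreover have "u \<in> V" using \<gamma> \<Gamma>_V v by auto
    ultimately show "u \<in> M' w" unfolding M'_def M_def by auto
  qed
  define W where "W = (\<Union>u\<in>U. M u)"
  have W: "finite W" "W \<subseteq> V" using U cardM by (auto simp: W_def)
  have rel: "f v u = f w v \<and> card (orb v w) = card (orb u v) \<and> card (M w) = card (orb w v)"
    if uw: "u \<in> V" "w \<in> M u" for u w
  proof -
    obtain \<gamma> where \<gamma>: "\<gamma> \<in> \<Gamma>" "\<gamma> u = v" "w = \<gamma> v" using uw by (auto simp: M_def)
    moreover have "w \<in> V" using \<gamma> \<Gamma>_V v by auto
    ultimately show ?thesis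
      using f(1) card_orb_\<Gamma>[of \<gamma> u v] cardM v uw(1) unfolding invariant_def by metis
  qed
  \<comment> \<open>The mass \<open>f v u\<close> is shared equally among the
    \<open>card (orb u v)\<close> points of \<open>M u\<close>. Summing over \<open>u\<close> first
    instead, each \<open>w\<close> occurs at most \<open>card (orb w v)\<close> times with weight
    \<open>1 / card (orb v w)\<close>, and this quotient is \<open>D v w\<close>.\<close>
  have "sum (f v) U = (\<Sum>u\<in>U. \<Sum>w\<in>M u. f w v / card (orb v w))"
  proof (intro sum.cong refl)
    fix u assume "u \<in> U"
    then have u: "u \<in> V" using U by auto
    have "(\<Sum>w\<in>M u. f w v / card (orb v w)) = (\<Sum>w\<in>M u. f v u / card (orb u v))"
      using rel[OF u] by (intro sum.cong) auto
    then show "f v u = (\<Sum>w\<in>M u. f w v / card (orb v w))"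
      using cardM[OF u] card_orb_pos[OF u v] by simp
  qed
  also have "\<dots> = (\<Sum>u\<in>U. \<Sum>w | w \<in> W \<and> w \<in> M u. f w v / card (orb v w))"
    by (intro sum.cong refl) (auto simp: W_def)
  also have "\<dots> = (\<Sum>w\<in>W. \<Sum>u | u \<in> U \<and> w \<in> M u. f w v / card (orb v w))"
    using U(1) W(1) by (rule sum.swap_restrict)
  also have "\<dots> \<le> (\<Sum>w\<in>W. \<Sum>u\<in>M' w. f w v / card (orb v w))"
  proof (intro sum_mono sum_mono2)
    fix w assume "w \<in> W"
    then have w: "w \<in> V" using W by auto
    show "finite (M' w)" using M'M[OF w] cardM[OF w] by simp
    show "{u. u \<in> U \<and> w \<in> M u} \<subseteq> M' w" using U by (auto simp: M'_def)
    show "0 \<le> f w v / card (orb v w)" using f(2)[OF w v] by simp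
  qed
  also have "\<dots> = (\<Sum>w\<in>W. f w v * D v w)"
    using W M'M cardM by (intro sum.cong) (auto simp: D_eq)
  also have "\<dots> \<le> c" using bdd W by (auto simp: sum_bdd_def)
  finally show "sum (f v) U \<le> c" .
qed

end

section \<open>Infinite-volume probabilities and heights\<close>

context transitive_graph
begin

subsection \<open>Increasing events in infinite volume\<close>

text \<open>For increasing events this is the limit over growing balls, and if such an event always
  has a finite witness, it is the probability under the product measure
  (\<open>percolation_event\<close>).\<close>

definition PP :: "real \<Rightarrow> ('a set set \<Rightarrow> bool) \<Rightarrow> real" where
  "PP p A = (SUP F\<in>{F. finite F \<and> F \<subseteq> E}. Pr p F A)"

lemma PP_upper:
  assumes "finite F" "F \<subseteq> E" "0 \<le> p" "p \<le> 1"
  shows "Pr p F A \<le> PP p A"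
  unfolding PP_def
proof (rule cSUP_upper)
  show "bdd_above ((\<lambda>F. Pr p F A) ` {F. finite F \<and> F \<subseteq> E})"
    using Pr_le_1 assms by (intro bdd_aboveI[of _ 1]) auto
qed (use assms in auto)

lemma PP_least: "(\<And>F. finite F \<Longrightarrow> F \<subseteq> E \<Longrightarrow> Pr p F A \<le> c) \<Longrightarrow> PP p A \<le> c"
  unfolding PP_def by (rule cSUP_least) auto

lemma PP_le_1: "0 \<le> p \<Longrightarrow> p \<le> 1 \<Longrightarrow> PP p A \<le> 1"
  by (intro PP_least Pr_le_1)

lemma PP_nonneg: "0 \<le> p \<Longrightarrow> p \<le> 1 \<Longrightarrow> 0 \<le> PP p A"
  using PP_upper[of "{}" p A] Pr_nonneg[of p "{}" A] by auto

lemma PP_approx: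
  assumes "c < PP p A"
  obtains F where "finite F" "F \<subseteq> E" "c < Pr p F A"
  using PP_least[of p A c] assms by (metis not_le)

lemma PP_mono:
  assumes "0 \<le> p" "p \<le> 1" "\<And>S. S \<subseteq> E \<Longrightarrow> A S \<Longrightarrow> B S"
  shows "PP p A \<le> PP p B"
proof (rule PP_least)
  fix F assume F: "finite F" "F \<subseteq> E"
  then have "Pr p F A \<le> Pr p F B" using assms by (intro Pr_mono) auto
  then show "Pr p F A \<le> PP p B" using PP_upper[OF F assms(1,2)] order_trans by blast
qed

lemma PP_mono_p:
  assumes "0 \<le> p" "p \<le> p'" "p' \<le> 1" "incr A"
  shows "PP p A \<le> PP p' A"
proof (rule PP_least)
  fix F assume F: "finite F" "F \<subseteq> E"
  then have "Pr p F A \<le> Pr p' F A" using assms by (intro Pr_mono_p) auto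
  then show "Pr p F A \<le> PP p' A" using PP_upper[OF F, of p'] assms order_trans by fastforce
qed

lemma Pr_continuous: "continuous_on UNIV (\<lambda>p. Pr p F A)"
  unfolding Pr_def by (rule Eb_continuous)

text \<open>A finite-volume probability is a polynomial in \<open>p\<close>. This makes bridges that
  are likely at one parameter likely at all nearby parameters.\<close>

lemma Pr_gt_nearby:
  assumes "c < Pr p F A"
  obtains d where "0 < d" "\<And>p'. \<bar>p' - p\<bar> < d \<Longrightarrow> c < Pr p' F A"
proof -
  have "((\<lambda>p. Pr p F A) \<longlongrightarrow> Pr p F A) (at p)"
    using Pr_continuous[of F A] by (simp add: continuous_on_def)
  then have "\<forall>\<^sub>F p' in at p. c < Pr p' F A" using assms by (rule order_tendstoD)
  then obtain d where d: "0 < d" "\<And>p'. p' \<noteq> p \<Longrightarrow> dist p' p < d \<Longrightarrow> c < Pr p' F A"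
    unfolding eventually_at by auto
  show ?thesis
  proof (rule that[OF d(1)])
    fix p' assume "\<bar>p' - p\<bar> < d"
    then show "c < Pr p' F A" using d(2)[of p'] assms by (cases "p' = p") (auto simp: dist_real_def)
  qed
qed

text \<open>As a supremum of polynomials in \<open>p\<close>, \<open>PP\<close> is lower
  semicontinuous, so upper bounds survive the limit from the left.\<close>

lemma PP_left_limit:
  assumes "0 < p" "p \<le> 1" "\<And>p'. 0 \<le> p' \<Longrightarrow> p' < p \<Longrightarrow> PP p' A \<le> c"
  shows "PP p A \<le> c"
proof (rule ccontr)
  assume "\<not> PP p A \<le> c"
  then obtain F where F: "finite F" "F \<subseteq> E" "c < Pr p F A" using PP_approx[of c p A] by auto
  obtain d where d: "0 < d" "\<And>p'. \<bar>p' - p\<bar> < d \<Longrightarrow> c < Pr p' F A" using Pr_gt_nearby[OF F(3)] by blast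
  define p' where "p' = max 0 (p - d / 2)"
  have p': "0 \<le> p'" "p' < p" "\<bar>p' - p\<bar> < d" using assms d by (auto simp: p'_def)
  then have "c < PP p' A" using d(2)[OF p'(3)] PP_upper[OF F(1,2), of p' A] assms by auto
  then show False using assms(3)[OF p'(1,2)] by simp
qed

definition ball_edges :: "'a \<Rightarrow> nat \<Rightarrow> 'a set set" where
  "ball_edges x n = {e \<in> E. e \<subseteq> gball x n}"

lemma ball_edges_finite: "x \<in> V \<Longrightarrow> finite (ball_edges x n)"
  using gball_finite[of x n] by (simp add: ball_edges_def finite_subset[of _ "Pow (gball x n)"] Collect_mono_iff subset_iff)

lemma ball_edges_E: "ball_edges x n \<subseteq> E"
  by (auto simp: ball_edges_def)

lemma finite_subset_ball_edges:
  assumes "x \<in> V" "finite F" "F \<subseteq> E"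
  obtains n where "F \<subseteq> ball_edges x n"
proof -
  have "\<exists>n. F \<subseteq> ball_edges x n"
    using assms(2,3)
  proof (induction F rule: finite_induct)
    case (insert e F)
    then obtain n where n: "F \<subseteq> ball_edges x n" by auto
    obtain a b where ab: "e = {a, b}" "a \<in> V" "b \<in> V" using edgeE insert.prems by blast
    then obtain i j where "a \<in> gball x i" "b \<in> gball x j" using gball_Union[OF assms(1)] by blast
    then have "e \<subseteq> gball x (max n (max i j))"
      using ab gball_mono[of i "max n (max i j)" x] gball_mono[of j "max n (max i j)" x]
      by (simp add: subset_iff)
    moreover have "F \<subseteq> ball_edges x (max n (max i j))"
      using n gball_mono[of n "max n (max i j)" x] by (auto simp: ball_edges_def)
    ultimately show ?case using insert.prems by (intro exI[of _ "max n (max i j)"]) (auto simp: ball_edges_def)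
  qed simp
  then show ?thesis using that by blast
qed

lemma PP_limit:
  assumes "x \<in> V" "0 \<le> p" "p \<le> 1" "incr A"
  shows "(\<lambda>n. Pr p (ball_edges x n) A) \<longlonglongrightarrow> PP p A"
proof (rule order_tendstoI)
  fix a assume "a < PP p A"
  then obtain F where F: "finite F" "F \<subseteq> E" "a < Pr p F A" using PP_approx by blast
  obtain n where n: "F \<subseteq> ball_edges x n" using finite_subset_ball_edges[OF assms(1) F(1,2)] by blast
  have "a < Pr p (ball_edges x m) A" if "n \<le> m" for m
  proof -
    have "F \<subseteq> ball_edges x m" using n gball_mono[OF that, of x] by (auto simp: ball_edges_def)
    then have "Pr p F A \<le> Pr p (ball_edges x m) A" using assms ball_edges_finite by (intro Pr_mono_F) auto
    then show ?thesis using F by simp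
  qed
  then show "\<forall>\<^sub>F n in sequentially. a < Pr p (ball_edges x n) A" by (auto simp: eventually_sequentially)
next
  fix a assume "PP p A < a"
  then show "\<forall>\<^sub>F n in sequentially. Pr p (ball_edges x n) A < a"
    using PP_upper[OF ball_edges_finite ball_edges_E, of x p] assms by (intro always_eventually) (auto intro: le_less_trans)
qed

text \<open>A finite sum commutes with the limit over balls. Tilted sums are estimated on finite
  edge sets and transferred to infinite volume here.\<close>

lemma sum_PP_le:
  assumes "V \<noteq> {}" "0 \<le> p" "p \<le> 1" "\<And>u. u \<in> U \<Longrightarrow> incr (A u)"
    "\<And>F. finite F \<Longrightarrow> F \<subseteq> E \<Longrightarrow> (\<Sum>u\<in>U. Pr p F (A u) * c u) \<le> C"
  shows "(\<Sum>u\<in>U. PP p (A u) * c u) \<le> C"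
proof -
  obtain x where x: "x \<in> V" using assms(1) by auto
  have "(\<lambda>n. \<Sum>u\<in>U. Pr p (ball_edges x n) (A u) * c u) \<longlonglongrightarrow> (\<Sum>u\<in>U. PP p (A u) * c u)"
    using PP_limit[OF x assms(2,3)] assms(4) by (intro tendsto_sum tendsto_mult tendsto_const) auto
  then show ?thesis
    by (rule LIMSEQ_le_const2) (use assms(5)[OF ball_edges_finite[OF x] ball_edges_E] in auto)
qed

lemma PP_edge_open:
  assumes "e \<in> E" "0 \<le> p" "p \<le> 1" "incr A" "\<And>S. S \<subseteq> E \<Longrightarrow> e \<in> S \<Longrightarrow> A S \<Longrightarrow> B S"
  shows "p * PP p A \<le> PP p B"
proof (cases "p = 0")
  case True
  then show ?thesis using PP_nonneg[of p B] assms by simp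
next
  case False
  have "PP p A \<le> PP p B / p"
  proof (rule PP_least)
    fix F assume F: "finite F" "F \<subseteq> E"
    have "Pr p F A \<le> Pr p (insert e F) A" using F assms by (intro Pr_mono_F) auto
    also have "p * \<dots> \<le> Pr p (insert e F) (\<lambda>S. e \<in> S \<and> A S)"
      using F assms by (intro Pr_edge_open) auto
    also have "\<dots> \<le> Pr p (insert e F) B" using F assms by (intro Pr_mono) auto
    also have "\<dots> \<le> PP p B" using F assms by (intro PP_upper) auto
    finally show "Pr p F A \<le> PP p B / p" using False assms(2) by (simp add: field_simps mult_left_mono)
  qed
  then show ?thesis using False assms(2) by (simp add: field_simps)
qed

subsection \<open>Invariance\<close>

lemma image_E:
  assumes "\<gamma> \<in> \<Gamma>" "e \<in> E"
  shows "\<gamma> ` e \<in> E"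
proof -
  obtain a b where "e = {a, b}" "a \<in> V" "b \<in> V" using edgeE assms by blast
  then show ?thesis using \<Gamma>_edge[OF assms(1)] assms(2) by auto
qed

lemma inj_image_E: "\<gamma> \<in> \<Gamma> \<Longrightarrow> F \<subseteq> E \<Longrightarrow> inj_on (image \<gamma>) F"
proof (rule inj_onI)
  fix e e' assume g: "\<gamma> \<in> \<Gamma>" "F \<subseteq> E" "e \<in> F" "e' \<in> F" "\<gamma> ` e = \<gamma> ` e'"
  then have "e \<subseteq> V" "e' \<subseteq> V" using edge_subset by auto
  then show "e = e'" using g \<Gamma>_inj[OF g(1)] by (simp add: inj_on_image_eq_iff)
qed

lemma image_inverse: "(\<And>x. x \<in> V \<Longrightarrow> \<gamma>' (\<gamma> x) = x) \<Longrightarrow> R \<subseteq> V \<Longrightarrow> \<gamma>' ` \<gamma> ` R = R"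
proof -
  assume a: "\<And>x. x \<in> V \<Longrightarrow> \<gamma>' (\<gamma> x) = x" "R \<subseteq> V"
  have "\<gamma>' ` \<gamma> ` R = (\<lambda>x. \<gamma>' (\<gamma> x)) ` R" by (simp add: image_image)
  also have "\<dots> = (\<lambda>x. x) ` R" using a by (intro image_cong) auto
  finally show ?thesis by simp
qed

lemma image_image_inverse: "(\<And>x. x \<in> V \<Longrightarrow> \<gamma>' (\<gamma> x) = x) \<Longrightarrow> F \<subseteq> E \<Longrightarrow> image \<gamma>' ` image \<gamma> ` F = F"
proof -
  assume a: "\<And>x. x \<in> V \<Longrightarrow> \<gamma>' (\<gamma> x) = x" "F \<subseteq> E"
  have "image \<gamma>' ` image \<gamma> ` F = (\<lambda>e. \<gamma>' ` \<gamma> ` e) ` F" by (simp only: image_image)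
  also have "\<dots> = (\<lambda>x. x) ` F"
    using a(2) edge_subset by (intro image_cong refl image_inverse a(1)) auto
  finally show ?thesis by simp
qed

lemma linked_image:
  assumes "linked S R x y"
  shows "linked (image \<gamma> ` S) (\<gamma> ` R) (\<gamma> x) (\<gamma> y)"
  using assms unfolding linked_def
proof (induction rule: rtrancl_induct)
  case (step y z)
  then have "{y, z} \<in> S" "{y, z} \<subseteq> R" by (auto simp: adj_def)
  then have "\<gamma> ` {y, z} \<in> image \<gamma> ` S" "\<gamma> ` {y, z} \<subseteq> \<gamma> ` R" by blast+
  then have "(\<gamma> y, \<gamma> z) \<in> adj {e \<in> image \<gamma> ` S. e \<subseteq> \<gamma> ` R}" by (auto simp: adj_def)
  then show ?case using step.IH by (rule rtrancl_into_rtrancl[rotated])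
qed simp

lemma linked_\<Gamma>:
  assumes "\<gamma> \<in> \<Gamma>" "S \<subseteq> E" "R \<subseteq> V" "x \<in> V" "y \<in> V"
  shows "linked (image \<gamma> ` S) (\<gamma> ` R) (\<gamma> x) (\<gamma> y) \<longleftrightarrow> linked S R x y"
proof
  obtain \<gamma>' where \<gamma>': "\<gamma>' \<in> \<Gamma>" "\<And>x. x \<in> V \<Longrightarrow> \<gamma>' (\<gamma> x) = x" "\<And>x. x \<in> V \<Longrightarrow> \<gamma> (\<gamma>' x) = x"
    using \<Gamma>_inv[OF assms(1)] by blast
  assume "linked (image \<gamma> ` S) (\<gamma> ` R) (\<gamma> x) (\<gamma> y)"
  then have "linked (image \<gamma>' ` image \<gamma> ` S) (\<gamma>' ` \<gamma> ` R) (\<gamma>' (\<gamma> x)) (\<gamma>' (\<gamma> y))" by (rule linked_image)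
  then show "linked S R x y" using \<gamma>' assms by (simp add: image_inverse image_image_inverse)
qed (rule linked_image)

lemma Eb_\<Gamma>: "\<gamma> \<in> \<Gamma> \<Longrightarrow> finite F \<Longrightarrow> F \<subseteq> E \<Longrightarrow> Eb p (image \<gamma> ` F) f = Eb p F (\<lambda>S. f (image \<gamma> ` S))"
  by (intro Eb_image inj_image_E)

lemma PP_\<Gamma>:
  assumes "\<gamma> \<in> \<Gamma>" "0 \<le> p" "p \<le> 1" "\<And>S. S \<subseteq> E \<Longrightarrow> B (image \<gamma> ` S) = A S"
  shows "PP p B = PP p A"
proof (rule antisym)
  have eq: "Pr p (image \<gamma> ` F) B = Pr p F A" if "finite F" "F \<subseteq> E" for F
  proof -
    have "Pr p (image \<gamma> ` F) B = Pr p F (\<lambda>S. B (image \<gamma> ` S))"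
      unfolding Pr_def using that by (intro Eb_\<Gamma> assms(1))
    also have "\<dots> = Pr p F A" using that assms(4) by (intro Pr_cong) auto
    finally show ?thesis .
  qed
  show "PP p A \<le> PP p B"
  proof (rule PP_least)
    fix F assume F: "finite F" "F \<subseteq> E"
    have "Pr p (image \<gamma> ` F) B \<le> PP p B"
      using F image_E[OF assms(1)] assms by (intro PP_upper) auto
    then show "Pr p F A \<le> PP p B" using eq[OF F] by simp
  qed
  obtain \<gamma>' where \<gamma>': "\<gamma>' \<in> \<Gamma>" "\<And>x. x \<in> V \<Longrightarrow> \<gamma>' (\<gamma> x) = x" "\<And>x. x \<in> V \<Longrightarrow> \<gamma> (\<gamma>' x) = x"
    using \<Gamma>_inv[OF assms(1)] by blast
  show "PP p B \<le> PP p A"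
  proof (rule PP_least)
    fix F assume F: "finite F" "F \<subseteq> E"
    define F' where "F' = image \<gamma>' ` F"
    have F': "finite F'" "F' \<subseteq> E" using F image_E[OF \<gamma>'(1)] by (auto simp: F'_def)
    have "image \<gamma> ` F' = F" unfolding F'_def by (rule image_image_inverse[of \<gamma> \<gamma>', OF \<gamma>'(3) F(2)])
    then have "Pr p F B = Pr p F' A" using eq[OF F'] by simp
    then show "Pr p F B \<le> PP p A" using PP_upper[OF F' assms(2,3)] by simp
  qed
qed

lemma PP_linked_invariant:
  assumes "0 \<le> p" "p \<le> 1" "\<And>x y. R x y \<subseteq> V" "\<And>\<gamma> x y. \<gamma> \<in> \<Gamma> \<Longrightarrow> x \<in> V \<Longrightarrow> y \<in> V \<Longrightarrow> \<gamma> ` R x y = R (\<gamma> x) (\<gamma> y)"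
  shows "invariant (\<lambda>x y. PP p (\<lambda>S. linked S (R x y) x y))"
  unfolding invariant_def
proof (intro ballI)
  fix \<gamma> x y assume g: "\<gamma> \<in> \<Gamma>" "x \<in> V" "y \<in> V"
  show "PP p (\<lambda>S. linked S (R (\<gamma> x) (\<gamma> y)) (\<gamma> x) (\<gamma> y)) = PP p (\<lambda>S. linked S (R x y) x y)"
    using linked_\<Gamma>[OF g(1) _ assms(3)[of x y] g(2,3)] assms(4)[OF g] assms(1,2)
    by (intro PP_\<Gamma>[OF g(1)]) simp_all
qed

lemma \<Gamma>_image_Collect:
  assumes "\<gamma> \<in> \<Gamma>" "\<And>x. x \<in> V \<Longrightarrow> Q (\<gamma> x) = P x"
  shows "\<gamma> ` {x \<in> V. P x} = {x \<in> V. Q x}"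
proof -
  obtain \<gamma>' where \<gamma>': "\<gamma>' \<in> \<Gamma>" "\<And>x. x \<in> V \<Longrightarrow> \<gamma>' (\<gamma> x) = x" "\<And>x. x \<in> V \<Longrightarrow> \<gamma> (\<gamma>' x) = x"
    using \<Gamma>_inv[OF assms(1)] by blast
  show ?thesis
  proof (intro equalityI subsetI)
    fix y assume "y \<in> {x \<in> V. Q x}"
    then show "y \<in> \<gamma> ` {x \<in> V. P x}"
      using \<gamma>'(3)[of y] \<Gamma>_V[OF \<gamma>'(1), of y] assms(2)[of "\<gamma>' y"] by (intro rev_image_eqI[of "\<gamma>' y"]) auto
  qed (use assms \<Gamma>_V in auto)
qed

end

locale nonunimodular_graph = transitive_graph +
  fixes r :: 'a
  assumes r: "r \<in> V" and nonuni: "nonunimodular V \<Gamma>"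
begin

subsection \<open>Heights\<close>

text \<open>Heights are normalized so that the largest height difference along an edge is 2.\<close>

definition \<eta> :: real where
  "\<eta> = Max ((\<lambda>y. \<bar>ln (D r y)\<bar>) ` {y. {r, y} \<in> E})"

definition q :: real where "q = exp (\<eta> / 2)"

definition ht :: "'a \<Rightarrow> 'a \<Rightarrow> real" where
  "ht x y = ln (D x y) / (\<eta> / 2)"

lemma V_ne: "V \<noteq> {}" using r by auto

lemma D_edge_\<Gamma>:
  assumes "{x, y} \<in> E"
  obtains z where "{r, z} \<in> E" "D r z = D x y"
proof -
  have xy: "x \<in> V" "y \<in> V" using edgeD assms by auto
  obtain \<gamma> where \<gamma>: "\<gamma> \<in> \<Gamma>" "\<gamma> x = r" using \<Gamma>_trans xy r by blast
  show ?thesis using that[of "\<gamma> y"] \<Gamma>_edge[OF \<gamma>(1) xy] D_\<Gamma>[OF \<gamma>(1) xy] \<gamma> assms by auto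
qed

lemma nbrs_r: "finite {y. {r, y} \<in> E}"
  using nbr_finite[OF r] by (simp add: adj_def)

text \<open>If \<open>D\<close> were 1 on the edges at \<open>r\<close>, then by transitivity it
  would be 1 on all edges, and by the cocycle identity along paths everywhere.\<close>

lemma \<eta>_pos: "0 < \<eta>"
proof -
  have "\<exists>y. {r, y} \<in> E \<and> D r y \<noteq> 1"
  proof (rule ccontr)
    assume neg: "\<not> (\<exists>y. {r, y} \<in> E \<and> D r y \<noteq> 1)"
    have e: "D x y = 1" if "{x, y} \<in> E" for x y using D_edge_\<Gamma>[OF that] neg by metis
    have "D x y = 1" if "x \<in> V" "y \<in> V" for x y
    proof -
      have "(x, y) \<in> (adj E)\<^sup>*" using conn that by (auto simp: connected_graph_def)
      then have "D x y = 1 \<and> y \<in> V"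
      proof (induction rule: rtrancl_induct)
        case (step y z)
        then show ?case using D_cocycle[of x y z] adj_V[of y z] e[of y z] that by (auto simp: adj_def)
      qed (use that in auto)
      then show ?thesis by simp
    qed
    then show False using nonuni by (auto simp: nonunimodular_def)
  qed
  then obtain y where y: "{r, y} \<in> E" "D r y \<noteq> 1" by auto
  then have "0 < \<bar>ln (D r y)\<bar>" using D_pos[of r y] edgeD[of r y] by auto
  also have "\<dots> \<le> \<eta>" unfolding \<eta>_def using nbrs_r y by (intro Max_ge) auto
  finally show ?thesis .
qed

lemma q_gt_1: "1 < q" using \<eta>_pos by (simp add: q_def)

lemma ln_q: "ln q = \<eta> / 2" by (simp add: q_def)

lemma D_ht: "x \<in> V \<Longrightarrow> y \<in> V \<Longrightarrow> D x y = q powr ht x y"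
  using D_pos[of x y] \<eta>_pos by (simp add: powr_def ln_q ht_def) (simp add: q_def)

lemma ht_add: "x \<in> V \<Longrightarrow> y \<in> V \<Longrightarrow> z \<in> V \<Longrightarrow> ht x z = ht x y + ht y z"
proof -
  assume xyz: "x \<in> V" "y \<in> V" "z \<in> V"
  have "ln (D x z) = ln (D x y) + ln (D y z)"
    using D_cocycle[OF xyz, symmetric] D_pos[OF xyz(1,2)] D_pos[OF xyz(2,3)] by (simp add: ln_mult)
  then show ?thesis by (simp add: ht_def add_divide_distrib)
qed

lemma ht_self [simp]: "x \<in> V \<Longrightarrow> ht x x = 0"
  by (simp add: ht_def)

lemma ht_sym: "x \<in> V \<Longrightarrow> y \<in> V \<Longrightarrow> ht y x = - ht x y"
  using ht_add[of x y x] by simp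

lemma ht_\<Gamma>: "\<gamma> \<in> \<Gamma> \<Longrightarrow> x \<in> V \<Longrightarrow> y \<in> V \<Longrightarrow> ht (\<gamma> x) (\<gamma> y) = ht x y"
  by (simp add: ht_def D_\<Gamma>)

lemma ht_edge: "{x, y} \<in> E \<Longrightarrow> \<bar>ht x y\<bar> \<le> 2"
proof -
  assume "{x, y} \<in> E"
  then obtain z where z: "{r, z} \<in> E" "D r z = D x y" by (rule D_edge_\<Gamma>)
  then have "\<bar>ln (D x y)\<bar> \<le> \<eta>" unfolding \<eta>_def z(2)[symmetric] using nbrs_r by (intro Max_ge) auto
  then show ?thesis using \<eta>_pos by (simp add: ht_def abs_divide field_simps)
qed

text \<open>An edge at \<open>r\<close> of maximal height difference, read in either direction and
  moved to \<open>x\<close> by the group, provides both a neighbour 2 higher and a neighbour 2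
  lower.\<close>

lemma extremal_nbr:
  assumes "x \<in> V" "\<sigma> = 1 \<or> \<sigma> = -1"
  obtains y where "{x, y} \<in> E" "\<sigma> * ht x y = 2"
proof -
  have "\<eta> \<in> (\<lambda>y. \<bar>ln (D r y)\<bar>) ` {y. {r, y} \<in> E}"
    unfolding \<eta>_def
  proof (rule Max_in)
    show "(\<lambda>y. \<bar>ln (D r y)\<bar>) ` {y. {r, y} \<in> E} \<noteq> {}"
    proof
      assume "(\<lambda>y. \<bar>ln (D r y)\<bar>) ` {y. {r, y} \<in> E} = {}"
      then have no: "{x, y} \<notin> E" for x y using D_edge_\<Gamma>[of x y] by (metis empty_iff image_eqI mem_Collect_eq)
      have "x = y" if "x \<in> V" "y \<in> V" for x y
      proof -
        have "adj E = {}" using no by (auto simp: adj_def)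
        then show ?thesis using conn that by (auto simp: connected_graph_def)
      qed
      then have "\<forall>x\<in>V. \<forall>y\<in>V. D x y = 1" using D_self by metis
      then show False using nonuni by (simp add: nonunimodular_def)
    qed
  qed (use nbrs_r in auto)
  then obtain z where z: "{r, z} \<in> E" "\<bar>ln (D r z)\<bar> = \<eta>" by auto
  have zV: "z \<in> V" using edgeD z by auto
  have "\<bar>ht r z\<bar> = 2" using z(2) \<eta>_pos by (simp add: ht_def abs_divide abs_mult)
  then consider "\<sigma> * ht r z = 2" | "\<sigma> * ht z r = 2"
    using assms(2) ht_sym[OF r zV] by (auto simp: abs_if split: if_splits)
  then show ?thesis
  proof cases
    case 1
    obtain \<gamma> where \<gamma>: "\<gamma> \<in> \<Gamma>" "\<gamma> r = x" using \<Gamma>_trans assms r by blast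
    then show ?thesis using that[of "\<gamma> z"] 1 ht_\<Gamma>[OF \<gamma>(1) r zV] \<Gamma>_edge[OF \<gamma>(1) r zV] z by auto
  next
    case 2
    obtain \<gamma> where \<gamma>: "\<gamma> \<in> \<Gamma>" "\<gamma> z = x" using \<Gamma>_trans assms zV by blast
    then show ?thesis using that[of "\<gamma> r"] 2 ht_\<Gamma>[OF \<gamma>(1) zV r] \<Gamma>_edge[OF \<gamma>(1) zV r] z
      by (auto simp: insert_commute)
  qed
qed

lemma q_pos: "0 < q" using q_gt_1 by simp

lemma powr_q_le: "q powr x \<le> q powr y \<longleftrightarrow> x \<le> y"
  using q_gt_1 by simp

end

section \<open>Growth of sets along bridges\<close>

lemma linked_restrict: "linked S R x y \<Longrightarrow> linked {e \<in> S. e \<subseteq> R} R x y"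
  by (subst linked_cong[of R _ S]) auto

context nonunimodular_graph
begin

text \<open>A bridge from \<open>y\<close> to \<open>w\<close> climbs in direction \<open>\<sigma>\<close>, and keeps height distance at least 2 from both ends.
  The gap makes the edge sets used by successive generations of bridges disjoint.\<close>

definition bridge_region :: "real \<Rightarrow> nat \<Rightarrow> 'a \<Rightarrow> 'a \<Rightarrow> 'a set" where
  "bridge_region \<sigma> \<rho> y w = {x \<in> gball w \<rho>. x = y \<or> x = w \<or> 2 \<le> \<sigma> * ht y x \<and> 2 \<le> \<sigma> * ht x w}"

text \<open>Confinement to a ball around the endpoint \<open>w\<close> makes the set of parents of
  \<open>w\<close> depend on finitely many edges. The height window of width 1 determines the
  modular function up to a factor \<open>q\<close>.\<close>

definition bridge :: "real \<Rightarrow> real \<Rightarrow> nat \<Rightarrow> 'a set set \<Rightarrow> 'a \<Rightarrow> 'a \<Rightarrow> bool" where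
  "bridge \<sigma> s \<rho> S y w \<longleftrightarrow> y \<in> gball w \<rho> \<and> s \<le> \<sigma> * ht y w \<and> \<sigma> * ht y w < s + 1 \<and> linked S (bridge_region \<sigma> \<rho> y w) y w"

definition parents :: "real \<Rightarrow> real \<Rightarrow> nat \<Rightarrow> 'a set set \<Rightarrow> 'a \<Rightarrow> nat" where
  "parents \<sigma> s \<rho> S w = card {y. bridge \<sigma> s \<rho> S y w}"

text \<open>Each \<open>w\<close> is split equally among its parents, so the shares add up to 1
  whenever there is a parent. This keeps the first moment exact although many points may have
  bridges to the same \<open>w\<close>.\<close>

definition offspring :: "real \<Rightarrow> real \<Rightarrow> real \<Rightarrow> nat \<Rightarrow> 'a \<Rightarrow> 'a \<Rightarrow> real" where
  "offspring p \<sigma> s \<rho> y w = Eb p (ball_edges w \<rho>) (\<lambda>S. of_bool (bridge \<sigma> s \<rho> S y w) / real (parents \<sigma> s \<rho> S w))"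

definition parent_prob :: "real \<Rightarrow> real \<Rightarrow> real \<Rightarrow> nat \<Rightarrow> 'a \<Rightarrow> real" where
  "parent_prob p \<sigma> s \<rho> w = Pr p (ball_edges w \<rho>) (\<lambda>S. \<exists>y. bridge \<sigma> s \<rho> S y w)"

lemma bridge_region_V: "w \<in> V \<Longrightarrow> bridge_region \<sigma> \<rho> y w \<subseteq> V"
  using gball_V by (auto simp: bridge_region_def)

lemma bridge_V: "bridge \<sigma> s \<rho> S y w \<Longrightarrow> w \<in> V \<Longrightarrow> y \<in> V"
  using gball_V by (auto simp: bridge_def)

lemma bridge_cong:
  assumes "\<And>e. e \<subseteq> bridge_region \<sigma> \<rho> y w \<Longrightarrow> e \<in> S \<longleftrightarrow> e \<in> S'"
  shows "bridge \<sigma> s \<rho> S y w = bridge \<sigma> s \<rho> S' y w"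
  using linked_cong[of "bridge_region \<sigma> \<rho> y w" S S'] assms by (auto simp: bridge_def)

lemma bridge_local: "S \<subseteq> E \<Longrightarrow> bridge \<sigma> s \<rho> S y w = bridge \<sigma> s \<rho> (S \<inter> ball_edges w \<rho>) y w"
  by (rule bridge_cong) (auto simp: bridge_region_def ball_edges_def)

lemma parents_local: "S \<subseteq> E \<Longrightarrow> parents \<sigma> s \<rho> S w = parents \<sigma> s \<rho> (S \<inter> ball_edges w \<rho>) w"
  unfolding parents_def using bridge_local by metis

lemma finite_bridge: "w \<in> V \<Longrightarrow> finite {y. bridge \<sigma> s \<rho> S y w}"
  by (rule finite_subset[OF _ gball_finite[of w \<rho>]]) (auto simp: bridge_def)

lemma parents_pos: "w \<in> V \<Longrightarrow> bridge \<sigma> s \<rho> S y w \<Longrightarrow> 0 < parents \<sigma> s \<rho> S w"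
  unfolding parents_def using finite_bridge by (auto simp: card_gt_0_iff)

lemma ball_edges_\<Gamma>:
  assumes "\<gamma> \<in> \<Gamma>" "x \<in> V"
  shows "ball_edges (\<gamma> x) n = image \<gamma> ` ball_edges x n"
proof (rule Set.set_eqI, rule iffI)
  fix e assume "e \<in> image \<gamma> ` ball_edges x n"
  then obtain d where d: "e = \<gamma> ` d" "d \<in> E" "d \<subseteq> gball x n" by (auto simp: ball_edges_def)
  then have "\<gamma> ` d \<in> E" "\<gamma> ` d \<subseteq> gball (\<gamma> x) n"
    using image_E[OF assms(1)] \<Gamma>_gball[OF assms] by blast+
  then show "e \<in> ball_edges (\<gamma> x) n" using d by (simp add: ball_edges_def)
next
  obtain \<gamma>' where \<gamma>': "\<gamma>' \<in> \<Gamma>" "\<And>x. x \<in> V \<Longrightarrow> \<gamma>' (\<gamma> x) = x" "\<And>x. x \<in> V \<Longrightarrow> \<gamma> (\<gamma>' x) = x"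
    using \<Gamma>_inv[OF assms(1)] by blast
  fix e assume "e \<in> ball_edges (\<gamma> x) n"
  then have e: "e \<in> E" "e \<subseteq> gball (\<gamma> x) n" by (auto simp: ball_edges_def)
  have "\<gamma>' ` e \<in> E" using e(1) by (rule image_E[OF \<gamma>'(1)])
  moreover have "\<gamma>' ` e \<subseteq> gball x n"
    using e(2) \<Gamma>_gball[OF \<gamma>'(1) \<Gamma>_V[OF assms]] \<gamma>'(2)[OF assms(2)] by (metis image_mono)
  moreover have "\<gamma> ` \<gamma>' ` e = e" by (rule image_inverse[of \<gamma> \<gamma>', OF \<gamma>'(3) edge_subset[OF e(1)]])
  ultimately show "e \<in> image \<gamma> ` ball_edges x n" unfolding ball_edges_def by (metis (mono_tags, lifting) imageI mem_Collect_eq)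
qed

lemma bridge_region_\<Gamma>:
  assumes "\<gamma> \<in> \<Gamma>" "y \<in> V" "w \<in> V"
  shows "\<gamma> ` bridge_region \<sigma> \<rho> y w = bridge_region \<sigma> \<rho> (\<gamma> y) (\<gamma> w)"
proof -
  have R: "bridge_region \<sigma> \<rho> y w = {x \<in> V. x \<in> gball w \<rho> \<and> (x = y \<or> x = w \<or> 2 \<le> \<sigma> * ht y x \<and> 2 \<le> \<sigma> * ht x w)}"
    if "w \<in> V" for y w using gball_V[OF that] by (auto simp: bridge_region_def)
  have b: "\<gamma> x \<in> gball (\<gamma> w) \<rho> \<longleftrightarrow> x \<in> gball w \<rho>" if "x \<in> V" for x
    unfolding \<Gamma>_gball[OF assms(1,3), symmetric]
    using inj_on_image_mem_iff[OF \<Gamma>_inj[OF assms(1)] that gball_V[OF assms(3)]] .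
  have i: "\<gamma> x = \<gamma> z \<longleftrightarrow> x = z" if "x \<in> V" "z \<in> V" for x z
    using \<Gamma>_inj[OF assms(1)] that by (auto dest: inj_onD)
  show ?thesis
    unfolding R[OF assms(3)] R[OF \<Gamma>_V[OF assms(1,3)]]
    by (rule \<Gamma>_image_Collect[OF assms(1)]) (simp add: b i assms ht_\<Gamma>)
qed

lemma bridge_\<Gamma>:
  assumes "\<gamma> \<in> \<Gamma>" "S \<subseteq> E" "y \<in> V" "w \<in> V"
  shows "bridge \<sigma> s \<rho> (image \<gamma> ` S) (\<gamma> y) (\<gamma> w) = bridge \<sigma> s \<rho> S y w"
proof -
  have "\<gamma> y \<in> gball (\<gamma> w) \<rho> \<longleftrightarrow> y \<in> gball w \<rho>"
    unfolding \<Gamma>_gball[OF assms(1,4), symmetric]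
    using inj_on_image_mem_iff[OF \<Gamma>_inj[OF assms(1)] assms(3) gball_V[OF assms(4)]] .
  moreover have "linked (image \<gamma> ` S) (bridge_region \<sigma> \<rho> (\<gamma> y) (\<gamma> w)) (\<gamma> y) (\<gamma> w) = linked S (bridge_region \<sigma> \<rho> y w) y w"
    using linked_\<Gamma>[OF assms(1,2) bridge_region_V[OF assms(4), of \<sigma> \<rho> y] assms(3,4)] bridge_region_\<Gamma>[OF assms(1,3,4), of \<sigma> \<rho>] by simp
  ultimately show ?thesis using assms by (simp add: bridge_def ht_\<Gamma>)
qed

lemma parents_\<Gamma>:
  assumes "\<gamma> \<in> \<Gamma>" "S \<subseteq> E" "w \<in> V"
  shows "parents \<sigma> s \<rho> (image \<gamma> ` S) (\<gamma> w) = parents \<sigma> s \<rho> S w"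
proof -
  have V: "{y. bridge \<sigma> s \<rho> S y w} = {y \<in> V. bridge \<sigma> s \<rho> S y w}"
    "{y. bridge \<sigma> s \<rho> (image \<gamma> ` S) y (\<gamma> w)} = {y \<in> V. bridge \<sigma> s \<rho> (image \<gamma> ` S) y (\<gamma> w)}"
    using bridge_V assms(3) \<Gamma>_V[OF assms(1,3)] by auto
  have "\<gamma> ` {y \<in> V. bridge \<sigma> s \<rho> S y w} = {y \<in> V. bridge \<sigma> s \<rho> (image \<gamma> ` S) y (\<gamma> w)}"
    by (rule \<Gamma>_image_Collect[OF assms(1)]) (simp add: bridge_\<Gamma>[OF assms(1,2)] assms(3))
  then show ?thesis
    unfolding parents_def V using card_image[OF inj_on_subset[OF \<Gamma>_inj[OF assms(1)]], of "{y \<in> V. bridge \<sigma> s \<rho> S y w}"]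
    by simp
qed

lemma offspring_invariant: "invariant (offspring p \<sigma> s \<rho>)"
  unfolding invariant_def
proof (intro ballI)
  fix \<gamma> y w assume g: "\<gamma> \<in> \<Gamma>" "y \<in> V" "w \<in> V"
  have "offspring p \<sigma> s \<rho> (\<gamma> y) (\<gamma> w) = Eb p (ball_edges w \<rho>)
    (\<lambda>S. of_bool (bridge \<sigma> s \<rho> (image \<gamma> ` S) (\<gamma> y) (\<gamma> w)) / real (parents \<sigma> s \<rho> (image \<gamma> ` S) (\<gamma> w)))"
    unfolding offspring_def ball_edges_\<Gamma>[OF g(1,3)] by (rule Eb_\<Gamma>[OF g(1) ball_edges_finite[OF g(3)] ball_edges_E])
  also have "\<dots> = offspring p \<sigma> s \<rho> y w"
    unfolding offspring_def using ball_edges_E by (intro Eb_cong) (simp add: bridge_\<Gamma>[OF g(1) _ g(2,3)] parents_\<Gamma>[OF g(1) _ g(3)] subset_trans[OF _ ball_edges_E])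
  finally show "offspring p \<sigma> s \<rho> (\<gamma> y) (\<gamma> w) = offspring p \<sigma> s \<rho> y w" .
qed

lemma parent_prob_\<Gamma>:
  assumes "x \<in> V" "y \<in> V"
  shows "parent_prob p \<sigma> s \<rho> x = parent_prob p \<sigma> s \<rho> y"
proof -
  obtain \<gamma> where g: "\<gamma> \<in> \<Gamma>" "\<gamma> x = y" using \<Gamma>_trans assms by blast
  have ex: "(\<exists>z. bridge \<sigma> s \<rho> S z w) \<longleftrightarrow> 0 < parents \<sigma> s \<rho> S w" if "w \<in> V" for S w
    using finite_bridge[OF that] by (auto simp: parents_def card_gt_0_iff)
  have "parent_prob p \<sigma> s \<rho> y = Eb p (ball_edges x \<rho>) (\<lambda>S. of_bool (0 < parents \<sigma> s \<rho> (image \<gamma> ` S) y))"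
    using Eb_\<Gamma>[OF g(1) ball_edges_finite[OF assms(1)] ball_edges_E, of p \<rho> "\<lambda>S. of_bool (0 < parents \<sigma> s \<rho> S y)"]
    unfolding parent_prob_def Pr_def ex[OF assms(2)] ball_edges_\<Gamma>[OF g(1) assms(1), symmetric] g(2) .
  also have "\<dots> = parent_prob p \<sigma> s \<rho> x"
    unfolding parent_prob_def Pr_def ex[OF assms(1)] g(2)[symmetric]
    using ball_edges_E by (intro Eb_cong) (simp add: parents_\<Gamma>[OF g(1) _ assms(1)] subset_trans[OF _ ball_edges_E])
  finally show ?thesis by simp
qed

lemma offspring_nonneg: "0 \<le> p \<Longrightarrow> p \<le> 1 \<Longrightarrow> 0 \<le> offspring p \<sigma> s \<rho> y w"
  unfolding offspring_def by (intro Eb_nonneg) auto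

lemma offspring_outside: "w \<notin> gball y \<rho> \<Longrightarrow> offspring p \<sigma> s \<rho> y w = 0"
  unfolding offspring_def using gball_sym by (auto simp: bridge_def Eb_def)

lemma offspring_height: "\<not> (s \<le> \<sigma> * ht y w \<and> \<sigma> * ht y w < s + 1) \<Longrightarrow> offspring p \<sigma> s \<rho> y w = 0"
  unfolding offspring_def by (auto simp: bridge_def Eb_def)

lemma sum_offspring_in:
  assumes "w \<in> V"
  shows "(\<Sum>y\<in>gball w \<rho>. offspring p \<sigma> s \<rho> y w) = parent_prob p \<sigma> s \<rho> w"
proof -
  have "(\<Sum>y\<in>gball w \<rho>. of_bool (bridge \<sigma> s \<rho> S y w) / real (parents \<sigma> s \<rho> S w)) = of_bool (\<exists>y. bridge \<sigma> s \<rho> S y w)" for S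
  proof -
    have "(\<Sum>y\<in>gball w \<rho>. of_bool (bridge \<sigma> s \<rho> S y w) / real (parents \<sigma> s \<rho> S w))
        = (\<Sum>y\<in>{y. bridge \<sigma> s \<rho> S y w}. 1 / real (parents \<sigma> s \<rho> S w))"
      using gball_finite[OF assms] by (intro sum.mono_neutral_cong_right) (auto simp: bridge_def)
    also have "\<dots> = real (parents \<sigma> s \<rho> S w) / real (parents \<sigma> s \<rho> S w)" by (simp add: parents_def)
    also have "\<dots> = of_bool (\<exists>y. bridge \<sigma> s \<rho> S y w)"
      using finite_bridge[OF assms] by (auto simp: parents_def card_eq_0_iff)
    finally show ?thesis .
  qed
  then show ?thesis by (simp add: offspring_def parent_prob_def Pr_def Eb_sum[symmetric])
qed

text \<open>By mass transport, the mean number of offspring of a point, each divided among all its parents, is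
  \<open>q powr (-\<sigma> s)\<close> times the probability of having a parent.\<close>

lemma offspring_mean:
  assumes "0 \<le> p" "p \<le> 1" "y \<in> V" "\<sigma> = 1 \<or> \<sigma> = -1"
  shows "q powr (- \<sigma> * s - 1) * parent_prob p \<sigma> s \<rho> r \<le> (\<Sum>w\<in>gball y \<rho>. offspring p \<sigma> s \<rho> y w)"
proof -
  let ?c = "\<Sum>w\<in>gball y \<rho>. offspring p \<sigma> s \<rho> y w"
  \<comment> \<open>The weight \<open>D x u\<close> cancels the factor produced by
    \<open>mass_transport\<close>: one side becomes the offspring of \<open>y\<close>, the other the
    shares received at \<open>y\<close> weighted by \<open>D y u\<close>, which the height window
    bounds below by \<open>q powr (- \<sigma> * s - 1)\<close>.\<close>
  define f where "f x u = offspring p \<sigma> s \<rho> u x * D x u" for x u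
  have "sum_bdd (f y) ?c"
  proof (rule mass_transport)
    show "invariant f"
      using offspring_invariant[of p \<sigma> s \<rho>] D_\<Gamma> unfolding invariant_def f_def by metis
    show "0 \<le> f x u" if "x \<in> V" "u \<in> V" for x u
      unfolding f_def using offspring_nonneg[OF assms(1,2)] D_pos[OF that] by simp
    show "sum_bdd (\<lambda>u. f u y * D y u) ?c"
      unfolding sum_bdd_def
    proof (intro allI impI)
      fix U assume U: "finite U" "U \<subseteq> V"
      have "(\<Sum>u\<in>U. f u y * D y u) = (\<Sum>u\<in>U. offspring p \<sigma> s \<rho> y u)"
      proof (intro sum.cong refl)
        fix u assume "u \<in> U"
        then have "D u y * D y u = 1" using D_cocycle[of u y u] U assms(3) by auto
        then show "f u y * D y u = offspring p \<sigma> s \<rho> y u" by (simp add: f_def mult.assoc)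
      qed
      also have "\<dots> = (\<Sum>u\<in>U \<inter> gball y \<rho>. offspring p \<sigma> s \<rho> y u)"
        using U offspring_outside by (intro sum.mono_neutral_right) auto
      also have "\<dots> \<le> ?c"
        using gball_finite[OF assms(3)] offspring_nonneg[OF assms(1,2)] by (intro sum_mono2) auto
      finally show "(\<Sum>u\<in>U. f u y * D y u) \<le> ?c" .
    qed
  qed (use assms in auto)
  then have "(\<Sum>u\<in>gball y \<rho>. f y u) \<le> ?c"
    using gball_finite[OF assms(3)] gball_V[OF assms(3)] by (auto simp: sum_bdd_def)
  moreover have "q powr (- \<sigma> * s - 1) * offspring p \<sigma> s \<rho> u y \<le> f y u" if "u \<in> gball y \<rho>" for u
  proof (cases "s \<le> \<sigma> * ht u y \<and> \<sigma> * ht u y < s + 1")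
    case True
    have u: "u \<in> V" using that gball_V assms by blast
    have "- \<sigma> * s - 1 \<le> ht y u" using True assms(4) ht_sym[OF u assms(3)] by auto
    then have "q powr (- \<sigma> * s - 1) \<le> D y u" using D_ht[OF assms(3) u] q_gt_1 by simp
    then show ?thesis unfolding f_def using offspring_nonneg[OF assms(1,2), of \<sigma> s \<rho> u y]
      by (subst mult.commute) (rule mult_left_mono)
  qed (simp add: f_def offspring_height)
  then have "(\<Sum>u\<in>gball y \<rho>. q powr (- \<sigma> * s - 1) * offspring p \<sigma> s \<rho> u y) \<le> (\<Sum>u\<in>gball y \<rho>. f y u)"
    by (intro sum_mono)
  ultimately show ?thesis
    using sum_offspring_in[OF assms(3)] parent_prob_\<Gamma>[OF assms(3) r] by (simp add: sum_distrib_left[symmetric])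
qed

section \<open>First and second moments of one generation of bridges\<close>

definition ball_card :: "nat \<Rightarrow> nat" where "ball_card n = card (gball r n)"

lemma card_gball: "x \<in> V \<Longrightarrow> card (gball x n) = ball_card n"
proof -
  assume x: "x \<in> V"
  obtain \<gamma> where g: "\<gamma> \<in> \<Gamma>" "\<gamma> x = r" using \<Gamma>_trans x r by blast
  show ?thesis
    unfolding ball_card_def using \<Gamma>_gball[OF g(1) x, of n] g(2) card_image[OF inj_on_subset[OF \<Gamma>_inj[OF g(1)] gball_V[OF x]]]
    by metis
qed

definition reached :: "real \<Rightarrow> real \<Rightarrow> nat \<Rightarrow> 'a set \<Rightarrow> 'a set set \<Rightarrow> 'a set" where
  "reached \<sigma> s \<rho> Y S = {w \<in> V. \<exists>y\<in>Y. bridge \<sigma> s \<rho> S y w}"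

lemma reached_sub: "reached \<sigma> s \<rho> Y S \<subseteq> (\<Union>y\<in>Y. gball y \<rho>)"
  using gball_sym by (auto simp: reached_def bridge_def)

text \<open>First moment: a reached \<open>w\<close> counts at least as much as the shares of its
  parents in \<open>Y\<close>. Second moment: whether \<open>w\<close> is reached depends only on
  \<open>ball_edges w \<rho>\<close>, so the pairs that are not independent lie within distance
  \<open>2 * \<rho>\<close> of each other.\<close>

lemma reached_moments:
  assumes p: "0 \<le> p" "p \<le> 1" and Y: "finite Y" "Y \<subseteq> V"
    and \<kappa>: "\<And>y. y \<in> V \<Longrightarrow> \<kappa> \<le> (\<Sum>w\<in>gball y \<rho>. offspring p \<sigma> s \<rho> y w)"
    and F: "finite F" "F \<subseteq> E" "\<And>y w. y \<in> Y \<Longrightarrow> w \<in> gball y \<rho> \<Longrightarrow> ball_edges w \<rho> \<subseteq> F"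
  defines "Z \<equiv> \<lambda>S. real (card (reached \<sigma> s \<rho> Y S))"
  shows "real (card Y) * \<kappa> \<le> Eb p F Z"
    and "Eb p F (\<lambda>S. (Z S)\<^sup>2) \<le> (Eb p F Z)\<^sup>2 + real (card Y * ball_card \<rho> * ball_card (2 * \<rho>))"
proof -
  define W where "W = (\<Union>y\<in>Y. gball y \<rho>)"
  have W: "finite W" "W \<subseteq> V" unfolding W_def using Y gball_finite gball_V by blast+
  have EnF: "ball_edges w \<rho> \<subseteq> F" if "w \<in> W" for w using F(3) that by (auto simp: W_def)
  define I where "I w S = (of_bool (\<exists>y\<in>Y. bridge \<sigma> s \<rho> S y w) :: real)" for w S
  have Z: "Z S = (\<Sum>w\<in>W. I w S)" for S
  proof -
    have "(\<Sum>w\<in>W. I w S) = (\<Sum>w\<in>reached \<sigma> s \<rho> Y S. 1)"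
      using W reached_sub[of \<sigma> s \<rho> Y S] unfolding W_def[symmetric] I_def
      by (intro sum.mono_neutral_cong_right) (auto simp: reached_def)
    then show ?thesis by (simp add: Z_def)
  qed
  have Iloc: "I w S = I w (S \<inter> ball_edges w \<rho>)" if "S \<subseteq> F" for w S
    unfolding I_def using bridge_local[of S \<sigma> s \<rho> _ w] that F(2) by auto
  show "real (card Y) * \<kappa> \<le> Eb p F Z"
  proof -
    have le: "(\<Sum>y\<in>Y. of_bool (bridge \<sigma> s \<rho> S y w) / real (parents \<sigma> s \<rho> S w)) \<le> I w S" if "w \<in> W" for w S
    proof -
      have w: "w \<in> V" using that W by auto
      have "(\<Sum>y\<in>Y. of_bool (bridge \<sigma> s \<rho> S y w) / real (parents \<sigma> s \<rho> S w))
        = (\<Sum>y\<in>{y \<in> Y. bridge \<sigma> s \<rho> S y w}. 1 / real (parents \<sigma> s \<rho> S w))"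
        using Y by (intro sum.mono_neutral_cong_right) auto
      also have "\<dots> = real (card {y \<in> Y. bridge \<sigma> s \<rho> S y w}) / real (parents \<sigma> s \<rho> S w)" by simp
      also have "\<dots> \<le> I w S"
      proof (cases "\<exists>y\<in>Y. bridge \<sigma> s \<rho> S y w")
        case True
        have "card {y \<in> Y. bridge \<sigma> s \<rho> S y w} \<le> parents \<sigma> s \<rho> S w"
          unfolding parents_def using finite_bridge[OF w] by (intro card_mono) auto
        then show ?thesis using True parents_pos[OF w] by (auto simp: I_def divide_le_eq)
      next
        case False
        then have "{y \<in> Y. bridge \<sigma> s \<rho> S y w} = {}" by auto
        then have z: "card {y \<in> Y. bridge \<sigma> s \<rho> S y w} = 0" by (simp only: card.empty)
        show ?thesis unfolding z by (simp add: I_def)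
      qed
      finally show ?thesis .
    qed
    have "real (card Y) * \<kappa> = (\<Sum>y\<in>Y. \<kappa>)" by simp
    also have "\<dots> \<le> (\<Sum>y\<in>Y. \<Sum>w\<in>gball y \<rho>. offspring p \<sigma> s \<rho> y w)" using \<kappa> Y by (intro sum_mono) auto
    also have "\<dots> \<le> (\<Sum>y\<in>Y. \<Sum>w\<in>W. offspring p \<sigma> s \<rho> y w)"
      using W offspring_nonneg[OF p] by (intro sum_mono sum_mono2) (auto simp: W_def)
    also have "\<dots> = (\<Sum>w\<in>W. \<Sum>y\<in>Y. offspring p \<sigma> s \<rho> y w)" by (rule sum.swap)
    also have "\<dots> = (\<Sum>w\<in>W. \<Sum>y\<in>Y. Eb p F (\<lambda>S. of_bool (bridge \<sigma> s \<rho> S y w) / real (parents \<sigma> s \<rho> S w)))"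
    proof (intro sum.cong refl)
      fix w y assume "w \<in> W" "y \<in> Y"
      then show "offspring p \<sigma> s \<rho> y w = Eb p F (\<lambda>S. of_bool (bridge \<sigma> s \<rho> S y w) / real (parents \<sigma> s \<rho> S w))"
        unfolding offspring_def using F(1) EnF
        by (intro Eb_local[symmetric])
          (use F(2) bridge_local[of _ \<sigma> s \<rho> y w] parents_local[of _ \<sigma> s \<rho> w] in \<open>auto dest: subset_trans\<close>)
    qed
    also have "\<dots> = Eb p F (\<lambda>S. \<Sum>w\<in>W. \<Sum>y\<in>Y. of_bool (bridge \<sigma> s \<rho> S y w) / real (parents \<sigma> s \<rho> S w))"
      by (simp add: Eb_sum)
    also have "\<dots> \<le> Eb p F Z"
      unfolding Z using le by (intro Eb_mono[OF p] sum_mono)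
    finally show ?thesis .
  qed
  show "Eb p F (\<lambda>S. (Z S)\<^sup>2) \<le> (Eb p F Z)\<^sup>2 + real (card Y * ball_card \<rho> * ball_card (2 * \<rho>))"
  proof -
    let ?d = "\<lambda>w w'. of_bool (ball_edges w \<rho> \<inter> ball_edges w' \<rho> \<noteq> {}) :: real"
    have pair: "Eb p F (\<lambda>S. I w S * I w' S) \<le> Eb p F (I w) * Eb p F (I w') + ?d w w'" for w w'
    proof (cases "ball_edges w \<rho> \<inter> ball_edges w' \<rho> = {}")
      case True
      then have "Eb p F (\<lambda>S. I w S * I w' S) = Eb p F (I w) * Eb p F (I w')"
        using Iloc F(1) by (intro Eb_indep)
      then show ?thesis using True by simp
    next
      case False
      have "Eb p F (\<lambda>S. I w S * I w' S) \<le> Eb p F (\<lambda>S. 1)" by (intro Eb_mono[OF p]) (auto simp: I_def)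
      moreover have "0 \<le> Eb p F (I w) * Eb p F (I w')"
        by (intro mult_nonneg_nonneg Eb_nonneg[OF p]) (auto simp: I_def)
      ultimately show ?thesis using False F(1) by (simp add: Eb_const)
    qed
    have "Eb p F (\<lambda>S. (Z S)\<^sup>2) = (\<Sum>w\<in>W. \<Sum>w'\<in>W. Eb p F (\<lambda>S. I w S * I w' S))"
      unfolding Z power2_eq_square sum_product Eb_sum ..
    also have "\<dots> \<le> (\<Sum>w\<in>W. \<Sum>w'\<in>W. Eb p F (I w) * Eb p F (I w') + ?d w w')"
      by (intro sum_mono pair)
    also have "\<dots> = (Eb p F Z)\<^sup>2 + (\<Sum>w\<in>W. \<Sum>w'\<in>W. ?d w w')"
      unfolding Z Eb_sum by (simp add: sum.distrib power2_eq_square sum_product)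
    also have "(\<Sum>w\<in>W. \<Sum>w'\<in>W. ?d w w') \<le> (\<Sum>w\<in>W. real (ball_card (2 * \<rho>)))"
    proof (intro sum_mono)
      fix w assume w: "w \<in> W"
      have "(\<Sum>w'\<in>W. ?d w w') = real (card {w' \<in> W. ball_edges w \<rho> \<inter> ball_edges w' \<rho> \<noteq> {}})"
        using W by (simp add: of_bool_def sum.If_cases Int_def)
      also have "{w' \<in> W. ball_edges w \<rho> \<inter> ball_edges w' \<rho> \<noteq> {}} \<subseteq> gball w (2 * \<rho>)"
      proof
        fix w' assume "w' \<in> {w' \<in> W. ball_edges w \<rho> \<inter> ball_edges w' \<rho> \<noteq> {}}"
        then obtain e where e: "e \<in> E" "e \<subseteq> gball w \<rho>" "e \<subseteq> gball w' \<rho>" by (auto simp: ball_edges_def)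
        then obtain x where "x \<in> gball w \<rho>" "x \<in> gball w' \<rho>" using edgeE[OF e(1)] by blast
        then show "w' \<in> gball w (2 * \<rho>)" using gball_trans[of x w \<rho> w' \<rho>] gball_sym by (simp add: mult_2)
      qed
      then have "card {w' \<in> W. ball_edges w \<rho> \<inter> ball_edges w' \<rho> \<noteq> {}} \<le> card (gball w (2 * \<rho>))"
        using w W gball_finite by (intro card_mono) auto
      finally show "(\<Sum>w'\<in>W. ?d w w') \<le> real (ball_card (2 * \<rho>))" using w W card_gball by auto
    qed
    also have "\<dots> = real (card W * ball_card (2 * \<rho>))" by simp
    also have "card W \<le> (\<Sum>y\<in>Y. card (gball y \<rho>))" unfolding W_def using Y(1) by (rule card_UN_le)
    also have "(\<Sum>y\<in>Y. card (gball y \<rho>)) = card Y * ball_card \<rho>" using Y card_gball by (simp add: subset_iff)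
    finally show ?thesis by (simp add: mult_right_mono)
  qed
qed

text \<open>Chebyshev: the variance is linear in \<open>card Y\<close> and the squared mean
  quadratic, so the failure probability is of order \<open>1 / card Y\<close>.\<close>

lemma reached_many:
  assumes p: "0 \<le> p" "p \<le> 1" and Y: "finite Y" "Y \<subseteq> V" "Y \<noteq> {}" and \<kappa>0: "0 < \<kappa>"
    and \<kappa>: "\<And>y. y \<in> V \<Longrightarrow> \<kappa> \<le> (\<Sum>w\<in>gball y \<rho>. offspring p \<sigma> s \<rho> y w)"
    and F: "finite F" "F \<subseteq> E" "\<And>y w. y \<in> Y \<Longrightarrow> w \<in> gball y \<rho> \<Longrightarrow> ball_edges w \<rho> \<subseteq> F"
  shows "1 - 4 * real (ball_card \<rho> * ball_card (2 * \<rho>)) / \<kappa>\<^sup>2 / real (card Y)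
    \<le> Pr p F (\<lambda>S. \<kappa> * real (card Y) / 2 \<le> real (card (reached \<sigma> s \<rho> Y S)))"
proof -
  have n: "0 < real (card Y)" using Y by (simp add: card_gt_0_iff)
  define m where "m = \<kappa> * real (card Y)"
  have m: "0 < m" using n \<kappa>0 by (simp add: m_def)
  have "Pr p F (\<lambda>S. real (card (reached \<sigma> s \<rho> Y S)) < m / 2) \<le> 4 * real (card Y * ball_card \<rho> * ball_card (2 * \<rho>)) / m\<^sup>2"
    using reached_moments[OF p Y(1,2) \<kappa> F] by (intro chebyshev_half[OF F(1) p m]) (auto simp: m_def mult.commute)
  also have "\<dots> = 4 * real (ball_card \<rho> * ball_card (2 * \<rho>)) / \<kappa>\<^sup>2 / real (card Y)"
    using n by (simp add: m_def power2_eq_square field_simps)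
  finally have "Pr p F (\<lambda>S. real (card (reached \<sigma> s \<rho> Y S)) < m / 2) \<le> 4 * real (ball_card \<rho> * ball_card (2 * \<rho>)) / \<kappa>\<^sup>2 / real (card Y)" .
  then show ?thesis
    using Pr_not[OF F(1), of p "\<lambda>S. real (card (reached \<sigma> s \<rho> Y S)) < m / 2"] by (simp add: m_def not_less)
qed

text \<open>Edges still unseen after exploring below height \<open>t + 2\<close>. For
  \<open>s\<close> at least 4, a bridge that starts at height at least \<open>t\<close> uses only
  such edges, and a bridge that ends below \<open>t + 2\<close> uses none.\<close>

definition Fresh :: "'a \<Rightarrow> real \<Rightarrow> real \<Rightarrow> 'a set set" where
  "Fresh v \<sigma> t = {e. \<exists>x\<in>e. t + 2 \<le> \<sigma> * ht v x}"

text \<open>Confinement to the half-space above \<open>y\<close> allows the path to be appended to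
  any connection that arrives at \<open>y\<close>, without leaving a half-space that already
  contains the one above \<open>y\<close>.\<close>

definition Reach :: "'a \<Rightarrow> real \<Rightarrow> real \<Rightarrow> 'a set \<Rightarrow> real \<Rightarrow> 'a set set \<Rightarrow> bool" where
  "Reach v \<sigma> t Y h S \<longleftrightarrow>
    (\<exists>y\<in>Y. \<exists>u\<in>V. h \<le> \<sigma> * ht v u \<and> linked (S \<inter> Fresh v \<sigma> t) {x \<in> V. 0 \<le> \<sigma> * ht y x} y u)"

text \<open>A bridge is put in front of the given path. Each of its edges has an endpoint other than
  \<open>y\<close>, which is at least 2 above \<open>y\<close>, so the edge is fresh.\<close>

lemma Reach_step:
  assumes v: "v \<in> V" and ST: "S \<subseteq> E" and Y: "Y \<subseteq> V" "\<And>y. y \<in> Y \<Longrightarrow> t \<le> \<sigma> * ht v y"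
    and s: "4 \<le> s" and Y': "Y' \<subseteq> reached \<sigma> s \<rho> Y S" and t': "t \<le> t'" and R: "Reach v \<sigma> t' Y' h T"
  shows "Reach v \<sigma> t Y h (S \<union> T)"
proof -
  obtain w u where w: "w \<in> Y'" "u \<in> V" "h \<le> \<sigma> * ht v u"
    "linked (T \<inter> Fresh v \<sigma> t') {x \<in> V. 0 \<le> \<sigma> * ht w x} w u" using R by (auto simp: Reach_def)
  then obtain y where y: "y \<in> Y" "w \<in> V" "bridge \<sigma> s \<rho> S y w" using Y' by (auto simp: reached_def)
  have yV: "y \<in> V" using y Y by auto
  have swy: "s \<le> \<sigma> * ht y w" using y by (simp add: bridge_def)
  have add: "\<sigma> * ht v x = \<sigma> * ht v y + \<sigma> * ht y x" if "x \<in> V" for x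
    using ht_add[OF v yV that] by (simp add: distrib_left)
  have sub: "{e \<in> S. e \<subseteq> bridge_region \<sigma> \<rho> y w} \<subseteq> (S \<union> T) \<inter> Fresh v \<sigma> t"
  proof
    fix e assume e: "e \<in> {e \<in> S. e \<subseteq> bridge_region \<sigma> \<rho> y w}"
    then have "e \<in> E" using ST by auto
    then obtain a b where ab: "e = {a, b}" "a \<noteq> b" "a \<in> V" "b \<in> V" using edgeE[of e] by blast
    define x where "x = (if a = y then b else a)"
    have x: "x \<in> e" "x \<noteq> y" "x \<in> V" using ab by (auto simp: x_def)
    then have "2 \<le> \<sigma> * ht y x" using e swy s by (auto simp: bridge_region_def)
    then have "t + 2 \<le> \<sigma> * ht v x" using add[OF x(3)] Y(2)[OF y(1)] by simp
    then show "e \<in> (S \<union> T) \<inter> Fresh v \<sigma> t" using e x by (auto simp: Fresh_def)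
  qed
  have "linked {e \<in> S. e \<subseteq> bridge_region \<sigma> \<rho> y w} (bridge_region \<sigma> \<rho> y w) y w" using y by (intro linked_restrict) (simp add: bridge_def)
  then have 1: "linked ((S \<union> T) \<inter> Fresh v \<sigma> t) {x \<in> V. 0 \<le> \<sigma> * ht y x} y w"
    using bridge_region_V[OF y(2)] swy s yV sub by (elim linked_mono) (auto simp: bridge_region_def)
  have "{x \<in> V. 0 \<le> \<sigma> * ht w x} \<subseteq> {x \<in> V. 0 \<le> \<sigma> * ht y x}"
    using ht_add[OF yV y(2)] swy s by (auto simp: distrib_left)
  moreover have "T \<inter> Fresh v \<sigma> t' \<subseteq> (S \<union> T) \<inter> Fresh v \<sigma> t" using t' by (force simp: Fresh_def)
  ultimately have "linked ((S \<union> T) \<inter> Fresh v \<sigma> t) {x \<in> V. 0 \<le> \<sigma> * ht y x} w u" using w(4) by (elim linked_mono)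
  then show ?thesis unfolding Reach_def using w y linked_trans[OF 1] by blast
qed

text \<open>Counterpart of \<open>Reach_step\<close>: the first generation is decided by edges that
  later generations never use.\<close>

lemma reached_local:
  assumes v: "v \<in> V" and Y: "Y \<subseteq> V" "\<And>y. y \<in> Y \<Longrightarrow> \<sigma> * ht v y < t + 1" and s: "4 \<le> s" and S: "S \<subseteq> E"
  shows "reached \<sigma> s \<rho> Y S = reached \<sigma> s \<rho> Y (S - Fresh v \<sigma> (t + s))"
proof -
  have "bridge \<sigma> s \<rho> S y w = bridge \<sigma> s \<rho> (S - Fresh v \<sigma> (t + s)) y w" if yw: "y \<in> Y" "w \<in> V" for y w
  proof (cases "\<sigma> * ht y w < s + 1")
    case True
    have yV: "y \<in> V" using yw Y by auto
    have w: "\<sigma> * ht v w < t + s + 2" using ht_add[OF v yV yw(2)] Y(2)[OF yw(1)] True by (simp add: distrib_left)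
    have "\<sigma> * ht v x < t + s + 2" if x: "x \<in> bridge_region \<sigma> \<rho> y w" for x
    proof -
      have xV: "x \<in> V" using x bridge_region_V[OF yw(2)] by auto
      show ?thesis
        using x w Y(2)[OF yw(1)] s ht_add[OF v xV yw(2)] by (auto simp: bridge_region_def distrib_left)
    qed
    then show ?thesis by (intro bridge_cong) (force simp: Fresh_def)
  qed (simp add: bridge_def)
  then show ?thesis unfolding reached_def by blast
qed

text \<open>Induction over generations. Each multiplies the population by at least
  \<open>\<kappa>\<close>: of the mean factor \<open>4 * \<kappa>\<close>, one factor 2 is lost to
  Chebyshev and one to the choice of a height window. The failure probability in generation
  \<open>i\<close> is at most \<open>c / (\<kappa> ^ i * card Y)\<close>. The lemma serves
  \<open>\<kappa> = 2\<close> for survival and \<open>\<kappa>\<close> below 1 for decaying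
  populations.\<close>

lemma Pr_Reach:
  assumes p: "0 \<le> p" "p \<le> 1" and v: "v \<in> V" and \<kappa>0: "0 < \<kappa>" and s: "4 \<le> s"
    and \<kappa>: "\<And>y. y \<in> V \<Longrightarrow> 4 * \<kappa> \<le> (\<Sum>w\<in>gball y \<rho>. offspring p \<sigma> s \<rho> y w)"
  defines "c \<equiv> 4 * real (ball_card \<rho> * ball_card (2 * \<rho>)) / (4 * \<kappa>)\<^sup>2"
  assumes Y: "finite Y" "Y \<subseteq> V" "Y \<noteq> {}" "\<And>y. y \<in> Y \<Longrightarrow> t \<le> \<sigma> * ht v y \<and> \<sigma> * ht v y < t + 1"
  shows "\<exists>F0. finite F0 \<and> F0 \<subseteq> E \<and> (\<forall>F. finite F \<longrightarrow> F \<subseteq> E \<longrightarrow> F0 \<subseteq> F \<longrightarrow>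
    1 - c / real (card Y) * (\<Sum>i<k. (1 / \<kappa>) ^ i) \<le> Pr p F (Reach v \<sigma> t Y (t + real k * s)))"
  using Y
proof (induction k arbitrary: t Y)
  case 0
  then obtain y where y: "y \<in> Y" by auto
  then have "Reach v \<sigma> t Y t S" for S
    unfolding Reach_def using 0 by (intro bexI[of _ y] bexI[of _ y]) auto
  then show ?case by (intro exI[of _ "{}"]) (auto simp: Pr_def Eb_const)
next
  case (Suc k)
  define W where "W = (\<Union>y\<in>Y. gball y \<rho>)"
  have W: "finite W" "W \<subseteq> V" unfolding W_def using Suc.prems gball_finite gball_V by blast+
  define ok where "ok Y' t' \<longleftrightarrow> Y' \<noteq> {} \<and> (\<forall>y\<in>Y'. t' \<le> \<sigma> * ht v y \<and> \<sigma> * ht v y < t' + 1)" for Y' t'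
  define good where "good F0 Y' t' \<longleftrightarrow> finite F0 \<and> F0 \<subseteq> E \<and> (\<forall>F. finite F \<longrightarrow> F \<subseteq> E \<longrightarrow> F0 \<subseteq> F \<longrightarrow>
    1 - c / real (card Y') * (\<Sum>i<k. (1 / \<kappa>) ^ i) \<le> Pr p F (Reach v \<sigma> t' Y' (t' + real k * s)))" for F0 Y' t'
  have "\<forall>Y' t'. \<exists>F0. Y' \<subseteq> W \<longrightarrow> ok Y' t' \<longrightarrow> good F0 Y' t'"
  proof (intro allI)
    fix Y' t'
    show "\<exists>F0. Y' \<subseteq> W \<longrightarrow> ok Y' t' \<longrightarrow> good F0 Y' t'"
    proof (cases "Y' \<subseteq> W \<and> ok Y' t'")
      case True
      then have "finite Y'" "Y' \<subseteq> V" using W finite_subset by auto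
      then show ?thesis using Suc.IH[of Y' t'] True unfolding good_def ok_def by blast
    qed auto
  qed
  then obtain G where G: "\<And>Y' t'. Y' \<subseteq> W \<Longrightarrow> ok Y' t' \<Longrightarrow> good (G Y' t') Y' t'" by metis
  \<comment> \<open>The first generation is random, so the union runs over all its possible subsets
    and both possible windows; one finite edge set then serves every outcome.\<close>
  define F0 where "F0 = (\<Union>w\<in>W. ball_edges w \<rho>) \<union> (\<Union>Y'\<in>Pow W. \<Union>t'\<in>{t + s, t + s + 1}. if ok Y' t' then G Y' t' else {})"
  have F0: "finite F0" "F0 \<subseteq> E"
    unfolding F0_def using W ball_edges_finite ball_edges_E G by (auto simp: good_def subset_iff split: if_splits)
  define a where "a = c / (\<kappa> * real (card Y)) * (\<Sum>i<k. (1 / \<kappa>) ^ i)"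
  have nY: "0 < real (card Y)" using Suc.prems by (simp add: card_gt_0_iff)
  have c0: "0 \<le> c" by (simp add: c_def)
  have a0: "0 \<le> a" unfolding a_def using c0 \<kappa>0 nY by (intro mult_nonneg_nonneg sum_nonneg) auto
  show ?case
  proof (intro exI[of _ F0] conjI F0 allI impI)
    fix F assume F: "finite F" "F \<subseteq> E" "F0 \<subseteq> F"
    define F1 where "F1 = F - Fresh v \<sigma> (t + s)"
    define F2 where "F2 = F \<inter> Fresh v \<sigma> (t + s)"
    have F12: "F = F1 \<union> F2" "F1 \<inter> F2 = {}" "finite F1" "finite F2" using F by (auto simp: F1_def F2_def)
    let ?gd = "\<lambda>S. 4 * \<kappa> * real (card Y) / 2 \<le> real (card (reached \<sigma> s \<rho> Y S))"
    let ?R = "Reach v \<sigma> t Y (t + real (Suc k) * s)"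
    have ball_edges_sub: "ball_edges w \<rho> \<subseteq> F" if "y \<in> Y" "w \<in> gball y \<rho>" for y w
    proof -
      have "w \<in> W" using that by (auto simp: W_def)
      then show ?thesis using F(3) unfolding F0_def by blast
    qed
    have loc: "reached \<sigma> s \<rho> Y S = reached \<sigma> s \<rho> Y (S \<inter> F1)" if "S \<subseteq> F" for S
    proof -
      have "S - Fresh v \<sigma> (t + s) = S \<inter> F1" using that by (auto simp: F1_def)
      then show ?thesis using reached_local[OF v Suc.prems(2) _ s, of \<sigma> t S \<rho>] Suc.prems(4) that F(2) by auto
    qed
    have gd: "1 - c / real (card Y) \<le> Pr p F1 ?gd"
    proof -
      have "Pr p F ?gd = Pr p F1 ?gd"
        unfolding Pr_def using F12 F(1) by (intro Eb_local) (auto simp: loc[symmetric])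
      then show ?thesis
        using reached_many[OF p Suc.prems(1-3) _ \<kappa> F(1,2) ball_edges_sub] \<kappa>0 by (simp add: c_def)
    qed
    have step: "of_bool (?gd S) - a \<le> Pr p F2 (\<lambda>T. ?R (S \<union> T))" if S: "S \<subseteq> F1" for S
    proof (cases "?gd S")
      case True
      define Z where "Z = reached \<sigma> s \<rho> Y S"
      have ZW: "Z \<subseteq> W" unfolding Z_def W_def by (rule reached_sub)
      then have Zf: "finite Z" using W finite_subset by auto
      \<comment> \<open>A start in \<open>[t, t + 1)\<close> and a climb in
        \<open>[s, s + 1)\<close> end in a window of width 2; the more populated unit half keeps at
        least half of the points.\<close>
      define part where "part t' = {w \<in> Z. t' \<le> \<sigma> * ht v w \<and> \<sigma> * ht v w < t' + 1}" for t'
      have "Z \<subseteq> part (t + s) \<union> part (t + s + 1)"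
      proof
        fix w assume w: "w \<in> Z"
        then obtain y where y: "y \<in> Y" "w \<in> V" "s \<le> \<sigma> * ht y w" "\<sigma> * ht y w < s + 1"
          by (auto simp: Z_def reached_def bridge_def)
        then have "\<sigma> * ht v w = \<sigma> * ht v y + \<sigma> * ht y w"
          using ht_add[OF v, of y w] Suc.prems(2) by (auto simp: distrib_left)
        then show "w \<in> part (t + s) \<union> part (t + s + 1)"
          using y Suc.prems(4)[OF y(1)] w by (auto simp: part_def)
      qed
      then have "card Z \<le> card (part (t + s)) + card (part (t + s + 1))"
        using Zf by (intro order_trans[OF card_mono card_Un_le]) (auto simp: part_def)
      then have "\<exists>t'\<in>{t + s, t + s + 1}. real (card Z) / 2 \<le> real (card (part t'))" by auto
      then obtain t' where t': "t' \<in> {t + s, t + s + 1}" "real (card Z) / 2 \<le> real (card (part t'))" by blast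
      define Y' where "Y' = part t'"
      have Y': "Y' \<subseteq> Z" "\<And>y. y \<in> Y' \<Longrightarrow> t' \<le> \<sigma> * ht v y \<and> \<sigma> * ht v y < t' + 1" by (auto simp: Y'_def part_def)
      have big: "\<kappa> * real (card Y) \<le> real (card Y')" using True t'(2) by (simp add: Y'_def Z_def)
      have pos: "0 < \<kappa> * real (card Y)" using \<kappa>0 nY by simp
      have "0 < real (card Y')" using big pos by linarith
      then have nY': "0 < card Y'" by simp
      then have "Y' \<noteq> {}" by (intro notI) simp
      then have okY: "ok Y' t'" using Y' by (simp add: ok_def)
      have Y'W: "Y' \<subseteq> W" using Y'(1) ZW by auto
      have "G Y' t' \<subseteq> F0" unfolding F0_def using Y'W okY t'(1) by auto
      then have "1 - c / real (card Y') * (\<Sum>i<k. (1 / \<kappa>) ^ i) \<le> Pr p F (Reach v \<sigma> t' Y' (t' + real k * s))"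
        using G[OF Y'W okY] F unfolding good_def by auto
      moreover have "c / real (card Y') * (\<Sum>i<k. (1 / \<kappa>) ^ i) \<le> a"
        unfolding a_def using big pos c0 \<kappa>0 nY nY' by (intro mult_right_mono sum_nonneg divide_left_mono mult_pos_pos) auto
      moreover have "Pr p F (Reach v \<sigma> t' Y' (t' + real k * s)) = Pr p F2 (Reach v \<sigma> t' Y' (t' + real k * s))"
        unfolding Pr_def
      proof (rule Eb_local[OF F(1)])
        fix S' assume "S' \<subseteq> F"
        moreover have "Fresh v \<sigma> t' \<subseteq> Fresh v \<sigma> (t + s)" using t'(1) by (auto simp: Fresh_def) (smt (verit))
        ultimately have "S' \<inter> Fresh v \<sigma> t' = S' \<inter> F2 \<inter> Fresh v \<sigma> t'" by (auto simp: F2_def)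
        then show "of_bool (Reach v \<sigma> t' Y' (t' + real k * s) S') = of_bool (Reach v \<sigma> t' Y' (t' + real k * s) (S' \<inter> F2))"
          by (simp add: Reach_def)
      qed (auto simp: F2_def)
      moreover have "Pr p F2 (Reach v \<sigma> t' Y' (t' + real k * s)) \<le> Pr p F2 (\<lambda>T. ?R (S \<union> T))"
      proof (rule Pr_mono[OF p])
        fix T assume T: "Reach v \<sigma> t' Y' (t' + real k * s) T"
        have le: "t + real (Suc k) * s \<le> t' + real k * s" using t'(1) by (auto simp: algebra_simps)
        have "Reach v \<sigma> t' Y' (t + real (Suc k) * s) T"
          using T le unfolding Reach_def by (meson order_trans)
        then show "?R (S \<union> T)"
          using S F(2) Suc.prems(2,4) s Y'(1) t'(1)
          by (intro Reach_step[OF v _ _ _ s, where Y' = Y' and t' = t' and \<rho> = \<rho>]) (auto simp: F1_def Z_def)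
      qed
      ultimately show ?thesis using True by simp
    next
      case False
      then show ?thesis using a0 Pr_nonneg[OF p, of F2 "\<lambda>T. ?R (S \<union> T)"] by simp
    qed
    have "1 - c / real (card Y) - a \<le> Pr p F1 ?gd - a" using gd by simp
    also have "\<dots> = Eb p F1 (\<lambda>S. of_bool (?gd S) - a)" using F12 by (simp add: Pr_def Eb_diff Eb_const)
    also have "\<dots> \<le> Eb p F1 (\<lambda>S. Pr p F2 (\<lambda>T. ?R (S \<union> T)))" using step by (intro Eb_mono[OF p])
    also have "\<dots> = Pr p F ?R" unfolding Pr_def F12(1) using F12 by (intro Eb_Un[symmetric])
    finally have "1 - c / real (card Y) - a \<le> Pr p F ?R" .
    moreover have "c / real (card Y) + a = c / real (card Y) * (\<Sum>i<Suc k. (1 / \<kappa>) ^ i)"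
    proof -
      have "(\<Sum>i<k. (1 / \<kappa>) ^ Suc i) = (\<Sum>i<k. (1 / \<kappa>) ^ i) / \<kappa>"
        by (simp add: sum_divide_distrib mult.commute)
      then show ?thesis unfolding sum.lessThan_Suc_shift a_def using \<kappa>0 nY by (simp add: field_simps)
    qed
    ultimately show "1 - c / real (card Y) * (\<Sum>i<Suc k. (1 / \<kappa>) ^ i) \<le> Pr p F ?R" by linarith
  qed
qed

end

section \<open>Reaching a given height\<close>

text \<open>Fekete's lemma with the rate taken as an infimum: the upper bound then holds for every
  \<open>x\<close> with constant 1, and the lower bound along the multiples of one nearly optimal
  \<open>x\<close>.\<close>

lemma fekete_rate:
  fixes f :: "real \<Rightarrow> real"
  assumes q: "1 < q" and f: "\<And>x. 0 < x \<Longrightarrow> 0 < f x" "\<And>x. 0 < x \<Longrightarrow> f x \<le> 1"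
    and super: "\<And>x y. 0 < x \<Longrightarrow> 0 < y \<Longrightarrow> f x * f y \<le> f (x + y)"
  obtains \<alpha> where "0 \<le> \<alpha>" "\<And>x. 0 < x \<Longrightarrow> f x \<le> q powr (- \<alpha> * x)"
    "\<And>\<epsilon> X. 0 < \<epsilon> \<Longrightarrow> \<exists>x. X \<le> x \<and> 0 < x \<and> q powr (- (\<alpha> + \<epsilon>) * x) \<le> f x"
proof -
  define g where "g x = - log q (f x) / x" for x
  have g0: "0 \<le> g x" if "0 < x" for x
  proof -
    have "log q (f x) \<le> 0" using f(1,2)[OF that] q by simp
    then show ?thesis using that by (simp add: g_def divide_nonpos_pos)
  qed
  have fg: "f x = q powr (- g x * x)" if "0 < x" for x
    using f(1)[OF that] q that by (simp add: g_def)
  define \<alpha> where "\<alpha> = Inf (g ` {0<..})"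
  have bdd: "bdd_below (g ` {0<..})" using g0 by (intro bdd_belowI[of _ 0]) auto
  show ?thesis
  proof (rule that[of \<alpha>])
    show "0 \<le> \<alpha>" unfolding \<alpha>_def using g0 by (intro cInf_greatest) auto
    show "f x \<le> q powr (- \<alpha> * x)" if x: "0 < x" for x
    proof -
      have "\<alpha> \<le> g x" unfolding \<alpha>_def using bdd x by (intro cInf_lower) auto
      then have "- g x * x \<le> - \<alpha> * x" using x by (simp add: mult_right_mono)
      then show ?thesis using q fg[OF x] by simp
    qed
    fix \<epsilon> X :: real assume \<epsilon>: "0 < \<epsilon>"
    have "\<exists>y\<in>g ` {0<..}. y < \<alpha> + \<epsilon>"
      using cInf_lessD[of "g ` {0<..}" "\<alpha> + \<epsilon>"] \<epsilon> unfolding \<alpha>_def by auto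
    then obtain x where x: "0 < x" "g x < \<alpha> + \<epsilon>" by auto
    have pow: "f x ^ Suc k \<le> f (real (Suc k) * x)" for k
    proof (induction k)
      case (Suc k)
      have "f x ^ Suc (Suc k) = f x * f x ^ Suc k" by simp
      also have "\<dots> \<le> f x * f (real (Suc k) * x)" using Suc f(1)[OF x(1)] by (intro mult_left_mono) auto
      also have "\<dots> \<le> f (x + real (Suc k) * x)" using x by (intro super) auto
      also have "x + real (Suc k) * x = real (Suc (Suc k)) * x" by (simp add: algebra_simps)
      finally show ?case .
    qed simp
    obtain k :: nat where k: "X / x \<le> real k" using real_arch_simple by blast
    define y where "y = real (Suc k) * x"
    have "X \<le> real k * x" using k x by (simp add: field_simps)
    also have "\<dots> \<le> y" using x by (simp add: y_def)
    finally have "X \<le> y" .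
    moreover have y0: "0 < y" using x by (simp add: y_def)
    moreover have "q powr (- (\<alpha> + \<epsilon>) * y) \<le> f y"
    proof -
      have "g x * y \<le> (\<alpha> + \<epsilon>) * y" using x y0 by (intro mult_right_mono) auto
      then have "- (\<alpha> + \<epsilon>) * y \<le> - g x * y" by linarith
      then have "q powr (- (\<alpha> + \<epsilon>) * y) \<le> q powr (- g x * y)" using q by (simp only: powr_le_cancel_iff)
      also have "\<dots> = (q powr (- g x * x)) powr real (Suc k)" by (simp add: powr_powr y_def mult_ac)
      also have "\<dots> = f x ^ Suc k" using fg[OF x(1)] f(1)[OF x(1)] by (simp only: powr_realpow)
      also have "\<dots> \<le> f y" unfolding y_def by (rule pow)
      finally show ?thesis .
    qed
    ultimately show "\<exists>x. X \<le> x \<and> 0 < x \<and> q powr (- (\<alpha> + \<epsilon>) * x) \<le> f x" by blast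
  qed
qed

lemma linked_last_edge:
  assumes "linked S (insert w R) v w" "v \<noteq> w" "\<And>e. e \<in> S \<Longrightarrow> card e = 2"
  obtains z where "{z, w} \<in> S" "z \<in> R"
proof -
  have "(v, w) \<in> (adj {e \<in> S. e \<subseteq> insert w R})\<^sup>*" using assms(1) by (simp add: linked_def)
  then obtain z where "(z, w) \<in> adj {e \<in> S. e \<subseteq> insert w R}"
    using assms(2) by (metis rtranclE)
  then have z: "{z, w} \<in> S" "{z, w} \<subseteq> insert w R" by (auto simp: adj_def)
  then have "z \<noteq> w" using assms(3)[of "{z, w}"] by auto
  then show ?thesis using that z by auto
qed

lemma linked_shrink: "linked S R x y \<Longrightarrow> (\<And>e. e \<in> S \<Longrightarrow> e \<subseteq> B) \<Longrightarrow> linked S (R \<inter> B) x y"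
proof -
  assume "\<And>e. e \<in> S \<Longrightarrow> e \<subseteq> B"
  then have "{e \<in> S. e \<subseteq> R \<inter> B} = {e \<in> S. e \<subseteq> R}" by auto
  then show "linked S R x y \<Longrightarrow> linked S (R \<inter> B) x y" by (simp add: linked_def)
qed

context nonunimodular_graph
begin

lemma finite_Union_edges: "finite F \<Longrightarrow> F \<subseteq> E \<Longrightarrow> finite (\<Union>F)"
  using edge_card card_ge_0_finite by (intro finite_Union) force+

text \<open>The flag \<open>b\<close> selects either the half-space above \<open>v\<close> in direction \<open>\<sigma>\<close> or, for \<open>b = False\<close>, all of \<open>V\<close>,
  so that both cases share the same estimates.\<close>

definition halfspace :: "bool \<Rightarrow> real \<Rightarrow> 'a \<Rightarrow> 'a set" where
  "halfspace b \<sigma> v = {x \<in> V. b \<longrightarrow> 0 \<le> \<sigma> * ht v x}"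

definition reaches :: "bool \<Rightarrow> real \<Rightarrow> real \<Rightarrow> 'a \<Rightarrow> 'a set set \<Rightarrow> bool" where
  "reaches b \<sigma> h v S \<longleftrightarrow> (\<exists>u\<in>V. h \<le> \<sigma> * ht v u \<and> linked S (halfspace b \<sigma> v) v u)"

definition reach_prob :: "real \<Rightarrow> bool \<Rightarrow> real \<Rightarrow> real \<Rightarrow> real" where
  "reach_prob p b \<sigma> h = PP p (reaches b \<sigma> h r)"

lemma halfspace_V: "halfspace b \<sigma> v \<subseteq> V" by (auto simp: halfspace_def)

lemma halfspace_\<Gamma>: "\<gamma> \<in> \<Gamma> \<Longrightarrow> v \<in> V \<Longrightarrow> \<gamma> ` halfspace b \<sigma> v = halfspace b \<sigma> (\<gamma> v)"
  unfolding halfspace_def by (rule \<Gamma>_image_Collect) (auto simp: ht_\<Gamma>)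

lemma incr_reaches: "incr (reaches b \<sigma> h v)"
  unfolding reaches_def by (intro incr_bex incr_conj incr_linked) (simp add: incr_def)

lemma reaches_\<Gamma>:
  assumes "\<gamma> \<in> \<Gamma>" "S \<subseteq> E" "v \<in> V"
  shows "reaches b \<sigma> h (\<gamma> v) (image \<gamma> ` S) = reaches b \<sigma> h v S"
proof -
  have *: "(h \<le> \<sigma> * ht (\<gamma> v) (\<gamma> u) \<and> linked (image \<gamma> ` S) (halfspace b \<sigma> (\<gamma> v)) (\<gamma> v) (\<gamma> u)) =
      (h \<le> \<sigma> * ht v u \<and> linked S (halfspace b \<sigma> v) v u)" if "u \<in> V" for u
    using linked_\<Gamma>[OF assms(1,2) halfspace_V[of b \<sigma> v] assms(3) that] halfspace_\<Gamma>[OF assms(1,3), of b \<sigma>] that assms by (simp add: ht_\<Gamma>)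
  have "bij_betw \<gamma> V V" by (rule \<Gamma>_bij[OF assms(1)])
  then have "\<gamma> ` V = V" by (simp add: bij_betw_def)
  then have "reaches b \<sigma> h (\<gamma> v) (image \<gamma> ` S) \<longleftrightarrow>
      (\<exists>u\<in>V. h \<le> \<sigma> * ht (\<gamma> v) (\<gamma> u) \<and> linked (image \<gamma> ` S) (halfspace b \<sigma> (\<gamma> v)) (\<gamma> v) (\<gamma> u))"
  proof -
    have "(\<exists>u\<in>\<gamma> ` V. P u) \<longleftrightarrow> (\<exists>u\<in>V. P (\<gamma> u))" for P by blast
    then show ?thesis unfolding reaches_def \<open>\<gamma> ` V = V\<close> .
  qed
  then show ?thesis using * unfolding reaches_def by simp
qed

lemma PP_reaches:
  assumes "v \<in> V" "0 \<le> p" "p \<le> 1"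
  shows "PP p (reaches b \<sigma> h v) = reach_prob p b \<sigma> h"
proof -
  obtain \<gamma> where g: "\<gamma> \<in> \<Gamma>" "\<gamma> r = v" using \<Gamma>_trans assms r by blast
  show ?thesis unfolding reach_prob_def g(2)[symmetric] by (rule PP_\<Gamma>[OF g(1) assms(2,3)]) (rule reaches_\<Gamma>[OF g(1) _ r])
qed

lemma reach_prob_antimono: "0 \<le> p \<Longrightarrow> p \<le> 1 \<Longrightarrow> h \<le> h' \<Longrightarrow> reach_prob p b \<sigma> h' \<le> reach_prob p b \<sigma> h"
  unfolding reach_prob_def reaches_def by (rule PP_mono) (auto dest: order_trans)

lemma reach_prob_mono_p: "0 \<le> p \<Longrightarrow> p \<le> p' \<Longrightarrow> p' \<le> 1 \<Longrightarrow> reach_prob p b \<sigma> h \<le> reach_prob p' b \<sigma> h"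
  unfolding reach_prob_def by (intro PP_mono_p incr_reaches)

subsection \<open>First passage\<close>

text \<open>What an exploration from \<open>v\<close> leaves unseen when it stops on arrival at
  height \<open>x\<close>.\<close>

definition edges_above :: "real \<Rightarrow> 'a \<Rightarrow> real \<Rightarrow> 'a set set" where
  "edges_above \<sigma> v x = {e. \<forall>z\<in>e. x \<le> \<sigma> * ht v z}"

text \<open>Heights change by at most 2 along an edge, hence the window of width 2.\<close>

definition first_passage :: "real \<Rightarrow> 'a \<Rightarrow> real \<Rightarrow> 'a set set \<Rightarrow> 'a \<Rightarrow> bool" where
  "first_passage \<sigma> v x S w \<longleftrightarrow> w \<in> V \<and> x \<le> \<sigma> * ht v w \<and> \<sigma> * ht v w < x + 2 \<and>
     linked (S - edges_above \<sigma> v x) (insert w {z \<in> halfspace True \<sigma> v. \<sigma> * ht v z < x}) v w"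

lemma first_passage_incr: "S \<subseteq> T \<Longrightarrow> first_passage \<sigma> v x S w \<Longrightarrow> first_passage \<sigma> v x T w"
  unfolding first_passage_def by (auto elim!: linked_mono)

text \<open>The path is stopped at its first vertex not below \<open>x\<close>. The predecessor is
  below \<open>x\<close>, which bounds the overshoot by 2. Every edge used has an endpoint other
  than \<open>w\<close>, again below \<open>x\<close>, so none lies in
  \<open>edges_above\<close>.\<close>

lemma reaches_first_passage:
  assumes v: "v \<in> V" and \<sigma>: "\<sigma> = 1 \<or> \<sigma> = -1" and x: "0 < x" and S: "S \<subseteq> E" and R: "reaches True \<sigma> x v S"
  shows "\<exists>w\<in>\<Union>S. first_passage \<sigma> v x S w"
proof -
  obtain u where u: "u \<in> V" "x \<le> \<sigma> * ht v u" "linked S (halfspace True \<sigma> v) v u" using R by (auto simp: reaches_def)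
  define B where "B = {z. \<sigma> * ht v z < x}"
  obtain w where w: "w \<in> \<Union>S" "w \<in> halfspace True \<sigma> v" "w \<notin> B"
    "disjointly (\<lambda>S. linked S (insert w (halfspace True \<sigma> v \<inter> B)) v w) (\<lambda>S. linked S (halfspace True \<sigma> v) w u) S"
    using linked_first_exit[OF u(3), of B] v x u by (auto simp: B_def)
  then have c: "linked S (insert w (halfspace True \<sigma> v \<inter> B)) v w"
    using disD[OF w(4)] incr_linked by blast
  have "v \<noteq> w" using w(3) v x by (auto simp: B_def)
  then obtain z where z: "{z, w} \<in> S" "z \<in> halfspace True \<sigma> v \<inter> B" using linked_last_edge[OF c] edge_card S by blast
  have zw: "z \<in> V" "w \<in> V" "\<bar>ht z w\<bar> \<le> 2" using z S edgeD ht_edge by blast+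
  have wlt: "\<sigma> * ht v w < x + 2"
    using ht_add[OF v zw(1,2)] z(2) zw(3) \<sigma> by (auto simp: B_def)
  have "linked (S - edges_above \<sigma> v x) (insert w (halfspace True \<sigma> v \<inter> B)) v w"
  proof (rule linked_mono[OF linked_restrict[OF c]])
    show "{e \<in> S. e \<subseteq> insert w (halfspace True \<sigma> v \<inter> B)} \<subseteq> S - edges_above \<sigma> v x"
    proof
      fix e assume e: "e \<in> {e \<in> S. e \<subseteq> insert w (halfspace True \<sigma> v \<inter> B)}"
      then have "e \<in> E" using S by auto
      then obtain a b where "e = {a, b}" "a \<noteq> b" using edgeE by blast
      then obtain y where "y \<in> e" "y \<noteq> w" by blast
      then show "e \<in> S - edges_above \<sigma> v x" using e by (force simp: edges_above_def B_def)
    qed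
  qed auto
  moreover have "insert w (halfspace True \<sigma> v \<inter> B) = insert w {z \<in> halfspace True \<sigma> v. \<sigma> * ht v z < x}"
    by (auto simp: B_def)
  ultimately show ?thesis using w wlt zw unfolding first_passage_def B_def by (intro bexI[of _ w]) auto
qed

text \<open>A Markov property at first passage: the passage point is decided by the edges outside
  \<open>edges_above\<close>, and \<open>Q w\<close> by the edges inside. Once the former are
  revealed, any one passage point may be chosen and \<open>Q\<close> tested there.\<close>

lemma PP_markov:
  assumes p: "0 \<le> p" "p \<le> 1" and v: "v \<in> V" and \<sigma>: "\<sigma> = 1 \<or> \<sigma> = -1" and x: "0 < x"
    and Dm: "\<And>w. incr (Q w)" and Dl: "\<And>w S. w \<in> V \<Longrightarrow> x \<le> \<sigma> * ht v w \<Longrightarrow> S \<subseteq> E \<Longrightarrow> Q w S \<Longrightarrow> Q w (S \<inter> edges_above \<sigma> v x)"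
    and m: "\<And>w. w \<in> V \<Longrightarrow> x \<le> \<sigma> * ht v w \<Longrightarrow> m \<le> PP p (Q w)" and m0: "0 \<le> m"
  shows "reach_prob p True \<sigma> x * m \<le> PP p (\<lambda>S. \<exists>w. first_passage \<sigma> v x S w \<and> Q w S)"
proof -
  let ?T = "\<lambda>S. \<exists>w. first_passage \<sigma> v x S w \<and> Q w S"
  have fin: "Pr p F (reaches True \<sigma> x v) * (m - \<epsilon>) \<le> PP p ?T" if F: "finite F" "F \<subseteq> E" and \<epsilon>: "0 < \<epsilon>" for F \<epsilon>
  proof -
    define W where "W = {w \<in> \<Union>F. w \<in> V \<and> x \<le> \<sigma> * ht v w}"
    have "finite (\<Union>F)" using F by (rule finite_Union_edges)
    then have W: "finite W" by (rule rev_finite_subset) (auto simp: W_def)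
    \<comment> \<open>The finitely many candidate passage points each get a finite edge set on which
      \<open>Q w\<close> is almost as likely as in infinite volume; \<open>H\<close> contains them
      all.\<close>
    have "\<forall>w\<in>W. \<exists>G. finite G \<and> G \<subseteq> E \<and> m - \<epsilon> < Pr p G (Q w)"
    proof
      fix w assume "w \<in> W"
      then have "m - \<epsilon> < PP p (Q w)" using m[of w] \<epsilon> by (auto simp: W_def)
      then show "\<exists>G. finite G \<and> G \<subseteq> E \<and> m - \<epsilon> < Pr p G (Q w)" using PP_approx by metis
    qed
    then obtain G where G: "\<And>w. w \<in> W \<Longrightarrow> finite (G w) \<and> G w \<subseteq> E \<and> m - \<epsilon> < Pr p (G w) (Q w)" by metis
    define H where "H = F \<union> (\<Union>w\<in>W. G w)"
    have H: "finite H" "H \<subseteq> E" "F \<subseteq> H" using F W G by (auto simp: H_def)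
    define H1 where "H1 = H - edges_above \<sigma> v x"
    define H2 where "H2 = H \<inter> edges_above \<sigma> v x"
    have H12: "H = H1 \<union> H2" "H1 \<inter> H2 = {}" "finite H1" "finite H2" using H by (auto simp: H1_def H2_def)
    have Q2: "m - \<epsilon> \<le> Pr p H2 (Q w)" if w: "w \<in> W" for w
    proof -
      have wV: "w \<in> V" "x \<le> \<sigma> * ht v w" using w by (auto simp: W_def)
      have "m - \<epsilon> < Pr p (G w) (Q w)" using G w by auto
      also have "\<dots> \<le> Pr p H (Q w)" using H p Dm w by (intro Pr_mono_F) (auto simp: H_def)
      also have "\<dots> = Pr p H2 (Q w)"
        unfolding Pr_def
      proof (rule Eb_local[OF H(1)])
        fix S assume S: "S \<subseteq> H"
        have "Q w S \<longleftrightarrow> Q w (S \<inter> edges_above \<sigma> v x)" using Dl[OF wV, of S] S H incrD[OF Dm, of w "S \<inter> edges_above \<sigma> v x" S] by auto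
        moreover have "S \<inter> edges_above \<sigma> v x = S \<inter> H2" using S by (auto simp: H2_def)
        ultimately show "of_bool (Q w S) = of_bool (Q w (S \<inter> H2))" by simp
      qed (auto simp: H2_def)
      finally show ?thesis by simp
    qed
    define F1 where "F1 = F - edges_above \<sigma> v x"
    have fp: "Pr p F (reaches True \<sigma> x v) \<le> Pr p F1 (\<lambda>S. \<exists>w\<in>W. first_passage \<sigma> v x S w)"
    proof -
      have "Pr p F (reaches True \<sigma> x v) \<le> Pr p F (\<lambda>S. \<exists>w\<in>W. first_passage \<sigma> v x S w)"
      proof (rule Pr_mono[OF p])
        fix S assume S: "S \<subseteq> F" "reaches True \<sigma> x v S"
        then obtain w where "w \<in> \<Union>S" "first_passage \<sigma> v x S w" using reaches_first_passage[OF v \<sigma> x] F(2) by blast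
        then show "\<exists>w\<in>W. first_passage \<sigma> v x S w" using S(1) by (intro bexI[of _ w]) (auto simp: W_def first_passage_def)
      qed
      also have "\<dots> = Pr p F1 (\<lambda>S. \<exists>w\<in>W. first_passage \<sigma> v x S w)"
        unfolding Pr_def
      proof (rule Eb_local[OF F(1)])
        fix S assume S: "S \<subseteq> F"
        then have "S \<inter> F1 - edges_above \<sigma> v x = S - edges_above \<sigma> v x" by (auto simp: F1_def)
        then show "of_bool (\<exists>w\<in>W. first_passage \<sigma> v x S w) = of_bool (\<exists>w\<in>W. first_passage \<sigma> v x (S \<inter> F1) w)"
          by (simp add: first_passage_def)
      qed (auto simp: F1_def)
      finally show ?thesis .
    qed
    show ?thesis
    proof (cases "m - \<epsilon> \<le> 0")
      case True
      then have "Pr p F (reaches True \<sigma> x v) * (m - \<epsilon>) \<le> 0" using Pr_nonneg[OF p] by (intro mult_nonneg_nonpos)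
      then show ?thesis using PP_nonneg[OF p, of ?T] by simp
    next
      case False
      have inc: "incr (\<lambda>S. \<exists>w\<in>W. first_passage \<sigma> v x S w)" using first_passage_incr unfolding incr_def by blast
      have "F1 \<subseteq> H1" using H(3) by (auto simp: F1_def H1_def)
      then have "Pr p F1 (\<lambda>S. \<exists>w\<in>W. first_passage \<sigma> v x S w) \<le> Pr p H1 (\<lambda>S. \<exists>w\<in>W. first_passage \<sigma> v x S w)"
        by (intro Pr_mono_F H12(3) p inc)
      then have "Pr p F (reaches True \<sigma> x v) * (m - \<epsilon>) \<le> Pr p H1 (\<lambda>S. \<exists>w\<in>W. first_passage \<sigma> v x S w) * (m - \<epsilon>)"
        using False fp by (intro mult_right_mono) auto
      also have "\<dots> = Eb p H1 (\<lambda>S. of_bool (\<exists>w\<in>W. first_passage \<sigma> v x S w) * (m - \<epsilon>))"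
        by (simp add: Pr_def Eb_cmult_right)
      also have "\<dots> \<le> Eb p H1 (\<lambda>S. Pr p H2 (\<lambda>T. ?T (S \<union> T)))"
      proof (rule Eb_mono[OF p])
        fix S assume S: "S \<subseteq> H1"
        show "of_bool (\<exists>w\<in>W. first_passage \<sigma> v x S w) * (m - \<epsilon>) \<le> Pr p H2 (\<lambda>T. ?T (S \<union> T))"
        proof (cases "\<exists>w\<in>W. first_passage \<sigma> v x S w")
          case True
          then obtain w where w: "w \<in> W" "first_passage \<sigma> v x S w" by auto
          have "m - \<epsilon> \<le> Pr p H2 (Q w)" by (rule Q2[OF w(1)])
          also have "\<dots> \<le> Pr p H2 (\<lambda>T. ?T (S \<union> T))"
          proof (rule Pr_mono[OF p])
            fix T assume "Q w T"
            then have "Q w (S \<union> T)" by (rule incrD[OF Dm]) auto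
            moreover have "first_passage \<sigma> v x (S \<union> T) w" by (rule first_passage_incr[OF _ w(2)]) auto
            ultimately show "?T (S \<union> T)" by blast
          qed
          finally show ?thesis using True by simp
        qed (use Pr_nonneg[OF p] in simp)
      qed
      also have "\<dots> = Pr p H ?T" unfolding Pr_def H12(1) using H12 by (intro Eb_Un[symmetric])
      also have "\<dots> \<le> PP p ?T" using H p by (intro PP_upper)
      finally show ?thesis .
    qed
  qed
  have fin0: "Pr p F (reaches True \<sigma> x v) * m \<le> PP p ?T" if F: "finite F" "F \<subseteq> E" for F
  proof (rule field_le_epsilon)
    fix \<epsilon> :: real assume \<epsilon>: "0 < \<epsilon>"
    have "Pr p F (reaches True \<sigma> x v) * \<epsilon> \<le> \<epsilon>" using Pr_le_1[OF F(1) p] \<epsilon> by simp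
    then show "Pr p F (reaches True \<sigma> x v) * m \<le> PP p ?T + \<epsilon>"
      using fin[OF F \<epsilon>] by (simp add: right_diff_distrib)
  qed
  show ?thesis
  proof (cases "m = 0")
    case True
    then show ?thesis using PP_nonneg[OF p, of ?T] by simp
  next
    case False
    then have "reach_prob p True \<sigma> x \<le> PP p ?T / m"
      unfolding PP_reaches[OF v p, symmetric] using fin0 m0 by (intro PP_least) (simp add: field_simps)
    then show ?thesis using False m0 by (simp add: field_simps)
  qed
qed

text \<open>The walk up restarts at the first passage point, whose upper half-space lies inside that
  of \<open>r\<close>.\<close>

lemma reach_prob_supermult:
  assumes p: "0 \<le> p" "p \<le> 1" and \<sigma>: "\<sigma> = 1 \<or> \<sigma> = -1" and x: "0 < x"
  shows "reach_prob p True \<sigma> x * reach_prob p True \<sigma> y \<le> reach_prob p True \<sigma> (x + y)"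
proof -
  have "reach_prob p True \<sigma> x * reach_prob p True \<sigma> y \<le> PP p (\<lambda>S. \<exists>w. first_passage \<sigma> r x S w \<and> reaches True \<sigma> y w S)"
  proof (rule PP_markov[OF p r \<sigma> x incr_reaches])
    fix w S assume w: "w \<in> V" "x \<le> \<sigma> * ht r w" and S: "S \<subseteq> E" "reaches True \<sigma> y w S"
    have "linked S (halfspace True \<sigma> w) w u = linked (S \<inter> edges_above \<sigma> r x) (halfspace True \<sigma> w) w u" for u
    proof (rule linked_cong)
      fix e assume "e \<subseteq> halfspace True \<sigma> w"
      then have "x \<le> \<sigma> * ht r z" if "z \<in> e" for z
        using that w ht_add[OF r w(1), of z] by (auto simp: halfspace_def distrib_left)
      then have "e \<in> edges_above \<sigma> r x" by (auto simp: edges_above_def)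
      then show "e \<in> S \<longleftrightarrow> e \<in> S \<inter> edges_above \<sigma> r x" by simp
    qed
    then show "reaches True \<sigma> y w (S \<inter> edges_above \<sigma> r x)" using S(2) by (simp add: reaches_def)
  next
    fix w assume w: "w \<in> V"
    show "reach_prob p True \<sigma> y \<le> PP p (reaches True \<sigma> y w)" using PP_reaches[OF w p] by simp
  next
    show "0 \<le> reach_prob p True \<sigma> y" unfolding reach_prob_def by (rule PP_nonneg[OF p])
  qed
  also have "\<dots> \<le> reach_prob p True \<sigma> (x + y)"
    unfolding reach_prob_def
  proof (rule PP_mono[OF p])
    fix S assume "S \<subseteq> E" "\<exists>w. first_passage \<sigma> r x S w \<and> reaches True \<sigma> y w S"
    then obtain w u where w: "first_passage \<sigma> r x S w" "u \<in> V" "y \<le> \<sigma> * ht w u" "linked S (halfspace True \<sigma> w) w u"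
      by (auto simp: reaches_def)
    have wV: "w \<in> V" "x \<le> \<sigma> * ht r w" using w(1) by (auto simp: first_passage_def)
    have "linked S (halfspace True \<sigma> r) r w"
      using w(1) wV x unfolding first_passage_def by (auto simp: halfspace_def elim!: linked_mono)
    moreover have "halfspace True \<sigma> w \<subseteq> halfspace True \<sigma> r"
    proof
      fix z assume "z \<in> halfspace True \<sigma> w"
      then show "z \<in> halfspace True \<sigma> r" using ht_add[OF r wV(1), of z] wV x by (simp add: halfspace_def distrib_left)
    qed
    then have "linked S (halfspace True \<sigma> r) w u" using w(4) by (elim linked_mono) auto
    ultimately have "linked S (halfspace True \<sigma> r) r u" by (rule linked_trans)
    moreover have "x + y \<le> \<sigma> * ht r u" using ht_add[OF r wV(1) w(2)] w(3) wV(2) by (simp add: distrib_left)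
    ultimately show "reaches True \<sigma> (x + y) r S" using w(2) by (auto simp: reaches_def)
  qed
  finally show ?thesis .
qed

lemma Pr_edge: "Pr p {e} (\<lambda>S. e \<in> S) = p"
  using Pr_insert[of "{}" e p "\<lambda>S. e \<in> S"] by (simp add: Pr_def)

lemma PP_edge: "e \<in> E \<Longrightarrow> 0 \<le> p \<Longrightarrow> p \<le> 1 \<Longrightarrow> p \<le> PP p (\<lambda>S. e \<in> S)"
  using PP_upper[of "{e}" p "\<lambda>S. e \<in> S"] by (simp add: Pr_edge)

lemma reach_prob_2:
  assumes p: "0 \<le> p" "p \<le> 1" and \<sigma>: "\<sigma> = 1 \<or> \<sigma> = -1"
  shows "p \<le> reach_prob p True \<sigma> 2"
proof -
  obtain y where y: "{r, y} \<in> E" "\<sigma> * ht r y = 2" using extremal_nbr[OF r \<sigma>] by blast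
  have "p \<le> PP p (\<lambda>S. {r, y} \<in> S)" by (rule PP_edge[OF y(1) p])
  also have "\<dots> \<le> reach_prob p True \<sigma> 2"
    unfolding reach_prob_def
  proof (rule PP_mono[OF p])
    fix S assume "{r, y} \<in> S"
    moreover have "y \<in> V" using edgeD y by auto
    ultimately show "reaches True \<sigma> 2 r S"
      unfolding reaches_def using y r by (intro bexI[of _ y]) (auto intro!: linked_edge simp: halfspace_def)
  qed
  finally show ?thesis .
qed

lemma reach_prob_pos:
  assumes p: "0 < p" "p \<le> 1" and \<sigma>: "\<sigma> = 1 \<or> \<sigma> = -1"
  shows "0 < reach_prob p True \<sigma> x"
proof -
  have "p ^ Suc k \<le> reach_prob p True \<sigma> (2 * real (Suc k))" for k
  proof (induction k)
    case 0
    then show ?case using reach_prob_2[of p \<sigma>] p \<sigma> by simp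
  next
    case (Suc k)
    have "p ^ Suc (Suc k) = p * p ^ Suc k" by simp
    also have "\<dots> \<le> reach_prob p True \<sigma> 2 * reach_prob p True \<sigma> (2 * real (Suc k))"
      using Suc reach_prob_2[of p \<sigma>] p \<sigma> PP_nonneg[of p] by (intro mult_mono) (auto simp: reach_prob_def)
    also have "\<dots> \<le> reach_prob p True \<sigma> (2 + 2 * real (Suc k))" using p \<sigma> by (intro reach_prob_supermult) auto
    finally show ?case by (simp add: algebra_simps)
  qed
  moreover obtain k :: nat where "x \<le> real k" using real_arch_simple by blast
  then have "reach_prob p True \<sigma> (2 * real (Suc k)) \<le> reach_prob p True \<sigma> x" using p by (intro reach_prob_antimono) auto
  ultimately show ?thesis using p by (meson less_le_trans zero_less_power)
qed

lemma reach_prob_le_1: "0 \<le> p \<Longrightarrow> p \<le> 1 \<Longrightarrow> reach_prob p b \<sigma> x \<le> 1"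
  unfolding reach_prob_def by (rule PP_le_1)

subsection \<open>Existence of bridges\<close>

text \<open>A bridge into \<open>r\<close> is a connection from \<open>r\<close> in the opposite
  direction, read backwards. A steepest edge is attached at each end of a half-space connection:
  this creates the gaps of height 2 and costs \<open>p^2\<close>. The total height lies in
  \<open>[x + 4, x + 6)\<close>, and choosing one of its two unit windows costs the factor
  2.\<close>

lemma parent_prob_lower:
  assumes p: "0 < p" "p \<le> 1" and \<sigma>: "\<sigma> = 1 \<or> \<sigma> = -1" and x: "0 < x" and c: "c < p\<^sup>2 * reach_prob p True (- \<sigma>) x"
  shows "\<exists>\<rho> s. (s = x + 4 \<or> s = x + 5) \<and> c / 2 < parent_prob p \<sigma> s \<rho> r"
proof -
  have p': "0 \<le> p" using p by simp
  define \<tau> where "\<tau> = - \<sigma>"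
  have \<tau>: "\<tau> = 1 \<or> \<tau> = -1" using \<sigma> by (auto simp: \<tau>_def)
  obtain v where v: "{r, v} \<in> E" "\<tau> * ht r v = 2" using extremal_nbr[OF r \<tau>] by blast
  have vV: "v \<in> V" using edgeD v by auto
  have "\<forall>w\<in>V. \<exists>y. {w, y} \<in> E \<and> \<tau> * ht w y = 2" using extremal_nbr[OF _ \<tau>] by metis
  then obtain up where up: "\<And>w. w \<in> V \<Longrightarrow> {w, up w} \<in> E \<and> \<tau> * ht w (up w) = 2" by metis
  define B where "B S \<longleftrightarrow> (\<exists>y\<in>V. x + 4 \<le> \<tau> * ht r y \<and> \<tau> * ht r y < x + 6 \<and>
      linked S {z \<in> V. z = y \<or> z = r \<or> 2 \<le> \<sigma> * ht y z \<and> 2 \<le> \<sigma> * ht z r} y r)" for S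
  have "p * (p * reach_prob p True \<tau> x) \<le> PP p B"
  proof -
    let ?Q = "\<lambda>w S. {w, up w} \<in> S"
    have "reach_prob p True \<tau> x * p \<le> PP p (\<lambda>S. \<exists>w. first_passage \<tau> v x S w \<and> ?Q w S)"
    proof (rule PP_markov[OF p' p(2) vV \<tau> x])
      show "incr (?Q w)" for w by (auto simp: incr_def)
      fix w assume w: "w \<in> V" "x \<le> \<tau> * ht v w"
      have "up w \<in> V" using up[OF w(1)] edgeD by blast
      then have "x \<le> \<tau> * ht v (up w)" using ht_add[OF vV w(1)] up[OF w(1)] w(2) by (simp add: distrib_left)
      then show "{w, up w} \<in> S \<inter> edges_above \<tau> v x" if "{w, up w} \<in> S" for S
        using that w by (auto simp: edges_above_def)
      show "p \<le> PP p (?Q w)" using up[OF w(1)] p by (intro PP_edge) auto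
    qed (use p in auto)
    then have "p * (reach_prob p True \<tau> x * p) \<le> p * PP p (\<lambda>S. \<exists>w. first_passage \<tau> v x S w \<and> ?Q w S)"
      using p by (intro mult_left_mono) auto
    also have "\<dots> \<le> PP p B"
    proof (rule PP_edge_open[OF v(1) p' p(2)])
      show "incr (\<lambda>S. \<exists>w. first_passage \<tau> v x S w \<and> ?Q w S)" unfolding incr_def using first_passage_incr by blast
      fix S assume S: "S \<subseteq> E" "{r, v} \<in> S" "\<exists>w. first_passage \<tau> v x S w \<and> ?Q w S"
      then obtain w where w: "first_passage \<tau> v x S w" "{w, up w} \<in> S" by auto
      define y where "y = up w"
      have wV: "w \<in> V" "x \<le> \<tau> * ht v w" "\<tau> * ht v w < x + 2" using w(1) by (auto simp: first_passage_def)
      have y: "y \<in> V" "\<tau> * ht w y = 2" using up[OF wV(1)] edgeD unfolding y_def by blast+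
      define R where "R = {z \<in> V. z = y \<or> z = r \<or> 2 \<le> \<sigma> * ht y z \<and> 2 \<le> \<sigma> * ht z r}"
      have mid: "z \<in> R" if "z \<in> V" "0 \<le> \<tau> * ht v z" "\<tau> * ht v z \<le> \<tau> * ht v w" for z
      proof -
        have "\<sigma> * ht z r = \<tau> * ht r v + \<tau> * ht v z"
        proof -
          have eq: "ht z r = - ht r v - ht v z" using ht_add[OF r vV that(1)] ht_sym[OF r that(1)] by simp
          show ?thesis unfolding \<tau>_def eq by (simp add: algebra_simps)
        qed
        moreover have "\<sigma> * ht y z = \<tau> * ht v w + \<tau> * ht w y - \<tau> * ht v z"
        proof -
          have eq: "ht y z = ht v z - ht v w - ht w y"
            using ht_add[OF vV that(1) y(1)] ht_add[OF vV wV(1) y(1)] ht_sym[OF that(1) y(1)] by simp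
          show ?thesis unfolding \<tau>_def eq by (simp add: algebra_simps)
        qed
        ultimately show ?thesis using that v y by (simp add: R_def)
      qed
      have "linked S R v w"
        using w(1) wV mid x unfolding first_passage_def by (auto simp: halfspace_def elim!: linked_mono)
      moreover have "linked S R r v"
        using S(2) mid[OF vV] vV r x wV by (intro linked_edge) (auto simp: R_def)
      moreover have "linked S R w y"
        using w(2) mid[OF wV(1)] y wV x by (intro linked_edge) (auto simp: R_def y_def)
      ultimately have "linked S R y r" by (meson linked_sym linked_trans)
      moreover have "\<tau> * ht r y = 2 + \<tau> * ht v w + 2"
        using ht_add[OF r vV y(1)] ht_add[OF vV wV(1) y(1)] v y by (simp add: distrib_left)
      ultimately show "B S" unfolding B_def R_def using y wV by (intro bexI[of _ y]) auto
    qed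
    finally show ?thesis by (simp add: mult_ac)
  qed
  then have "c < PP p B" using c by (simp add: \<tau>_def power2_eq_square mult.assoc)
  then obtain F where F: "finite F" "F \<subseteq> E" "c < Pr p F B" using PP_approx by blast
  obtain \<rho> where \<rho>: "F \<subseteq> ball_edges r \<rho>" using finite_subset_ball_edges[OF r F(1,2)] by blast
  have "incr B" unfolding B_def incr_def by (meson linked_mono order_refl)
  then have "c < Pr p (ball_edges r \<rho>) B"
    using F(3) Pr_mono_F[OF ball_edges_finite[OF r] \<rho> p' p(2)] by (metis less_le_trans)
  also have "\<dots> \<le> Pr p (ball_edges r \<rho>) (\<lambda>S. (\<exists>y. bridge \<sigma> (x + 4) \<rho> S y r) \<or> (\<exists>y. bridge \<sigma> (x + 5) \<rho> S y r))"
  proof (rule Pr_mono[OF p' p(2)])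
    fix S assume S: "S \<subseteq> ball_edges r \<rho>" "B S"
    then obtain y where y: "y \<in> V" "x + 4 \<le> \<tau> * ht r y" "\<tau> * ht r y < x + 6"
      "linked S {z \<in> V. z = y \<or> z = r \<or> 2 \<le> \<sigma> * ht y z \<and> 2 \<le> \<sigma> * ht z r} y r" by (auto simp: B_def)
    have "y \<noteq> r" using y x r by auto
    have h: "\<sigma> * ht y r = \<tau> * ht r y" using ht_sym[OF r y(1)] by (simp add: \<tau>_def)
    have "y \<in> gball r \<rho>"
    proof -
      have c2: "card e = 2" if "e \<in> S" for e using that S(1) edge_card by (auto simp: ball_edges_def)
      have "linked S (insert y UNIV) r y" by (rule linked_mono[OF linked_sym[OF y(4)]]) auto
      then obtain z where "{z, y} \<in> S" by (rule linked_last_edge) (use \<open>y \<noteq> r\<close> c2 in auto)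
      then show ?thesis using S(1) by (auto simp: ball_edges_def)
    qed
    moreover have "linked S ({z \<in> V. z = y \<or> z = r \<or> 2 \<le> \<sigma> * ht y z \<and> 2 \<le> \<sigma> * ht z r} \<inter> gball r \<rho>) y r"
      by (rule linked_shrink[OF y(4)]) (use S(1) in \<open>auto simp: ball_edges_def\<close>)
    then have "linked S (bridge_region \<sigma> \<rho> y r) y r" by (rule linked_mono) (auto simp: bridge_region_def)
    ultimately show "(\<exists>y. bridge \<sigma> (x + 4) \<rho> S y r) \<or> (\<exists>y. bridge \<sigma> (x + 5) \<rho> S y r)"
      using y h by (cases "\<tau> * ht r y < x + 5") (auto simp: bridge_def)
  qed
  also have "\<dots> \<le> parent_prob p \<sigma> (x + 4) \<rho> r + parent_prob p \<sigma> (x + 5) \<rho> r"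
    unfolding parent_prob_def by (rule Pr_or_le[OF p' p(2)])
  finally have "c / 2 < parent_prob p \<sigma> (x + 4) \<rho> r \<or> c / 2 < parent_prob p \<sigma> (x + 5) \<rho> r" by linarith
  then show ?thesis by blast
qed

end

section \<open>Tail bounds\<close>

lemma sum_inverse_powers_le:
  fixes \<kappa> :: real
  assumes "0 < \<kappa>" "\<kappa> \<le> 1 / 2"
  shows "(\<Sum>i<k. (1 / \<kappa>) ^ i) \<le> (1 / \<kappa>) ^ k"
proof (induction k)
  case (Suc k)
  have "2 \<le> 1 / \<kappa>" using assms by (simp add: field_simps)
  then have "2 * (1 / \<kappa>) ^ k \<le> 1 / \<kappa> * (1 / \<kappa>) ^ k" using assms by (intro mult_right_mono) auto
  then show ?case using Suc by simp
qed simp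

lemma powr_eventually_ge:
  fixes q :: real
  assumes "1 < q" "0 < \<epsilon>"
  obtains X where "0 < X" "\<And>s. X \<le> s \<Longrightarrow> K \<le> q powr (\<epsilon> * s)"
proof -
  define X where "X = max 1 (log q (max 1 K) / \<epsilon>)"
  have "K \<le> q powr (\<epsilon> * s)" if "X \<le> s" for s
  proof -
    have "log q (max 1 K) \<le> \<epsilon> * s" using that assms by (simp add: X_def field_simps)
    then have "q powr log q (max 1 K) \<le> q powr (\<epsilon> * s)" using assms by (simp only: powr_le_cancel_iff)
    moreover have "q powr log q (max 1 K) = max 1 K" using assms by simp
    ultimately show ?thesis by linarith
  qed
  then show ?thesis using that[of X] by (simp add: X_def)
qed

context nonunimodular_graph
begin

text \<open>Only connections that stay below \<open>t + 1\<close> count, so the set is decided by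
  edges below \<open>t + 1\<close> and the edges used by later bridges remain unseen.\<close>

definition layer :: "bool \<Rightarrow> real \<Rightarrow> 'a \<Rightarrow> real \<Rightarrow> 'a set set \<Rightarrow> 'a set" where
  "layer b \<sigma> v t S = {u \<in> V. t \<le> \<sigma> * ht v u \<and> \<sigma> * ht v u < t + 1 \<and>
     linked S {z \<in> halfspace b \<sigma> v. \<sigma> * ht v z < t + 1} v u}"

lemma layer_sub: "layer b \<sigma> v t S \<subseteq> insert v (\<Union>S)"
proof
  fix u assume "u \<in> layer b \<sigma> v t S"
  then have "linked S {z \<in> halfspace b \<sigma> v. \<sigma> * ht v z < t + 1} v u" by (simp add: layer_def)
  then obtain xs where xs: "distinct xs" "xs \<noteq> []" "hd xs = v" "last xs = u" "path_edges xs \<subseteq> S"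
    "set xs \<subseteq> {z \<in> halfspace b \<sigma> v. \<sigma> * ht v z < t + 1} \<or> xs = [v]" "set xs \<subseteq> insert v (\<Union>S)"
    by (rule linked_path)
  have "last xs \<in> set xs" using xs(2) by simp
  then show "u \<in> insert v (\<Union>S)" using xs(4,7) by blast
qed

lemma layer_finite: "finite F \<Longrightarrow> F \<subseteq> E \<Longrightarrow> S \<subseteq> F \<Longrightarrow> finite (layer b \<sigma> v t S)"
proof (rule finite_subset[OF layer_sub])
  assume "finite F" "F \<subseteq> E" "S \<subseteq> F"
  then have "finite S" "S \<subseteq> E" using finite_subset by auto
  then show "finite (insert v (\<Union>S))" using finite_Union_edges by simp
qed

lemma layer_local: "layer b \<sigma> v t S = layer b \<sigma> v t (S \<inter> {e. \<forall>x\<in>e. \<sigma> * ht v x < t + 1})"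
proof -
  have "linked S {z \<in> halfspace b \<sigma> v. \<sigma> * ht v z < t + 1} v u =
      linked (S \<inter> {e. \<forall>x\<in>e. \<sigma> * ht v x < t + 1}) {z \<in> halfspace b \<sigma> v. \<sigma> * ht v z < t + 1} v u" for u
    by (rule linked_cong) auto
  then show ?thesis by (simp add: layer_def)
qed

text \<open>If many points at height \<open>t\<close> have been found below height \<open>t + 1\<close>, then bridges in the unexplored
  region above lead on to height \<open>t + k s\<close> with probability at least one half.\<close>

lemma tail_bound:
  assumes p: "0 \<le> p" "p \<le> 1" and v: "v \<in> V" and \<kappa>0: "0 < \<kappa>" and s: "4 \<le> s" and t: "0 \<le> t"
    and \<kappa>: "\<And>y. y \<in> V \<Longrightarrow> 4 * \<kappa> \<le> (\<Sum>w\<in>gball y \<rho>. offspring p \<sigma> s \<rho> y w)"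
  defines "c \<equiv> 4 * real (ball_card \<rho> * ball_card (2 * \<rho>)) / (4 * \<kappa>)\<^sup>2"
  assumes n: "1 \<le> n" "c * (\<Sum>i<k. (1 / \<kappa>) ^ i) \<le> real n / 2" and F: "finite F" "F \<subseteq> E"
  shows "Pr p F (\<lambda>S. n \<le> card (layer b \<sigma> v t S)) \<le> 2 * reach_prob p b \<sigma> (t + real k * s)"
proof -
  define Below where "Below = {e. \<forall>x\<in>e. \<sigma> * ht v x < t + 1}"
  define W where "W = {u \<in> insert v (\<Union>F). u \<in> V \<and> t \<le> \<sigma> * ht v u \<and> \<sigma> * ht v u < t + 1}"
  have "finite (insert v (\<Union>F))" using finite_Union_edges[OF F] by simp
  then have W: "finite W" by (rule rev_finite_subset) (auto simp: W_def)
  let ?A = "\<lambda>S. n \<le> card (layer b \<sigma> v t S)"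
  let ?h = "t + real k * s"
  have "\<forall>Y\<in>{Y. Y \<subseteq> W \<and> n \<le> card Y}. \<exists>F0. finite F0 \<and> F0 \<subseteq> E \<and> (\<forall>F. finite F \<longrightarrow> F \<subseteq> E \<longrightarrow> F0 \<subseteq> F \<longrightarrow>
      1 / 2 \<le> Pr p F (Reach v \<sigma> t Y ?h))"
  proof
    fix Y assume "Y \<in> {Y. Y \<subseteq> W \<and> n \<le> card Y}"
    then have Y: "Y \<subseteq> W" "n \<le> card Y" by auto
    then have Yf: "finite Y" "Y \<subseteq> V" "Y \<noteq> {}" using W finite_subset n(1) by (auto simp: W_def)
    have le: "c / real (card Y) * (\<Sum>i<k. (1 / \<kappa>) ^ i) \<le> 1 / 2"
    proof -
      have "c * (\<Sum>i<k. (1 / \<kappa>) ^ i) \<le> real (card Y) / 2" using n Y by linarith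
      then show ?thesis using n(1) Y(2) by (simp add: field_simps)
    qed
    have "\<exists>F0. finite F0 \<and> F0 \<subseteq> E \<and> (\<forall>F. finite F \<longrightarrow> F \<subseteq> E \<longrightarrow> F0 \<subseteq> F \<longrightarrow>
      1 - c / real (card Y) * (\<Sum>i<k. (1 / \<kappa>) ^ i) \<le> Pr p F (Reach v \<sigma> t Y ?h))"
      unfolding c_def using Y by (intro Pr_Reach[OF p v \<kappa>0 s \<kappa> Yf]) (auto simp: W_def)
    then obtain F0 where F0: "finite F0" "F0 \<subseteq> E" "\<And>F. finite F \<Longrightarrow> F \<subseteq> E \<Longrightarrow> F0 \<subseteq> F \<Longrightarrow>
      1 - c / real (card Y) * (\<Sum>i<k. (1 / \<kappa>) ^ i) \<le> Pr p F (Reach v \<sigma> t Y ?h)" by blast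
    have "1 / 2 \<le> Pr p F (Reach v \<sigma> t Y ?h)" if "finite F" "F \<subseteq> E" "F0 \<subseteq> F" for F
      using F0(3)[OF that] le by linarith
    then show "\<exists>F0. finite F0 \<and> F0 \<subseteq> E \<and> (\<forall>F. finite F \<longrightarrow> F \<subseteq> E \<longrightarrow> F0 \<subseteq> F \<longrightarrow>
      1 / 2 \<le> Pr p F (Reach v \<sigma> t Y ?h))" using F0(1,2) by blast
  qed
  then obtain G where G: "\<And>Y. Y \<subseteq> W \<Longrightarrow> n \<le> card Y \<Longrightarrow> finite (G Y) \<and> G Y \<subseteq> E \<and>
      (\<forall>F. finite F \<longrightarrow> F \<subseteq> E \<longrightarrow> G Y \<subseteq> F \<longrightarrow> 1 / 2 \<le> Pr p F (Reach v \<sigma> t Y ?h))"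
    by (metis (mono_tags, lifting) mem_Collect_eq)
  \<comment> \<open>One finite edge set for all possible values \<open>Y\<close> of the
    layer.\<close>
  define GG where "GG = (\<Union>Y\<in>{Y. Y \<subseteq> W \<and> n \<le> card Y}. G Y)"
  have "finite {Y. Y \<subseteq> W \<and> n \<le> card Y}" using W by simp
  then have GG: "finite GG" "GG \<subseteq> E" using G by (auto simp: GG_def)
  define H1 where "H1 = F \<inter> Below"
  define H2 where "H2 = GG - Below"
  have H: "finite H1" "finite H2" "H1 \<inter> H2 = {}" "H1 \<union> H2 \<subseteq> E" using F GG by (auto simp: H1_def H2_def)
  have "Pr p F ?A = Pr p H1 ?A"
    unfolding Pr_def
  proof (rule Eb_local[OF F(1)])
    fix S assume "S \<subseteq> F"
    then have "S \<inter> H1 = S \<inter> Below" by (auto simp: H1_def)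
    then show "of_bool (?A S) = of_bool (?A (S \<inter> H1))" using layer_local[of b \<sigma> v t S] by (simp add: Below_def)
  qed (auto simp: H1_def)
  also have "\<dots> / 2 = Eb p H1 (\<lambda>S. of_bool (?A S) / 2)"
    using Eb_cmult_right[of p H1 "\<lambda>S. of_bool (?A S)" "1 / 2"] by (simp add: Pr_def)
  also have "\<dots> \<le> Eb p H1 (\<lambda>S. Pr p H2 (\<lambda>T. reaches b \<sigma> ?h v (S \<union> T)))"
  proof (rule Eb_mono[OF p])
    fix S assume S: "S \<subseteq> H1"
    show "of_bool (?A S) / 2 \<le> Pr p H2 (\<lambda>T. reaches b \<sigma> ?h v (S \<union> T))"
    proof (cases "?A S")
      case True
      define Y where "Y = layer b \<sigma> v t S"
      have "Y \<subseteq> insert v (\<Union>F)" using layer_sub[of b \<sigma> v t S] S unfolding Y_def H1_def by blast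
      then have Y: "Y \<subseteq> W" "n \<le> card Y" using True by (auto simp: Y_def W_def layer_def)
      then have "G Y \<subseteq> GG" by (auto simp: GG_def)
      then have "1 / 2 \<le> Pr p GG (Reach v \<sigma> t Y ?h)" using G[OF Y] GG by blast
      also have "\<dots> = Pr p H2 (Reach v \<sigma> t Y ?h)"
        unfolding Pr_def
      proof (rule Eb_local[OF GG(1)])
        fix T assume "T \<subseteq> GG"
        moreover have "e \<notin> Below" if e: "e \<in> Fresh v \<sigma> t" for e
        proof -
          obtain x where "x \<in> e" "t + 2 \<le> \<sigma> * ht v x" using e by (auto simp: Fresh_def)
          then show ?thesis by (auto simp: Below_def intro!: bexI[of _ x])
        qed
        ultimately have "T \<inter> Fresh v \<sigma> t = T \<inter> H2 \<inter> Fresh v \<sigma> t" by (auto simp: H2_def)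
        then show "of_bool (Reach v \<sigma> t Y ?h T) = of_bool (Reach v \<sigma> t Y ?h (T \<inter> H2))" by (simp add: Reach_def)
      qed (auto simp: H2_def)
      also have "\<dots> \<le> Pr p H2 (\<lambda>T. reaches b \<sigma> ?h v (S \<union> T))"
      proof (rule Pr_mono[OF p])
        fix T assume "Reach v \<sigma> t Y ?h T"
        then obtain y u where y: "y \<in> Y" "u \<in> V" "?h \<le> \<sigma> * ht v u"
          "linked (T \<inter> Fresh v \<sigma> t) {x \<in> V. 0 \<le> \<sigma> * ht y x} y u" by (auto simp: Reach_def)
        have yV: "y \<in> V" "t \<le> \<sigma> * ht v y" "linked S {z \<in> halfspace b \<sigma> v. \<sigma> * ht v z < t + 1} v y"
          using y(1) by (auto simp: Y_def layer_def)
        have vy: "linked (S \<union> T) (halfspace b \<sigma> v) v y" using yV(3) by (rule linked_mono) auto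
        have sub: "{x \<in> V. 0 \<le> \<sigma> * ht y x} \<subseteq> halfspace b \<sigma> v"
        proof
          fix x assume "x \<in> {x \<in> V. 0 \<le> \<sigma> * ht y x}"
          then show "x \<in> halfspace b \<sigma> v" using ht_add[OF v yV(1), of x] yV(2) t by (simp add: halfspace_def distrib_left)
        qed
        have "linked (S \<union> T) (halfspace b \<sigma> v) y u" using y(4) by (rule linked_mono) (use sub in auto)
        then have "linked (S \<union> T) (halfspace b \<sigma> v) v u" by (rule linked_trans[OF vy])
        then show "reaches b \<sigma> ?h v (S \<union> T)" unfolding reaches_def using y(2,3) by (intro bexI[of _ u]) auto
      qed
      finally show ?thesis using True by simp
    qed (use Pr_nonneg[OF p] in simp)
  qed
  also have "\<dots> = Pr p (H1 \<union> H2) (reaches b \<sigma> ?h v)"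
    unfolding Pr_def using H by (intro Eb_Un[symmetric])
  also have "\<dots> \<le> reach_prob p b \<sigma> ?h"
    unfolding PP_reaches[OF v p, symmetric] using H p by (intro PP_upper) auto
  finally show ?thesis by simp
qed

text \<open>The constant \<open>c\<close> of \<open>Pr_Reach\<close> when the mean offspring is
  \<open>4 * \<kappa>\<close>.\<close>

definition fluctuation_const :: "real \<Rightarrow> nat \<Rightarrow> real" where
  "fluctuation_const \<kappa> \<rho> = 4 * real (ball_card \<rho> * ball_card (2 * \<rho>)) / (4 * \<kappa>)\<^sup>2"

lemma ball_card_pos: "0 < ball_card n"
  unfolding ball_card_def using gball_finite[OF r] by (metis card_gt_0_iff empty_iff gball_self)

lemma fluctuation_const_pos: "0 < \<kappa> \<Longrightarrow> 0 < fluctuation_const \<kappa> \<rho>"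
  using ball_card_pos by (simp add: fluctuation_const_def)

text \<open>A generation climbs \<open>s\<close> and shrinks the population by
  \<open>\<kappa> = q powr (- \<mu> * s)\<close>, so \<open>n\<close> points last for
  \<open>k\<close> generations with \<open>\<kappa> ^ k\<close> of order \<open>1 / n\<close>.
  Reaching height \<open>t + k * s\<close> has probability at most \<open>Q * q powr (- \<alpha> *
  t) * (\<kappa> ^ k) powr (\<alpha> / \<mu>)\<close>, hence the exponent
  \<open>\<alpha> / \<mu>\<close> of \<open>n\<close>.\<close>

lemma tail_polynomial:
  assumes p: "0 \<le> p" "p \<le> 1" and v: "v \<in> V" and s: "4 \<le> s" and t: "0 \<le> t" and \<mu>: "0 < \<mu>" and \<alpha>: "0 \<le> \<alpha>"
    and half: "q powr (- \<mu> * s) \<le> 1 / 2"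
    and \<kappa>: "\<And>y. y \<in> V \<Longrightarrow> 4 * q powr (- \<mu> * s) \<le> (\<Sum>w\<in>gball y \<rho>. offspring p \<sigma> s \<rho> y w)"
    and Q: "0 \<le> Q" "\<And>x. 0 \<le> x \<Longrightarrow> reach_prob p b \<sigma> x \<le> Q * q powr (- \<alpha> * x)"
    and n: "1 \<le> n" and F: "finite F" "F \<subseteq> E"
  shows "Pr p F (\<lambda>S. n \<le> card (layer b \<sigma> v t S)) \<le>
    2 * (2 * fluctuation_const (q powr (- \<mu> * s)) \<rho> / q powr (- \<mu> * s)) powr (\<alpha> / \<mu>) * Q * q powr (- \<alpha> * t) * real n powr (- (\<alpha> / \<mu>))"
proof -
  define \<kappa> where "\<kappa> = q powr (- \<mu> * s)"
  define c where "c = fluctuation_const \<kappa> \<rho>"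
  define \<theta> where "\<theta> = \<alpha> / \<mu>"
  have \<kappa>0: "0 < \<kappa>" using q_gt_1 by (simp add: \<kappa>_def)
  have c0: "0 < c" unfolding c_def by (rule fluctuation_const_pos[OF \<kappa>0])
  have \<theta>0: "0 \<le> \<theta>" using \<mu> \<alpha> by (simp add: \<theta>_def)
  have inv: "1 < 1 / \<kappa>" using half \<kappa>0 by (simp add: \<kappa>_def field_simps)
  define y where "y = real n / (2 * c)"
  have y0: "0 < y" using n c0 by (simp add: y_def)
  \<comment> \<open>\<open>Suc k\<close> is the least exponent at which
    \<open>(1 / \<kappa>)\<close> to that power exceeds \<open>y\<close>; then \<open>k\<close>
    generations are still affordable because the geometric sum is at most its next term. If
    \<open>y < 1\<close>, the choice \<open>k = 0\<close> has an empty sum.\<close>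
  have "\<exists>k. c * (\<Sum>i<k. (1 / \<kappa>) ^ i) \<le> real n / 2 \<and> y < (1 / \<kappa>) ^ Suc k"
  proof -
    obtain m where m: "y < (1 / \<kappa>) ^ m" using real_arch_pow[OF inv] by blast
    define l where "l = (LEAST m. y < (1 / \<kappa>) ^ m)"
    have l: "y < (1 / \<kappa>) ^ l" unfolding l_def by (rule LeastI[of _ m]) (rule m)
    show ?thesis
    proof (cases l)
      case 0
      then have "y < 1" using l by simp
      then have "y < (1 / \<kappa>) ^ Suc 0" using inv by simp
      then show ?thesis by (intro exI[of _ 0]) simp
    next
      case (Suc k)
      then have "\<not> y < (1 / \<kappa>) ^ k" using not_less_Least[of k "\<lambda>m. y < (1 / \<kappa>) ^ m"] by (simp add: l_def)
      then have "(\<Sum>i<k. (1 / \<kappa>) ^ i) \<le> y"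
        using sum_inverse_powers_le[OF \<kappa>0, of k] half by (simp add: \<kappa>_def)
      then have "c * (\<Sum>i<k. (1 / \<kappa>) ^ i) \<le> c * y" using c0 by (intro mult_left_mono) auto
      also have "c * y = real n / 2" using c0 by (simp add: y_def)
      finally show ?thesis using l Suc by blast
    qed
  qed
  then obtain k where k: "c * (\<Sum>i<k. (1 / \<kappa>) ^ i) \<le> real n / 2" "y < (1 / \<kappa>) ^ Suc k" by blast
  have "Pr p F (\<lambda>S. n \<le> card (layer b \<sigma> v t S)) \<le> 2 * reach_prob p b \<sigma> (t + real k * s)"
    using k(1) \<kappa> unfolding c_def fluctuation_const_def \<kappa>_def
    by (intro tail_bound[OF p v _ s t _ n _ F, where \<rho> = \<rho> and \<kappa> = "q powr (- \<mu> * s)"]) (use q_gt_1 in auto)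
  also have "\<dots> \<le> 2 * (Q * q powr (- \<alpha> * (t + real k * s)))"
    using t s by (intro mult_left_mono Q) auto
  also have "q powr (- \<alpha> * (t + real k * s)) = q powr (- \<alpha> * t) * (\<kappa> ^ k) powr \<theta>"
  proof -
    have "(\<kappa> ^ k) powr \<theta> = q powr (- \<mu> * s * real k * \<theta>)"
      using \<kappa>0 by (simp add: \<kappa>_def powr_realpow[symmetric] powr_powr)
    also have "- \<mu> * s * real k * \<theta> = - \<alpha> * (real k * s)" using \<mu> by (simp add: \<theta>_def)
    finally show ?thesis by (simp add: powr_add[symmetric] algebra_simps)
  qed
  also have "(\<kappa> ^ k) powr \<theta> \<le> (1 / (\<kappa> * y)) powr \<theta>"
  proof (rule powr_mono2[OF \<theta>0])
    show "\<kappa> ^ k \<le> 1 / (\<kappa> * y)"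
      using k(2) \<kappa>0 y0 by (simp add: field_simps power_divide)
  qed (use \<kappa>0 in auto)
  also have "(1 / (\<kappa> * y)) powr \<theta> = (2 * c / \<kappa>) powr \<theta> * real n powr (- \<theta>)"
  proof -
    have "1 / (\<kappa> * y) = (2 * c / \<kappa>) * (1 / real n)" using c0 by (simp add: y_def)
    then show ?thesis using \<kappa>0 c0 n by (simp add: powr_mult powr_minus_divide powr_divide)
  qed
  finally show ?thesis
    using Q(1) by (simp add: \<kappa>_def c_def \<theta>_def mult_left_mono mult_right_mono mult_ac)
qed

section \<open>The rates of upward and downward connections\<close>

text \<open>The constant factors of \<open>parent_prob_lower\<close> are absorbed by half of
  \<open>\<epsilon>\<close> once \<open>x\<close> is large.\<close>

lemma parent_prob_sharp:
  assumes p: "0 < p" "p \<le> 1" and \<sigma>: "\<sigma> = 1 \<or> \<sigma> = -1" and \<beta>: "0 \<le> \<beta>" and \<epsilon>: "0 < \<epsilon>"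
    and sharp: "\<And>\<epsilon> M. 0 < \<epsilon> \<Longrightarrow> \<exists>x. M \<le> x \<and> 0 < x \<and> q powr (- (\<beta> + \<epsilon>) * x) \<le> reach_prob p True (- \<sigma>) x"
  shows "\<exists>s \<rho>. M \<le> s \<and> 4 \<le> s \<and> q powr (- (\<beta> + \<epsilon>) * s) < parent_prob p \<sigma> s \<rho> r"
proof -
  obtain X0 where X0: "0 < X0" "\<And>s. X0 \<le> s \<Longrightarrow> 4 / p\<^sup>2 \<le> q powr (\<epsilon> / 2 * s)"
    using powr_eventually_ge[of q "\<epsilon> / 2" "4 / p\<^sup>2"] q_gt_1 \<epsilon> by auto
  obtain x where x: "max M X0 \<le> x" "0 < x" "q powr (- (\<beta> + \<epsilon> / 2) * x) \<le> reach_prob p True (- \<sigma>) x"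
    using sharp[of "\<epsilon> / 2" "max M X0"] \<epsilon> by auto
  have A: "0 < reach_prob p True (- \<sigma>) x" using p \<sigma> by (intro reach_prob_pos) auto
  have "p\<^sup>2 * reach_prob p True (- \<sigma>) x / 2 < p\<^sup>2 * reach_prob p True (- \<sigma>) x" using A p by simp
  then obtain \<rho> s where s: "s = x + 4 \<or> s = x + 5" "p\<^sup>2 * reach_prob p True (- \<sigma>) x / 2 / 2 < parent_prob p \<sigma> s \<rho> r"
    using parent_prob_lower[OF p \<sigma> x(2)] by blast
  have "q powr (- (\<beta> + \<epsilon>) * s) \<le> q powr (- (\<beta> + \<epsilon>) * x)" using s(1) \<beta> \<epsilon> q_gt_1 by auto
  also have "\<dots> = q powr (- (\<beta> + \<epsilon> / 2) * x) / q powr (\<epsilon> / 2 * x)"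
    using q_gt_1 by (simp add: powr_diff[symmetric] algebra_simps)
  also have "\<dots> \<le> q powr (- (\<beta> + \<epsilon> / 2) * x) / (4 / p\<^sup>2)"
    using X0(2)[of x] x p q_gt_1 by (intro divide_left_mono) auto
  also have "\<dots> \<le> reach_prob p True (- \<sigma>) x / (4 / p\<^sup>2)" using x(3) p by (intro divide_right_mono) auto
  also have "\<dots> = p\<^sup>2 * reach_prob p True (- \<sigma>) x / 2 / 2" by simp
  also have "\<dots> < parent_prob p \<sigma> s \<rho> r" by (rule s(2))
  finally have "q powr (- (\<beta> + \<epsilon>) * s) < parent_prob p \<sigma> s \<rho> r" .
  moreover have "M \<le> s" "4 \<le> s" using s(1) x by auto
  ultimately show ?thesis by blast
qed

text \<open>If downward connections decayed faster than \<open>q powr (-(\<alpha> - 1) x)\<close>, large sets would descend so far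
  that the number of points reached at a given depth has bounded normalized mean, contradicting the lower bound
  on this mean coming from mass transport.\<close>

lemma downward_rate_le:
  assumes p: "0 < p" "p \<le> 1" and \<alpha>: "1 \<le> \<alpha>"
    and sharp: "\<And>\<epsilon> M. 0 < \<epsilon> \<Longrightarrow> \<exists>x. M \<le> x \<and> 0 < x \<and> q powr (- (\<alpha> + \<epsilon>) * x) \<le> reach_prob p True 1 x"
    and \<beta>: "\<And>x. 0 < x \<Longrightarrow> reach_prob p True (-1) x \<le> q powr (- \<beta> * x)"
  shows "\<beta> \<le> \<alpha> - 1"
proof (rule ccontr)
  assume "\<not> \<beta> \<le> \<alpha> - 1"
  define \<epsilon> where "\<epsilon> = (\<beta> - (\<alpha> - 1)) / 3"
  have \<epsilon>: "0 < \<epsilon>" "\<beta> = \<alpha> - 1 + 3 * \<epsilon>" using \<open>\<not> \<beta> \<le> \<alpha> - 1\<close> by (simp_all add: \<epsilon>_def field_simps)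
  have p': "0 \<le> p" using p by simp
  \<comment> \<open>A downward bridge of length \<open>s\<close> has mean offspring about
    \<open>q powr (s - (\<alpha> + \<epsilon>) * s)\<close>; the second \<open>\<epsilon>\<close>
    absorbs the factor \<open>4 * q\<close>. Since \<open>\<mu>\<close> stays below
    \<open>\<beta>\<close>, the tail exponent \<open>\<theta>\<close> exceeds 1.\<close>
  define \<mu> where "\<mu> = \<alpha> - 1 + 2 * \<epsilon>"
  have \<mu>: "0 < \<mu>" using \<alpha> \<epsilon> by (simp add: \<mu>_def)
  define \<theta> where "\<theta> = \<beta> / \<mu>"
  have \<theta>: "1 < \<theta>" using \<epsilon> \<mu> by (simp add: \<theta>_def \<mu>_def)
  have sharp': "\<exists>x. M \<le> x \<and> 0 < x \<and> q powr (- (\<alpha> + \<epsilon>) * x) \<le> reach_prob p True (- (-1)) x" if "0 < \<epsilon>" for \<epsilon> M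
    using sharp[OF that] by simp
  obtain X1 where X1: "0 < X1" "\<And>s. X1 \<le> s \<Longrightarrow> 4 * q \<le> q powr (\<epsilon> * s)"
    using powr_eventually_ge[of q \<epsilon> "4 * q"] q_gt_1 \<epsilon> by auto
  obtain X2 where X2: "0 < X2" "\<And>s. X2 \<le> s \<Longrightarrow> 2 \<le> q powr (\<mu> * s)"
    using powr_eventually_ge[of q \<mu> 2] q_gt_1 \<mu> by auto
  obtain s \<rho> where s: "max X1 X2 \<le> s" "4 \<le> s" "q powr (- (\<alpha> + \<epsilon>) * s) < parent_prob p (-1) s \<rho> r"
    using parent_prob_sharp[OF p _ _ \<epsilon>(1) sharp', of "max X1 X2"] \<alpha> by auto
  have half: "q powr (- \<mu> * s) \<le> 1 / 2"
    using X2(2)[of s] s(1) q_gt_1 by (simp add: powr_minus divide_simps)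
  have \<kappa>: "4 * q powr (- \<mu> * s) \<le> (\<Sum>w\<in>gball y \<rho>. offspring p (-1) s \<rho> y w)" if "y \<in> V" for y
  proof -
    have "4 * q powr (- \<mu> * s) * q \<le> q powr (\<epsilon> * s) * q powr (- \<mu> * s)"
      using X1(2)[of s] s(1) q_gt_1 by (simp add: mult_right_mono mult_ac)
    also have "\<dots> = q powr (s - 1) * q * q powr (- (\<alpha> + \<epsilon>) * s)"
    proof -
      have "q powr (s - 1) * q = q powr s" using q_gt_1 by (simp add: powr_diff)
      then show ?thesis unfolding \<mu>_def by (simp add: powr_add[symmetric] algebra_simps)
    qed
    also have "\<dots> \<le> q powr (s - 1) * q * parent_prob p (-1) s \<rho> r"
      using s(3) q_gt_1 by (intro mult_left_mono) auto
    finally have "4 * q powr (- \<mu> * s) \<le> q powr (s - 1) * parent_prob p (-1) s \<rho> r"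
      using q_gt_1 by (simp add: mult.assoc mult.commute[of q] mult.left_commute[of q])
    then show ?thesis using offspring_mean[OF p' p(2) that, of "-1" s \<rho>] by simp
  qed
  have \<beta>0: "0 \<le> \<beta>" using \<alpha> \<epsilon> by simp
  have \<beta>': "reach_prob p True (-1) x \<le> 1 * q powr (- \<beta> * x)" if "0 \<le> x" for x
    using \<beta>[of x] that reach_prob_le_1[OF p' p(2)] q_gt_1 by (cases "x = 0") auto
  define C where "C = 2 * (2 * fluctuation_const (q powr (- \<mu> * s)) \<rho> / q powr (- \<mu> * s)) powr \<theta>"
  have C0: "0 \<le> C" by (simp add: C_def)
  have tail: "Pr p F (\<lambda>S. n \<le> card (layer True (-1) r t S)) \<le> C * q powr (- \<beta> * t) * real n powr (- \<theta>)"
    if "1 \<le> n" "finite F" "F \<subseteq> E" "0 \<le> t" for n F t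
    using tail_polynomial[OF p' p(2) r s(2) that(4) \<mu> \<beta>0 half \<kappa> _ \<beta>' that(1,2,3)]
    by (simp add: C_def \<theta>_def)
  \<comment> \<open>Finite since \<open>\<theta>\<close> exceeds 1, so the expected layer at depth
    \<open>t\<close> is of the same order as the bound \<open>q powr (- \<beta> * t)\<close> on the
    probability of getting there.\<close>
  define \<zeta> where "\<zeta> = (\<Sum>n. real (Suc n) powr (- \<theta>))"
  have summ: "summable (\<lambda>n. real (Suc n) powr (- \<theta>))"
    using summable_real_powr_iff[of "- \<theta>"] \<theta> by (subst summable_Suc_iff) simp
  have upper: "Eb p F (\<lambda>S. real (card (layer True (-1) r t S))) \<le> C * q powr (- \<beta> * t) * \<zeta>"
    if F: "finite F" "F \<subseteq> E" and t: "0 \<le> t" for F t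
  proof -
    define N where "N = card (insert r (\<Union>F))"
    have cardX: "card (layer True (-1) r t S) \<le> N" if "S \<subseteq> F" for S
      unfolding N_def using finite_Union_edges[OF F] layer_sub[of True "-1" r t S] that
      by (intro card_mono) auto
    have "Eb p F (\<lambda>S. real (card (layer True (-1) r t S)))
        = Eb p F (\<lambda>S. \<Sum>n<N. of_bool (Suc n \<le> card (layer True (-1) r t S)))"
    proof (rule Eb_cong)
      fix S assume S: "S \<subseteq> F"
      have "(\<Sum>n<N. of_bool (Suc n \<le> card (layer True (-1) r t S))) = (\<Sum>n\<in>{..<card (layer True (-1) r t S)}. 1 :: real)"
        using cardX[OF S] by (intro sum.mono_neutral_cong_right) auto
      then show "real (card (layer True (-1) r t S)) = (\<Sum>n<N. of_bool (Suc n \<le> card (layer True (-1) r t S)))" by simp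
    qed
    also have "\<dots> = (\<Sum>n<N. Pr p F (\<lambda>S. Suc n \<le> card (layer True (-1) r t S)))" by (simp only: Eb_sum Pr_def)
    also have "\<dots> \<le> (\<Sum>n<N. C * q powr (- \<beta> * t) * real (Suc n) powr (- \<theta>))"
      by (intro sum_mono tail F t) auto
    also have "\<dots> = C * q powr (- \<beta> * t) * (\<Sum>n<N. real (Suc n) powr (- \<theta>))" by (simp add: sum_distrib_left)
    also have "\<dots> \<le> C * q powr (- \<beta> * t) * \<zeta>"
      unfolding \<zeta>_def using C0 summ by (intro mult_left_mono sum_le_suminf) auto
    finally show ?thesis .
  qed
  \<comment> \<open>Mass transport bounds the mean number of points reached by one downward bridge
    from \<open>r\<close> from below, and every such point belongs to the layer.\<close>
  have lower: "q powr (s' - 1) * parent_prob p (-1) s' \<rho>' r \<le> C * q powr (- \<beta> * s') * \<zeta>" if s': "4 \<le> s'" for s' \<rho>'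
  proof -
    define F where "F = (\<Union>w\<in>gball r \<rho>'. ball_edges w \<rho>')"
    have F: "finite F" "F \<subseteq> E"
      unfolding F_def using gball_finite[OF r] gball_V[OF r] ball_edges_finite ball_edges_E by blast+
    have "q powr (s' - 1) * parent_prob p (-1) s' \<rho>' r \<le> Eb p F (\<lambda>S. real (card (reached (-1) s' \<rho>' {r} S)))"
      using reached_moments(1)[where p = p and Y = "{r}" and \<kappa> = "q powr (s' - 1) * parent_prob p (-1) s' \<rho>' r"
          and \<rho> = \<rho>' and \<sigma> = "-1" and s = s' and F = F]
        offspring_mean[OF p' p(2), of _ "-1" s' \<rho>'] p r F by (auto simp: F_def)
    also have "\<dots> \<le> Eb p F (\<lambda>S. real (card (layer True (-1) r s' S)))"
    proof (rule Eb_mono[OF p' p(2)])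
      fix S assume S: "S \<subseteq> F"
      have "reached (-1) s' \<rho>' {r} S \<subseteq> layer True (-1) r s' S"
      proof
        fix w assume "w \<in> reached (-1) s' \<rho>' {r} S"
        then have w: "w \<in> V" "s' \<le> -1 * ht r w" "-1 * ht r w < s' + 1" "linked S (bridge_region (-1) \<rho>' r w) r w"
          by (auto simp: reached_def bridge_def)
        have "bridge_region (-1) \<rho>' r w \<subseteq> {z \<in> halfspace True (-1) r. -1 * ht r z < s' + 1}"
        proof
          fix z assume z: "z \<in> bridge_region (-1) \<rho>' r w"
          then have zV: "z \<in> V" using bridge_region_V w(1) by blast
          show "z \<in> {z \<in> halfspace True (-1) r. -1 * ht r z < s' + 1}"
            using z zV w s' r ht_add[OF r zV w(1)] by (auto simp: bridge_region_def halfspace_def)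
        qed
        then show "w \<in> layer True (-1) r s' S" using w by (auto simp: layer_def elim!: linked_mono)
      qed
      then show "real (card (reached (-1) s' \<rho>' {r} S)) \<le> real (card (layer True (-1) r s' S))"
        using layer_finite[OF F S] by (simp add: card_mono)
    qed
    also have "\<dots> \<le> C * q powr (- \<beta> * s') * \<zeta>" using s' by (intro upper F) auto
    finally show ?thesis .
  qed
  \<comment> \<open>The exponents
    \<open>s' - 1 - (\<alpha> + \<epsilon>) * s' + \<beta> * s'\<close> add up to
    \<open>2 * \<epsilon> * s' - 1\<close>, which outgrows every constant.\<close>
  obtain X3 where X3: "0 < X3" "\<And>s. X3 \<le> s \<Longrightarrow> q * (C * \<zeta> + 1) \<le> q powr (2 * \<epsilon> * s)"
    using powr_eventually_ge[of q "2 * \<epsilon>" "q * (C * \<zeta> + 1)"] q_gt_1 \<epsilon> by auto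
  obtain s' \<rho>' where s': "X3 \<le> s'" "4 \<le> s'" "q powr (- (\<alpha> + \<epsilon>) * s') < parent_prob p (-1) s' \<rho>' r"
    using parent_prob_sharp[OF p _ _ \<epsilon>(1) sharp', of X3] \<alpha> by auto
  have "q powr (s' - 1) * q powr (- (\<alpha> + \<epsilon>) * s') \<le> C * q powr (- \<beta> * s') * \<zeta>"
  proof (rule order_trans[OF _ lower[OF s'(2), of \<rho>']])
    show "q powr (s' - 1) * q powr (- (\<alpha> + \<epsilon>) * s') \<le> q powr (s' - 1) * parent_prob p (-1) s' \<rho>' r"
      using s'(3) q_gt_1 by (intro mult_left_mono) auto
  qed
  then have "q powr (s' - 1) * q powr (- (\<alpha> + \<epsilon>) * s') * q powr (\<beta> * s') \<le> C * q powr (- \<beta> * s') * \<zeta> * q powr (\<beta> * s')"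
    using q_gt_1 by (intro mult_right_mono) auto
  moreover have "q powr (s' - 1) * q powr (- (\<alpha> + \<epsilon>) * s') * q powr (\<beta> * s') = q powr (2 * \<epsilon> * s') / q"
  proof -
    have "q powr (s' - 1) * q powr (- (\<alpha> + \<epsilon>) * s') * q powr (\<beta> * s') = q powr (2 * \<epsilon> * s' - 1)"
      unfolding powr_add[symmetric] \<epsilon>(2) by (simp add: algebra_simps)
    then show ?thesis using q_gt_1 by (simp add: powr_diff)
  qed
  moreover have "C * q powr (- \<beta> * s') * \<zeta> * q powr (\<beta> * s') = C * \<zeta>"
    using q_gt_1 by (simp add: powr_minus field_simps)
  ultimately have "q powr (2 * \<epsilon> * s') / q \<le> C * \<zeta>" by (simp only:)
  then have "q powr (2 * \<epsilon> * s') \<le> q * (C * \<zeta>)" using q_gt_1 by (simp add: pos_divide_le_eq mult.commute)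
  then show False using X3(2)[OF s'(1)] q_gt_1 by (simp add: algebra_simps)
qed

end

section \<open>Tilted susceptibilities\<close>

text \<open>Comparison with an integral, one unit interval at a time by the mean value
  theorem.\<close>

lemma sum_powr_le:
  fixes \<theta> :: real
  assumes "0 < \<theta>" "\<theta> < 1"
  shows "(\<Sum>n=1..m. real n powr (- \<theta>)) \<le> real m powr (1 - \<theta>) / (1 - \<theta>)"
proof (induction m)
  case (Suc m)
  have "(1 - \<theta>) * real (Suc m) powr (- \<theta>) \<le> real (Suc m) powr (1 - \<theta>) - real m powr (1 - \<theta>)"
  proof (cases "m = 0")
    case False
    have der: "((\<lambda>x. x powr (1 - \<theta>)) has_real_derivative (1 - \<theta>) * x powr (- \<theta>)) (at x)" if "real m \<le> x" for x
    proof -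
      have "0 < x" using that False by simp
      then show ?thesis using has_real_derivative_powr[of x "1 - \<theta>"] by simp
    qed
    obtain z where z: "real m < z" "z < real (Suc m)"
      "real (Suc m) powr (1 - \<theta>) - real m powr (1 - \<theta>) = (real (Suc m) - real m) * ((1 - \<theta>) * z powr (- \<theta>))"
      using MVT2[of "real m" "real (Suc m)" "\<lambda>x. x powr (1 - \<theta>)" "\<lambda>x. (1 - \<theta>) * x powr (- \<theta>)"] der by auto
    have "real (Suc m) powr (- \<theta>) \<le> z powr (- \<theta>)"
      using z False assms by (intro powr_mono2') auto
    then show ?thesis using z(3) assms by simp
  qed (use assms in simp)
  then have "real (Suc m) powr (- \<theta>) \<le> (real (Suc m) powr (1 - \<theta>) - real m powr (1 - \<theta>)) / (1 - \<theta>)"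
    using assms by (simp add: field_simps)
  then show ?case using Suc by (simp add: diff_divide_distrib)
qed simp

context transitive_graph
begin

lemma sum_bdd_mono: "sum_bdd g c \<Longrightarrow> (\<And>u. u \<in> V \<Longrightarrow> f u \<le> g u) \<Longrightarrow> sum_bdd f c"
  unfolding sum_bdd_def by (meson order_trans subsetD sum_mono)

lemma sum_bdd_point: "sum_bdd f c \<Longrightarrow> u \<in> V \<Longrightarrow> f u \<le> c"
  unfolding sum_bdd_def by (drule spec[of _ "{u}"]) simp

lemma sum_bdd_invariant:
  assumes f: "invariant f" and x: "x \<in> V" "y \<in> V" and s: "sum_bdd (f x) c"
  shows "sum_bdd (f y) c"
  unfolding sum_bdd_def
proof (intro allI impI)
  fix U assume U: "finite U" "U \<subseteq> V"
  obtain \<gamma> where \<gamma>: "\<gamma> \<in> \<Gamma>" "\<gamma> y = x" using \<Gamma>_trans x by blast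
  have inj: "inj_on \<gamma> U" using \<Gamma>_inj[OF \<gamma>(1)] U(2) inj_on_subset by blast
  have "sum (f y) U = (\<Sum>u\<in>U. f (\<gamma> y) (\<gamma> u))"
    using f \<gamma>(1) U x unfolding invariant_def by (intro sum.cong) auto
  also have "\<dots> = sum (f x) (\<gamma> ` U)" using inj by (simp add: sum.reindex \<gamma>)
  also have "\<dots> \<le> c" using s U \<Gamma>_V[OF \<gamma>(1)] unfolding sum_bdd_def by (metis finite_imageI image_subsetI subsetD)
  finally show "sum (f y) U \<le> c" .
qed

definition tot :: "('a \<Rightarrow> real) \<Rightarrow> real" where
  "tot f = (SUP U\<in>{U. finite U \<and> U \<subseteq> V}. sum f U)"

lemma tot_least: "sum_bdd f c \<Longrightarrow> tot f \<le> c"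
  unfolding tot_def sum_bdd_def by (rule cSUP_least) auto

lemma sum_bdd_tot: "sum_bdd f c \<Longrightarrow> sum_bdd f (tot f)"
  unfolding tot_def sum_bdd_def by (intro allI impI cSUP_upper) (auto simp: bdd_above_def)

end

context nonunimodular_graph
begin

lemma edges_V: "finite F \<Longrightarrow> F \<subseteq> E \<Longrightarrow> v \<in> V \<Longrightarrow> finite (insert v (\<Union>F)) \<and> insert v (\<Union>F) \<subseteq> V"
proof -
  assume F: "finite F" "F \<subseteq> E" and v: "v \<in> V"
  have "\<Union>F \<subseteq> V" using F(2) edge_subset by blast
  then show ?thesis using finite_Union_edges[OF F] v by simp
qed

text \<open>The total mass of a convolution is at most the product of the total masses. The middle
  point \<open>w\<close> runs over the finitely many vertices of \<open>F\<close>, so no infinite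
  sums have to be interchanged.\<close>

lemma sum_bdd_conv:
  assumes p: "0 \<le> p" "p \<le> 1" and v: "v \<in> V" and A: "\<And>u. u \<in> V \<Longrightarrow> incr (A u)"
    and le: "\<And>F u. finite F \<Longrightarrow> F \<subseteq> E \<Longrightarrow> u \<in> V \<Longrightarrow> Pr p F (A u) * c u \<le> (\<Sum>w\<in>insert v (\<Union>F). a w * b w u)"
    and a: "\<And>w. w \<in> V \<Longrightarrow> 0 \<le> a w" "sum_bdd a CA" and b: "0 \<le> CB" "\<And>w. w \<in> V \<Longrightarrow> sum_bdd (b w) CB"
  shows "sum_bdd (\<lambda>u. PP p (A u) * c u) (CA * CB)"
  unfolding sum_bdd_def
proof (intro allI impI sum_PP_le p)
  fix U F assume U: "finite U" "U \<subseteq> V" and F: "finite F" "F \<subseteq> E"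
  define W where "W = insert v (\<Union>F)"
  have W: "finite W" "W \<subseteq> V" using edges_V[OF F v] by (auto simp: W_def)
  have "(\<Sum>u\<in>U. Pr p F (A u) * c u) \<le> (\<Sum>u\<in>U. \<Sum>w\<in>W. a w * b w u)"
    using le[OF F] U by (intro sum_mono) (auto simp: W_def)
  also have "\<dots> = (\<Sum>w\<in>W. a w * (\<Sum>u\<in>U. b w u))"
    by (subst sum.swap) (simp add: sum_distrib_left)
  also have "\<dots> \<le> (\<Sum>w\<in>W. a w * CB)"
  proof (intro sum_mono mult_left_mono)
    fix w assume "w \<in> W"
    then have w: "w \<in> V" using W by blast
    show "0 \<le> a w" by (rule a(1)[OF w])
    show "(\<Sum>u\<in>U. b w u) \<le> CB" using b(2)[OF w] U by (simp add: sum_bdd_def)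
  qed
  also have "\<dots> = sum a W * CB" by (simp add: sum_distrib_right)
  also have "\<dots> \<le> CA * CB" using a(2) W by (intro mult_right_mono b(1)) (simp add: sum_bdd_def)
  finally show "(\<Sum>u\<in>U. Pr p F (A u) * c u) \<le> CA * CB" .
qed (use V_ne A in \<open>auto dest: subsetD\<close>)

section \<open>Tilted sums over ladder points\<close>

definition tilt :: "real \<Rightarrow> 'a \<Rightarrow> 'a \<Rightarrow> real" where
  "tilt l x y = q powr (l * ht x y)"

definition conn_prob :: "real \<Rightarrow> bool \<Rightarrow> 'a \<Rightarrow> 'a \<Rightarrow> real" where
  "conn_prob p b x y = PP p (\<lambda>S. linked S (halfspace b 1 x) x y)"

definition ladder_prob :: "real \<Rightarrow> bool \<Rightarrow> 'a \<Rightarrow> 'a \<Rightarrow> real" where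
  "ladder_prob p b x y = PP p (\<lambda>S. linked S {z \<in> halfspace b 1 x. ht x z \<le> ht x y} x y)"

lemma tilt_pos: "0 < tilt l x y" using q_gt_1 by (simp add: tilt_def)

lemma tilt_split: "x \<in> V \<Longrightarrow> y \<in> V \<Longrightarrow> z \<in> V \<Longrightarrow> tilt l x z = tilt l x y * tilt l y z"
  by (simp add: tilt_def ht_add[of x y z] distrib_left powr_add)

lemma tilt_\<Gamma>: "\<gamma> \<in> \<Gamma> \<Longrightarrow> x \<in> V \<Longrightarrow> y \<in> V \<Longrightarrow> tilt l (\<gamma> x) (\<gamma> y) = tilt l x y"
  by (simp add: tilt_def ht_\<Gamma>)

lemma conn_prob_nonneg: "0 \<le> p \<Longrightarrow> p \<le> 1 \<Longrightarrow> 0 \<le> conn_prob p b x y"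
  unfolding conn_prob_def by (rule PP_nonneg)

lemma ladder_prob_nonneg: "0 \<le> p \<Longrightarrow> p \<le> 1 \<Longrightarrow> 0 \<le> ladder_prob p b x y"
  unfolding ladder_prob_def by (rule PP_nonneg)

lemma ladder_prob_le_conn_prob: "0 \<le> p \<Longrightarrow> p \<le> 1 \<Longrightarrow> ladder_prob p b x y \<le> conn_prob p b x y"
  unfolding ladder_prob_def conn_prob_def by (rule PP_mono) (auto elim!: linked_mono)

lemma conn_prob_invariant: "0 \<le> p \<Longrightarrow> p \<le> 1 \<Longrightarrow> invariant (conn_prob p b)"
  unfolding conn_prob_def by (rule PP_linked_invariant) (use halfspace_V halfspace_\<Gamma> in auto)

lemma invariant_mult: "invariant f \<Longrightarrow> invariant g \<Longrightarrow> invariant (\<lambda>x y. f x y * g x y)"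
  unfolding invariant_def by simp

lemma tilt_invariant: "invariant (tilt l)"
  unfolding invariant_def by (auto simp: tilt_\<Gamma>)

lemma ladder_prob_invariant:
  assumes "0 \<le> p" "p \<le> 1"
  shows "invariant (ladder_prob p b)"
  unfolding ladder_prob_def
proof (rule PP_linked_invariant[OF assms])
  fix \<gamma> x y assume a: "\<gamma> \<in> \<Gamma>" "x \<in> V" "y \<in> V"
  have "\<gamma> ` {z \<in> V. (b \<longrightarrow> 0 \<le> 1 * ht x z) \<and> ht x z \<le> ht x y} =
      {z \<in> V. (b \<longrightarrow> 0 \<le> 1 * ht (\<gamma> x) z) \<and> ht (\<gamma> x) z \<le> ht (\<gamma> x) (\<gamma> y)}"
    using a by (intro \<Gamma>_image_Collect) (auto simp: ht_\<Gamma>)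
  then show "\<gamma> ` {z \<in> halfspace b 1 x. ht x z \<le> ht x y} = {z \<in> halfspace b 1 (\<gamma> x). ht (\<gamma> x) z \<le> ht (\<gamma> x) (\<gamma> y)}"
    by (simp add: halfspace_def conj_assoc)
qed (auto simp: halfspace_def)

definition below_prob :: "real \<Rightarrow> 'a \<Rightarrow> 'a \<Rightarrow> real" where
  "below_prob p x y = PP p (\<lambda>S. linked S {z \<in> V. ht x z \<le> 0} x y)"

lemma below_prob_invariant:
  assumes "0 \<le> p" "p \<le> 1"
  shows "invariant (below_prob p)"
  unfolding below_prob_def
proof (rule PP_linked_invariant[OF assms])
  fix \<gamma> x y assume a: "\<gamma> \<in> \<Gamma>" "x \<in> V" "y \<in> V"
  then show "\<gamma> ` {z \<in> V. ht x z \<le> 0} = {z \<in> V. ht (\<gamma> x) z \<le> 0}"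
    by (intro \<Gamma>_image_Collect) (auto simp: ht_\<Gamma>)
qed auto

lemma PP_False: "(\<And>S. S \<subseteq> E \<Longrightarrow> \<not> A S) \<Longrightarrow> PP p A \<le> 0"
proof (rule PP_least)
  fix F assume "finite F" "F \<subseteq> E" and "\<And>S. S \<subseteq> E \<Longrightarrow> \<not> A S"
  then show "Pr p F A \<le> 0" using Pr_cong[of F A "\<lambda>_. False" p] by (simp add: Pr_def Eb_def)
qed

lemma linked_endpoints: "linked S R x y \<Longrightarrow> x \<noteq> y \<Longrightarrow> x \<in> R \<and> y \<in> R"
proof -
  assume "linked S R x y" and ne: "x \<noteq> y"
  then have "(x, y) \<in> (adj {e \<in> S. e \<subseteq> R})\<^sup>*" by (simp add: linked_def)
  moreover from this obtain a where "(x, a) \<in> adj {e \<in> S. e \<subseteq> R}"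
    using ne by (cases rule: converse_rtranclE) auto
  moreover from calculation(1) obtain b where "(b, y) \<in> adj {e \<in> S. e \<subseteq> R}"
    using ne by (cases rule: rtranclE) auto
  ultimately show ?thesis by (simp add: adj_def)
qed

text \<open>Reversing a path that never rises above its start \<open>u\<close> makes
  \<open>u\<close> a ladder point seen from \<open>w\<close>. The modular factor turns the weight
  \<open>l\<close> into \<open>1 - l\<close>, which is no larger than \<open>l\<close> by
  hypothesis, and \<open>ht w u\<close> is nonnegative.\<close>

lemma below_prob_le_ladder_prob:
  assumes p: "0 \<le> p" "p \<le> 1" and l: "1 / 2 \<le> l" and u: "u \<in> V" "w \<in> V"
  shows "below_prob p u w * tilt l u w * D w u \<le> ladder_prob p False w u * tilt l w u"
proof (cases "u = w \<or> ht u w \<le> 0")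
  case True
  then have h: "0 \<le> ht w u" using ht_sym[of u w] u by auto
  have below_prob: "below_prob p u w \<le> ladder_prob p False w u"
    unfolding below_prob_def ladder_prob_def
  proof (rule PP_mono[OF p])
    fix S assume "linked S {z \<in> V. ht u z \<le> 0} u w"
    then have "linked S {z \<in> V. ht u z \<le> 0} w u" by (rule linked_sym)
    then show "linked S {z \<in> halfspace False 1 w. ht w z \<le> ht w u} w u"
      by (rule linked_mono) (use ht_add[OF u(2) u(1)] in \<open>auto simp: halfspace_def\<close>)
  qed
  have "tilt l u w * D w u = q powr ((1 - l) * ht w u)"
    using u by (simp add: tilt_def D_ht ht_sym[of w u] powr_add[symmetric] algebra_simps)
  also have "\<dots> \<le> tilt l w u"
    unfolding tilt_def powr_q_le using h l by (intro mult_right_mono) auto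
  finally have "tilt l u w * D w u \<le> tilt l w u" .
  then have "below_prob p u w * (tilt l u w * D w u) \<le> ladder_prob p False w u * tilt l w u"
    using below_prob p tilt_pos[of l u w] D_pos[OF u(2,1)] ladder_prob_nonneg by (intro mult_mono) auto
  then show ?thesis by (simp add: mult.assoc)
next
  case False
  have "below_prob p u w \<le> 0"
    unfolding below_prob_def
  proof (rule PP_False)
    fix S show "\<not> linked S {z \<in> V. ht u z \<le> 0} u w" using linked_endpoints False by fastforce
  qed
  then have "below_prob p u w = 0" using PP_nonneg[OF p] by (simp add: below_prob_def antisym)
  then show ?thesis using ladder_prob_nonneg[OF p] tilt_pos[of l w u] by simp
qed

lemma below_prob_bdd:
  assumes p: "0 \<le> p" "p \<le> 1" and l: "1 / 2 \<le> l" and w: "w \<in> V"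
    and G: "sum_bdd (\<lambda>u. ladder_prob p False w u * tilt l w u) G"
  shows "sum_bdd (\<lambda>u. below_prob p w u * tilt l w u) G"
proof (rule mass_transport)
  show "invariant (\<lambda>x y. below_prob p x y * tilt l x y)"
    by (intro invariant_mult below_prob_invariant tilt_invariant p)
  show "0 \<le> below_prob p x y * tilt l x y" for x y
    using PP_nonneg[OF p] tilt_pos[of l x y] by (simp add: below_prob_def)
  show "sum_bdd (\<lambda>u. below_prob p u w * tilt l u w * D w u) G"
    using G by (rule sum_bdd_mono) (rule below_prob_le_ladder_prob[OF p l _ w])
qed (rule w)

text \<open>A path is cut at its highest point: it first climbs to a ladder point and then stays
  below it. The second factor is bounded by a ladder sum through mass transport.\<close>

lemma conn_prob_bdd:
  assumes p: "0 \<le> p" "p \<le> 1" and l: "1 / 2 \<le> l" and v: "v \<in> V" and G0: "0 \<le> G"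
    and A: "sum_bdd (\<lambda>u. ladder_prob p b v u * tilt l v u) CA"
    and G: "\<And>w. w \<in> V \<Longrightarrow> sum_bdd (\<lambda>u. ladder_prob p False w u * tilt l w u) G"
  shows "sum_bdd (\<lambda>u. conn_prob p b v u * tilt l v u) (CA * G)"
  unfolding conn_prob_def
proof (rule sum_bdd_conv[where a = "\<lambda>w. ladder_prob p b v w * tilt l v w" and b = "\<lambda>w u. below_prob p w u * tilt l w u", OF p v])
  fix F u assume F: "finite F" "F \<subseteq> E" and u: "u \<in> V"
  define W where "W = insert v (\<Union>F)"
  have W: "finite W" "W \<subseteq> V" using edges_V[OF F v] by (auto simp: W_def)
  have "Pr p F (\<lambda>S. linked S (halfspace b 1 v) v u) \<le>
      (\<Sum>w\<in>W. Pr p F (\<lambda>S. linked S {z \<in> halfspace b 1 v. ht v z \<le> ht v w} v w) * Pr p F (\<lambda>S. linked S {z \<in> halfspace b 1 v. ht v z \<le> ht v w} w u))"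
    using W p F by (intro Pr_linked_highest) (auto simp: W_def)
  also have "\<dots> \<le> (\<Sum>w\<in>W. ladder_prob p b v w * below_prob p w u)"
  proof (rule sum_mono)
    fix w assume "w \<in> W"
    then have w: "w \<in> V" using W by auto
    have "Pr p F (\<lambda>S. linked S {z \<in> halfspace b 1 v. ht v z \<le> ht v w} v w) \<le> ladder_prob p b v w"
      unfolding ladder_prob_def using F p by (intro PP_upper)
    moreover have "Pr p F (\<lambda>S. linked S {z \<in> halfspace b 1 v. ht v z \<le> ht v w} w u) \<le> below_prob p w u"
    proof -
      have "Pr p F (\<lambda>S. linked S {z \<in> halfspace b 1 v. ht v z \<le> ht v w} w u) \<le> Pr p F (\<lambda>S. linked S {z \<in> V. ht w z \<le> 0} w u)"
        using p
      proof (rule Pr_mono)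
        fix S assume "linked S {z \<in> halfspace b 1 v. ht v z \<le> ht v w} w u"
        then show "linked S {z \<in> V. ht w z \<le> 0} w u"
          by (rule linked_mono) (use ht_add[OF v w] in \<open>auto simp: halfspace_def\<close>)
      qed
      also have "\<dots> \<le> below_prob p w u" unfolding below_prob_def using F p by (intro PP_upper)
      finally show ?thesis .
    qed
    ultimately show "Pr p F (\<lambda>S. linked S {z \<in> halfspace b 1 v. ht v z \<le> ht v w} v w) * Pr p F (\<lambda>S. linked S {z \<in> halfspace b 1 v. ht v z \<le> ht v w} w u) \<le> ladder_prob p b v w * below_prob p w u"
      using Pr_nonneg[OF p] ladder_prob_nonneg[OF p] by (intro mult_mono) auto
  qed
  finally have "Pr p F (\<lambda>S. linked S (halfspace b 1 v) v u) * tilt l v u \<le> (\<Sum>w\<in>W. ladder_prob p b v w * below_prob p w u) * tilt l v u"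
    using tilt_pos[of l v u] by (intro mult_right_mono) auto
  also have "\<dots> = (\<Sum>w\<in>W. ladder_prob p b v w * tilt l v w * (below_prob p w u * tilt l w u))"
    unfolding sum_distrib_right
  proof (rule sum.cong)
    fix w assume "w \<in> W"
    then have "w \<in> V" using W by auto
    then show "ladder_prob p b v w * below_prob p w u * tilt l v u = ladder_prob p b v w * tilt l v w * (below_prob p w u * tilt l w u)"
      using tilt_split[OF v _ u] by simp
  qed simp
  finally show "Pr p F (\<lambda>S. linked S (halfspace b 1 v) v u) * tilt l v u \<le>
      (\<Sum>w\<in>insert v (\<Union>F). ladder_prob p b v w * tilt l v w * (below_prob p w u * tilt l w u))" by (simp add: W_def)
next
  show "0 \<le> ladder_prob p b v w * tilt l v w" for w using ladder_prob_nonneg[OF p] tilt_pos[of l v w] by simp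
  show "sum_bdd (\<lambda>u. below_prob p w u * tilt l w u) G" if "w \<in> V" for w
    by (rule below_prob_bdd[OF p l that G[OF that]])
qed (use A G0 in auto)

text \<open>Tree-graph inequality with tilts. Two endpoints at height at least \<open>t\<close> give
  the factor \<open>q powr (- 2 * l * t)\<close>. Splitting both tilts at the branching point
  produces its tilt twice; one copy is kept for the sum, the other is at most
  \<open>q powr (l * (t + 1))\<close>.\<close>

lemma layer_second_moment:
  assumes p: "0 \<le> p" "p \<le> 1" and l: "0 \<le> l" and v: "v \<in> V" and t: "0 \<le> t" and C0: "0 \<le> C"
    and C: "\<And>w. w \<in> V \<Longrightarrow> sum_bdd (\<lambda>u. conn_prob p False w u * tilt l w u) C"
    and F: "finite F" "F \<subseteq> E"
  shows "Eb p F (\<lambda>S. (real (card (layer b 1 v t S)))\<^sup>2) \<le> q powr (l - l * t) * C ^ 3"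
proof -
  define W where "W = insert v (\<Union>F)"
  have W: "finite W" "W \<subseteq> V" using edges_V[OF F v] by (auto simp: W_def)
  define R where "R = {z \<in> halfspace b 1 v. 1 * ht v z < t + 1}"
  have RV: "R \<subseteq> halfspace False 1 x" for x by (auto simp: R_def halfspace_def)
  define g where "g x y = conn_prob p False x y * tilt l x y" for x y
  have g0: "0 \<le> g x y" for x y using conn_prob_nonneg[OF p] tilt_pos[of l x y] by (simp add: g_def)
  have gC: "sum (g w) W \<le> C" if "w \<in> V" for w using C[OF that] W by (auto simp: sum_bdd_def g_def)
  define K where "K = q powr (- 2 * l * t) * q powr (l * (t + 1))"
  have K0: "0 \<le> K" by (simp add: K_def)
  have two: "Pr p F (\<lambda>S. u \<in> layer b 1 v t S \<and> u' \<in> layer b 1 v t S) \<le> (\<Sum>w\<in>W. K * (g v w * (g w u * g w u')))"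
    if u: "u \<in> W" "u' \<in> W" for u u'
  proof (cases "t \<le> ht v u \<and> t \<le> ht v u'")
    case True
    define W' where "W' = {w \<in> W. w \<in> R \<or> w = v}"
    have uV: "u \<in> V" "u' \<in> V" using u W by auto
    have "Pr p F (\<lambda>S. u \<in> layer b 1 v t S \<and> u' \<in> layer b 1 v t S) \<le> Pr p F (\<lambda>S. linked S R v u \<and> linked S R v u')"
      by (rule Pr_mono[OF p]) (auto simp: layer_def R_def)
    also have "\<dots> \<le> (\<Sum>w\<in>W'. Pr p F (\<lambda>S. linked S R v w) * (Pr p F (\<lambda>S. linked S R w u) * Pr p F (\<lambda>S. linked S R w u')))"
      using Pr_tree_graph[OF F(1) p W(1), of v R u u'] by (simp add: W'_def W_def)
    also have "\<dots> \<le> (\<Sum>w\<in>W'. K * (g v w * (g w u * g w u')))"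
    proof (rule sum_mono)
      fix w assume w: "w \<in> W'"
      then have wV: "w \<in> V" using W by (auto simp: W'_def)
      have le: "Pr p F (\<lambda>S. linked S R x y) \<le> conn_prob p False x y" for x y
      proof -
        have "Pr p F (\<lambda>S. linked S R x y) \<le> Pr p F (\<lambda>S. linked S (halfspace False 1 x) x y)"
          by (rule Pr_mono[OF p]) (erule linked_mono[OF _ order_refl RV])
        also have "\<dots> \<le> conn_prob p False x y" unfolding conn_prob_def using F p by (intro PP_upper)
        finally show ?thesis .
      qed
      \<comment> \<open>The branching point inherits the ceiling imposed on the layer; without it
        the extra tilt would be unbounded.\<close>
      have hw: "ht v w \<le> t + 1" using w t v by (auto simp: W'_def R_def)
      have "1 \<le> q powr (- 2 * l * t) * (tilt l v u * tilt l v u')"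
      proof -
        have "0 \<le> l * (ht v u - t) + l * (ht v u' - t)"
          using True l by (intro add_nonneg_nonneg mult_nonneg_nonneg) auto
        then have "q powr 0 \<le> q powr (- 2 * l * t + (l * ht v u + l * ht v u'))"
          unfolding powr_q_le by (simp add: algebra_simps)
        moreover have "q powr (- 2 * l * t + (l * ht v u + l * ht v u')) = q powr (- 2 * l * t) * (tilt l v u * tilt l v u')"
          unfolding tilt_def powr_add ..
        ultimately show ?thesis using q_pos by simp
      qed
      also have "tilt l v u * tilt l v u' = tilt l v w * (tilt l v w * (tilt l w u * tilt l w u'))"
        using tilt_split[OF v wV uV(1)] tilt_split[OF v wV uV(2)] by simp
      also have "q powr (- 2 * l * t) * \<dots> \<le> q powr (- 2 * l * t) * (q powr (l * (t + 1)) * (tilt l v w * (tilt l w u * tilt l w u')))"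
      proof (intro mult_left_mono mult_right_mono)
        show "tilt l v w \<le> q powr (l * (t + 1))"
          unfolding tilt_def powr_q_le using hw l by (rule mult_left_mono)
      qed (auto intro!: mult_nonneg_nonneg less_imp_le[OF tilt_pos])
      finally have one: "1 \<le> K * (tilt l v w * (tilt l w u * tilt l w u'))" by (simp add: K_def mult.assoc)
      have "Pr p F (\<lambda>S. linked S R v w) * (Pr p F (\<lambda>S. linked S R w u) * Pr p F (\<lambda>S. linked S R w u'))
          \<le> conn_prob p False v w * (conn_prob p False w u * conn_prob p False w u')"
        using le Pr_nonneg[OF p] conn_prob_nonneg[OF p] by (intro mult_mono mult_nonneg_nonneg) auto
      also have "\<dots> \<le> conn_prob p False v w * (conn_prob p False w u * conn_prob p False w u') * (K * (tilt l v w * (tilt l w u * tilt l w u')))"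
        using mult_left_mono[OF one, of "conn_prob p False v w * (conn_prob p False w u * conn_prob p False w u')"] conn_prob_nonneg[OF p] by simp
      also have "\<dots> = K * (g v w * (g w u * g w u'))" by (simp add: g_def)
      finally show "Pr p F (\<lambda>S. linked S R v w) * (Pr p F (\<lambda>S. linked S R w u) * Pr p F (\<lambda>S. linked S R w u')) \<le> K * (g v w * (g w u * g w u'))" .
    qed
    also have "\<dots> \<le> (\<Sum>w\<in>W. K * (g v w * (g w u * g w u')))"
      using W K0 g0 by (intro sum_mono2) (auto simp: W'_def)
    finally show ?thesis .
  next
    case False
    have "Pr p F (\<lambda>S. u \<in> layer b 1 v t S \<and> u' \<in> layer b 1 v t S) = Pr p F (\<lambda>S. False)"
      by (rule Pr_cong) (use False in \<open>auto simp: layer_def\<close>)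
    also have "\<dots> = 0" by (simp add: Pr_def Eb_def)
    finally show ?thesis using K0 g0 by (simp add: sum_nonneg)
  qed
  have "Eb p F (\<lambda>S. (real (card (layer b 1 v t S)))\<^sup>2) =
      Eb p F (\<lambda>S. \<Sum>u\<in>W. \<Sum>u'\<in>W. of_bool (u \<in> layer b 1 v t S \<and> u' \<in> layer b 1 v t S))"
  proof (rule Eb_cong)
    fix S assume S: "S \<subseteq> F"
    have "layer b 1 v t S \<subseteq> W" using layer_sub[of b 1 v t S] S by (auto simp: W_def)
    then have "real (card (layer b 1 v t S)) = (\<Sum>u\<in>W. of_bool (u \<in> layer b 1 v t S))"
      using W(1) by (simp add: sum.If_cases of_bool_def Int_absorb1)
    then show "(real (card (layer b 1 v t S)))\<^sup>2 = (\<Sum>u\<in>W. \<Sum>u'\<in>W. of_bool (u \<in> layer b 1 v t S \<and> u' \<in> layer b 1 v t S))"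
      by (simp add: power2_eq_square sum_product of_bool_conj)
  qed
  also have "\<dots> = (\<Sum>u\<in>W. \<Sum>u'\<in>W. Pr p F (\<lambda>S. u \<in> layer b 1 v t S \<and> u' \<in> layer b 1 v t S))"
    by (simp add: Eb_sum Pr_def)
  also have "\<dots> \<le> (\<Sum>u\<in>W. \<Sum>u'\<in>W. \<Sum>w\<in>W. K * (g v w * (g w u * g w u')))"
    by (intro sum_mono two)
  also have "\<dots> = (\<Sum>u\<in>W. \<Sum>w\<in>W. \<Sum>u'\<in>W. K * (g v w * (g w u * g w u')))"
    by (intro sum.cong sum.swap refl)
  also have "\<dots> = (\<Sum>w\<in>W. \<Sum>u\<in>W. \<Sum>u'\<in>W. K * (g v w * (g w u * g w u')))"
    by (rule sum.swap)
  also have "\<dots> = K * (\<Sum>w\<in>W. g v w * ((\<Sum>u\<in>W. g w u) * (\<Sum>u'\<in>W. g w u')))"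
    by (simp only: sum_product) (simp only: sum_distrib_left)
  also have "\<dots> \<le> K * (\<Sum>w\<in>W. g v w * (C * C))"
    using K0 g0 gC W C0 by (intro mult_left_mono sum_mono mult_mono sum_nonneg) auto
  also have "\<dots> = K * (sum (g v) W * (C * C))" by (simp add: sum_distrib_right)
  also have "\<dots> \<le> K * (C * (C * C))"
    using K0 gC[OF v] C0 by (intro mult_left_mono mult_right_mono) auto
  also have "K = q powr (l - l * t)" unfolding K_def powr_add[symmetric] by (simp add: algebra_simps)
  finally show ?thesis by (simp add: power3_eq_cube)
qed

text \<open>Ladder points are sorted by the integer part of their height. A path that does not rise
  above its endpoint stays below \<open>t + 1\<close>, so the endpoint lies in the corresponding
  layer.\<close>

lemma ladder_prob_bdd:
  assumes p: "0 \<le> p" "p \<le> 1" and l: "0 \<le> l" and v: "v \<in> V"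
    and B: "\<And>F t. finite F \<Longrightarrow> F \<subseteq> E \<Longrightarrow> Eb p F (\<lambda>S. real (card (layer b 1 v (real t) S))) \<le> B t"
    and M: "\<And>T. (\<Sum>t<T. q powr (l * (real t + 1)) * B t) \<le> M"
  shows "sum_bdd (\<lambda>u. ladder_prob p b v u * tilt l v u) M"
  unfolding sum_bdd_def ladder_prob_def
proof (intro allI impI sum_PP_le p V_ne incr_linked)
  fix U F assume U: "finite U" "U \<subseteq> V" and F: "finite F" "F \<subseteq> E"
  let ?ev = "\<lambda>u S. linked S {z \<in> halfspace b 1 v. ht v z \<le> ht v u} v u"
  let ?c = "\<lambda>t. q powr (l * (real t + 1))"
  obtain T where T: "\<And>u. u \<in> U \<Longrightarrow> nat \<lfloor>ht v u\<rfloor> < T"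
    using U(1) finite_nat_set_iff_bounded[of "(\<lambda>u. nat \<lfloor>ht v u\<rfloor>) ` U"] by auto
  have pt: "of_bool (?ev u S) * tilt l v u \<le> (\<Sum>t<T. ?c t * of_bool (u \<in> layer b 1 v (real t) S))" if u: "u \<in> U" for u S
  proof (cases "?ev u S")
    case True
    have uV: "u \<in> V" using u U by auto
    have h: "0 \<le> ht v u"
    proof (cases "u = v")
      case False
      then show ?thesis using linked_endpoints[OF True] v by auto
    qed (use v in simp)
    define t where "t = nat \<lfloor>ht v u\<rfloor>"
    have t: "real t \<le> ht v u" "ht v u < real t + 1" using h by (auto simp: t_def)
    have "u \<in> layer b 1 v (real t) S"
      unfolding layer_def using t uV True by (auto elim!: linked_mono)
    moreover have "tilt l v u \<le> ?c t" unfolding tilt_def powr_q_le using t l by (intro mult_left_mono) auto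
    ultimately have "of_bool (?ev u S) * tilt l v u \<le> ?c t * of_bool (u \<in> layer b 1 v (real t) S)" using True by simp
    also have "\<dots> \<le> (\<Sum>t<T. ?c t * of_bool (u \<in> layer b 1 v (real t) S))"
      using T[OF u] by (intro member_le_sum) (auto simp: t_def)
    finally show ?thesis .
  qed (auto intro!: sum_nonneg)
  have "(\<Sum>u\<in>U. Pr p F (?ev u) * tilt l v u) = Eb p F (\<lambda>S. \<Sum>u\<in>U. of_bool (?ev u S) * tilt l v u)"
    by (simp add: Eb_sum Pr_def Eb_cmult_right)
  also have "\<dots> \<le> Eb p F (\<lambda>S. \<Sum>t<T. ?c t * real (card (layer b 1 v (real t) S)))"
  proof (rule Eb_mono[OF p])
    fix S assume S: "S \<subseteq> F"
    have "(\<Sum>u\<in>U. of_bool (?ev u S) * tilt l v u) \<le> (\<Sum>u\<in>U. \<Sum>t<T. ?c t * of_bool (u \<in> layer b 1 v (real t) S))"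
      by (intro sum_mono pt)
    also have "\<dots> = (\<Sum>t<T. ?c t * (\<Sum>u\<in>U. of_bool (u \<in> layer b 1 v (real t) S)))"
      by (subst sum.swap) (simp add: sum_distrib_left)
    also have "\<dots> \<le> (\<Sum>t<T. ?c t * real (card (layer b 1 v (real t) S)))"
    proof (intro sum_mono mult_left_mono)
      fix t
      have "(\<Sum>u\<in>U. of_bool (u \<in> layer b 1 v (real t) S)) = real (card (U \<inter> layer b 1 v (real t) S))"
        using U(1) by (simp add: of_bool_def sum.If_cases)
      also have "\<dots> \<le> real (card (layer b 1 v (real t) S))"
        using layer_finite[OF F S] by (simp add: card_mono)
      finally show "(\<Sum>u\<in>U. of_bool (u \<in> layer b 1 v (real t) S)) \<le> real (card (layer b 1 v (real t) S))" .
    qed auto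
    finally show "(\<Sum>u\<in>U. of_bool (?ev u S) * tilt l v u) \<le> (\<Sum>t<T. ?c t * real (card (layer b 1 v (real t) S)))" .
  qed
  also have "\<dots> = (\<Sum>t<T. ?c t * Eb p F (\<lambda>S. real (card (layer b 1 v (real t) S))))"
    by (simp add: Eb_sum Eb_cmult)
  also have "\<dots> \<le> (\<Sum>t<T. ?c t * B t)" using B[OF F] by (intro sum_mono mult_left_mono) auto
  also have "\<dots> \<le> M" by (rule M)
  finally show "(\<Sum>u\<in>U. Pr p F (?ev u) * tilt l v u) \<le> M" .
qed

end

section \<open>A priori bounds up to the threshold\<close>

text \<open>Take \<open>k\<close> near \<open>y\<close>, where
  \<open>G = q powr (2 * (1 + a) * y)\<close>. Then \<open>(q powr a) ^ k\<close> is at most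
  \<open>G powr (1 - \<gamma>)\<close>, and \<open>q powr (- 2 * l * real k)\<close> is of order
  \<open>G powr (- \<gamma>)\<close>. After the two losses \<open>G powr (\<gamma> / 4)\<close>, the
  right side is of order \<open>G powr (1 - \<gamma> / 2)\<close>, a power below 1.\<close>

lemma self_improving_bound:
  fixes G :: real
  assumes G: "1 \<le> G" and q: "1 < q" and l: "0 < l" "l \<le> 1" and a: "1 \<le> a" and C: "1 \<le> C"
    and \<gamma>: "\<gamma> = l / (1 + a)"
    and H: "\<And>k. G \<le> C * (((q powr a) ^ k + C * G powr (1 + \<gamma> / 4) * q powr (- 2 * l * real k)) * G powr (\<gamma> / 4) + 1)"
  shows "G \<le> (C * (2 + C * q\<^sup>2)) powr (2 / \<gamma>)"
proof -
  define y where "y = log q G / (2 * (1 + a))"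
  define k where "k = nat \<lfloor>y\<rfloor>"
  have \<gamma>0: "0 < \<gamma>" "\<gamma> \<le> 1 / 2" using l a by (auto simp: \<gamma> field_simps)
  have Gq: "G = q powr (2 * (1 + a) * y)" using G q a by (simp add: y_def)
  have y0: "0 \<le> y" using G q a by (simp add: y_def)
  have k: "real k \<le> y" "y - 1 \<le> real k" using y0 by (auto simp: k_def)
  have "(q powr a) ^ k = q powr (a * real k)" using q by (simp add: powr_realpow[symmetric] powr_powr)
  also have "\<dots> \<le> q powr (a * y)" using q k a by simp
  also have "\<dots> \<le> q powr (2 * (1 + a) * y * (1 - \<gamma>))"
  proof -
    have "a * y \<le> (1 + a) * y * 1" using a y0 by (simp add: algebra_simps)
    also have "\<dots> \<le> (1 + a) * y * (2 * (1 - \<gamma>))" using \<gamma>0 a y0 by (intro mult_left_mono) auto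
    finally have "a * y \<le> 2 * (1 + a) * y * (1 - \<gamma>)" by (simp add: algebra_simps)
    then show ?thesis using q by simp
  qed
  also have "\<dots> = G powr (1 - \<gamma>)" by (simp add: Gq powr_powr)
  also have "\<dots> \<le> G powr (1 + \<gamma> / 4 - \<gamma>)" using G \<gamma>0 by (intro powr_mono) auto
  finally have 1: "(q powr a) ^ k \<le> G powr (1 + \<gamma> / 4 - \<gamma>)" .
  \<comment> \<open>Rounding \<open>y\<close> down to \<open>k\<close> costs a factor
    \<open>q powr (2 * l)\<close>, hence at most \<open>q^2\<close>.\<close>
  have "q powr (- 2 * l * real k) \<le> q powr (2 * l - 2 * l * y)"
    using q k mult_left_mono[OF k(2), of "2 * l"] l by (simp add: algebra_simps)
  also have "\<dots> = q powr (2 * l) * q powr (- 2 * l * y)" by (simp add: powr_add[symmetric])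
  also have "q powr (- 2 * l * y) = G powr (- \<gamma>)"
  proof -
    have "(1 + a) * \<gamma> = l" using a by (simp add: \<gamma>)
    then have "2 * (1 + a) * y * (- \<gamma>) = - 2 * l * y" by (simp add: algebra_simps) (metis distrib_left mult.commute mult.left_commute)
    then show ?thesis by (simp only: Gq powr_powr)
  qed
  also have "q powr (2 * l) \<le> q\<^sup>2" using powr_mono[of "2 * l" 2 q] q l by simp
  finally have "q powr (- 2 * l * real k) \<le> q\<^sup>2 * G powr (- \<gamma>)" by (simp add: mult_right_mono)
  then have "C * G powr (1 + \<gamma> / 4) * q powr (- 2 * l * real k) \<le> C * G powr (1 + \<gamma> / 4) * (q\<^sup>2 * G powr (- \<gamma>))"
    using C by (intro mult_left_mono) auto
  also have "\<dots> = C * q\<^sup>2 * (G powr (1 + \<gamma> / 4) * G powr (- \<gamma>))" by simp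
  also have "G powr (1 + \<gamma> / 4) * G powr (- \<gamma>) = G powr (1 + \<gamma> / 4 - \<gamma>)" by (simp add: powr_add[symmetric])
  finally have "(q powr a) ^ k + C * G powr (1 + \<gamma> / 4) * q powr (- 2 * l * real k) \<le> (1 + C * q\<^sup>2) * G powr (1 + \<gamma> / 4 - \<gamma>)"
    using 1 by (simp add: algebra_simps)
  then have "((q powr a) ^ k + C * G powr (1 + \<gamma> / 4) * q powr (- 2 * l * real k)) * G powr (\<gamma> / 4) \<le>
      (1 + C * q\<^sup>2) * G powr (1 + \<gamma> / 4 - \<gamma>) * G powr (\<gamma> / 4)"
    by (intro mult_right_mono) auto
  also have "\<dots> = (1 + C * q\<^sup>2) * (G powr (1 + \<gamma> / 4 - \<gamma>) * G powr (\<gamma> / 4))" by simp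
  also have "G powr (1 + \<gamma> / 4 - \<gamma>) * G powr (\<gamma> / 4) = G powr (1 - \<gamma> / 2)" by (simp add: powr_add[symmetric])
  finally have "((q powr a) ^ k + C * G powr (1 + \<gamma> / 4) * q powr (- 2 * l * real k)) * G powr (\<gamma> / 4) + 1
      \<le> (1 + C * q\<^sup>2) * G powr (1 - \<gamma> / 2) + G powr (1 - \<gamma> / 2)"
    using ge_one_powr_ge_zero[of G "1 - \<gamma> / 2"] G \<gamma>0 by simp
  then have "C * (((q powr a) ^ k + C * G powr (1 + \<gamma> / 4) * q powr (- 2 * l * real k)) * G powr (\<gamma> / 4) + 1)
      \<le> C * ((1 + C * q\<^sup>2) * G powr (1 - \<gamma> / 2) + G powr (1 - \<gamma> / 2))"
    using C by (intro mult_left_mono) auto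
  then have "G \<le> C * (2 + C * q\<^sup>2) * G powr (1 - \<gamma> / 2)" using H[of k] by (simp add: algebra_simps)
  also have "G powr (1 - \<gamma> / 2) = G / G powr (\<gamma> / 2)" using G by (simp add: powr_diff)
  finally have "G * 1 \<le> G * (C * (2 + C * q\<^sup>2) / G powr (\<gamma> / 2))" by (simp add: mult.commute)
  then have "1 \<le> C * (2 + C * q\<^sup>2) / G powr (\<gamma> / 2)" using G by (subst (asm) mult_le_cancel_left_pos) auto
  then have "G powr (\<gamma> / 2) \<le> C * (2 + C * q\<^sup>2)" using G by (simp add: le_divide_eq)
  then have "(G powr (\<gamma> / 2)) powr (2 / \<gamma>) \<le> (C * (2 + C * q\<^sup>2)) powr (2 / \<gamma>)"
    using \<gamma>0 by (intro powr_mono2) auto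
  then show ?thesis using \<gamma>0 G by (simp add: powr_powr)
qed

context nonunimodular_graph
begin

text \<open>The upward mean offspring is about \<open>q powr (- s - \<beta> * s)\<close>, which by
  \<open>\<beta> \<le> \<alpha> - 1\<close> allows \<open>\<mu>\<close> to be any number above
  \<open>\<alpha>\<close>; thus \<open>\<theta> = \<alpha> / \<mu>\<close> can be prescribed. The
  bridge length and radius are fixed at \<open>p\<close>, and continuity of a finite-volume
  probability keeps them valid nearby. This is what makes \<open>K\<close> independent of
  \<open>p'\<close>.\<close>

lemma tail_up:
  assumes p: "0 < p" "p \<le> 1" and \<alpha>: "1 \<le> \<alpha>" and \<beta>: "0 \<le> \<beta>" "\<beta> \<le> \<alpha> - 1" and \<theta>: "0 < \<theta>" "\<theta> < 1"
    and sharp: "\<And>\<epsilon> M. 0 < \<epsilon> \<Longrightarrow> \<exists>x. M \<le> x \<and> 0 < x \<and> q powr (- (\<beta> + \<epsilon>) * x) \<le> reach_prob p True (- 1) x"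
  obtains d K where "0 < d" "0 \<le> K"
    "\<And>p' b Q v t n F. 0 \<le> p' \<Longrightarrow> p' \<le> 1 \<Longrightarrow> \<bar>p' - p\<bar> < d \<Longrightarrow> 0 \<le> Q \<Longrightarrow>
      (\<And>x. 0 \<le> x \<Longrightarrow> reach_prob p' b 1 x \<le> Q * q powr (- \<alpha> * x)) \<Longrightarrow> v \<in> V \<Longrightarrow> 0 \<le> t \<Longrightarrow> 1 \<le> n \<Longrightarrow> finite F \<Longrightarrow> F \<subseteq> E \<Longrightarrow>
      Pr p' F (\<lambda>S. n \<le> card (layer b 1 v t S)) \<le> K * Q * q powr (- \<alpha> * t) * real n powr (- \<theta>)"
proof -
  define \<mu> where "\<mu> = \<alpha> / \<theta>"
  define \<epsilon> where "\<epsilon> = (\<mu> - \<alpha>) / 2"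
  have \<mu>: "\<alpha> < \<mu>" "0 < \<mu>" using \<theta> \<alpha> by (auto simp: \<mu>_def field_simps)
  have \<epsilon>: "0 < \<epsilon>" "\<mu> = \<alpha> + 2 * \<epsilon>" using \<mu> by (auto simp: \<epsilon>_def field_simps)
  obtain M where M: "0 < M" "\<And>s. M \<le> s \<Longrightarrow> 4 * q \<le> q powr (\<epsilon> * s)"
    using powr_eventually_ge[OF q_gt_1 \<epsilon>(1), of "4 * q"] by blast
  obtain s \<rho> where s: "M \<le> s" "4 \<le> s" "q powr (- (\<beta> + \<epsilon>) * s) < parent_prob p 1 s \<rho> r"
    using parent_prob_sharp[where \<sigma> = 1, OF p _ \<beta>(1) \<epsilon>(1), of M] sharp by auto
  obtain d where d: "0 < d" "\<And>p'. \<bar>p' - p\<bar> < d \<Longrightarrow> q powr (- (\<beta> + \<epsilon>) * s) < parent_prob p' 1 s \<rho> r"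
    using Pr_gt_nearby[OF s(3)[unfolded parent_prob_def]] unfolding parent_prob_def by blast
  define \<kappa> where "\<kappa> = q powr (- \<mu> * s)"
  have big: "4 * q \<le> q powr (\<epsilon> * s)" by (rule M(2)[OF s(1)])
  have half: "\<kappa> \<le> 1 / 2"
  proof -
    have "2 \<le> q powr (\<epsilon> * s)" using big q_gt_1 by linarith
    also have "\<dots> \<le> q powr (\<mu> * s)" using q_gt_1 s \<epsilon> \<alpha> by (simp add: mult_right_mono)
    finally show ?thesis using q_gt_1 by (simp add: \<kappa>_def powr_minus field_simps)
  qed
  have mean: "4 * \<kappa> \<le> (\<Sum>w\<in>gball y \<rho>. offspring p' 1 s \<rho> y w)"
    if p': "0 \<le> p'" "p' \<le> 1" "\<bar>p' - p\<bar> < d" and y: "y \<in> V" for p' y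
  proof -
    have "4 * q * q powr (- \<mu> * s) \<le> q powr (\<epsilon> * s) * q powr (- \<mu> * s)"
      using big by (rule mult_right_mono) simp
    also have "\<dots> = q powr (- (\<alpha> - 1 + \<epsilon>) * s - s)" by (simp add: powr_add[symmetric] \<epsilon>(2) algebra_simps)
    also have "\<dots> \<le> q powr (- (\<beta> + \<epsilon>) * s - s)"
      unfolding powr_q_le using mult_right_mono[OF \<beta>(2), of s] s(2) by (simp add: algebra_simps)
    also have "\<dots> = q powr (- s) * q powr (- (\<beta> + \<epsilon>) * s)" by (simp add: powr_add[symmetric])
    also have "\<dots> \<le> q powr (- s) * parent_prob p' 1 s \<rho> r" using d(2)[OF p'(3)] by (intro mult_left_mono) auto
    finally have "4 * q * \<kappa> \<le> q powr (- s) * parent_prob p' 1 s \<rho> r" by (simp add: \<kappa>_def)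
    then have "4 * \<kappa> \<le> q powr (- s) * parent_prob p' 1 s \<rho> r / q" using q_gt_1 by (simp add: field_simps)
    also have "\<dots> = q powr (- 1 * s - 1) * parent_prob p' 1 s \<rho> r" using q_gt_1 by (simp add: powr_diff)
    also have "\<dots> \<le> (\<Sum>w\<in>gball y \<rho>. offspring p' 1 s \<rho> y w)"
      using p' y by (intro offspring_mean) auto
    finally show ?thesis .
  qed
  define K where "K = 2 * (2 * fluctuation_const \<kappa> \<rho> / \<kappa>) powr (\<alpha> / \<mu>)"
  have \<theta>': "\<alpha> / \<mu> = \<theta>" using \<alpha> \<theta> by (simp add: \<mu>_def)
  show thesis
  proof (rule that[OF d(1), of K])
    show "0 \<le> K" by (simp add: K_def)
    fix p' b Q v F and t :: real and n :: nat
    assume a: "0 \<le> p'" "p' \<le> 1" "\<bar>p' - p\<bar> < d" "0 \<le> Q"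
      "\<And>x. 0 \<le> x \<Longrightarrow> reach_prob p' b 1 x \<le> Q * q powr (- \<alpha> * x)" "v \<in> V" "0 \<le> t" "1 \<le> n" "finite F" "F \<subseteq> E"
    show "Pr p' F (\<lambda>S. n \<le> card (layer b 1 v t S)) \<le> K * Q * q powr (- \<alpha> * t) * real n powr (- \<theta>)"
      using tail_polynomial[OF a(1,2,6) s(2) a(7) \<mu>(2) _ half[unfolded \<kappa>_def] mean[OF a(1,2,3), unfolded \<kappa>_def] a(4,5,8,9,10)] \<alpha>
      unfolding K_def \<kappa>_def \<theta>' by simp
  qed
qed

text \<open>The factor \<open>2 * q^2\<close> bounds the tilts across unit layers and the rounding
  of the truncation level, \<open>1 - \<theta>\<close> comes from summing \<open>n\<close> to the
  power \<open>-\<theta>\<close>, and the last factor from a geometric series over heights.\<close>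

definition ladder_const :: "real \<Rightarrow> real \<Rightarrow> real" where
  "ladder_const l \<theta> = 2 * q\<^sup>2 / ((1 - \<theta>) * (1 - q powr (- ((1 - l) / 2))))"

lemma ladder_const_ge_1:
  assumes "l < 1" "0 < \<theta>" "\<theta> < 1"
  shows "1 \<le> ladder_const l \<theta>"
proof -
  have a: "0 < 1 - q powr (- ((1 - l) / 2))" using assms q_gt_1 by (simp add: powr_minus field_simps)
  have "(1 - \<theta>) * (1 - q powr (- ((1 - l) / 2))) \<le> 1 * 1" using assms a by (intro mult_mono) auto
  moreover have "1 \<le> 2 * q\<^sup>2" using one_le_power[of q 2] q_gt_1 by linarith
  moreover have "0 < (1 - \<theta>) * (1 - q powr (- ((1 - l) / 2)))" using assms a by simp
  ultimately show ?thesis unfolding ladder_const_def by (subst le_divide_eq_1_pos) linarith+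
qed

text \<open>The number of points at height \<open>t\<close> is truncated at \<open>G ^ 7 * q powr (\<kappa> t)\<close>: below, the polynomial tail is
  summed; above, the second moment, bounded by the tree-graph inequality, is used.\<close>

lemma ladder_prob_estimate:
  assumes p: "0 \<le> p" "p \<le> 1" and l: "0 \<le> l" "l < 1" and v: "v \<in> V" and G: "1 \<le> G" and \<theta>: "0 < \<theta>" "\<theta> < 1"
    and conn_prob: "\<And>w. w \<in> V \<Longrightarrow> sum_bdd (\<lambda>u. conn_prob p False w u * tilt l w u) (G\<^sup>2)"
    and K: "0 \<le> K"
    and tail: "\<And>t n F. 0 \<le> t \<Longrightarrow> 1 \<le> n \<Longrightarrow> finite F \<Longrightarrow> F \<subseteq> E \<Longrightarrow>
      Pr p F (\<lambda>S. n \<le> card (layer b 1 v t S)) \<le> K * q powr (- t) * real n powr (- \<theta>)"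
  shows "sum_bdd (\<lambda>u. ladder_prob p b v u * tilt l v u) (ladder_const l \<theta> * (K * G powr (7 * (1 - \<theta>)) + 1))"
proof -
  \<comment> \<open>Half of \<open>1 - l\<close>, so that after tilting both the truncated part, of
    exponent \<open>l - 1 + \<kappa>\<close>, and the second-moment part, of exponent
    \<open>- \<kappa>\<close>, decay like \<open>q powr (- \<kappa> * t)\<close>.\<close>
  define \<kappa> where "\<kappa> = (1 - l) / 2"
  have \<kappa>: "0 < \<kappa>" using l by (simp add: \<kappa>_def)
  define a where "a = q powr (- \<kappa>)"
  have a: "0 < a" "a < 1" using q_gt_1 \<kappa> by (auto simp: a_def powr_minus field_simps)
  have at: "a ^ t = q powr (- \<kappa> * real t)" for t
    using q_gt_1 by (simp add: a_def powr_realpow[symmetric] powr_powr)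
  define H where "H = 2 * K / (1 - \<theta>) * G powr (7 * (1 - \<theta>))"
  have H0: "0 \<le> H" using K \<theta> by (simp add: H_def)
  define B where "B t = H * q powr (- real t + \<kappa> * real t) + q powr (l - l * real t - \<kappa> * real t)" for t :: nat
  show ?thesis
  proof (rule ladder_prob_bdd[OF p l(1) v, of b B])
    fix F t assume F: "finite F" "F \<subseteq> E"
    define z where "z = G ^ 7 * q powr (\<kappa> * real t)"
    have z1: "1 \<le> z"
    proof -
      have "1 * 1 \<le> G ^ 7 * q powr (\<kappa> * real t)"
        using G q_gt_1 \<kappa> by (intro mult_mono one_le_power ge_one_powr_ge_zero) auto
      then show ?thesis by (simp add: z_def)
    qed
    define m where "m = nat \<lceil>z\<rceil>"
    have m: "z \<le> real m" "real m \<le> 2 * z" "0 < m" using z1 by (auto simp: m_def) linarith+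
    have "real m powr (1 - \<theta>) \<le> (2 * z) powr (1 - \<theta>)" using m \<theta> by (intro powr_mono2) auto
    also have "\<dots> = 2 powr (1 - \<theta>) * (G powr (7 * (1 - \<theta>)) * q powr (\<kappa> * real t * (1 - \<theta>)))"
      using G q_gt_1 z1 by (simp add: z_def powr_mult powr_powr powr_realpow[symmetric] del: powr_numeral)
    also have "\<dots> \<le> 2 * (G powr (7 * (1 - \<theta>)) * q powr (\<kappa> * real t))"
    proof (intro mult_mono mult_left_mono)
      show "2 powr (1 - \<theta>) \<le> 2" using powr_mono[of "1 - \<theta>" 1 2] \<theta> by simp
      have "\<kappa> * real t * (1 - \<theta>) \<le> \<kappa> * real t * 1" using \<kappa> \<theta> by (intro mult_left_mono) auto
      then show "q powr (\<kappa> * real t * (1 - \<theta>)) \<le> q powr (\<kappa> * real t)" unfolding powr_q_le by simp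
    qed (auto intro!: mult_nonneg_nonneg)
    finally have mp: "real m powr (1 - \<theta>) \<le> 2 * (G powr (7 * (1 - \<theta>)) * q powr (\<kappa> * real t))" .
    have "Eb p F (\<lambda>S. real (card (layer b 1 v (real t) S))) \<le>
        (\<Sum>n=1..m. Pr p F (\<lambda>S. n \<le> card (layer b 1 v (real t) S))) + Eb p F (\<lambda>S. (real (card (layer b 1 v (real t) S)))\<^sup>2) / real m"
      by (rule Eb_le_truncated[OF F(1) p m(3)])
    also have "(\<Sum>n=1..m. Pr p F (\<lambda>S. n \<le> card (layer b 1 v (real t) S))) \<le> (\<Sum>n=1..m. K * q powr (- real t) * real n powr (- \<theta>))"
      by (intro sum_mono tail F) auto
    also have "\<dots> = K * q powr (- real t) * (\<Sum>n=1..m. real n powr (- \<theta>))" by (simp add: sum_distrib_left)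
    also have "\<dots> \<le> K * q powr (- real t) * (2 * (G powr (7 * (1 - \<theta>)) * q powr (\<kappa> * real t)) / (1 - \<theta>))"
    proof (intro mult_left_mono)
      show "(\<Sum>n=1..m. real n powr (- \<theta>)) \<le> 2 * (G powr (7 * (1 - \<theta>)) * q powr (\<kappa> * real t)) / (1 - \<theta>)"
        using sum_powr_le[OF \<theta>, of m] divide_right_mono[OF mp, of "1 - \<theta>"] \<theta> by linarith
    qed (use K in simp)
    also have "\<dots> = H * (q powr (- real t) * q powr (\<kappa> * real t))" by (simp add: H_def)
    also have "q powr (- real t) * q powr (\<kappa> * real t) = q powr (- real t + \<kappa> * real t)" by (simp only: powr_add)
    \<comment> \<open>The second moment carries \<open>(G^2)^3 = G^6\<close>; division by the
      truncation level with its \<open>G^7\<close> leaves no positive power of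
      \<open>G\<close>.\<close>
    also have "Eb p F (\<lambda>S. (real (card (layer b 1 v (real t) S)))\<^sup>2) / real m \<le> q powr (l - l * real t) * (G\<^sup>2) ^ 3 / z"
    proof (rule frac_le)
      show "Eb p F (\<lambda>S. (real (card (layer b 1 v (real t) S)))\<^sup>2) \<le> q powr (l - l * real t) * (G\<^sup>2) ^ 3"
        by (rule layer_second_moment[OF p l(1) v _ _ conn_prob F]) auto
    qed (use m z1 in auto)
    also have "\<dots> = q powr (l - l * real t) * q powr (- (\<kappa> * real t)) / G"
      using G by (simp add: z_def powr_minus field_simps power_numeral_reduce)
    also have "\<dots> \<le> q powr (l - l * real t) * q powr (- (\<kappa> * real t)) / 1"
      using G by (intro divide_left_mono) auto
    also have "\<dots> = q powr (l - l * real t - \<kappa> * real t)" by (simp add: powr_add[symmetric])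
    finally show "Eb p F (\<lambda>S. real (card (layer b 1 v (real t) S))) \<le> B t" by (simp add: B_def)
  next
    fix T
    have summand: "q powr (l * (real t + 1)) * B t = (H * q powr l + q powr (2 * l)) * a ^ t" for t
    proof -
      have "q powr (l * (real t + 1)) * q powr (- real t + \<kappa> * real t) = q powr l * q powr (- \<kappa> * real t)"
        unfolding powr_add[symmetric] by (simp add: \<kappa>_def algebra_simps) (simp add: field_simps)
      moreover have "q powr (l * (real t + 1)) * q powr (l - l * real t - \<kappa> * real t) = q powr (2 * l) * q powr (- \<kappa> * real t)"
        unfolding powr_add[symmetric] by (simp add: algebra_simps)
      ultimately show ?thesis unfolding B_def at by (simp add: algebra_simps)
    qed
    have "q powr l \<le> q\<^sup>2" "q powr (2 * l) \<le> q\<^sup>2"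
      using powr_mono[of l 2 q] powr_mono[of "2 * l" 2 q] q_gt_1 l by auto
    then have "H * q powr l + q powr (2 * l) \<le> H * q\<^sup>2 + q\<^sup>2" using H0 by (intro add_mono mult_left_mono) auto
    also have "\<dots> \<le> 2 * q\<^sup>2 / (1 - \<theta>) * (K * G powr (7 * (1 - \<theta>)) + 1)"
    proof -
      have "1 \<le> 2 / (1 - \<theta>)" using \<theta> by (simp add: field_simps)
      then have "q\<^sup>2 \<le> 2 / (1 - \<theta>) * q\<^sup>2" using mult_right_mono[of 1 "2 / (1 - \<theta>)" "q\<^sup>2"] by simp
      then show ?thesis by (simp add: H_def algebra_simps add_divide_distrib)
    qed
    finally have c: "H * q powr l + q powr (2 * l) \<le> 2 * q\<^sup>2 / (1 - \<theta>) * (K * G powr (7 * (1 - \<theta>)) + 1)" .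
    have c0: "0 \<le> H * q powr l + q powr (2 * l)" using H0 by simp
    have "(\<Sum>t<T. q powr (l * (real t + 1)) * B t) = (H * q powr l + q powr (2 * l)) * (\<Sum>t<T. a ^ t)"
      by (simp add: summand sum_distrib_left)
    also have "(\<Sum>t<T. a ^ t) \<le> 1 / (1 - a)"
      using a by (simp add: sum_gp_strict divide_right_mono)
    finally have "(\<Sum>t<T. q powr (l * (real t + 1)) * B t) \<le> (H * q powr l + q powr (2 * l)) * (1 / (1 - a))"
      using c0 by (simp add: mult_left_mono)
    also have "\<dots> \<le> 2 * q\<^sup>2 / (1 - \<theta>) * (K * G powr (7 * (1 - \<theta>)) + 1) * (1 / (1 - a))"
      using c a by (intro mult_right_mono) auto
    also have "\<dots> = ladder_const l \<theta> * (K * G powr (7 * (1 - \<theta>)) + 1)"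
      by (simp add: ladder_const_def a_def \<kappa>_def)
    finally show "(\<Sum>t<T. q powr (l * (real t + 1)) * B t) \<le> ladder_const l \<theta> * (K * G powr (7 * (1 - \<theta>)) + 1)" .
  qed
qed

section \<open>Connections that leave the half-space\<close>

definition reaches_from_depth :: "nat \<Rightarrow> 'a \<Rightarrow> real \<Rightarrow> 'a set set \<Rightarrow> bool" where
  "reaches_from_depth k v x S \<longleftrightarrow> (\<exists>u\<in>V. x \<le> ht v u \<and> linked S {z \<in> V. - 2 * real k \<le> ht v z} v u)"

lemma incr_reaches_from_depth: "incr (reaches_from_depth k v x)"
  unfolding reaches_from_depth_def by (intro incr_bex incr_conj incr_linked) (simp add: incr_def)

text \<open>Opening \<open>k\<close> edges that descend as steeply as possible.\<close>

lemma reaches_from_depth_le_reach_prob: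
  assumes p: "0 \<le> p" "p \<le> 1" and v: "v \<in> V"
  shows "p ^ k * PP p (reaches_from_depth k v x) \<le> reach_prob p True 1 x"
  using v
proof (induction k arbitrary: v)
  case 0
  have "PP p (reaches_from_depth 0 v x) \<le> PP p (reaches True 1 x v)"
    by (rule PP_mono[OF p]) (simp add: reaches_from_depth_def reaches_def halfspace_def)
  then show ?case using PP_reaches[OF 0 p, of True 1 x] by simp
next
  case (Suc k)
  obtain y where y: "{v, y} \<in> E" "-1 * ht v y = 2" using extremal_nbr[OF Suc.prems, of "-1"] by auto
  have yV: "y \<in> V" using edgeD[OF y(1)] by simp
  have h: "ht y z = 2 + ht v z" if "z \<in> V" for z
    using ht_add[OF yV Suc.prems that] ht_sym[OF Suc.prems yV] y(2) by simp
  have "p * PP p (reaches_from_depth (Suc k) v x) \<le> PP p (reaches_from_depth k y x)"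
  proof (rule PP_edge_open[OF y(1) p incr_reaches_from_depth])
    fix S assume e: "{v, y} \<in> S" and "reaches_from_depth (Suc k) v x S"
    then obtain u where u: "u \<in> V" "x \<le> ht v u" "linked S {z \<in> V. - 2 * real (Suc k) \<le> ht v z} v u"
      by (auto simp: reaches_from_depth_def)
    let ?R = "{z \<in> V. - 2 * real k \<le> ht y z}"
    have "linked S ?R v u" using u(3) by (rule linked_mono) (use h in auto)
    moreover have "linked S ?R y v"
    proof (rule linked_edge)
      show "{y, v} \<in> S" using e by (simp add: insert_commute)
    qed (use yV Suc.prems h[OF Suc.prems] in auto)
    ultimately have "linked S ?R y u" by (blast intro: linked_trans)
    moreover have "x \<le> ht y u" using h[OF u(1)] u(2) by simp
    ultimately show "reaches_from_depth k y x S" unfolding reaches_from_depth_def using u(1) by blast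
  qed
  then have "p ^ k * (p * PP p (reaches_from_depth (Suc k) v x)) \<le> p ^ k * PP p (reaches_from_depth k y x)"
    using p by (intro mult_left_mono) auto
  then show ?case using Suc.IH[OF yV] by (simp add: mult.assoc mult.left_commute)
qed

text \<open>Consider the lowest point of the path. If its depth is at most \<open>2 * k\<close>,
  opening \<open>k\<close> steepest edges reduces to the half-space. If it is deeper, the path cut
  there gives two edge-disjoint half-space connections from that point, one back to \<open>r\<close>
  and one climbing by \<open>x\<close> plus the depth; BK separates them.\<close>

lemma reach_prob_False_le:
  assumes p: "0 < p" "p \<le> 1" and \<alpha>: "1 \<le> \<alpha>" and l: "0 \<le> l"
    and reach_prob: "\<And>x. 0 \<le> x \<Longrightarrow> reach_prob p True 1 x \<le> q powr (- \<alpha> * x)"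
    and H: "sum_bdd (\<lambda>u. conn_prob p True r u * tilt l r u) H" and x: "0 \<le> x"
  shows "reach_prob p False 1 x \<le> ((1 / p) ^ k + H * q powr (- 2 * l * real k)) * q powr (- \<alpha> * x)"
proof -
  have p0: "0 \<le> p" using p by simp
  \<comment> \<open>The deep case, with the decay due to depth included. Mass transport turns the
    sum over minima \<open>w\<close> below \<open>r\<close> into a sum over points \<open>u\<close>
    above \<open>r\<close>, where \<open>D r u * q powr (- \<alpha> * ht r u)\<close> is at most 1
    as \<open>\<alpha>\<close> is at least 1. Since \<open>ht r u\<close> exceeds
    \<open>2 * k\<close>, it is also at most
    \<open>tilt l r u * q powr (- 2 * l * k)\<close>.\<close>
  define f where "f y w = conn_prob p True w y * (if 2 * real k < ht w y then q powr (- \<alpha> * ht w y) else 0)" for y w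
  have f0: "0 \<le> f y w" for y w using conn_prob_nonneg[OF p0 p(2)] by (simp add: f_def)
  have f_bdd: "sum_bdd (\<lambda>w. f r w) (H * q powr (- 2 * l * real k))"
  proof (rule mass_transport)
    show "invariant f" unfolding invariant_def f_def
      using conn_prob_invariant[OF p0 p(2), of True] by (auto simp: ht_\<Gamma> invariant_def)
    show "sum_bdd (\<lambda>u. f u r * D r u) (H * q powr (- 2 * l * real k))"
      unfolding sum_bdd_def
    proof (intro allI impI)
      fix U assume U: "finite U" "U \<subseteq> V"
      have "(\<Sum>u\<in>U. f u r * D r u) \<le> (\<Sum>u\<in>U. conn_prob p True r u * tilt l r u * q powr (- 2 * l * real k))"
      proof (rule sum_mono)
        fix u assume "u \<in> U"
        then have u: "u \<in> V" using U by auto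
        show "f u r * D r u \<le> conn_prob p True r u * tilt l r u * q powr (- 2 * l * real k)"
        proof (cases "2 * real k < ht r u")
          case True
          have "q powr (- \<alpha> * ht r u) * D r u = q powr ((1 - \<alpha>) * ht r u)"
            using u r by (simp add: D_ht powr_add[symmetric] algebra_simps)
          also have "\<dots> \<le> q powr (l * (ht r u - 2 * real k))"
          proof -
            have "(1 - \<alpha>) * ht r u \<le> 0" using \<alpha> True by (intro mult_nonpos_nonneg) auto
            also have "0 \<le> l * (ht r u - 2 * real k)" using l True by simp
            finally show ?thesis unfolding powr_q_le .
          qed
          also have "\<dots> = tilt l r u * q powr (- 2 * l * real k)"
            by (simp add: tilt_def powr_add[symmetric] algebra_simps)
          finally have "conn_prob p True r u * (q powr (- \<alpha> * ht r u) * D r u) \<le> conn_prob p True r u * (tilt l r u * q powr (- 2 * l * real k))"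
            using conn_prob_nonneg[OF p0 p(2)] by (intro mult_left_mono) auto
          then show ?thesis using True by (simp add: f_def mult.assoc)
        next
          case False
          then show ?thesis using conn_prob_nonneg[OF p0 p(2)] tilt_pos[of l r u] by (simp add: f_def)
        qed
      qed
      also have "\<dots> = (\<Sum>u\<in>U. conn_prob p True r u * tilt l r u) * q powr (- 2 * l * real k)"
        by (simp add: sum_distrib_right)
      also have "\<dots> \<le> H * q powr (- 2 * l * real k)"
        using H U by (intro mult_right_mono) (auto simp: sum_bdd_def)
      finally show "(\<Sum>u\<in>U. f u r * D r u) \<le> H * q powr (- 2 * l * real k)" .
    qed
  qed (use f0 r in auto)
  show ?thesis
    unfolding reach_prob_def
  proof (rule PP_least)
    fix F assume F: "finite F" "F \<subseteq> E"
    define W where "W = insert r (\<Union>F)"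
    have W: "finite W" "W \<subseteq> V" using edges_V[OF F r] by (auto simp: W_def)
    define W' where "W' = {w \<in> W. ht r w < - 2 * real k}"
    have W': "finite W'" "W' \<subseteq> V" using W by (auto simp: W'_def)
    let ?R = "\<lambda>w. {z \<in> V. ht r w \<le> ht r z}"
    let ?A = "\<lambda>w S. linked S (?R w) r w"
    let ?B = "\<lambda>w S. \<exists>u\<in>V. x \<le> ht r u \<and> linked S (?R w) w u"
    have incrB: "incr (?B w)" for w by (intro incr_bex incr_conj incr_linked) (simp add: incr_def)
    have "Pr p F (reaches False 1 x r) \<le> Pr p F (\<lambda>S. reaches_from_depth k r x S \<or> (\<exists>w\<in>W'. disjointly (?A w) (?B w) S))"
    proof (rule Pr_mono[OF p0 p(2)])
      fix S assume S: "S \<subseteq> F" and "reaches False 1 x r S"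
      then obtain u where u: "u \<in> V" "x \<le> ht r u" "linked S V r u" by (auto simp: reaches_def halfspace_def)
      obtain w where w: "w \<in> insert r (\<Union>S)" and
        d: "disjointly (\<lambda>S. linked S {z \<in> V. - ht r z \<le> - ht r w} r w) (\<lambda>S. linked S {z \<in> V. - ht r z \<le> - ht r w} w u) S"
        using linked_highest[OF u(3), of "\<lambda>z. - ht r z"] by blast
      have wW: "w \<in> W" using w S by (auto simp: W_def)
      show "reaches_from_depth k r x S \<or> (\<exists>w\<in>W'. disjointly (?A w) (?B w) S)"
      proof (cases "ht r w < - 2 * real k")
        case True
        from d have "disjointly (?A w) (?B w) S" using u(1,2) unfolding disjointly_def by auto
        then show ?thesis using wW True by (auto simp: W'_def)
      next
        case False
        have "linked S (?R w) r w \<and> linked S (?R w) w u" using disD[OF d incr_linked incr_linked] by simp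
        then have "linked S (?R w) r u" by (blast intro: linked_trans)
        then have "linked S {z \<in> V. - 2 * real k \<le> ht r z} r u" by (rule linked_mono) (use False in auto)
        then show ?thesis using u(1,2) unfolding reaches_from_depth_def by blast
      qed
    qed
    also have "\<dots> \<le> Pr p F (reaches_from_depth k r x) + Pr p F (\<lambda>S. \<exists>w\<in>W'. disjointly (?A w) (?B w) S)"
      by (rule Pr_or_le[OF p0 p(2)])
    also have "Pr p F (\<lambda>S. \<exists>w\<in>W'. disjointly (?A w) (?B w) S) \<le> (\<Sum>w\<in>W'. Pr p F (disjointly (?A w) (?B w)))"
      by (rule Pr_union_le[OF p0 p(2) W'(1)])
    also have "\<dots> \<le> (\<Sum>w\<in>W'. f r w * q powr (- \<alpha> * x))"
    proof (rule sum_mono)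
      fix w assume w: "w \<in> W'"
      then have wV: "w \<in> V" and hw: "ht r w < - 2 * real k" using W' by (auto simp: W'_def)
      have hh: "ht r z = ht r w + ht w z" if "z \<in> V" for z by (rule ht_add[OF r wV that])
      have hs: "ht w r = - ht r w" by (rule ht_sym[OF r wV])
      have R: "?R w = halfspace True 1 w" using hh by (auto simp: halfspace_def)
      have "Pr p F (disjointly (?A w) (?B w)) \<le> Pr p F (?A w) * Pr p F (?B w)"
        by (rule BK[OF F(1) p0 p(2) incr_linked incrB])
      also have "\<dots> \<le> conn_prob p True w r * q powr (- \<alpha> * (x + ht w r))"
      proof (rule mult_mono)
        have "Pr p F (?A w) \<le> Pr p F (\<lambda>S. linked S (halfspace True 1 w) w r)"
          unfolding R by (rule Pr_mono[OF p0 p(2)]) (rule linked_sym)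
        also have "\<dots> \<le> conn_prob p True w r" unfolding conn_prob_def by (rule PP_upper[OF F p0 p(2)])
        finally show "Pr p F (?A w) \<le> conn_prob p True w r" .
        have "Pr p F (?B w) \<le> Pr p F (reaches True 1 (x + ht w r) w)"
          unfolding R
        proof (rule Pr_mono[OF p0 p(2)])
          fix S assume "\<exists>u\<in>V. x \<le> ht r u \<and> linked S (halfspace True 1 w) w u"
          then obtain u where u: "u \<in> V" "x \<le> ht r u" "linked S (halfspace True 1 w) w u" by blast
          then show "reaches True 1 (x + ht w r) w S"
            unfolding reaches_def using hh[OF u(1)] hs by (intro bexI[of _ u]) auto
        qed
        also have "\<dots> \<le> PP p (reaches True 1 (x + ht w r) w)" by (rule PP_upper[OF F p0 p(2)])
        also have "\<dots> = reach_prob p True 1 (x + ht w r)" by (rule PP_reaches[OF wV p0 p(2)])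
        also have "\<dots> \<le> q powr (- \<alpha> * (x + ht w r))" using reach_prob x hw hs by simp
        finally show "Pr p F (?B w) \<le> q powr (- \<alpha> * (x + ht w r))" .
      qed (use conn_prob_nonneg[OF p0 p(2)] Pr_nonneg[OF p0 p(2)] in auto)
      also have "\<dots> = f r w * q powr (- \<alpha> * x)"
        using hw hs by (simp add: f_def powr_add[symmetric] algebra_simps)
      finally show "Pr p F (disjointly (?A w) (?B w)) \<le> f r w * q powr (- \<alpha> * x)" .
    qed
    also have "\<dots> = (\<Sum>w\<in>W'. f r w) * q powr (- \<alpha> * x)" by (simp add: sum_distrib_right)
    also have "\<dots> \<le> H * q powr (- 2 * l * real k) * q powr (- \<alpha> * x)"
      using f_bdd W' by (intro mult_right_mono) (auto simp: sum_bdd_def)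
    also have "Pr p F (reaches_from_depth k r x) \<le> (1 / p) ^ k * q powr (- \<alpha> * x)"
    proof -
      have "Pr p F (reaches_from_depth k r x) \<le> PP p (reaches_from_depth k r x)" by (rule PP_upper[OF F p0 p(2)])
      also have "\<dots> \<le> reach_prob p True 1 x / p ^ k" using reaches_from_depth_le_reach_prob[OF p0 p(2) r, of k x] p by (simp add: field_simps)
      also have "\<dots> \<le> q powr (- \<alpha> * x) / p ^ k" using reach_prob[OF x] p by (intro divide_right_mono) auto
      finally show ?thesis by (simp add: power_one_over)
    qed
    finally show "Pr p F (reaches False 1 x r) \<le> ((1 / p) ^ k + H * q powr (- 2 * l * real k)) * q powr (- \<alpha> * x)"
      by (simp add: algebra_simps)
  qed
qed

text \<open>Finiteness below \<open>p\<close> makes \<open>G\<close> a genuine real number, so that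
  an inequality bounding \<open>G\<close> by a smaller power of itself can be solved. The solution
  \<open>M\<close> does not involve the finite values, hence is uniform in \<open>p'\<close> and
  passes to the limit.\<close>

lemma tilted_sum_at_threshold:
  assumes p: "0 < p" "p \<le> 1" and l: "1 / 2 \<le> l" "l < 1"
    and AA1: "\<And>x. 0 < x \<Longrightarrow> reach_prob p True 1 x \<le> q powr (- x)"
    and below: "\<And>p'. 0 \<le> p' \<Longrightarrow> p' < p \<Longrightarrow> \<exists>c. sum_bdd (\<lambda>u. conn_prob p' False r u * tilt l r u) c"
  shows "\<exists>c. sum_bdd (\<lambda>u. conn_prob p False r u * tilt l r u) c"
proof -
  have p0: "0 \<le> p" using p by simp
  obtain \<alpha> where \<alpha>0: "0 \<le> \<alpha>" "\<And>x. 0 < x \<Longrightarrow> reach_prob p True 1 x \<le> q powr (- \<alpha> * x)"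
    "\<And>\<epsilon> X. 0 < \<epsilon> \<Longrightarrow> \<exists>x. X \<le> x \<and> 0 < x \<and> q powr (- (\<alpha> + \<epsilon>) * x) \<le> reach_prob p True 1 x"
    using fekete_rate[OF q_gt_1, of "reach_prob p True 1"] reach_prob_pos[OF p, of 1] reach_prob_le_1[OF p0 p(2)] reach_prob_supermult[OF p0 p(2), of 1] by auto
  obtain \<beta> where \<beta>0: "0 \<le> \<beta>" "\<And>x. 0 < x \<Longrightarrow> reach_prob p True (-1) x \<le> q powr (- \<beta> * x)"
    "\<And>\<epsilon> X. 0 < \<epsilon> \<Longrightarrow> \<exists>x. X \<le> x \<and> 0 < x \<and> q powr (- (\<beta> + \<epsilon>) * x) \<le> reach_prob p True (-1) x"
    using fekete_rate[OF q_gt_1, of "reach_prob p True (-1)"] reach_prob_pos[OF p, of "-1"] reach_prob_le_1[OF p0 p(2)] reach_prob_supermult[OF p0 p(2), of "-1"] by auto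
  have \<alpha>1: "1 \<le> \<alpha>"
  proof (rule ccontr)
    assume "\<not> 1 \<le> \<alpha>"
    then obtain x where x: "0 < x" "q powr (- (\<alpha> + (1 - \<alpha>) / 2) * x) \<le> reach_prob p True 1 x"
      using \<alpha>0(3)[of "(1 - \<alpha>) / 2" 1] by auto
    then have "q powr (- (\<alpha> + (1 - \<alpha>) / 2) * x) \<le> q powr (- x)" using AA1[OF x(1)] by linarith
    then have "x \<le> (\<alpha> + (1 - \<alpha>) / 2) * x" unfolding powr_q_le by linarith
    then have "1 \<le> \<alpha> + (1 - \<alpha>) / 2" using x(1) by simp
    then show False using \<open>\<not> 1 \<le> \<alpha>\<close> by (simp add: field_simps)
  qed
  have \<beta>\<alpha>: "\<beta> \<le> \<alpha> - 1" by (rule downward_rate_le[OF p \<alpha>1 \<alpha>0(3) \<beta>0(2)])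
  have reach_prob\<alpha>: "reach_prob p True 1 x \<le> q powr (- \<alpha> * x)" if "0 \<le> x" for x
    using \<alpha>0(2)[of x] that reach_prob_le_1[OF p0 p(2), of True 1 0] q_gt_1 by (cases "x = 0") auto
  \<comment> \<open>The 2 leaves room for every parameter above \<open>p / 2\<close>: there
    \<open>1 / p'\<close> is still at most \<open>q powr a\<close>.\<close>
  define a where "a = max 1 (log q (2 / p))"
  have a: "1 \<le> a" "2 / p \<le> q powr a"
  proof -
    have "2 / p = q powr (log q (2 / p))" using p q_gt_1 by simp
    also have "\<dots> \<le> q powr a" unfolding powr_q_le by (simp add: a_def)
    finally show "2 / p \<le> q powr a" .
  qed (simp add: a_def)
  define \<gamma> where "\<gamma> = l / (1 + a)"
  have \<gamma>: "0 < \<gamma>" "\<gamma> < 1" using l a by (auto simp: \<gamma>_def)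
  \<comment> \<open>Chosen so that the truncation loss \<open>G powr (7 * (1 - \<theta>))\<close>
    equals \<open>G powr (\<gamma> / 4)\<close>.\<close>
  define \<theta> where "\<theta> = 1 - \<gamma> / 28"
  have \<theta>: "0 < \<theta>" "\<theta> < 1" "7 * (1 - \<theta>) = \<gamma> / 4" using \<gamma> by (auto simp: \<theta>_def)
  obtain d K where d: "0 < d" and K: "0 \<le> K" and tail:
    "\<And>p' b Q v t n F. 0 \<le> p' \<Longrightarrow> p' \<le> 1 \<Longrightarrow> \<bar>p' - p\<bar> < d \<Longrightarrow> 0 \<le> Q \<Longrightarrow>
      (\<And>x. 0 \<le> x \<Longrightarrow> reach_prob p' b 1 x \<le> Q * q powr (- \<alpha> * x)) \<Longrightarrow> v \<in> V \<Longrightarrow> 0 \<le> t \<Longrightarrow> 1 \<le> n \<Longrightarrow> finite F \<Longrightarrow> F \<subseteq> E \<Longrightarrow>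
      Pr p' F (\<lambda>S. n \<le> card (layer b 1 v t S)) \<le> K * Q * q powr (- \<alpha> * t) * real n powr (- \<theta>)"
    using tail_up[OF p \<alpha>1 \<beta>0(1) \<beta>\<alpha> \<theta>(1,2) \<beta>0(3)] by blast
  define C where "C = ladder_const l \<theta> * (K + 1)"
  have EC1: "1 \<le> ladder_const l \<theta>" using l \<theta> by (intro ladder_const_ge_1)
  have C1: "1 \<le> C" using mult_mono[OF EC1, of 1 "K + 1"] K EC1 by (simp add: C_def)
  define M where "M = (C * (2 + C * q\<^sup>2)) powr (2 / \<gamma>)"
  have main: "sum_bdd (\<lambda>u. conn_prob p' False r u * tilt l r u) (M * M)"
    if p': "0 \<le> p'" "p' < p" "p - d < p'" "p / 2 < p'" for p'
  proof -
    have p'1: "p' \<le> 1" "0 < p'" "\<bar>p' - p\<bar> < d" using p' p by auto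
    define g where "g x y = ladder_prob p' False x y * tilt l x y" for x y
    define G where "G = tot (g r)"
    obtain c where c: "sum_bdd (\<lambda>u. conn_prob p' False r u * tilt l r u) c" using below[OF p'(1,2)] by blast
    have "sum_bdd (g r) c"
      using c by (rule sum_bdd_mono) (use ladder_prob_le_conn_prob[OF p'(1) p'1(1)] tilt_pos less_imp_le in \<open>auto simp: g_def intro!: mult_right_mono\<close>)
    then have Gr: "sum_bdd (g r) G" unfolding G_def by (rule sum_bdd_tot)
    have ginv: "invariant g" unfolding g_def by (intro invariant_mult ladder_prob_invariant tilt_invariant p'(1) p'1(1))
    have G: "sum_bdd (\<lambda>u. ladder_prob p' False w u * tilt l w u) G" if w: "w \<in> V" for w
      using sum_bdd_invariant[OF ginv r w Gr] by (simp add: g_def)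
    have "1 \<le> g r r"
    proof -
      have "1 \<le> ladder_prob p' False r r"
        unfolding ladder_prob_def using PP_upper[of "{}" p' "\<lambda>S. linked S {z \<in> halfspace False 1 r. ht r z \<le> ht r r} r r"] p'(1) p'1(1)
        by (simp add: Pr_def)
      then show ?thesis using r by (simp add: g_def tilt_def q_pos[THEN less_imp_neq, symmetric])
    qed
    then have G1: "1 \<le> G" using sum_bdd_point[OF Gr r] by linarith
    have al2: "sum_bdd (\<lambda>u. conn_prob p' False w u * tilt l w u) (G\<^sup>2)" if w: "w \<in> V" for w
      using conn_prob_bdd[OF p'(1) p'1(1) l(1) w _ G[OF w] G] G1 by (simp add: power2_eq_square)
    \<comment> \<open>By monotonicity in the parameter, the exponent \<open>\<alpha>\<close> of
      \<open>p\<close> serves all smaller parameters; the exponents of \<open>p'\<close> itself are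
      never considered.\<close>
    have AA': "reach_prob p' True 1 x \<le> q powr (- \<alpha> * x)" if "0 \<le> x" for x
      using reach_prob_mono_p[OF p'(1) less_imp_le[OF p'(2)] p(2), of True 1 x] reach_prob\<alpha>[OF that] by linarith
    have ldQ: "sum_bdd (\<lambda>u. ladder_prob p' b r u * tilt l r u) (ladder_const l \<theta> * (K * Q * G powr (\<gamma> / 4) + 1))"
      if Q: "0 \<le> Q" "\<And>x. 0 \<le> x \<Longrightarrow> reach_prob p' b 1 x \<le> Q * q powr (- \<alpha> * x)" for b Q
      unfolding \<theta>(3)[symmetric]
    proof (rule ladder_prob_estimate[OF p'(1) p'1(1) _ l(2) r G1 \<theta>(1,2) al2])
      fix t :: real and n F assume a: "0 \<le> t" "1 \<le> (n::nat)" "finite F" "F \<subseteq> E"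
      have "Pr p' F (\<lambda>S. n \<le> card (layer b 1 r t S)) \<le> K * Q * q powr (- \<alpha> * t) * real n powr (- \<theta>)"
        by (rule tail[OF p'(1) p'1(1,3) Q r a])
      also have "\<dots> \<le> K * Q * q powr (- t) * real n powr (- \<theta>)"
      proof (intro mult_right_mono mult_left_mono)
        show "q powr (- \<alpha> * t) \<le> q powr (- t)" unfolding powr_q_le using mult_right_mono[OF \<alpha>1 a(1)] by simp
      qed (use K Q(1) in auto)
      finally show "Pr p' F (\<lambda>S. n \<le> card (layer b 1 r t S)) \<le> K * Q * q powr (- t) * real n powr (- \<theta>)" .
    qed (use l K Q(1) in auto)
    have G\<delta>: "1 \<le> G powr (\<gamma> / 4)" using G1 \<gamma> by (intro ge_one_powr_ge_zero) auto
    have ladder_const_le: "ladder_const l \<theta> * (K * y + 1) \<le> C * y" if "1 \<le> y" for y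
    proof -
      have "K * y + 1 \<le> (K + 1) * y" using that by (simp add: algebra_simps)
      then show ?thesis using EC1 unfolding C_def mult.assoc by (intro mult_left_mono) auto
    qed
    \<comment> \<open>In the half-space \<open>Q = 1\<close> is available. The resulting bound on
      half-space connections, of order \<open>G powr (1 + \<gamma> / 4)\<close>, enters
      \<open>reach_prob_False_le\<close> and supplies the \<open>Q\<close> for unrestricted ladder
      points.\<close>
    have half: "sum_bdd (\<lambda>u. ladder_prob p' True r u * tilt l r u) (C * G powr (\<gamma> / 4))"
    proof -
      have "sum_bdd (\<lambda>u. ladder_prob p' True r u * tilt l r u) (ladder_const l \<theta> * (K * 1 * G powr (\<gamma> / 4) + 1))"
        using AA' by (intro ldQ) auto
      then show ?thesis using ladder_const_le[OF G\<delta>] unfolding sum_bdd_def by (auto intro: order_trans)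
    qed
    have Gp: "sum_bdd (\<lambda>u. conn_prob p' True r u * tilt l r u) (C * G powr (1 + \<gamma> / 4))"
    proof -
      have "C * G powr (\<gamma> / 4) * G = C * G powr (1 + \<gamma> / 4)" using G1 by (simp add: powr_add)
      moreover have "sum_bdd (\<lambda>u. conn_prob p' True r u * tilt l r u) (C * G powr (\<gamma> / 4) * G)"
        using G1 by (intro conn_prob_bdd[OF p'(1) p'1(1) l(1) r _ half G]) auto
      ultimately show ?thesis by (simp only:)
    qed
    have "G \<le> C * (((q powr a) ^ k + C * G powr (1 + \<gamma> / 4) * q powr (- 2 * l * real k)) * G powr (\<gamma> / 4) + 1)" for k
    proof -
      define Q where "Q = (q powr a) ^ k + C * G powr (1 + \<gamma> / 4) * q powr (- 2 * l * real k)"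
      have Q0: "0 \<le> Q" using C1 by (simp add: Q_def)
      have "1 / p' \<le> 2 / p" using p' p p'1 by (simp add: field_simps)
      then have "1 / p' \<le> q powr a" using a by linarith
      then have pk: "(1 / p') ^ k \<le> (q powr a) ^ k" using p'1 by (intro power_mono) auto
      have "reach_prob p' False 1 x \<le> Q * q powr (- \<alpha> * x)" if x: "0 \<le> x" for x
      proof -
        have "reach_prob p' False 1 x \<le> ((1 / p') ^ k + C * G powr (1 + \<gamma> / 4) * q powr (- 2 * l * real k)) * q powr (- \<alpha> * x)"
          by (rule reach_prob_False_le[OF p'1(2,1) \<alpha>1 _ AA' Gp x]) (use l in auto)
        also have "\<dots> \<le> Q * q powr (- \<alpha> * x)" using pk by (intro mult_right_mono) (auto simp: Q_def)
        finally show ?thesis .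
      qed
      then have "sum_bdd (g r) (ladder_const l \<theta> * (K * Q * G powr (\<gamma> / 4) + 1))"
        unfolding g_def by (intro ldQ Q0)
      then have "G \<le> ladder_const l \<theta> * (K * Q * G powr (\<gamma> / 4) + 1)" unfolding G_def by (rule tot_least)
      also have "\<dots> \<le> ladder_const l \<theta> * ((K + 1) * (Q * G powr (\<gamma> / 4) + 1))"
        using EC1 K Q0 G1 by (intro mult_left_mono) (auto simp: algebra_simps)
      finally show ?thesis by (simp add: C_def Q_def mult.assoc)
    qed
    then have GM: "G \<le> M" unfolding M_def using l by (intro self_improving_bound[OF G1 q_gt_1 _ _ a(1) C1 \<gamma>_def]) auto
    have "G\<^sup>2 \<le> M * M" using GM G1 by (simp add: power2_eq_square mult_mono)
    then show ?thesis using al2[OF r] unfolding sum_bdd_def by (auto intro: order_trans)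
  qed
  have "sum_bdd (\<lambda>u. conn_prob p False r u * tilt l r u) (M * M)"
    unfolding sum_bdd_def conn_prob_def
  proof (intro allI impI sum_PP_le p0 p V_ne incr_linked)
    fix U F assume U: "finite U" "U \<subseteq> V" and F: "finite F" "F \<subseteq> E"
    \<comment> \<open>With \<open>U\<close> and \<open>F\<close> fixed this is continuous in the
      parameter, so the uniform bound from below reaches \<open>p\<close>.\<close>
    let ?s = "\<lambda>p. \<Sum>u\<in>U. Pr p F (\<lambda>S. linked S (halfspace False 1 r) r u) * tilt l r u"
    show "?s p \<le> M * M"
    proof (rule tendsto_upperbound)
      have "continuous_on UNIV ?s" by (intro continuous_on_sum continuous_on_mult Pr_continuous continuous_on_const)
      then have "isCont ?s p" by (simp add: continuous_on_eq_continuous_at)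
      then show "(?s \<longlongrightarrow> ?s p) (at_left p)"
        by (simp add: isCont_def filterlim_at_split)
      have "\<forall>\<^sub>F p' in at_left p. max 0 (max (p - d) (p / 2)) < p' \<and> p' < p"
        using eventually_at_left_real[of "max 0 (max (p - d) (p / 2))" p] d p by simp
      then show "\<forall>\<^sub>F p' in at_left p. ?s p' \<le> M * M"
      proof (rule eventually_mono)
        fix p' assume "max 0 (max (p - d) (p / 2)) < p' \<and> p' < p"
        then have p': "0 \<le> p'" "p' < p" "p - d < p'" "p / 2 < p'" "p' \<le> 1" using p by auto
        have "?s p' \<le> (\<Sum>u\<in>U. conn_prob p' False r u * tilt l r u)"
          unfolding conn_prob_def by (intro sum_mono mult_right_mono PP_upper F p'(1,5) less_imp_le[OF tilt_pos])
        also have "\<dots> \<le> M * M" using main[OF p'(1-4)] U by (auto simp: sum_bdd_def)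
        finally show "?s p' \<le> M * M" .
      qed
    qed simp
  qed
  then show ?thesis by blast
qed

end

section \<open>Openness of the subcritical phase\<close>

lemma Eb_0: "finite F \<Longrightarrow> Eb 0 F f = f {}"
  by (induction F rule: finite_induct) (auto simp: Eb_insert)

lemma finite_sum_close:
  fixes f :: "'b \<Rightarrow> real"
  assumes "\<And>U. finite U \<Longrightarrow> U \<subseteq> A \<Longrightarrow> sum f U \<le> c" "0 < \<epsilon>"
  obtains U0 where "finite U0" "U0 \<subseteq> A" "\<And>U. finite U \<Longrightarrow> U \<subseteq> A - U0 \<Longrightarrow> sum f U \<le> \<epsilon>"
proof -
  define T where "T = (SUP U\<in>{U. finite U \<and> U \<subseteq> A}. sum f U)"
  have bdd: "bdd_above (sum f ` {U. finite U \<and> U \<subseteq> A})"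
    using assms(1) by (auto simp: bdd_above_def)
  have "T - \<epsilon> < T" using assms(2) by simp
  then obtain U0 where U0: "finite U0" "U0 \<subseteq> A" "T - \<epsilon> < sum f U0"
    unfolding T_def by (subst (asm) less_cSUP_iff[OF _ bdd]) auto
  show thesis
  proof (rule that[OF U0(1,2)])
    fix U assume U: "finite U" "U \<subseteq> A - U0"
    have "sum f (U0 \<union> U) \<le> T" unfolding T_def by (rule cSUP_upper[OF _ bdd]) (use U U0 in auto)
    moreover have "sum f (U0 \<union> U) = sum f U0 + sum f U" using U U0 by (intro sum.union_disjoint) auto
    ultimately show "sum f U \<le> \<epsilon>" using U0(3) by linarith
  qed
qed

context nonunimodular_graph
begin

lemma conn_prob_False: "conn_prob p False x y = PP p (\<lambda>S. linked S V x y)"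
  by (simp add: conn_prob_def halfspace_def)

lemma tilted_sum_zero: "sum_bdd (\<lambda>u. conn_prob 0 False r u * tilt l r u) 1"
proof -
  have "sum_bdd (\<lambda>u. if u = r then 1 else 0) 1"
    unfolding sum_bdd_def by (auto simp: sum.delta)
  then show ?thesis
  proof (rule sum_bdd_mono)
    fix u assume u: "u \<in> V"
    show "conn_prob 0 False r u * tilt l r u \<le> (if u = r then 1 else 0)"
    proof (cases "u = r")
      case True
      then show ?thesis using r PP_le_1[of 0] q_gt_1 by (simp add: conn_prob_False tilt_def)
    next
      case False
      have "conn_prob 0 False r u \<le> 0" unfolding conn_prob_False
      proof (rule PP_least)
        fix F :: "'a set set" assume "finite F"
        have "\<not> linked {} V r u"
        proof
          assume "linked {} V r u"
          then show False using False unfolding linked_def by (cases rule: converse_rtranclE) (auto simp: adj_def)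
        qed
        then show "Pr 0 F (\<lambda>S. linked S V r u) \<le> 0" using \<open>finite F\<close> by (simp add: Pr_def Eb_0)
      qed
      then show ?thesis using False tilt_pos[of l r u] by (simp add: mult_nonpos_nonneg)
    qed
  qed
qed

text \<open>The first-exit kernel of a ball, which acts as the step kernel of the renewal inequality
  in \<open>tilted_sum_open\<close>; it is set to 0 inside the ball.\<close>

definition exit_weight :: "real \<Rightarrow> real \<Rightarrow> nat \<Rightarrow> 'a \<Rightarrow> 'a \<Rightarrow> real" where
  "exit_weight p l n x w = (if w \<in> gball x n then 0 else PP p (\<lambda>S. linked S (insert w (gball x n)) x w) * tilt l x w)"

lemma gball_\<Gamma>_iff: "\<gamma> \<in> \<Gamma> \<Longrightarrow> x \<in> V \<Longrightarrow> w \<in> V \<Longrightarrow> \<gamma> w \<in> gball (\<gamma> x) n \<longleftrightarrow> w \<in> gball x n"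
  using \<Gamma>_gball[of \<gamma> x n] \<Gamma>_inj[of \<gamma>] gball_V[of x n] by (metis image_eqI inj_on_image_mem_iff)

lemma exit_weight_invariant:
  assumes p: "0 \<le> p" "p \<le> 1"
  shows "invariant (exit_weight p l n)"
proof -
  have "invariant (\<lambda>x y. PP p (\<lambda>S. linked S (insert y (gball x n) \<inter> V) x y))"
  proof (rule PP_linked_invariant[OF p])
    fix \<gamma> x y assume a: "\<gamma> \<in> \<Gamma>" "x \<in> V" "y \<in> V"
    have V: "insert y (gball x n) \<inter> V = insert y (gball x n)" if "x \<in> V" "y \<in> V" for x y
      using gball_V[OF that(1)] that by auto
    show "\<gamma> ` (insert y (gball x n) \<inter> V) = insert (\<gamma> y) (gball (\<gamma> x) n) \<inter> V"
      unfolding V[OF a(2,3)] V[OF \<Gamma>_V[OF a(1,2)] \<Gamma>_V[OF a(1,3)]] using a by (simp add: \<Gamma>_gball)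
  qed auto
  moreover have "insert y (gball x n) \<inter> V = insert y (gball x n)" if "x \<in> V" "y \<in> V" for x y
    using gball_V[OF that(1)] that by auto
  ultimately show ?thesis
    unfolding invariant_def exit_weight_def by (auto simp: gball_\<Gamma>_iff tilt_\<Gamma> \<Gamma>_V)
qed

lemma exit_weight_far:
  assumes w: "w \<notin> gball r (Suc n)" "w \<in> V"
  shows "exit_weight p l n r w = 0"
proof -
  have 0: "Pr p F (\<lambda>S. linked S (insert w (gball r n)) r w) = 0" if F: "F \<subseteq> E" for F
  proof -
    have "Pr p F (\<lambda>S. linked S (insert w (gball r n)) r w) = Pr p F (\<lambda>S. False)"
    proof (rule Pr_cong)
      fix S assume S: "S \<subseteq> F"
      show "linked S (insert w (gball r n)) r w = False"
      proof
        assume c: "linked S (insert w (gball r n)) r w"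
        have "r \<noteq> w" using w by auto
        then obtain z where z: "{z, w} \<in> S" "z \<in> gball r n"
          using linked_last_edge[OF c] edge_card S F by blast
        have "w \<in> gball z (Suc 0)" using z(1) S F by (intro gball_edge) auto
        then have "w \<in> gball r (n + Suc 0)" by (rule gball_trans[OF z(2)])
        then show False using w by simp
      qed simp
    qed
    then show ?thesis by (simp add: Pr_def Eb_def)
  qed
  then have "PP p (\<lambda>S. linked S (insert w (gball r n)) r w) = (SUP F\<in>{F. finite F \<and> F \<subseteq> E}. 0)"
    unfolding PP_def by (intro SUP_cong) (auto simp only: 0 mem_Collect_eq)
  also have "\<dots> = 0" by (rule cSUP_const) auto
  finally show ?thesis by (simp add: exit_weight_def)
qed

text \<open>A path from \<open>x\<close> leaves a large ball through a boundary point; the tilted sum over boundary points is small,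
  and it depends continuously on \<open>p\<close> since it involves finitely many edges.\<close>

lemma tilted_sum_open:
  assumes p: "0 \<le> p" "p < 1" and bdd: "sum_bdd (\<lambda>u. conn_prob p False r u * tilt l r u) c"
  shows "\<exists>p'>p. p' \<le> 1 \<and> (\<exists>c. sum_bdd (\<lambda>u. conn_prob p' False r u * tilt l r u) c)"
proof -
  have p1: "p \<le> 1" using p by simp
  \<comment> \<open>The gap between \<open>1 / 4\<close> here and the contraction factor
    \<open>1 / 2\<close> wanted at \<open>p'\<close> is the room for continuity in the
    parameter.\<close>
  obtain U0 where U0: "finite U0" "U0 \<subseteq> V" "\<And>U. finite U \<Longrightarrow> U \<subseteq> V - U0 \<Longrightarrow> (\<Sum>u\<in>U. conn_prob p False r u * tilt l r u) \<le> 1 / 4"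
    using finite_sum_close[of V "\<lambda>u. conn_prob p False r u * tilt l r u" c "1 / 4"] bdd unfolding sum_bdd_def by auto
  obtain n where n: "U0 \<subseteq> gball r n"
  proof -
    have "U0 \<subseteq> (\<Union>n. gball r n)" using U0(2) gball_Union[OF r] by simp
    then have "\<forall>u\<in>U0. \<exists>m. u \<in> gball r m" by blast
    then obtain m where m: "\<And>u. u \<in> U0 \<Longrightarrow> u \<in> gball r (m u)" by metis
    have "U0 \<subseteq> gball r (Max (insert 0 (m ` U0)))"
    proof
      fix u assume u: "u \<in> U0"
      then have "m u \<le> Max (insert 0 (m ` U0))" using U0(1) by (intro Max_ge) auto
      then show "u \<in> gball r (Max (insert 0 (m ` U0)))" using m[OF u] gball_mono by blast
    qed
    then show thesis by (rule that)
  qed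
  define W where "W = gball r (Suc n) - gball r n"
  have W: "finite W" "W \<subseteq> V" using gball_finite[OF r] gball_V[OF r] by (auto simp: W_def)
  define F1 where "F1 = ball_edges r (Suc n)"
  have F1: "finite F1" "F1 \<subseteq> E" using ball_edges_finite[OF r] ball_edges_E by (auto simp: F1_def)
  define \<phi> where "\<phi> p = (\<Sum>w\<in>W. Pr p F1 (\<lambda>S. linked S (insert w (gball r n)) r w) * tilt l r w)" for p
  have "\<phi> p \<le> (\<Sum>w\<in>W. conn_prob p False r w * tilt l r w)"
    unfolding \<phi>_def
  proof (intro sum_mono mult_right_mono)
    fix w assume "w \<in> W"
    then have "insert w (gball r n) \<subseteq> V" using W gball_V[OF r] by auto
    then have "Pr p F1 (\<lambda>S. linked S (insert w (gball r n)) r w) \<le> Pr p F1 (\<lambda>S. linked S V r w)"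
      by (intro Pr_mono p p1) (erule linked_mono, auto)
    also have "\<dots> \<le> conn_prob p False r w" unfolding conn_prob_False by (rule PP_upper[OF F1 p(1) p1])
    finally show "Pr p F1 (\<lambda>S. linked S (insert w (gball r n)) r w) \<le> conn_prob p False r w" .
  qed (rule less_imp_le[OF tilt_pos])
  also have "\<dots> \<le> 1 / 4" using W n by (intro U0(3)) (auto simp: W_def)
  finally have "\<phi> p < 1 / 2" by simp
  moreover have "isCont \<phi> p"
  proof -
    have "continuous_on UNIV \<phi>"
      unfolding \<phi>_def by (intro continuous_on_sum continuous_on_mult Pr_continuous continuous_on_const)
    then show ?thesis by (simp add: continuous_on_eq_continuous_at)
  qed
  ultimately have "\<forall>\<^sub>F p' in at p. \<phi> p' < 1 / 2"
    unfolding isCont_def by (intro order_tendstoD(2))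
  then have "\<forall>\<^sub>F p' in at_right p. \<phi> p' < 1 / 2 \<and> p' \<in> {p<..<1}"
    using eventually_at_right_real[OF p(2)] by (intro eventually_conj) (auto simp: eventually_at_split)
  then obtain p' where p': "\<phi> p' < 1 / 2" "p < p'" "p' < 1"
    using eventually_happens'[OF trivial_limit_at_right_real] by fastforce
  have p'0: "0 \<le> p'" "p' \<le> 1" using p' p by auto
  have fe0: "0 \<le> exit_weight p' l n x w" for x w
    using PP_nonneg[OF p'0] tilt_pos[of l x w] by (simp add: exit_weight_def)
  have "sum_bdd (exit_weight p' l n r) (1 / 2)"
    unfolding sum_bdd_def
  proof (intro allI impI)
    fix U assume U: "finite U" "U \<subseteq> V"
    have "sum (exit_weight p' l n r) U = sum (exit_weight p' l n r) (U \<inter> W)"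
    proof (rule sum.mono_neutral_right)
      show "\<forall>i\<in>U - U \<inter> W. exit_weight p' l n r i = 0"
      proof
        fix i assume "i \<in> U - U \<inter> W"
        then have "i \<in> gball r n \<or> i \<notin> gball r (Suc n)" "i \<in> V" using U by (auto simp: W_def)
        then show "exit_weight p' l n r i = 0" using exit_weight_far[of i n p' l] by (cases "i \<in> gball r n") (simp_all add: exit_weight_def)
      qed
    qed (use U in auto)
    also have "\<dots> \<le> sum (exit_weight p' l n r) W" using W fe0 by (intro sum_mono2) auto
    also have "\<dots> \<le> \<phi> p'"
      unfolding \<phi>_def
    proof (rule sum_mono)
      fix w assume w: "w \<in> W"
      let ?B = "insert w (gball r n)"
      have B: "?B \<subseteq> gball r (Suc n)" using w gball_mono[of n "Suc n" r] by (auto simp: W_def)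
      have "PP p' (\<lambda>S. linked S ?B r w) \<le> Pr p' F1 (\<lambda>S. linked S ?B r w)"
      proof (rule PP_least)
        fix F assume F: "finite F" "F \<subseteq> E"
        have "Pr p' F (\<lambda>S. linked S ?B r w) = Pr p' (F \<inter> F1) (\<lambda>S. linked S ?B r w)"
          unfolding Pr_def
        proof (rule Eb_local[OF F(1)])
          fix S assume "S \<subseteq> F"
          then have "linked S ?B r w = linked (S \<inter> (F \<inter> F1)) ?B r w"
            using F B by (intro linked_cong) (auto simp: F1_def ball_edges_def)
          then show "of_bool (linked S ?B r w) = (of_bool (linked (S \<inter> (F \<inter> F1)) ?B r w) :: real)" by simp
        qed auto
        also have "\<dots> \<le> Pr p' F1 (\<lambda>S. linked S ?B r w)"
          by (rule Pr_mono_F[OF F1(1) _ p'0 incr_linked]) auto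
        finally show "Pr p' F (\<lambda>S. linked S ?B r w) \<le> Pr p' F1 (\<lambda>S. linked S ?B r w)" .
      qed
      then show "exit_weight p' l n r w \<le> Pr p' F1 (\<lambda>S. linked S ?B r w) * tilt l r w"
        using w by (simp add: exit_weight_def W_def mult_right_mono less_imp_le[OF tilt_pos])
    qed
    finally show "sum (exit_weight p' l n r) U \<le> 1 / 2" using p'(1) by simp
  qed
  then have exit_weight_half: "sum_bdd (exit_weight p' l n x) (1 / 2)" if "x \<in> V" for x
    using sum_bdd_invariant[OF exit_weight_invariant[OF p'0] r that] by blast
  define h where "h x u = (if u \<in> gball x n then tilt l x u else 0)" for x u
  define c0 where "c0 = (\<Sum>u\<in>gball r n. tilt l r u)"
  have h0: "0 \<le> h x u" for x u using tilt_pos[of l x u] by (simp add: h_def)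
  have "sum_bdd (h r) c0"
    unfolding sum_bdd_def
  proof (intro allI impI)
    fix U assume U: "finite U" "U \<subseteq> V"
    have "sum (h r) U = (\<Sum>u\<in>U \<inter> gball r n. tilt l r u)"
      unfolding h_def using U by (simp add: sum.inter_restrict)
    also have "\<dots> \<le> c0" unfolding c0_def using gball_finite[OF r] tilt_pos less_imp_le by (intro sum_mono2) blast+
    finally show "sum (h r) U \<le> c0" .
  qed
  moreover have "invariant h"
    unfolding invariant_def h_def by (auto simp: gball_\<Gamma>_iff tilt_\<Gamma>)
  ultimately have hc: "sum_bdd (h x) c0" if "x \<in> V" for x
    using sum_bdd_invariant r that by blast
  have "sum_bdd (\<lambda>u. conn_prob p' False r u * tilt l r u) (2 * c0)"
    unfolding sum_bdd_def conn_prob_False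
  proof (intro allI impI sum_PP_le p'0 V_ne incr_linked)
    fix U F assume U: "finite U" "U \<subseteq> V" and F: "finite F" "F \<subseteq> E"
    define s where "s x = (\<Sum>u\<in>U. Pr p' F (\<lambda>S. linked S V x u) * tilt l x u)" for x
    define Y where "Y = insert r (\<Union>F)"
    have Y: "finite Y" "Y \<subseteq> V" using edges_V[OF F r] by (auto simp: Y_def)
    \<comment> \<open>With \<open>F\<close> finite, \<open>s\<close> has a maximum over the vertices
      involved, attained at some \<open>x\<close>. Exiting the ball around that \<open>x\<close>
      gives \<open>m \<le> c0 + m / 2\<close>, so \<open>m \<le> 2 * c0\<close> independently of
      \<open>U\<close> and \<open>F\<close>.\<close>
    define m where "m = Max (s ` Y)"
    have m: "s x \<le> m" if "x \<in> Y" for x unfolding m_def using that Y by (intro Max_ge) auto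
    obtain x where x: "x \<in> Y" "m = s x"
      using Max_in[of "s ` Y"] Y by (auto simp: m_def Y_def)
    have xV: "x \<in> V" using x Y by auto
    have s0: "0 \<le> s y" for y unfolding s_def using Pr_nonneg[OF p'0] tilt_pos less_imp_le by (intro sum_nonneg mult_nonneg_nonneg) blast+
    define Z where "Z = \<Union>F - gball x n"
    have Z: "finite Z" "Z \<subseteq> Y" using Y by (auto simp: Z_def Y_def)
    have pt: "Pr p' F (\<lambda>S. linked S V x u) * tilt l x u \<le> h x u + (\<Sum>w\<in>Z. exit_weight p' l n x w * (Pr p' F (\<lambda>S. linked S V w u) * tilt l w u))"
      if u: "u \<in> U" for u
    proof (cases "u \<in> gball x n")
      case True
      have "Pr p' F (\<lambda>S. linked S V x u) * tilt l x u \<le> 1 * tilt l x u"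
        using Pr_le_1[OF F(1) p'0] less_imp_le[OF tilt_pos] by (intro mult_right_mono)
      then have "Pr p' F (\<lambda>S. linked S V x u) * tilt l x u \<le> h x u" using True by (simp add: h_def)
      moreover have "0 \<le> (\<Sum>w\<in>Z. exit_weight p' l n x w * (Pr p' F (\<lambda>S. linked S V w u) * tilt l w u))"
        using fe0 Pr_nonneg[OF p'0] less_imp_le[OF tilt_pos] by (intro sum_nonneg mult_nonneg_nonneg)
      ultimately show ?thesis by linarith
    next
      case False
      have uV: "u \<in> V" using u U by auto
      have VB: "V \<inter> gball x n = gball x n" using gball_V[OF xV] by auto
      have "Pr p' F (\<lambda>S. linked S V x u) \<le>
          (\<Sum>w\<in>Z. Pr p' F (\<lambda>S. linked S (insert w (gball x n)) x w) * Pr p' F (\<lambda>S. linked S V w u))"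
        using Pr_linked_first_exit[OF F(1) p'0 Z(1), of "gball x n" x u V] False by (simp add: Z_def VB)
      then have "Pr p' F (\<lambda>S. linked S V x u) * tilt l x u \<le>
          (\<Sum>w\<in>Z. Pr p' F (\<lambda>S. linked S (insert w (gball x n)) x w) * Pr p' F (\<lambda>S. linked S V w u)) * tilt l x u"
        using less_imp_le[OF tilt_pos] by (rule mult_right_mono)
      also have "\<dots> \<le> (\<Sum>w\<in>Z. exit_weight p' l n x w * (Pr p' F (\<lambda>S. linked S V w u) * tilt l w u))"
        unfolding sum_distrib_right
      proof (rule sum_mono)
        fix w assume w: "w \<in> Z"
        then have wV: "w \<in> V" and wn: "w \<notin> gball x n" using Z Y by (auto simp: Z_def)
        have "Pr p' F (\<lambda>S. linked S (insert w (gball x n)) x w) \<le> PP p' (\<lambda>S. linked S (insert w (gball x n)) x w)"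
          by (rule PP_upper[OF F p'0])
        then have "Pr p' F (\<lambda>S. linked S (insert w (gball x n)) x w) * (Pr p' F (\<lambda>S. linked S V w u) * tilt l x u) \<le>
            PP p' (\<lambda>S. linked S (insert w (gball x n)) x w) * (Pr p' F (\<lambda>S. linked S V w u) * tilt l x u)"
          using Pr_nonneg[OF p'0] less_imp_le[OF tilt_pos] by (intro mult_right_mono mult_nonneg_nonneg)
        then show "Pr p' F (\<lambda>S. linked S (insert w (gball x n)) x w) * Pr p' F (\<lambda>S. linked S V w u) * tilt l x u \<le>
            exit_weight p' l n x w * (Pr p' F (\<lambda>S. linked S V w u) * tilt l w u)"
          using wn tilt_split[OF xV wV uV] by (simp add: exit_weight_def mult_ac)
      qed
      finally show ?thesis using h0[of x u] by linarith
    qed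
    have "m \<le> (\<Sum>u\<in>U. h x u + (\<Sum>w\<in>Z. exit_weight p' l n x w * (Pr p' F (\<lambda>S. linked S V w u) * tilt l w u)))"
      unfolding x(2) s_def by (intro sum_mono pt)
    also have "\<dots> = sum (h x) U + (\<Sum>w\<in>Z. exit_weight p' l n x w * s w)"
      unfolding sum.distrib s_def sum_distrib_left by (subst (2) sum.swap) simp
    also have "\<dots> \<le> c0 + (\<Sum>w\<in>Z. exit_weight p' l n x w * m)"
    proof (intro add_mono sum_mono mult_left_mono fe0)
      show "sum (h x) U \<le> c0" using hc[OF xV] U by (simp add: sum_bdd_def)
      show "s w \<le> m" if "w \<in> Z" for w using m Z that by auto
    qed
    also have "(\<Sum>w\<in>Z. exit_weight p' l n x w * m) = sum (exit_weight p' l n x) Z * m" by (simp add: sum_distrib_right)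
    also have "\<dots> \<le> 1 / 2 * m"
    proof (rule mult_right_mono)
      show "sum (exit_weight p' l n x) Z \<le> 1 / 2" using exit_weight_half[OF xV] Z Y by (simp add: sum_bdd_def)
      show "0 \<le> m" using s0 x by simp
    qed
    finally have "m \<le> 2 * c0" by simp
    moreover have "s r \<le> m" by (rule m) (simp add: Y_def)
    ultimately show "(\<Sum>u\<in>U. Pr p' F (\<lambda>S. linked S V r u) * tilt l r u) \<le> 2 * c0" by (simp add: s_def)
  qed
  then show ?thesis using p' by (intro exI[of _ p']) auto
qed

end

section \<open>The percolation measure\<close>

lemma linked_finite:
  assumes "linked S R x y"
  shows "\<exists>F. finite F \<and> F \<subseteq> S \<and> linked F R x y"
  using assms unfolding linked_def
proof (induction rule: rtrancl_induct)
  case base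
  then show ?case by (intro exI[of _ "{}"]) simp
next
  case (step y z)
  then obtain F where F: "finite F" "F \<subseteq> S" "(x, y) \<in> (adj {e \<in> F. e \<subseteq> R})\<^sup>*" by blast
  have e: "{y, z} \<in> S" "{y, z} \<subseteq> R" using step(2) by (auto simp: adj_def)
  have "linked F R x y" unfolding linked_def by (rule F(3))
  then have "linked (insert {y, z} F) R x y" by (rule linked_mono) auto
  moreover have "linked (insert {y, z} F) R y z" by (rule linked_edge) (use e in auto)
  ultimately have "linked (insert {y, z} F) R x z" by (rule linked_trans)
  then show ?case unfolding linked_def using F(1,2) e(1) by (intro exI[of _ "insert {y, z} F"]) simp
qed

lemma open_edges_subset: "open_edges E \<omega> \<subseteq> E"
  by (auto simp: open_edges_def)

lemma percolation_prob_space: "prob_space (percolation E p)"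
  unfolding percolation_def by (intro prob_space_PiM measure_pmf.prob_space_axioms)

lemma percolation_cylinder:
  assumes F: "finite F" "F \<subseteq> E" "S \<subseteq> F" and p: "0 \<le> p" "p \<le> 1"
  shows "{\<omega> \<in> space (percolation E p). open_edges E \<omega> \<inter> F = S} \<in> sets (percolation E p)"
    and "measure (percolation E p) {\<omega> \<in> space (percolation E p). open_edges E \<omega> \<inter> F = S} = weight p F S"
proof -
  interpret product_prob_space "\<lambda>e. measure_pmf (bernoulli_pmf p)" E
    by (intro product_prob_spaceI measure_pmf.prob_space_axioms)
  have eq: "{\<omega> \<in> space (percolation E p). open_edges E \<omega> \<inter> F = S} =
      prod_emb E (\<lambda>e. measure_pmf (bernoulli_pmf p)) F (\<Pi>\<^sub>E e\<in>F. {e \<in> S})"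
    using F by (auto simp: prod_emb_def percolation_def space_PiM open_edges_def PiE_iff extensional_def)
  show "{\<omega> \<in> space (percolation E p). open_edges E \<omega> \<inter> F = S} \<in> sets (percolation E p)"
    unfolding eq unfolding percolation_def using F by (intro sets_PiM_I) auto
  have "measure (percolation E p) {\<omega> \<in> space (percolation E p). open_edges E \<omega> \<inter> F = S} =
      (\<Prod>e\<in>F. measure (measure_pmf (bernoulli_pmf p)) {e \<in> S})"
    unfolding eq unfolding percolation_def using F by (intro measure_PiM_emb) auto
  also have "\<dots> = weight p F S" unfolding weight_def using p by (intro prod.cong) (auto simp: measure_pmf_single)
  finally show "measure (percolation E p) {\<omega> \<in> space (percolation E p). open_edges E \<omega> \<inter> F = S} = weight p F S" .
qed

lemma percolation_finite:
  assumes F: "finite F" "F \<subseteq> E" and p: "0 \<le> p" "p \<le> 1"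
  shows "{\<omega> \<in> space (percolation E p). A (open_edges E \<omega> \<inter> F)} \<in> sets (percolation E p)"
    and "measure (percolation E p) {\<omega> \<in> space (percolation E p). A (open_edges E \<omega> \<inter> F)} = Pr p F A"
proof -
  interpret prob_space "percolation E p" by (rule percolation_prob_space)
  define C where "C S = {\<omega> \<in> space (percolation E p). open_edges E \<omega> \<inter> F = S}" for S
  define I where "I = {S \<in> Pow F. A S}"
  have I: "finite I" using F by (simp add: I_def)
  have C: "C S \<in> sets (percolation E p)" "measure (percolation E p) (C S) = weight p F S" if "S \<in> I" for S
    using percolation_cylinder[OF F _ p, of S] that by (auto simp: C_def I_def)
  have eq: "{\<omega> \<in> space (percolation E p). A (open_edges E \<omega> \<inter> F)} = (\<Union>S\<in>I. C S)"
    by (auto simp: C_def I_def)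
  show "{\<omega> \<in> space (percolation E p). A (open_edges E \<omega> \<inter> F)} \<in> sets (percolation E p)"
    unfolding eq using I C by (intro sets.finite_UN) auto
  have "measure (percolation E p) (\<Union>S\<in>I. C S) = (\<Sum>S\<in>I. measure (percolation E p) (C S))"
    using I C by (intro finite_measure_finite_Union) (auto simp: disjoint_family_on_def C_def)
  also have "\<dots> = (\<Sum>S\<in>I. weight p F S)" using C by simp
  also have "\<dots> = Pr p F A"
    unfolding Pr_def Eb_def I_def using F by (intro sum.mono_neutral_cong_left) auto
  finally show "measure (percolation E p) {\<omega> \<in> space (percolation E p). A (open_edges E \<omega> \<inter> F)} = Pr p F A"
    unfolding eq .
qed

context transitive_graph
begin

text \<open>An increasing event with finite witnesses is the increasing union of its versions on
  balls, so continuity from below identifies its measure with \<open>PP\<close>.\<close>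

lemma percolation_event:
  assumes x: "x \<in> V" and p: "0 \<le> p" "p \<le> 1" and A: "incr A"
    and fin: "\<And>S. S \<subseteq> E \<Longrightarrow> A S \<Longrightarrow> \<exists>F. finite F \<and> F \<subseteq> S \<and> A F"
  shows "{\<omega> \<in> space (percolation E p). A (open_edges E \<omega>)} \<in> sets (percolation E p)"
    and "measure (percolation E p) {\<omega> \<in> space (percolation E p). A (open_edges E \<omega>)} = PP p A"
proof -
  interpret prob_space "percolation E p" by (rule percolation_prob_space)
  define B where "B n = {\<omega> \<in> space (percolation E p). A (open_edges E \<omega> \<inter> ball_edges x n)}" for n
  have B: "B n \<in> sets (percolation E p)" "measure (percolation E p) (B n) = Pr p (ball_edges x n) A" for n
    using percolation_finite[OF ball_edges_finite[OF x] ball_edges_E p] by (auto simp: B_def)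
  have mono: "incseq B"
  proof (rule incseq_SucI)
    fix n
    have "ball_edges x n \<subseteq> ball_edges x (Suc n)" using gball_mono[of n "Suc n" x] by (auto simp: ball_edges_def)
    then show "B n \<subseteq> B (Suc n)"
      unfolding B_def by (auto intro: incrD[OF A])
  qed
  have eq: "(\<Union>n. B n) = {\<omega> \<in> space (percolation E p). A (open_edges E \<omega>)}"
  proof (intro equalityI subsetI)
    fix \<omega> assume "\<omega> \<in> (\<Union>n. B n)"
    then show "\<omega> \<in> {\<omega> \<in> space (percolation E p). A (open_edges E \<omega>)}"
      by (auto simp: B_def intro: incrD[OF A])
  next
    fix \<omega> assume \<omega>: "\<omega> \<in> {\<omega> \<in> space (percolation E p). A (open_edges E \<omega>)}"
    then obtain F where F: "finite F" "F \<subseteq> open_edges E \<omega>" "A F"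
      using fin[of "open_edges E \<omega>"] open_edges_subset by auto
    obtain n where "F \<subseteq> ball_edges x n"
      using finite_subset_ball_edges[OF x F(1)] F(2) open_edges_subset by (metis subset_trans)
    then have "\<omega> \<in> B n" using \<omega> F incrD[OF A F(3), of "open_edges E \<omega> \<inter> ball_edges x n"] by (auto simp: B_def)
    then show "\<omega> \<in> (\<Union>n. B n)" by blast
  qed
  show "{\<omega> \<in> space (percolation E p). A (open_edges E \<omega>)} \<in> sets (percolation E p)"
    unfolding eq[symmetric] using B by (intro sets.countable_UN) auto
  have "(\<lambda>n. measure (percolation E p) (B n)) \<longlonglongrightarrow> measure (percolation E p) (\<Union>n. B n)"
    using B mono by (intro finite_Lim_measure_incseq) auto
  moreover have "(\<lambda>n. measure (percolation E p) (B n)) \<longlonglongrightarrow> PP p A"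
    unfolding B(2) by (rule PP_limit[OF x p A])
  ultimately show "measure (percolation E p) {\<omega> \<in> space (percolation E p). A (open_edges E \<omega>)} = PP p A"
    unfolding eq by (rule LIMSEQ_unique)
qed

lemma cluster_linked: "v \<in> cluster E \<omega> u \<longleftrightarrow> linked (open_edges E \<omega>) V u v"
proof -
  have "{e \<in> open_edges E \<omega>. e \<subseteq> V} = open_edges E \<omega>"
    using open_edges_subset[of E \<omega>] edge_subset by blast
  then show ?thesis by (simp add: cluster_def linked_def)
qed

lemma tau_PP:
  assumes "x \<in> V" "0 \<le> p" "p \<le> 1"
  shows "tau E p x y = PP p (\<lambda>S. linked S V x y)"
  unfolding tau_def cluster_linked by (rule percolation_event(2)[OF assms incr_linked linked_finite])

end

context nonunimodular_graph
begin

text \<open>For nonnegative terms the infinite sum is the supremum of the finite partial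
  sums.\<close>

lemma tilted_susceptibility_finite_iff:
  assumes p: "0 \<le> p" "p \<le> 1"
  shows "tilted_susceptibility V E \<Gamma> p l r < \<infinity> \<longleftrightarrow> (\<exists>c. sum_bdd (\<lambda>u. conn_prob p False r u * tilt l r u) c)"
proof -
  define f where "f u = conn_prob p False r u * tilt l r u" for u
  have f0: "0 \<le> f u" for u using conn_prob_nonneg[OF p] tilt_pos[of l r u] by (simp add: f_def)
  have "tilted_susceptibility V E \<Gamma> p l r = (\<Sum>\<^sub>\<infinity>u\<in>V. ennreal (f u))"
    unfolding tilted_susceptibility_def
  proof (rule infsum_cong)
    fix u assume "u \<in> V"
    then show "ennreal (tau E p r u * D r u powr l) = ennreal (f u)"
      using r p by (simp add: tau_PP f_def conn_prob_False tilt_def D_ht powr_powr mult.commute)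
  qed
  also have "\<dots> = (SUP U\<in>{U. finite U \<and> U \<subseteq> V}. \<Sum>u\<in>U. ennreal (f u))"
    by (rule nonneg_infsum_complete) simp
  also have "\<dots> = (SUP U\<in>{U. finite U \<and> U \<subseteq> V}. ennreal (sum f U))"
    using f0 by (intro SUP_cong) (auto simp: sum_ennreal)
  finally have eq: "tilted_susceptibility V E \<Gamma> p l r = (SUP U\<in>{U. finite U \<and> U \<subseteq> V}. ennreal (sum f U))" .
  show ?thesis
    unfolding f_def[symmetric]
  proof
    assume fin: "tilted_susceptibility V E \<Gamma> p l r < \<infinity>"
    define c where "c = enn2real (tilted_susceptibility V E \<Gamma> p l r)"
    have "sum_bdd f c"
      unfolding sum_bdd_def
    proof (intro allI impI)
      fix U assume "finite U" "U \<subseteq> V"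
      then have "ennreal (sum f U) \<le> tilted_susceptibility V E \<Gamma> p l r" unfolding eq by (intro SUP_upper) auto
      also have "\<dots> = ennreal c" using fin by (simp add: c_def less_top)
      finally show "sum f U \<le> c" by (simp add: c_def ennreal_le_iff)
    qed
    then show "\<exists>c. sum_bdd f c" by blast
  next
    assume "\<exists>c. sum_bdd f c"
    then obtain c where "sum_bdd f c" by blast
    then have "tilted_susceptibility V E \<Gamma> p l r \<le> ennreal c"
      unfolding eq sum_bdd_def by (intro SUP_least ennreal_leI) auto
    then show "tilted_susceptibility V E \<Gamma> p l r < \<infinity>" by (auto simp: less_top[symmetric] top_unique)
  qed
qed

section \<open>Infinite clusters from descending populations\<close>

lemma exists_high: "\<exists>x\<in>V. real (2 * k) \<le> ht r x"
proof (induction k)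
  case 0
  show ?case using r by (intro bexI[of _ r]) auto
next
  case (Suc k)
  then obtain x where x: "x \<in> V" "real (2 * k) \<le> ht r x" by blast
  obtain y where y: "{x, y} \<in> E" "1 * ht x y = 2" using extremal_nbr[OF x(1), of 1] by auto
  then show ?case using x edgeD[OF y(1)] ht_add[OF r x(1), of y] by (intro bexI[of _ y]) auto
qed

text \<open>Take the orbit of \<open>r\<close> under the stabilizer of a very high point
  \<open>x\<close>. The stabilizer preserves heights relative to \<open>x\<close>, so the orbit lies
  at height 0, and it has at least \<open>D r x\<close> elements.\<close>

lemma exists_level_set: "\<exists>Y. finite Y \<and> Y \<subseteq> V \<and> real n \<le> real (card Y) \<and> (\<forall>y\<in>Y. ht r y = 0)"
proof -
  obtain X where X: "\<And>s. X \<le> s \<Longrightarrow> real n \<le> q powr (1 * s)"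
    using powr_eventually_ge[OF q_gt_1 zero_less_one, of "real n"] by blast
  obtain k where "X \<le> real k" using real_arch_simple by blast
  then obtain x where x: "x \<in> V" "X \<le> ht r x" using exists_high[of k] by force
  have fin: "finite (orb x r)" "0 < card (orb r x)" using orb_finite[OF x(1) r] card_orb_pos[OF r x(1)] by auto
  have "real n \<le> D r x" using X[OF x(2)] D_ht[OF r x(1)] by simp
  also have "\<dots> \<le> real (card (orb x r)) / 1" unfolding D_eq using fin(2) by (intro divide_left_mono) auto
  finally have "real n \<le> real (card (orb x r))" by simp
  moreover have "orb x r \<subseteq> V" using \<Gamma>_V r by (auto simp: orb_def)
  moreover have "ht r y = 0" if yo: "y \<in> orb x r" for y
  proof -
    obtain \<gamma> where \<gamma>: "\<gamma> \<in> \<Gamma>" "\<gamma> x = x" "y = \<gamma> r" using yo by (auto simp: orb_def)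
    then have "ht x y = ht x r" "y \<in> V" using ht_\<Gamma>[OF \<gamma>(1) x(1) r] \<Gamma>_V r by auto
    then show ?thesis using ht_add[OF r x(1), of y] ht_add[OF r x(1) r] r by simp
  qed
  ultimately show ?thesis using fin by blast
qed

text \<open>A mean of 8 allows \<open>\<kappa> = 2\<close> in \<open>Pr_Reach\<close>, so the
  failure probabilities form a convergent geometric series and a level set of at least
  \<open>Suc j\<close> points has descendants at every depth with probability at least
  \<open>1 - 2 * c / Suc j\<close>. Letting \<open>j\<close> grow gives probability 1.\<close>

lemma infinite_cluster_AE:
  assumes p: "0 \<le> p" "p \<le> 1" and s: "4 \<le> s"
    and mean: "\<And>y. y \<in> V \<Longrightarrow> 8 \<le> (\<Sum>w\<in>gball y \<rho>. offspring p (-1) s \<rho> y w)"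
  shows "AE \<omega> in percolation E p. \<exists>v\<in>V. infinite (cluster E \<omega> v)"
proof -
  let ?P = "percolation E p"
  interpret prob_space ?P by (rule percolation_prob_space)
  define c where "c = 4 * real (ball_card \<rho> * ball_card (2 * \<rho>)) / (4 * 2)\<^sup>2"
  have c0: "0 \<le> c" by (simp add: c_def)
  have "\<exists>B\<in>sets ?P. measure ?P (space ?P - B) \<le> 2 * c / real (Suc j) \<and> (\<forall>\<omega>\<in>B. \<exists>v\<in>V. infinite (cluster E \<omega> v))" for j
  proof -
    obtain Y where Y: "finite Y" "Y \<subseteq> V" "real (Suc j) \<le> real (card Y)" "\<And>y. y \<in> Y \<Longrightarrow> ht r y = 0"
      using exists_level_set[of "Suc j"] by blast
    have Yne: "Y \<noteq> {}" using Y(3) by auto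
    define A where "A k = Reach r (-1) 0 Y (0 + real k * s)" for k
    have incrA: "incr (A k)" for k
      unfolding A_def Reach_def incr_def by (meson Int_mono linked_mono order_refl)
    have finA: "\<exists>F. finite F \<and> F \<subseteq> S \<and> A k F" if AS: "A k S" for k S
    proof -
      obtain y u where y: "y \<in> Y" "u \<in> V" "0 + real k * s \<le> -1 * ht r u"
        "linked (S \<inter> Fresh r (-1) 0) {x \<in> V. 0 \<le> -1 * ht y x} y u" using AS unfolding A_def Reach_def by blast
      obtain F where F: "finite F" "F \<subseteq> S \<inter> Fresh r (-1) 0" "linked F {x \<in> V. 0 \<le> -1 * ht y x} y u"
        using linked_finite[OF y(4)] by blast
      then have "F \<inter> Fresh r (-1) 0 = F" by blast
      then have "A k F" unfolding A_def Reach_def using y F(3) by (intro bexI[of _ y] bexI[of _ u]) auto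
      then show ?thesis using F by blast
    qed
    define B where "B k = {\<omega> \<in> space ?P. A k (open_edges E \<omega>)}" for k
    have B: "B k \<in> sets ?P" "measure ?P (B k) = PP p (A k)" for k
      using percolation_event[OF r p incrA finA] by (auto simp: B_def)
    have low: "1 - 2 * c / real (Suc j) \<le> measure ?P (B k)" for k
    proof -
      obtain F0 where F0: "finite F0" "F0 \<subseteq> E" "\<And>F. finite F \<Longrightarrow> F \<subseteq> E \<Longrightarrow> F0 \<subseteq> F \<Longrightarrow>
        1 - c / real (card Y) * (\<Sum>i<k. (1 / 2) ^ i) \<le> Pr p F (A k)"
        using Pr_Reach[where v = r and \<sigma> = "-1" and \<kappa> = 2 and s = s and \<rho> = \<rho> and Y = Y and t = 0 and k = k, OF p r] s mean Y Yne unfolding c_def A_def by auto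
      have "(\<Sum>i<k. (1 / 2 :: real) ^ i) \<le> 2" by (simp add: sum_gp_strict)
      then have "c / real (card Y) * (\<Sum>i<k. (1 / 2) ^ i) \<le> c / real (Suc j) * 2"
        using c0 Y(3) by (intro mult_mono divide_left_mono) (auto intro: sum_nonneg)
      then have "1 - 2 * c / real (Suc j) \<le> Pr p F0 (A k)" using F0(3)[OF F0(1,2) order_refl] by (simp add: mult.commute)
      also have "\<dots> \<le> measure ?P (B k)" unfolding B(2) by (rule PP_upper[OF F0(1,2) p])
      finally show ?thesis .
    qed
    have dec: "decseq B"
    proof (rule decseq_SucI, rule subsetI)
      fix k \<omega> assume "\<omega> \<in> B (Suc k)"
      moreover have "A k S" if "A (Suc k) S" for S
      proof -
        have "real k * s \<le> real (Suc k) * s" using s by simp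
        then show ?thesis using that unfolding A_def Reach_def by (meson add_left_mono order_trans)
      qed
      ultimately show "\<omega> \<in> B k" by (auto simp: B_def)
    qed
    have "(\<lambda>k. measure ?P (B k)) \<longlonglongrightarrow> measure ?P (\<Inter>k. B k)"
      using B dec by (intro finite_Lim_measure_decseq) auto
    then have ge: "1 - 2 * c / real (Suc j) \<le> measure ?P (\<Inter>k. B k)"
      by (rule LIMSEQ_le_const) (use low in auto)
    have sets: "(\<Inter>k. B k) \<in> sets ?P" using B by (intro sets.countable_INT) auto
    have "\<exists>v\<in>V. infinite (cluster E \<omega> v)" if \<omega>: "\<omega> \<in> (\<Inter>k. B k)" for \<omega>
    proof (rule ccontr)
      assume "\<not> (\<exists>v\<in>V. infinite (cluster E \<omega> v))"
      then have fin: "finite (\<Union>y\<in>Y. cluster E \<omega> y)" using Y by blast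
      \<comment> \<open>If all clusters of the finite set \<open>Y\<close> were finite, their depths
        would be bounded by \<open>m\<close>, whereas \<open>A k\<close> holds for all
        \<open>k\<close>.\<close>
      define m where "m = Max (insert 0 ((\<lambda>u. - ht r u) ` (\<Union>y\<in>Y. cluster E \<omega> y)))"
      obtain k where k: "m / s < real k" using reals_Archimedean2 by blast
      have "A k (open_edges E \<omega>)" using \<omega> by (auto simp: B_def)
      then obtain y u where y: "y \<in> Y" "u \<in> V" "real k * s \<le> - ht r u"
        "linked (open_edges E \<omega> \<inter> Fresh r (-1) 0) {x \<in> V. 0 \<le> -1 * ht y x} y u" by (auto simp: A_def Reach_def)
      have "u \<in> cluster E \<omega> y" unfolding cluster_linked using y(4) by (rule linked_mono) auto
      then have "- ht r u \<le> m" unfolding m_def using fin y(1) by (intro Max_ge) auto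
      then show False using k y(3) s by (simp add: divide_less_eq)
    qed
    moreover have "measure ?P (space ?P - (\<Inter>k. B k)) \<le> 2 * c / real (Suc j)"
      using prob_compl[OF sets] ge by linarith
    ultimately show ?thesis using sets by blast
  qed
  then obtain B where B: "\<And>j. B j \<in> sets ?P" "\<And>j. measure ?P (space ?P - B j) \<le> 2 * c / real (Suc j)"
    "\<And>j \<omega>. \<omega> \<in> B j \<Longrightarrow> \<exists>v\<in>V. infinite (cluster E \<omega> v)" by metis
  define N where "N = (\<Inter>j. space ?P - B j)"
  have N: "N \<in> sets ?P" unfolding N_def using B(1) by (intro sets.countable_INT) auto
  have le: "measure ?P N \<le> 2 * c / real (Suc j)" for j
  proof -
    have "measure ?P N \<le> measure ?P (space ?P - B j)"
      using B(1) by (intro finite_measure_mono) (auto simp: N_def)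
    then show ?thesis using B(2)[of j] by linarith
  qed
  have "measure ?P N \<le> 0"
  proof (rule LIMSEQ_le_const)
    show "(\<lambda>j. 2 * c / real (Suc j)) \<longlonglongrightarrow> 0"
      using LIMSEQ_Suc[OF lim_const_over_n[of "2 * c"]] by simp
  qed (use le in auto)
  then have "emeasure ?P N = 0" by (simp add: emeasure_eq_measure measure_le_0_iff)
  show ?thesis
  proof (rule AE_I[OF _ \<open>emeasure ?P N = 0\<close> N])
    show "{\<omega> \<in> space ?P. \<not> (\<exists>v\<in>V. infinite (cluster E \<omega> v))} \<subseteq> N"
      using B(3) by (auto simp: N_def)
  qed
qed

lemma reach_prob_power_le:
  assumes p: "0 \<le> p" "p \<le> 1" and x: "0 < x"
  shows "reach_prob p True 1 x ^ Suc n \<le> reach_prob p True 1 (real (Suc n) * x)"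
proof (induction n)
  case (Suc n)
  have "reach_prob p True 1 x ^ Suc (Suc n) \<le> reach_prob p True 1 x * reach_prob p True 1 (real (Suc n) * x)"
    using Suc PP_nonneg[OF p] by (auto simp: reach_prob_def intro!: mult_left_mono)
  also have "\<dots> \<le> reach_prob p True 1 (x + real (Suc n) * x)" by (rule reach_prob_supermult[OF p _ x]) simp
  also have "x + real (Suc n) * x = real (Suc (Suc n)) * x" by (simp add: algebra_simps)
  finally show ?case .
qed simp

text \<open>Below \<open>p_c\<close> the mean offspring of downward bridges is less than 8 for every
  length. Their parents are found by upward connections, so this gives decay with a constant
  \<open>C\<close>. Supermultiplicativity removes it: a violation at one \<open>x\<close> would grow
  exponentially along the multiples of \<open>x\<close>.\<close>

lemma reach_prob_below_pc:
  assumes p: "0 < p" "p \<le> 1" "p < p_c V E" and x: "0 < x"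
  shows "reach_prob p True 1 x \<le> q powr (- x)"
proof (rule ccontr)
  have p0: "0 \<le> p" using p by simp
  have notAE: "\<not> (AE \<omega> in percolation E p. \<exists>v\<in>V. infinite (cluster E \<omega> v))"
  proof
    assume "AE \<omega> in percolation E p. \<exists>v\<in>V. infinite (cluster E \<omega> v)"
    then have "p_c V E \<le> p" unfolding p_c_def using p by (intro cInf_lower) (auto intro: bdd_belowI[of _ 0])
    then show False using p by simp
  qed
  have Rlt: "q powr (s - 1) * parent_prob p (-1) s \<rho> r < 8" if s: "4 \<le> s" for s \<rho>
  proof (rule ccontr)
    assume "\<not> q powr (s - 1) * parent_prob p (-1) s \<rho> r < 8"
    then have "8 \<le> (\<Sum>w\<in>gball y \<rho>. offspring p (-1) s \<rho> y w)" if "y \<in> V" for y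
      using offspring_mean[OF p0 p(2) that, of "-1" s \<rho>] by simp
    then show False using infinite_cluster_AE[OF p0 p(2) s] notAE by blast
  qed
  \<comment> \<open>The threshold 8 for the mean offspring, times the 2 and the
    \<open>1 / p^2\<close> lost in \<open>parent_prob_lower\<close>.\<close>
  define C where "C = 16 / p\<^sup>2"
  have poly: "reach_prob p True 1 y \<le> C * q powr (- y)" if y: "0 < y" for y
  proof -
    have "p\<^sup>2 * reach_prob p True 1 y \<le> 16 * q powr (- y)"
    proof (rule ccontr)
      assume "\<not> ?thesis"
      then obtain \<rho> s where s: "s = y + 4 \<or> s = y + 5" "16 * q powr (- y) / 2 < parent_prob p (-1) s \<rho> r"
        using parent_prob_lower[OF p(1,2), of "-1" y "16 * q powr (- y)"] y by auto
      have "8 = q powr (s - 1) * (8 * q powr (1 - s))" by (simp add: powr_add[symmetric] mult.left_commute) (use q_gt_1 in simp)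
      also have "\<dots> \<le> q powr (s - 1) * (8 * q powr (- y))"
        using s(1) q_gt_1 by (intro mult_left_mono) auto
      also have "\<dots> \<le> q powr (s - 1) * parent_prob p (-1) s \<rho> r" using s(2) by (intro mult_left_mono) auto
      finally show False using Rlt[of s \<rho>] s(1) y by auto
    qed
    then show ?thesis using p by (simp add: C_def field_simps)
  qed
  assume "\<not> reach_prob p True 1 x \<le> q powr (- x)"
  then have gt: "1 < reach_prob p True 1 x * q powr x" using q_gt_1 by (simp add: powr_minus field_simps)
  obtain n where n: "C < (reach_prob p True 1 x * q powr x) ^ n" using real_arch_pow[OF gt] by blast
  also have "\<dots> \<le> (reach_prob p True 1 x * q powr x) ^ Suc n" using gt by (intro power_increasing) auto
  also have "\<dots> = reach_prob p True 1 x ^ Suc n * q powr (real (Suc n) * x)"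
    using q_gt_1 by (simp add: power_mult_distrib powr_realpow[symmetric] powr_powr mult.commute del: power_Suc)
  also have "\<dots> \<le> C * q powr (- (real (Suc n) * x)) * q powr (real (Suc n) * x)"
    using reach_prob_power_le[OF p0 p(2) x, of n] poly[of "real (Suc n) * x"] x by (intro mult_right_mono) auto
  also have "\<dots> = C" using q_gt_1 by (simp add: powr_minus)
  finally show False by simp
qed

text \<open>The bound has constant 1 and does not depend on the parameter, so it extends from below
  to \<open>p_c\<close> itself.\<close>

lemma reach_prob_at_pc:
  assumes p: "0 < p" "p \<le> 1" "p \<le> p_c V E" and x: "0 < x"
  shows "reach_prob p True 1 x \<le> q powr (- x)"
  unfolding reach_prob_def
proof (rule PP_left_limit[OF p(1,2)])
  fix p' assume p': "0 \<le> p'" "p' < p"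
  define p'' where "p'' = (p' + p) / 2"
  have p'': "p' \<le> p''" "p'' < p" "0 < p''" "p'' \<le> 1" "p'' < p_c V E" using p' p by (auto simp: p''_def)
  have "PP p' (reaches True 1 x r) \<le> PP p'' (reaches True 1 x r)" by (rule PP_mono_p[OF p'(1) p''(1,4) incr_reaches])
  also have "\<dots> \<le> q powr (- x)" using reach_prob_below_pc[OF p''(3,4,5) x] by (simp add: reach_prob_def)
  finally show "PP p' (reaches True 1 x r) \<le> q powr (- x)" .
qed

text \<open>The mass-transport principle exchanges \<open>l\<close> and \<open>1 - l\<close>.\<close>

lemma tilted_sum_flip:
  assumes p: "0 \<le> p" "p \<le> 1" and b: "sum_bdd (\<lambda>u. conn_prob p False r u * tilt (1 - l) r u) c"
  shows "sum_bdd (\<lambda>u. conn_prob p False r u * tilt l r u) c"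
proof (rule mass_transport[of "\<lambda>x y. conn_prob p False x y * tilt l x y"])
  show "invariant (\<lambda>x y. conn_prob p False x y * tilt l x y)"
    by (intro invariant_mult conn_prob_invariant tilt_invariant p)
  show "0 \<le> conn_prob p False x y * tilt l x y" for x y
    using conn_prob_nonneg[OF p] tilt_pos[of l x y] by simp
  show "sum_bdd (\<lambda>u. conn_prob p False u r * tilt l u r * D r u) c"
    using b
  proof (rule sum_bdd_mono)
    fix u assume u: "u \<in> V"
    have "(\<lambda>S. linked S V u r) = (\<lambda>S. linked S V r u)" by (intro ext iffI) (erule linked_sym)+
    then have "conn_prob p False u r = conn_prob p False r u" by (simp add: conn_prob_False)
    moreover have "tilt l u r * D r u = tilt (1 - l) r u"
      using u r by (simp add: tilt_def D_ht ht_sym[of r u] powr_add[symmetric] algebra_simps)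
    ultimately show "conn_prob p False u r * tilt l u r * D r u \<le> conn_prob p False r u * tilt (1 - l) r u" by (simp add: mult.assoc)
  qed
qed (rule r)

lemma p_c_less_threshold:
  assumes l: "1 / 2 \<le> l" "l < 1"
  shows "p_c V E < Sup {p \<in> {0..1}. \<exists>c. sum_bdd (\<lambda>u. conn_prob p False r u * tilt l r u) c}"
proof (rule ccontr)
  define S where "S = {p \<in> {0..1}. \<exists>c. sum_bdd (\<lambda>u. conn_prob p False r u * tilt l r u) c}"
  define p where "p = Sup S"
  assume "\<not> p_c V E < Sup {p \<in> {0..1}. \<exists>c. sum_bdd (\<lambda>u. conn_prob p False r u * tilt l r u) c}"
  then have pc: "p \<le> p_c V E" by (simp add: p_def S_def)
  have bdd: "bdd_above S" by (auto simp: S_def)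
  have S0: "0 \<in> S" unfolding S_def using tilted_sum_zero by auto
  have upper: "s \<le> p" if "s \<in> S" for s unfolding p_def using that bdd by (rule cSup_upper)
  have "open": "\<exists>s'>s. s' \<in> S" if s: "s \<in> S" "s < 1" for s
  proof -
    obtain c where "0 \<le> s" "sum_bdd (\<lambda>u. conn_prob s False r u * tilt l r u) c" using s by (auto simp: S_def)
    then obtain s' where "s < s'" "s' \<le> 1" "\<exists>c. sum_bdd (\<lambda>u. conn_prob s' False r u * tilt l r u) c"
      using tilted_sum_open[of s l] s by blast
    then show ?thesis using \<open>0 \<le> s\<close> by (intro exI[of _ s']) (auto simp: S_def)
  qed
  have p0: "0 < p" using "open"[OF S0] upper by fastforce
  have p1: "p \<le> 1" unfolding p_def by (rule cSup_least) (use S0 in blast, auto simp: S_def)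
  have reach_prob: "reach_prob p True 1 x \<le> q powr (- x)" if "0 < x" for x
    by (rule reach_prob_at_pc[OF p0 p1 pc that])
  have "\<exists>c. sum_bdd (\<lambda>u. conn_prob p False r u * tilt l r u) c"
  proof (rule tilted_sum_at_threshold[OF p0 p1 l reach_prob])
    fix p' assume p': "0 \<le> p'" "p' < p"
    obtain s where s: "s \<in> S" "p' < s" using p'(2) less_cSup_iff[OF _ bdd] S0 unfolding p_def by blast
    then obtain c where c: "sum_bdd (\<lambda>u. conn_prob s False r u * tilt l r u) c" by (auto simp: S_def)
    have "sum_bdd (\<lambda>u. conn_prob p' False r u * tilt l r u) c"
      using c
    proof (rule sum_bdd_mono)
      fix u
      have "conn_prob p' False r u \<le> conn_prob s False r u"
        unfolding conn_prob_def using p' s by (intro PP_mono_p incr_linked) (auto simp: S_def)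
      then show "conn_prob p' False r u * tilt l r u \<le> conn_prob s False r u * tilt l r u"
        using less_imp_le[OF tilt_pos] by (rule mult_right_mono)
    qed
    then show "\<exists>c. sum_bdd (\<lambda>u. conn_prob p' False r u * tilt l r u) c" by blast
  qed auto
  then have pS: "p \<in> S" using p0 p1 by (simp add: S_def)
  \<comment> \<open>Openness is available only below 1. At parameter 1 a steepest edge is surely
    open, which contradicts the decay at height 2.\<close>
  have "p \<noteq> 1"
  proof
    assume "p = 1"
    then have "1 \<le> q powr (- 2)" using reach_prob_2[of 1 1] reach_prob[of 2] by simp
    then have "q powr 0 \<le> q powr (- 2)" using q_gt_1 by simp
    then show False unfolding powr_q_le by simp
  qed
  then show False using "open"[OF pS] upper p1 by fastforce
qed

end

theorem theorem1p8:
  fixes V :: "'a set" and E :: "'a set set" and \<Gamma> :: "('a \<Rightarrow> 'a) set" and l :: real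
  assumes "simple_graph V E" and "connected_graph V E" and "locally_finite_graph V E"
    and "subgroup \<Gamma> (graph_Aut V E)"
    and "vertex_transitive V \<Gamma>" and "nonunimodular V \<Gamma>"
    and "l \<in> {0<..<1}" and "v \<in> V"
  shows "p_c V E < p_c_tilted V E \<Gamma> l v \<and> p_c_tilted V E \<Gamma> l v \<le> p_t V E \<Gamma> v"
proof -
  interpret nonunimodular_graph V E \<Gamma> v
    by (intro nonunimodular_graph.intro transitive_graph.intro nonunimodular_graph_axioms.intro assms)
  have T: "p_c_tilted V E \<Gamma> l v = Sup {p \<in> {0..1}. \<exists>c. sum_bdd (\<lambda>u. conn_prob p False v u * tilt l v u) c}"
    unfolding p_c_tilted_def by (intro arg_cong[of _ _ Sup] Collect_cong conj_cong refl tilted_susceptibility_finite_iff) auto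
  have "p_c V E < p_c_tilted V E \<Gamma> l v"
  proof (cases "1 / 2 \<le> l")
    case True
    then show ?thesis unfolding T using assms(7) by (intro p_c_less_threshold) auto
  next
    case False
    have "{p \<in> {0..1}. \<exists>c. sum_bdd (\<lambda>u. conn_prob p False v u * tilt l v u) c} =
        {p \<in> {0..1}. \<exists>c. sum_bdd (\<lambda>u. conn_prob p False v u * tilt (1 - l) v u) c}"
      using tilted_sum_flip[of _ l] tilted_sum_flip[of _ "1 - l"] by fastforce
    then show ?thesis unfolding T using p_c_less_threshold[of "1 - l"] False assms(7) by simp
  qed
  moreover have "p_c_tilted V E \<Gamma> l v \<le> p_t V E \<Gamma> v"
    unfolding p_c_tilted_def p_t_def
  proof (rule cSup_subset_mono)
    have "0 \<in> {p \<in> {0..1}. tilted_susceptibility V E \<Gamma> p l v < \<infinity>}"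
      using tilted_sum_zero[of l] tilted_susceptibility_finite_iff[of 0 l] by auto
    then show "{p \<in> {0..1}. tilted_susceptibility V E \<Gamma> p l v < \<infinity>} \<noteq> {}" by blast
  qed auto
  ultimately show ?thesis ..
qed

end
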